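(* There is an equivalence of categories \[ \mathbb{S}^{[2]}\text{-}\mathsf{Vect}_{\mathbb{Q}}\ \longrightarrow\ \mathbf{P}[\mathbb{S}\text{-}\mathsf{Vect}_{\mathbb{Q}},\mathsf{Vect}_{\mathbb{Q}}]. \] It takes an $\mathbb{S}^{[2]}$-module $V=\bigoplus_\nu V_\nu$ to the polynomial functor $F_V$ determined on $\mathbb{S}$-modules by \[ F_V\Big(\bigoplus_{n\ge0}W_n\Big)=\bigoplus_{\nu\in\overline{\mathsf{Part}}}\mathrm{Hom}_{\mathbb{S}_\nu}\Big(V_\nu,\ \bigotimes_{i\ge0}W_i^{\otimes\nu_i}\Big). \]
   Context: **Categories.** - $\mathsf{Vect}_{\mathbb{Q}}$ is the category of finite-dimensional $\mathbb{Q}$-vector spaces. - An $\mathbb{S}$-module is a finite-dimensional $W\in\mathsf{Vect}_{\mathbb{Q}}$ with a decomposition $W=\bigoplus_{n\ge0}W_n$, each $W_n$ an $S_n$-representation. Morphisms are families of equivariant linear maps $W_n\to W'_n$. These form the category $\mathbb{S}\text{-}\mathsf{Vect}_{\mathbb{Q}}$. - A functor $F:\mathbb{S}\text{-}\mathsf{Vect}_{\mathbb{Q}}\to\mathsf{Vect}_{\mathbb{Q}}$ is polynomial if, for all $U,U'$, the map $\mathrm{Hom}_{\mathbb{S}\text{-}\mathsf{Vect}}(U,U')\to\mathrm{Hom}_{\mathbb{Q}}(F(U),F(U'))$ is a polynomial map of finite-dimensional vector spaces. - $\mathbf{P}[\mathbb{S}\text{-}\mathsf{Vect}_{\mathbb{Q}},\mathsf{Vect}_{\mathbb{Q}}]$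 is the category of such functors, with natural transformations as morphisms. **Generalized partitions and the groups $\mathbb{S}_\nu$.** - $\overline{\mathsf{Part}}$ is the set of generalized partitions $\nu=(0^{\nu_0},1^{\nu_1},2^{\nu_2},\dots)$: finite multisets of nonnegative integers, where $\nu_i$ is the multiplicity of $i$ and parts of size $0$ are allowed. - $\mathbb{S}_\nu:=\prod_{i\ge0}S_i\wr S_{\nu_i}$. - $S_i\wr S_m=S_i^m\rtimes S_m$ is the group of pairs $(\pi;\sigma_1,\dots,\sigma_m)$ with $\pi\in S_m$ and $\sigma_j\in S_i$, composed as the maps $(a,j)\mapsto(\sigma_j(a),\pi(j))$. For $i=0$ this is $S_m$. **$\mathbb{S}^{[2]}$-modules.** - An $\mathbb{S}^{[2]}$-module is a finite-dimensional $V=\bigoplus_{\nu\in\overline{\mathsf{Part}}}V_\nu$ with each $V_\nu$ an $\mathbb{S}_\nu$-representation. Morphisms are families of equivariant maps. These form $\mathbb{S}^{[2]}\text{-}\mathsf{Vect}_{\mathbb{Q}}$. **The action on $\bigotimes_i W_i^{\otimes\nu_i}$.** The group $S_i\wr S_{\nu_i}$ acts on $W_i^{\otimes\nu_i}$ as follows: $(\pi;\sigma_j)$ applies $\sigma_j$ to the $j$-th tensor factor and moves that factor to position $\pi(j)$. Hence $\mathbb{S}_\nu$ acts on $\bigotimes_{i\ge0}W_i^{\otimes\nu_i}$.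
   Formalization: Since ⊕_n(W_n)^{S_n} is polynomial but no F_V with V finite-dimensional, it is proved that finite-dimensional V match polynomial functors of uniformly bounded degree and support, and all polynomial functors match families (V_ν) with every F_V(W) finite-dimensional; both variances are given. *)

theory Defs
  imports
    "HOL-Algebra.AbelCoset"
    "HOL-Algebra.Sym_Groups"
    "HOL-Algebra.Product_Groups"
    "HOL-Library.Multiset"
    "Jordan_Normal_Form.VS_Connect"
begin

section \<open>Categories, functors, equivalences\<close>

text \<open>Hom-sets need not be disjoint; composition is therefore indexed by the three objects:
  \<open>Comp C X Y Z g f\<close> is the composite of \<open>f : X \<rightarrow> Y\<close> and \<open>g : Y \<rightarrow> Z\<close>.\<close>

record ('o, 'm) cat =
  Obj :: "'o set"
  Hom :: "'o \<Rightarrow> 'o \<Rightarrow> 'm set"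
  Id :: "'o \<Rightarrow> 'm"
  Comp :: "'o \<Rightarrow> 'o \<Rightarrow> 'o \<Rightarrow> 'm \<Rightarrow> 'm \<Rightarrow> 'm"

definition is_category :: "('o, 'm) cat \<Rightarrow> bool" where
  "is_category C \<longleftrightarrow>
    (\<forall>X\<in>Obj C. Id C X \<in> Hom C X X) \<and>
    (\<forall>X\<in>Obj C. \<forall>Y\<in>Obj C. \<forall>Z\<in>Obj C. \<forall>f\<in>Hom C X Y. \<forall>g\<in>Hom C Y Z.
       Comp C X Y Z g f \<in> Hom C X Z) \<and>
    (\<forall>X\<in>Obj C. \<forall>Y\<in>Obj C. \<forall>f\<in>Hom C X Y.
       Comp C X X Y f (Id C X) = f \<and> Comp C X Y Y (Id C Y) f = f) \<and>
    (\<forall>W\<in>Obj C. \<forall>X\<in>Obj C. \<forall>Y\<in>Obj C. \<forall>Z\<in>Obj C.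
       \<forall>f\<in>Hom C W X. \<forall>g\<in>Hom C X Y. \<forall>h\<in>Hom C Y Z.
       Comp C W X Z (Comp C X Y Z h g) f = Comp C W Y Z h (Comp C W X Y g f))"

definition opposite :: "('o, 'm) cat \<Rightarrow> ('o, 'm) cat" where
  "opposite C = \<lparr> Obj = Obj C, Hom = (\<lambda>X Y. Hom C Y X), Id = Id C,
     Comp = (\<lambda>X Y Z g f. Comp C Z Y X f g) \<rparr>"

definition full_subcat :: "('o, 'm) cat \<Rightarrow> ('o \<Rightarrow> bool) \<Rightarrow> ('o, 'm) cat" where
  "full_subcat C P = C\<lparr> Obj := {X \<in> Obj C. P X} \<rparr>"

definition is_iso :: "('o, 'm) cat \<Rightarrow> 'o \<Rightarrow> 'o \<Rightarrow> 'm \<Rightarrow> bool" where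
  "is_iso C X Y f \<longleftrightarrow> f \<in> Hom C X Y \<and>
    (\<exists>g\<in>Hom C Y X. Comp C X Y X g f = Id C X \<and> Comp C Y X Y f g = Id C Y)"

record ('o1, 'm1, 'o2, 'm2) fctr =
  omap :: "'o1 \<Rightarrow> 'o2"
  amap :: "'o1 \<Rightarrow> 'o1 \<Rightarrow> 'm1 \<Rightarrow> 'm2"

definition is_functor ::
  "('o1, 'm1) cat \<Rightarrow> ('o2, 'm2) cat \<Rightarrow> ('o1, 'm1, 'o2, 'm2) fctr \<Rightarrow> bool" where
  "is_functor C D F \<longleftrightarrow>
    (\<forall>X\<in>Obj C. omap F X \<in> Obj D) \<and>
    (\<forall>X\<in>Obj C. \<forall>Y\<in>Obj C. \<forall>f\<in>Hom C X Y. amap F X Y f \<in> Hom D (omap F X) (omap F Y)) \<and>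
    (\<forall>X\<in>Obj C. amap F X X (Id C X) = Id D (omap F X)) \<and>
    (\<forall>X\<in>Obj C. \<forall>Y\<in>Obj C. \<forall>Z\<in>Obj C. \<forall>f\<in>Hom C X Y. \<forall>g\<in>Hom C Y Z.
       amap F X Z (Comp C X Y Z g f)
         = Comp D (omap F X) (omap F Y) (omap F Z) (amap F Y Z g) (amap F X Y f))"

definition id_functor :: "('o, 'm, 'o, 'm) fctr" where
  "id_functor = \<lparr> omap = (\<lambda>X. X), amap = (\<lambda>X Y f. f) \<rparr>"

definition comp_functor ::
  "('o2, 'm2, 'o3, 'm3) fctr \<Rightarrow> ('o1, 'm1, 'o2, 'm2) fctr \<Rightarrow> ('o1, 'm1, 'o3, 'm3) fctr"
  where
  "comp_functor G F = \<lparr> omap = (\<lambda>X. omap G (omap F X)),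
     amap = (\<lambda>X Y f. amap G (omap F X) (omap F Y) (amap F X Y f)) \<rparr>"

definition nat_trans ::
  "('o1, 'm1) cat \<Rightarrow> ('o2, 'm2) cat \<Rightarrow> ('o1, 'm1, 'o2, 'm2) fctr \<Rightarrow>
   ('o1, 'm1, 'o2, 'm2) fctr \<Rightarrow> ('o1 \<Rightarrow> 'm2) set" where
  "nat_trans C D F G = {\<eta> \<in> extensional (Obj C).
    (\<forall>X\<in>Obj C. \<eta> X \<in> Hom D (omap F X) (omap G X)) \<and>
    (\<forall>X\<in>Obj C. \<forall>Y\<in>Obj C. \<forall>f\<in>Hom C X Y.
       Comp D (omap F X) (omap F Y) (omap G Y) (\<eta> Y) (amap F X Y f)
         = Comp D (omap F X) (omap G X) (omap G Y) (amap G X Y f) (\<eta> X))}"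

definition fun_cat ::
  "('o1, 'm1) cat \<Rightarrow> ('o2, 'm2) cat \<Rightarrow> (('o1, 'm1, 'o2, 'm2) fctr, 'o1 \<Rightarrow> 'm2) cat" where
  "fun_cat C D = \<lparr> Obj = {F. is_functor C D F}, Hom = nat_trans C D,
     Id = (\<lambda>F. \<lambda>X\<in>Obj C. Id D (omap F X)),
     Comp = (\<lambda>F G H \<epsilon> \<eta>. \<lambda>X\<in>Obj C. Comp D (omap F X) (omap G X) (omap H X) (\<epsilon> X) (\<eta> X)) \<rparr>"

definition is_equivalence ::
  "('o1, 'm1) cat \<Rightarrow> ('o2, 'm2) cat \<Rightarrow> ('o1, 'm1, 'o2, 'm2) fctr \<Rightarrow> bool" where
  "is_equivalence C D F \<longleftrightarrow> is_category C \<and> is_category D \<and> is_functor C D F \<and>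
    (\<exists>G. is_functor D C G \<and>
      (\<exists>\<eta>. is_iso (fun_cat C C) id_functor (comp_functor G F) \<eta>) \<and>
      (\<exists>\<epsilon>. is_iso (fun_cat D D) (comp_functor F G) id_functor \<epsilon>))"


section \<open>Rational vector spaces\<close>

text \<open>Vector spaces are carrier-based: \<open>('a) qvs\<close> is the type of candidate vector spaces whose
  elements live in the type \<open>'a\<close>.  Every finite-dimensional rational vector space is countable, so
  as soon as \<open>'a\<close> is infinite all of them occur up to isomorphism.  The ring fields \<open>mult\<close> and \<open>one\<close> of the module record play
  no role.\<close>

type_synonym 'a qvs = "(rat, 'a) module"

definition mk_qvs :: "'a set \<Rightarrow> 'a \<Rightarrow> ('a \<Rightarrow> 'a \<Rightarrow> 'a) \<Rightarrow> (rat \<Rightarrow> 'a \<Rightarrow> 'a) \<Rightarrow> 'a qvs" where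
  "mk_qvs A z p s = \<lparr> carrier = A, monoid.mult = undefined, one = undefined, zero = z, add = p, smult = s \<rparr>"

definition fdvs :: "'a qvs \<Rightarrow> bool" where
  "fdvs V \<longleftrightarrow> vectorspace class_ring V \<and> vectorspace.fin_dim class_ring V"

definition lin :: "'a qvs \<Rightarrow> 'b qvs \<Rightarrow> ('a \<Rightarrow> 'b) set" where
  "lin V W = LinearCombinations.module_hom class_ring V W \<inter> extensional (carrier V)"

definition Vect :: "('a qvs, 'a \<Rightarrow> 'a) cat" where
  "Vect = \<lparr> Obj = {V. fdvs V}, Hom = lin, Id = (\<lambda>V. \<lambda>v\<in>carrier V. v),
     Comp = (\<lambda>U V W g f. compose (carrier U) g f) \<rparr>"

text \<open>Subspace of \<open>Hom(V,W)\<close> with carrier \<open>H\<close>, pointwise operations.\<close>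

definition hom_subspace :: "('a \<Rightarrow> 'b) set \<Rightarrow> 'a qvs \<Rightarrow> 'b qvs \<Rightarrow> ('a \<Rightarrow> 'b) qvs" where
  "hom_subspace H V W = mk_qvs H (\<lambda>v\<in>carrier V. \<zero>\<^bsub>W\<^esub>)
     (\<lambda>f g. \<lambda>v\<in>carrier V. f v \<oplus>\<^bsub>W\<^esub> g v) (\<lambda>r f. \<lambda>v\<in>carrier V. r \<odot>\<^bsub>W\<^esub> f v)"

definition hom_vs :: "'a qvs \<Rightarrow> 'b qvs \<Rightarrow> ('a \<Rightarrow> 'b) qvs" where
  "hom_vs V W = hom_subspace (lin V W) V W"

definition dprod :: "('i \<Rightarrow> 'a qvs) \<Rightarrow> ('i \<Rightarrow> 'a) qvs" where
  "dprod V = mk_qvs {x. \<forall>i. x i \<in> carrier (V i)} (\<lambda>i. \<zero>\<^bsub>V i\<^esub>)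
     (\<lambda>x y i. x i \<oplus>\<^bsub>V i\<^esub> y i) (\<lambda>r x i. r \<odot>\<^bsub>V i\<^esub> x i)"

definition dsum :: "('i \<Rightarrow> 'a qvs) \<Rightarrow> ('i \<Rightarrow> 'a) qvs" where
  "dsum V = (dprod V)\<lparr> carrier := {x \<in> carrier (dprod V). finite {i. x i \<noteq> \<zero>\<^bsub>V i\<^esub>}} \<rparr>"


section \<open>Tensor products\<close>

text \<open>The tensor product \<open>\<Otimes>\<^sub>k\<^sub>\<in>\<^sub>J X k\<close> is the free vector space on the set \<open>\<Prod>\<^sub>k\<^sub>\<in>\<^sub>J X k\<close>
  modulo the span of the multilinearity relations.\<close>

definition free_vs :: "'s set \<Rightarrow> ('s \<Rightarrow> rat) qvs" where
  "free_vs S = mk_qvs {c. finite {s. c s \<noteq> 0} \<and> (\<forall>s. s \<notin> S \<longrightarrow> c s = 0)} (\<lambda>s. 0)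
     (\<lambda>c d s. c s + d s) (\<lambda>r c s. r * c s)"

definition pt :: "'s \<Rightarrow> 's \<Rightarrow> rat" where
  "pt s = (\<lambda>t. if t = s then 1 else 0)"

definition quot_vs :: "'a qvs \<Rightarrow> 'a set \<Rightarrow> 'a set qvs" where
  "quot_vs M N = mk_qvs (a_rcosets\<^bsub>M\<^esub> N) N (\<lambda>A B. A <+>\<^bsub>M\<^esub> B)
     (\<lambda>r A. \<Union>x\<in>A. N +>\<^bsub>M\<^esub> (r \<odot>\<^bsub>M\<^esub> x))"

definition tuples :: "'k set \<Rightarrow> ('k \<Rightarrow> 'a qvs) \<Rightarrow> ('k \<Rightarrow> 'a) set" where
  "tuples J X = (\<Pi>\<^sub>E k\<in>J. carrier (X k))"

definition multilinear_relations :: "'k set \<Rightarrow> ('k \<Rightarrow> 'a qvs) \<Rightarrow> (('k \<Rightarrow> 'a) \<Rightarrow> rat) set" where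
  "multilinear_relations J X =
    {(\<lambda>t. pt (w(k := a \<oplus>\<^bsub>X k\<^esub> b)) t - pt (w(k := a)) t - pt (w(k := b)) t) | w k a b.
       w \<in> tuples J X \<and> k \<in> J \<and> a \<in> carrier (X k) \<and> b \<in> carrier (X k)} \<union>
    {(\<lambda>t. pt (w(k := r \<odot>\<^bsub>X k\<^esub> a)) t - r * pt (w(k := a)) t) | w k r a.
       w \<in> tuples J X \<and> k \<in> J \<and> a \<in> carrier (X k)}"

definition null_tensors :: "'k set \<Rightarrow> ('k \<Rightarrow> 'a qvs) \<Rightarrow> (('k \<Rightarrow> 'a) \<Rightarrow> rat) set" where
  "null_tensors J X =
     LinearCombinations.module.span class_ring (free_vs (tuples J X)) (multilinear_relations J X)"

definition tensor :: "'k set \<Rightarrow> ('k \<Rightarrow> 'a qvs) \<Rightarrow> (('k \<Rightarrow> 'a) \<Rightarrow> rat) set qvs" where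
  "tensor J X = quot_vs (free_vs (tuples J X)) (null_tensors J X)"

definition pure_tensor :: "'k set \<Rightarrow> ('k \<Rightarrow> 'a qvs) \<Rightarrow> ('k \<Rightarrow> 'a) \<Rightarrow> (('k \<Rightarrow> 'a) \<Rightarrow> rat) set" where
  "pure_tensor J X w = null_tensors J X +>\<^bsub>free_vs (tuples J X)\<^esub> pt w"

text \<open>The linear map between tensor products that is given by \<open>h\<close> on pure tensors.  It is only
  used for \<open>h\<close> which apply linear maps to the factors and permute them; for such \<open>h\<close> it exists and
  is unique.\<close>

definition tensor_map ::
  "'k set \<Rightarrow> ('k \<Rightarrow> 'a qvs) \<Rightarrow> ('k \<Rightarrow> 'a qvs) \<Rightarrow> (('k \<Rightarrow> 'a) \<Rightarrow> ('k \<Rightarrow> 'a)) \<Rightarrow>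
   (('k \<Rightarrow> 'a) \<Rightarrow> rat) set \<Rightarrow> (('k \<Rightarrow> 'a) \<Rightarrow> rat) set" where
  "tensor_map J X Y h = (THE L. L \<in> lin (tensor J X) (tensor J Y) \<and>
     (\<forall>w\<in>tuples J X. L (pure_tensor J X w) = pure_tensor J Y (h w)))"


section \<open>Representations and graded representations\<close>

record ('g, 'a) rep =
  space :: "'a qvs"
  act :: "'g \<Rightarrow> 'a \<Rightarrow> 'a"

definition is_rep :: "'g monoid \<Rightarrow> ('g, 'a) rep \<Rightarrow> bool" where
  "is_rep G R \<longleftrightarrow> fdvs (space R) \<and>
    (\<forall>g\<in>carrier G. act R g \<in> LinearCombinations.module_hom class_ring (space R) (space R)) \<and>
    (\<forall>v\<in>carrier (space R). act R \<one>\<^bsub>G\<^esub> v = v) \<and>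
    (\<forall>g\<in>carrier G. \<forall>h\<in>carrier G. \<forall>v\<in>carrier (space R).
       act R (g \<otimes>\<^bsub>G\<^esub> h) v = act R g (act R h v))"

definition rep_hom :: "'g monoid \<Rightarrow> ('g, 'a) rep \<Rightarrow> ('g, 'b) rep \<Rightarrow> ('a \<Rightarrow> 'b) set" where
  "rep_hom G R R' = {f \<in> lin (space R) (space R').
     \<forall>g\<in>carrier G. \<forall>v\<in>carrier (space R). f (act R g v) = act R' g (f v)}"

definition rep_hom_vs :: "'g monoid \<Rightarrow> ('g, 'a) rep \<Rightarrow> ('g, 'b) rep \<Rightarrow> ('a \<Rightarrow> 'b) qvs" where
  "rep_hom_vs G R R' = hom_subspace (rep_hom G R R') (space R) (space R')"

text \<open>For a family of groups \<open>G i\<close>: families of finite-dimensional representations \<open>W i\<close> of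
  \<open>G i\<close> with families of equivariant maps as morphisms.  In \<open>graded_cat G\<close> the total space
  \<open>\<Oplus>\<^sub>i W i\<close> is required to be finite-dimensional, in \<open>pgraded_cat G\<close> it is not.\<close>

definition pgraded_cat ::
  "('i \<Rightarrow> 'g monoid) \<Rightarrow> ('i \<Rightarrow> ('g, 'a) rep, 'i \<Rightarrow> 'a \<Rightarrow> 'a) cat" where
  "pgraded_cat G = \<lparr> Obj = {W. \<forall>i. is_rep (G i) (W i)},
     Hom = (\<lambda>W W'. {f. \<forall>i. f i \<in> rep_hom (G i) (W i) (W' i)}),
     Id = (\<lambda>W i. \<lambda>v\<in>carrier (space (W i)). v),
     Comp = (\<lambda>U V W g f i. compose (carrier (space (U i))) (g i) (f i)) \<rparr>"

definition graded_cat ::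
  "('i \<Rightarrow> 'g monoid) \<Rightarrow> ('i \<Rightarrow> ('g, 'a) rep, 'i \<Rightarrow> 'a \<Rightarrow> 'a) cat" where
  "graded_cat G = full_subcat (pgraded_cat G) (\<lambda>W. fdvs (dsum (\<lambda>i. space (W i))))"

definition graded_hom_vs ::
  "('i \<Rightarrow> 'g monoid) \<Rightarrow> ('i \<Rightarrow> ('g, 'a) rep) \<Rightarrow> ('i \<Rightarrow> ('g, 'a) rep) \<Rightarrow> ('i \<Rightarrow> 'a \<Rightarrow> 'a) qvs" where
  "graded_hom_vs G W W' = dprod (\<lambda>i. rep_hom_vs (G i) (W i) (W' i))"


section \<open>The categories of S-modules and of modules over the generalized wreath products\<close>

type_synonym perm = "nat \<Rightarrow> nat"
type_synonym wr = "perm \<times> (nat \<Rightarrow> perm)"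
type_synonym 'a smod = "nat \<Rightarrow> (perm, 'a) rep"
type_synonym 'a s2mod = "nat multiset \<Rightarrow> (nat \<Rightarrow> wr, 'a) rep"

abbreviation SVect :: "('a smod, nat \<Rightarrow> 'a \<Rightarrow> 'a) cat" where
  "SVect \<equiv> graded_cat sym_group"

text \<open>\<open>S\<^sub>i \<wr> S\<^sub>m\<close>: the element \<open>(\<pi>, \<sigma>)\<close> stands for the map \<open>(a, j) \<mapsto> (\<sigma> j a, \<pi> j)\<close>, and the
  multiplication is composition of these maps.\<close>

definition wreath :: "nat \<Rightarrow> nat \<Rightarrow> wr monoid" where
  "wreath i m = \<lparr> carrier = carrier (sym_group m) \<times> ({1..m} \<rightarrow>\<^sub>E carrier (sym_group i)),
     monoid.mult = (\<lambda>(\<pi>, \<sigma>) (\<pi>', \<sigma>'). (\<pi> \<circ> \<pi>', \<lambda>j\<in>{1..m}. \<sigma> (\<pi>' j) \<circ> \<sigma>' j)),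
     one = (id, \<lambda>j\<in>{1..m}. id) \<rparr>"

text \<open>A generalized partition is a multiset of natural numbers, with \<open>\<nu>\<^sub>i = count \<nu> i\<close>.  All but
  finitely many factors of the following product are trivial.\<close>

definition S_nu :: "nat multiset \<Rightarrow> (nat \<Rightarrow> wr) monoid" where
  "S_nu \<nu> = product_group UNIV (\<lambda>i. wreath i (count \<nu> i))"

abbreviation S2Vect :: "('a s2mod, nat multiset \<Rightarrow> 'a \<Rightarrow> 'a) cat" where
  "S2Vect \<equiv> graded_cat S_nu"


section \<open>Polynomial functors\<close>

text \<open>A map \<open>\<phi> : A \<rightarrow> B\<close> is polynomial of degree at most \<open>d\<close> if for all vectors
  \<open>a\<^sub>0, \<dots>, a\<^sub>r\<^sub>-\<^sub>1\<close> of \<open>A\<close> the vector \<open>\<phi>(x\<^sub>0 a\<^sub>0 + \<dots> + x\<^sub>r\<^sub>-\<^sub>1 a\<^sub>r\<^sub>-\<^sub>1)\<close> is a polynomial of degree at most \<open>d\<close>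
  in the scalars \<open>x\<^sub>0, \<dots>, x\<^sub>r\<^sub>-\<^sub>1\<close> with coefficients in \<open>B\<close>.\<close>

definition exponents :: "nat \<Rightarrow> nat \<Rightarrow> (nat \<Rightarrow> nat) set" where
  "exponents r d = {e. (\<forall>i\<ge>r. e i = 0) \<and> (\<Sum>i<r. e i) \<le> d}"

definition polynomial_map_le :: "nat \<Rightarrow> 'a qvs \<Rightarrow> 'b qvs \<Rightarrow> ('a \<Rightarrow> 'b) \<Rightarrow> bool" where
  "polynomial_map_le d A B \<phi> \<longleftrightarrow> \<phi> \<in> carrier A \<rightarrow> carrier B \<and>
    (\<forall>r. \<forall>a\<in>{..<r} \<rightarrow> carrier A. \<exists>c\<in>exponents r d \<rightarrow> carrier B. \<forall>x :: nat \<Rightarrow> rat.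
       \<phi> (\<Oplus>\<^bsub>A\<^esub>i\<in>{..<r}. x i \<odot>\<^bsub>A\<^esub> a i)
         = (\<Oplus>\<^bsub>B\<^esub>e\<in>exponents r d. (\<Prod>i<r. x i ^ e i) \<odot>\<^bsub>B\<^esub> c e))"

definition polynomial_map :: "'a qvs \<Rightarrow> 'b qvs \<Rightarrow> ('a \<Rightarrow> 'b) \<Rightarrow> bool" where
  "polynomial_map A B \<phi> \<longleftrightarrow> (\<exists>d. polynomial_map_le d A B \<phi>)"

type_synonym ('a, 'b) svect_functor = "('a smod, nat \<Rightarrow> 'a \<Rightarrow> 'a, 'b qvs, 'b \<Rightarrow> 'b) fctr"

definition polynomial_functor :: "('a, 'b) svect_functor \<Rightarrow> bool" where
  "polynomial_functor F \<longleftrightarrow> (\<forall>U\<in>Obj SVect. \<forall>U'\<in>Obj SVect.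
     polynomial_map (graded_hom_vs sym_group U U') (hom_vs (omap F U) (omap F U')) (amap F U U'))"

text \<open>Uniform version: the degree of \<open>f \<mapsto> F f\<close> is bounded independently of source and target, and
  \<open>F f\<close> depends only on a bounded number of the components \<open>f\<^sub>0, f\<^sub>1, \<dots>\<close> of \<open>f\<close>.  Both
  \<open>W \<mapsto> \<Oplus>\<^sub>d \<Lambda>\<^sup>d W\<^sub>0\<close> and \<open>W \<mapsto> \<Oplus>\<^sub>n (W\<^sub>n)\<^bsup>S\<^sub>n\<^esup>\<close> are polynomial functors which are not
  bounded; they are not of the form \<open>F\<^sub>V\<close> with \<open>V\<close> of finite total dimension.\<close>

definition bounded_polynomial_functor :: "('a, 'b) svect_functor \<Rightarrow> bool" where
  "bounded_polynomial_functor F \<longleftrightarrow> (\<exists>d. \<forall>U\<in>Obj SVect. \<forall>U'\<in>Obj SVect.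
     polynomial_map_le d
       (graded_hom_vs sym_group U U') (hom_vs (omap F U) (omap F U')) (amap F U U') \<and>
     (\<forall>f\<in>Hom SVect U U'. \<forall>g\<in>Hom SVect U U'.
        (\<forall>n\<le>d. f n = g n) \<longrightarrow> amap F U U' f = amap F U U' g))"

abbreviation PolyFun :: "(('a, 'b) svect_functor, 'a smod \<Rightarrow> 'b \<Rightarrow> 'b) cat" where
  "PolyFun \<equiv> full_subcat (fun_cat SVect Vect) polynomial_functor"

abbreviation PolyFun_bounded :: "(('a, 'b) svect_functor, 'a smod \<Rightarrow> 'b \<Rightarrow> 'b) cat" where
  "PolyFun_bounded \<equiv> full_subcat (fun_cat SVect Vect) bounded_polynomial_functor"


section \<open>The functors \<open>F\<^sub>V\<close>\<close>

text \<open>\<open>\<Otimes>\<^sub>i W\<^sub>i\<^bsup>\<otimes>\<nu>\<^sub>i\<^esup>\<close> is the tensor product of the spaces \<open>W i\<close> over all pairs \<open>(i, j)\<close> with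
  \<open>1 \<le> j \<le> \<nu>\<^sub>i\<close>.\<close>

definition slots :: "nat multiset \<Rightarrow> (nat \<times> nat) set" where
  "slots \<nu> = (SIGMA i:UNIV. {1..count \<nu> i})"

definition factors :: "'a smod \<Rightarrow> nat \<times> nat \<Rightarrow> 'a qvs" where
  "factors W = (\<lambda>(i, j). space (W i))"

type_synonym 'a tens = "((nat \<times> nat \<Rightarrow> 'a) \<Rightarrow> rat) set"

text \<open>The component \<open>(\<pi>, \<sigma>)\<close> of \<open>g\<close> at \<open>i\<close> moves the \<open>j\<close>-th factor \<open>w\<^sub>j\<close> to position \<open>\<pi> j\<close>
  after applying \<open>\<sigma> j\<close>; so the new factor at position \<open>j\<close> comes from position \<open>\<pi>\<^bsup>-1\<^esup> j\<close>.\<close>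

definition wreath_act_tuple ::
  "'a smod \<Rightarrow> nat multiset \<Rightarrow> (nat \<Rightarrow> wr) \<Rightarrow> (nat \<times> nat \<Rightarrow> 'a) \<Rightarrow> nat \<times> nat \<Rightarrow> 'a" where
  "wreath_act_tuple W \<nu> g w = (\<lambda>(i, j)\<in>slots \<nu>.
     let \<pi> = fst (g i); \<sigma> = snd (g i); j' = inv_into UNIV \<pi> j in act (W i) (\<sigma> j') (w (i, j')))"

definition tensor_power :: "'a smod \<Rightarrow> nat multiset \<Rightarrow> (nat \<Rightarrow> wr, 'a tens) rep" where
  "tensor_power W \<nu> = \<lparr> space = tensor (slots \<nu>) (factors W),
     act = (\<lambda>g. tensor_map (slots \<nu>) (factors W) (factors W) (wreath_act_tuple W \<nu> g)) \<rparr>"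

definition tensor_power_map ::
  "'a smod \<Rightarrow> 'a smod \<Rightarrow> (nat \<Rightarrow> 'a \<Rightarrow> 'a) \<Rightarrow> nat multiset \<Rightarrow> 'a tens \<Rightarrow> 'a tens" where
  "tensor_power_map W W' f \<nu> = tensor_map (slots \<nu>) (factors W) (factors W')
     (\<lambda>w. \<lambda>(i, j)\<in>slots \<nu>. f i (w (i, j)))"

type_synonym ('v, 'a) schur = "nat multiset \<Rightarrow> 'v \<Rightarrow> 'a tens"

definition schur_space :: "'v s2mod \<Rightarrow> 'a smod \<Rightarrow> ('v, 'a) schur qvs" where
  "schur_space V W = dsum (\<lambda>\<nu>. rep_hom_vs (S_nu \<nu>) (V \<nu>) (tensor_power W \<nu>))"

definition F_functor :: "'v s2mod \<Rightarrow> ('a, ('v, 'a) schur) svect_functor" where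
  "F_functor V = \<lparr> omap = schur_space V,
     amap = (\<lambda>W W' f. \<lambda>x\<in>carrier (schur_space V W).
       \<lambda>\<nu>. compose (carrier (space (V \<nu>))) (tensor_power_map W W' f \<nu>) (x \<nu>)) \<rparr>"

text \<open>A morphism \<open>\<phi> : V' \<rightarrow> V\<close> induces \<open>F\<^sub>V \<rightarrow> F\<^sub>V\<^sub>'\<close> by precomposition; so \<open>V \<mapsto> F\<^sub>V\<close> with this
  action on morphisms is a functor on the opposite category.\<close>

definition schur_functor ::
  "('v s2mod, nat multiset \<Rightarrow> 'v \<Rightarrow> 'v,
    ('a, ('v, 'a) schur) svect_functor, 'a smod \<Rightarrow> ('v, 'a) schur \<Rightarrow> ('v, 'a) schur) fctr" where
  "schur_functor = \<lparr> omap = F_functor,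
     amap = (\<lambda>V V' \<phi>. \<lambda>W\<in>Obj SVect. \<lambda>x\<in>carrier (schur_space V W).
       \<lambda>\<nu>. compose (carrier (space (V' \<nu>))) (x \<nu>) (\<phi> \<nu>)) \<rparr>"

text \<open>Families \<open>(V\<^sub>\<nu>)\<close> of finite-dimensional representations, possibly infinitely many of them
  nonzero, for which \<open>F\<^sub>V\<close> still takes values in finite-dimensional spaces.\<close>

definition S2Vect_pf ::
  "'a itself \<Rightarrow> ('v s2mod, nat multiset \<Rightarrow> 'v \<Rightarrow> 'v) cat" where
  "S2Vect_pf _ = full_subcat (pgraded_cat S_nu)
     (\<lambda>V. \<forall>W\<in>Obj (SVect :: ('a smod, _) cat). fdvs (schur_space V W))"

end

theory Submission
 imports Defs
begin

text \<open>
  The representing objects of the construction are the free objects \<open>Proj nu\<close> with one generator for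
  each slot \<open>(i, j)\<close> of \<open>nu\<close>.  Scaling the generators gives endomorphisms \<open>diag nu t\<close> of \<open>Proj nu\<close>, and for a
  polynomial functor \<open>F\<close> the subspace \<open>mlpart nu F\<close> of \<open>F (Proj nu)\<close> on which \<open>F (diag nu t)\<close> is multiplication by
  \<open>\<Prod>s. t s\<close> is a representation of \<open>S_nu nu\<close>.  Extracting multilinear coefficients (polarization, where
  characteristic zero is used) from the decomposition of the identity of \<open>W\<close> into averages over the
  symmetric groups shows that a subfunctor of \<open>F\<close> is determined by its intersections with the spaces
  \<open>mlpart nu F\<close>.  For \<open>F = F_functor V\<close> these spaces are the dual spaces of the \<open>V nu\<close>, which gives full
  faithfulness; for arbitrary \<open>F\<close> the duals of \<open>mlpart nu F\<close> form a \<open>V\<close> with \<open>F_functor V\<close> isomorphic to \<open>F\<close>.  The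
  covariant equivalence differs from the contravariant one by taking adjoints with respect to
  invariant positive definite forms, which makes the category of the \<open>V\<close> self-dual.
\<close>

text \<open>The dimension of the values shapes the proof. The module \<open>V\<close> assembled from
  the multilinear parts of \<open>F\<close> may have infinitely many nonzero members, and the spaces
  \<open>schur_space V W\<close> are known to be finite-dimensional only once they have been
  embedded in those of \<open>F\<close>. The core argument therefore concerns functors whose values
  merely have enough functionals to separate points (\<open>SVS\<close>), with a degree that may
  depend on the vector (\<open>lpf\<close>). Identities between vectors are tested on functionals,
  where they become identities between rational polynomials. Coefficients of polynomial maps are
  obtained by Lagrange interpolation, that is, as fixed rational combinations of values. So they
  stay inside every subfunctor that contains the values, and this is what allows a subfunctor to be
  recovered from its multilinear parts. Three kinds of integers have to be inverted: orders of
  symmetric groups (decomposition of the identity), products of factorials (polarization) and the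
  order of \<open>S_nu nu\<close> (comparison of \<open>F_functor V\<close> with
  \<open>F\<close>).\<close>

abbreviation (input) index_add ("(_ \<oplus>[_]/ _)" [65, 0, 66] 65) where "x \<oplus>[V] y \<equiv> x \<oplus>\<^bsub>V\<^esub> y"
abbreviation (input) index_smult ("(_ \<odot>[_]/ _)" [70, 0, 71] 70) where "r \<odot>[V] x \<equiv> r \<odot>\<^bsub>V\<^esub> x"
abbreviation (input) index_mult ("(_ \<otimes>[_]/ _)" [70, 0, 71] 70) where "g \<otimes>[G] h \<equiv> g \<otimes>\<^bsub>G\<^esub> h"
abbreviation (input) index_zero ("\<zero>[_]") where "\<zero>[V] \<equiv> \<zero>\<^bsub>V\<^esub>"
abbreviation (input) index_one ("\<one>[_]") where "\<one>[G] \<equiv> \<one>\<^bsub>G\<^esub>"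
abbreviation (input) index_inv ("inv[_] _" [0, 81] 80) where "inv[G] g \<equiv> inv\<^bsub>G\<^esub> g"
abbreviation cs where "cs R \<equiv> carrier (space R)"
abbreviation cF where "cF V W \<equiv> carrier (schur_space V W)"
abbreviation SG where "SG nu \<equiv> carrier (S_nu nu)"
abbreviation tpow where "tpow nu W \<equiv> tensor (slots nu) (factors W)"
abbreviation pten where "pten nu W \<equiv> pure_tensor (slots nu) (factors W)"
abbreviation shv where "shv \<equiv> graded_hom_vs sym_group"
type_synonym ('v, 'a) sfr = "('a, ('v, 'a) schur) svect_functor"

section \<open>Equivalences of categories\<close>

lemma full_subcat_simps [simp]:
 "Obj (full_subcat C P) = {X : Obj C. P X}"
 "Hom (full_subcat C P) = Hom C"
 "Id (full_subcat C P) = Id C"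
 "Comp (full_subcat C P) = Comp C"
 by (simp_all add: full_subcat_def)

lemma opposite_simps [simp]:
 "Obj (opposite C) = Obj C"
 "Hom (opposite C) X Y = Hom C Y X"
 "Id (opposite C) = Id C"
 "Comp (opposite C) X Y Z g f = Comp C Z Y X f g"
 by (simp_all add: opposite_def)

lemma is_category_full_subcat: "is_category C ==> is_category (full_subcat C P)"
 by (auto simp: is_category_def)

lemma is_category_opposite: "is_category C ==> is_category (opposite C)"
 by (auto simp: is_category_def)

lemma category_id: "is_category C ==> X : Obj C ==> Id C X : Hom C X X"
 by (auto simp: is_category_def)

lemma category_comp:
 "is_category C ==> X : Obj C ==> Y : Obj C ==> Z : Obj C ==>
  f : Hom C X Y ==> g : Hom C Y Z ==> Comp C X Y Z g f : Hom C X Z"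
 by (auto simp: is_category_def)

lemma category_comp_id:
 "is_category C ==> X : Obj C ==> Y : Obj C ==> f : Hom C X Y ==> Comp C X X Y f (Id C X) = f"
 "is_category C ==> X : Obj C ==> Y : Obj C ==> f : Hom C X Y ==> Comp C X Y Y (Id C Y) f = f"
 by (auto simp: is_category_def)

lemma category_assoc:
 "is_category C ==> W : Obj C ==> X : Obj C ==> Y : Obj C ==> Z : Obj C ==>
  f : Hom C W X ==> g : Hom C X Y ==> h : Hom C Y Z ==>
  Comp C W X Z (Comp C X Y Z h g) f = Comp C W Y Z h (Comp C W X Y g f)"
 unfolding is_category_def by blast

lemma is_functorD:
 assumes "is_functor C D F"
 shows "X : Obj C ==> omap F X : Obj D"
  and "X : Obj C ==> Y : Obj C ==> f : Hom C X Y ==> amap F X Y f : Hom D (omap F X) (omap F Y)"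
  and "X : Obj C ==> amap F X X (Id C X) = Id D (omap F X)"
  and "X : Obj C ==> Y : Obj C ==> Z : Obj C ==> f : Hom C X Y ==> g : Hom C Y Z ==>
   amap F X Z (Comp C X Y Z g f)
    = Comp D (omap F X) (omap F Y) (omap F Z) (amap F Y Z g) (amap F X Y f)"
 using assms unfolding is_functor_def by blast+

lemma is_category_fun_cat:
 assumes "is_category C" "is_category D"
 shows "is_category (fun_cat C D)"
 unfolding is_category_def
proof (intro conjI ballI)
 fix F assume "F : Obj (fun_cat C D)"
 then have F: "is_functor C D F" by (simp add: fun_cat_def)
 note FD = is_functorD[OF F]
 show "Id (fun_cat C D) F : Hom (fun_cat C D) F F"
  by (simp add: fun_cat_def nat_trans_def FD category_id[OF assms(2)] category_comp_id[OF assms(2)])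
next
 fix F G H f g assume "F : Obj (fun_cat C D)" "G : Obj (fun_cat C D)" "H : Obj (fun_cat C D)"
  and fg: "f : Hom (fun_cat C D) F G" "g : Hom (fun_cat C D) G H"
 then have *: "is_functor C D F" "is_functor C D G" "is_functor C D H" by (simp_all add: fun_cat_def)
 note FD = is_functorD[OF *(1)] is_functorD[OF *(2)] is_functorD[OF *(3)]
 have f: "!!X. X : Obj C ==> f X : Hom D (omap F X) (omap G X)"
   "!!X Y h. X : Obj C ==> Y : Obj C ==> h : Hom C X Y ==>
    Comp D (omap F X) (omap F Y) (omap G Y) (f Y) (amap F X Y h)
    = Comp D (omap F X) (omap G X) (omap G Y) (amap G X Y h) (f X)"
  using fg by (auto simp: fun_cat_def nat_trans_def)
 have g: "!!X. X : Obj C ==> g X : Hom D (omap G X) (omap H X)"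
   "!!X Y h. X : Obj C ==> Y : Obj C ==> h : Hom C X Y ==>
    Comp D (omap G X) (omap G Y) (omap H Y) (g Y) (amap G X Y h)
    = Comp D (omap G X) (omap H X) (omap H Y) (amap H X Y h) (g X)"
  using fg by (auto simp: fun_cat_def nat_trans_def)
 show "Comp (fun_cat C D) F G H g f : Hom (fun_cat C D) F H"
  unfolding fun_cat_def nat_trans_def
 proof (simp, intro conjI ballI)
  fix X assume X: "X : Obj C"
  show "Comp D (omap F X) (omap G X) (omap H X) (g X) (f X) : Hom D (omap F X) (omap H X)"
   using X by (intro category_comp[OF assms(2)] FD f g)
  fix Y h assume Y: "Y : Obj C" and h: "h : Hom C X Y"
  note [simp] = category_assoc[OF assms(2)] FD X Y h f g
  have "Comp D (omap F X) (omap F Y) (omap H Y)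
    (Comp D (omap F Y) (omap G Y) (omap H Y) (g Y) (f Y)) (amap F X Y h)
    = Comp D (omap F X) (omap G Y) (omap H Y) (g Y)
    (Comp D (omap F X) (omap F Y) (omap G Y) (f Y) (amap F X Y h))"
   by (rule category_assoc[OF assms(2)]) (use X Y h in "auto intro!: FD f(1) g(1)")
  also have "... = Comp D (omap F X) (omap G X) (omap H Y)
    (Comp D (omap G X) (omap G Y) (omap H Y) (g Y) (amap G X Y h)) (f X)"
   unfolding f(2)[OF X Y h]
   by (rule category_assoc[OF assms(2), symmetric]) (use X Y h in "auto intro!: FD f(1) g(1)")
  also have "... = Comp D (omap F X) (omap H X) (omap H Y) (amap H X Y h)
    (Comp D (omap F X) (omap G X) (omap H X) (g X) (f X))"
   unfolding g(2)[OF X Y h]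
   by (rule category_assoc[OF assms(2)]) (use X Y h in "auto intro!: FD f(1) g(1)")
  finally show "Comp D (omap F X) (omap F Y) (omap H Y)
    (Comp D (omap F Y) (omap G Y) (omap H Y) (g Y) (f Y)) (amap F X Y h)
    = Comp D (omap F X) (omap H X) (omap H Y) (amap H X Y h)
    (Comp D (omap F X) (omap G X) (omap H X) (g X) (f X))" .
 qed
next
 fix F G f assume "F : Obj (fun_cat C D)" "G : Obj (fun_cat C D)" "f : Hom (fun_cat C D) F G"
 then have *: "is_functor C D F" "is_functor C D G" and f: "f : extensional (Obj C)"
   "!!X. X : Obj C ==> f X : Hom D (omap F X) (omap G X)"
  by (simp_all add: fun_cat_def nat_trans_def)
 note FD = is_functorD[OF *(1)] is_functorD[OF *(2)]
 show "Comp (fun_cat C D) F F G f (Id (fun_cat C D) F) = f"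
  using f by (auto simp: fun_cat_def FD category_comp_id[OF assms(2)] extensional_def fun_eq_iff)
 show "Comp (fun_cat C D) F G G (Id (fun_cat C D) G) f = f"
  using f by (auto simp: fun_cat_def FD category_comp_id[OF assms(2)] extensional_def fun_eq_iff)
next
 fix F G H K f g h assume "F : Obj (fun_cat C D)" "G : Obj (fun_cat C D)" "H : Obj (fun_cat C D)"
  "K : Obj (fun_cat C D)" "f : Hom (fun_cat C D) F G" "g : Hom (fun_cat C D) G H"
  "h : Hom (fun_cat C D) H K"
 then have *: "is_functor C D F" "is_functor C D G" "is_functor C D H" "is_functor C D K" 
  and f: "!!X. X : Obj C ==> f X : Hom D (omap F X) (omap G X)"
   "!!X. X : Obj C ==> g X : Hom D (omap G X) (omap H X)"
   "!!X. X : Obj C ==> h X : Hom D (omap H X) (omap K X)"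
  by (simp_all add: fun_cat_def nat_trans_def)
 note FD = is_functorD[OF *(1)] is_functorD[OF *(2)] is_functorD[OF *(3)] is_functorD[OF *(4)]
 show "Comp (fun_cat C D) F G K (Comp (fun_cat C D) G H K h g) f =
    Comp (fun_cat C D) F H K h (Comp (fun_cat C D) F G H g f)"
  by (auto simp: fun_cat_def fun_eq_iff intro!: category_assoc[OF assms(2)] FD f)
qed

text \<open>On objects the inverse is a choice from essential surjectivity; on arrows it is the
  unique lift along \<open>F\<close> of the conjugate by the chosen isomorphisms. The functor laws
  and naturality squares on the side of \<open>C\<close> are proved after applying the injective
  \<open>amap F\<close>.\<close>

lemma fully_faithful_essentially_surjective_imp_equivalence:
 assumes C: "is_category C" and D: "is_category D" and F: "is_functor C D F"
  and ff: "!!X Y. X : Obj C ==> Y : Obj C ==>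
   bij_betw (amap F X Y) (Hom C X Y) (Hom D (omap F X) (omap F Y))"
  and es: "!!Z. Z : Obj D ==> EX X:Obj C. EX f. is_iso D (omap F X) Z f"
 shows "is_equivalence C D F"
proof -
 note FD = is_functorD[OF F]
 \<comment> \<open>The inverse arrow is chosen together with the isomorphism, so that
   \<open>e\<close> and \<open>e'\<close> are both available as functions of
   \<open>Z\<close>.\<close>
 have "EX X f g. X : Obj C & f : Hom D (omap F X) Z & g : Hom D Z (omap F X)
   & Comp D (omap F X) Z (omap F X) g f = Id D (omap F X) & Comp D Z (omap F X) Z f g = Id D Z"
  if "Z : Obj D" for Z
  using es[OF that] unfolding is_iso_def by blast
 then obtain G0 e e' where G0: "!!Z. Z : Obj D ==> G0 Z : Obj C"
  and e: "!!Z. Z : Obj D ==> e Z : Hom D (omap F (G0 Z)) Z"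
  and e': "!!Z. Z : Obj D ==> e' Z : Hom D Z (omap F (G0 Z))"
  and ee1: "!!Z. Z : Obj D ==> Comp D (omap F (G0 Z)) Z (omap F (G0 Z)) (e' Z) (e Z) = Id D (omap F (G0 Z))"
  and ee2: "!!Z. Z : Obj D ==> Comp D Z (omap F (G0 Z)) Z (e Z) (e' Z) = Id D Z"
  by metis
 define lft where "lft X Y = inv_into (Hom C X Y) (amap F X Y)" for X Y
 have lft: "lft X Y h : Hom C X Y" "amap F X Y (lft X Y h) = h"
  if "X : Obj C" "Y : Obj C" "h : Hom D (omap F X) (omap F Y)" for X Y h
  using ff[OF that(1,2)] that(3) unfolding lft_def
  by (auto simp: bij_betw_def inv_into_into f_inv_into_f)
 have inj: "f = g" if "X : Obj C" "Y : Obj C" "f : Hom C X Y" "g : Hom C X Y"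
   "amap F X Y f = amap F X Y g" for X Y f g
  using ff[OF that(1,2)] that(3-5) by (auto simp: bij_betw_def inj_on_def)
 \<comment> \<open>\<open>e' Z\<close> after \<open>f\<close> after \<open>e Y\<close>: the arrow
   between values of \<open>F\<close> that corresponds to \<open>f\<close>.\<close>
 define h where "h Y Z f = Comp D (omap F (G0 Y)) Y (omap F (G0 Z))
  (Comp D Y Z (omap F (G0 Z)) (e' Z) f) (e Y)" for Y Z f
 define G where "G = \<lparr> omap = G0, amap = (%Y Z f. lft (G0 Y) (G0 Z) (h Y Z f)) \<rparr>"
 note cc = category_comp[OF D] and ca = category_assoc[OF D] and ci = category_comp_id[OF D]
 have h: "h Y Z f : Hom D (omap F (G0 Y)) (omap F (G0 Z))"
  if "Y : Obj D" "Z : Obj D" "f : Hom D Y Z" for Y Z f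
  unfolding h_def using that by (blast intro: cc FD G0 e e')
 have Gh: "amap G Y Z f : Hom C (G0 Y) (G0 Z)" "amap F (G0 Y) (G0 Z) (amap G Y Z f) = h Y Z f"
  if "Y : Obj D" "Z : Obj D" "f : Hom D Y Z" for Y Z f
  using that by (auto simp: G_def intro!: lft G0 h)
 have e_nat: "Comp D (omap F (G0 Y)) (omap F (G0 Z)) Z (e Z) (h Y Z f)
   = Comp D (omap F (G0 Y)) Y Z f (e Y)"
  if "Y : Obj D" "Z : Obj D" "f : Hom D Y Z" for Y Z f
 proof -
  have m: "omap F (G0 Y) : Obj D" "omap F (G0 Z) : Obj D" "e Y : Hom D (omap F (G0 Y)) Y"
    "e Z : Hom D (omap F (G0 Z)) Z" "e' Z : Hom D Z (omap F (G0 Z))"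
    "Comp D (omap F (G0 Y)) Y Z f (e Y) : Hom D (omap F (G0 Y)) Z"
   using that by (auto intro!: FD G0 e e' cc)
  have "h Y Z f = Comp D (omap F (G0 Y)) Z (omap F (G0 Z)) (e' Z) (Comp D (omap F (G0 Y)) Y Z f (e Y))"
   unfolding h_def by (rule ca) (use that m in auto)
  then have "Comp D (omap F (G0 Y)) (omap F (G0 Z)) Z (e Z) (h Y Z f) =
   Comp D (omap F (G0 Y)) Z Z (Comp D Z (omap F (G0 Z)) Z (e Z) (e' Z)) (Comp D (omap F (G0 Y)) Y Z f (e Y))"
   using that m by (simp add: ca)
  then show ?thesis using ee2[OF that(2)] ci(2)[OF _ _ m(6)] m that by simp
 qed
 have e'_nat: "Comp D Y (omap F (G0 Y)) (omap F (G0 Z)) (h Y Z f) (e' Y)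
   = Comp D Y Z (omap F (G0 Z)) (e' Z) f"
  if "Y : Obj D" "Z : Obj D" "f : Hom D Y Z" for Y Z f
 proof -
  have m: "omap F (G0 Y) : Obj D" "omap F (G0 Z) : Obj D" "e Y : Hom D (omap F (G0 Y)) Y"
    "e' Y : Hom D Y (omap F (G0 Y))" "e' Z : Hom D Z (omap F (G0 Z))"
    "Comp D Y Z (omap F (G0 Z)) (e' Z) f : Hom D Y (omap F (G0 Z))"
   using that by (auto intro!: FD G0 e e' cc)
  have "Comp D Y (omap F (G0 Y)) (omap F (G0 Z)) (h Y Z f) (e' Y)
   = Comp D Y Y (omap F (G0 Z)) (Comp D Y Z (omap F (G0 Z)) (e' Z) f) (Comp D Y (omap F (G0 Y)) Y (e Y) (e' Y))"
   unfolding h_def by (rule ca) (use that m in auto)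
  then show ?thesis using ee2[OF that(1)] ci(1)[OF _ _ m(6)] m that by simp
 qed
 have h_id: "h Z Z (Id D Z) = Id D (omap F (G0 Z))" if "Z : Obj D" for Z
  using that ee1[OF that] e[OF that] e'[OF that] FD(1)[OF G0[OF that]]
  by (simp add: h_def ci)
 have h_comp: "h X Z (Comp D X Y Z g f)
   = Comp D (omap F (G0 X)) (omap F (G0 Y)) (omap F (G0 Z)) (h Y Z g) (h X Y f)"
  if "X : Obj D" "Y : Obj D" "Z : Obj D" "f : Hom D X Y" "g : Hom D Y Z" for X Y Z f g
 proof -
  have m: "omap F (G0 X) : Obj D" "omap F (G0 Y) : Obj D" "omap F (G0 Z) : Obj D"
    "e X : Hom D (omap F (G0 X)) X" "e Y : Hom D (omap F (G0 Y)) Y"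
    "e' Z : Hom D Z (omap F (G0 Z))"
    "Comp D X Y Z g f : Hom D X Z" "Comp D Y Z (omap F (G0 Z)) (e' Z) g : Hom D Y (omap F (G0 Z))"
    "h X Y f : Hom D (omap F (G0 X)) (omap F (G0 Y))"
   using that by (auto intro!: FD G0 e e' cc h)
  have "Comp D (omap F (G0 X)) (omap F (G0 Y)) (omap F (G0 Z)) (h Y Z g) (h X Y f)
   = Comp D (omap F (G0 X)) Y (omap F (G0 Z)) (Comp D Y Z (omap F (G0 Z)) (e' Z) g)
    (Comp D (omap F (G0 X)) (omap F (G0 Y)) Y (e Y) (h X Y f))"
   unfolding h_def[of Y Z] by (rule ca) (use that m in auto)
  also have "... = Comp D (omap F (G0 X)) X (omap F (G0 Z))
   (Comp D X Y (omap F (G0 Z)) (Comp D Y Z (omap F (G0 Z)) (e' Z) g) f) (e X)"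
   unfolding e_nat[OF that(1,2,4)] by (rule ca[symmetric]) (use that m in auto)
  also have "Comp D X Y (omap F (G0 Z)) (Comp D Y Z (omap F (G0 Z)) (e' Z) g) f
    = Comp D X Z (omap F (G0 Z)) (e' Z) (Comp D X Y Z g f)"
   by (rule ca) (use that m in auto)
  finally show ?thesis by (simp add: h_def)
 qed
 have G: "is_functor D C G"
  unfolding is_functor_def
 proof (intro conjI ballI)
  fix X assume X: "X : Obj D"
  then show "omap G X : Obj C" by (simp add: G_def G0)
  show "amap G X X (Id D X) = Id C (omap G X)"
   using X by (intro inj[of "G0 X" "G0 X"])
    (simp_all add: G0 Gh category_id[OF D] category_id[OF C] FD h_id, simp_all add: G_def FD G0 category_id[OF C])
  fix Y f assume Y: "Y : Obj D" and f: "f : Hom D X Y"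
  show "amap G X Y f : Hom C (omap G X) (omap G Y)"
   using Gh(1)[OF X Y f] by (simp add: G_def)
  fix Z g assume Z: "Z : Obj D" and g: "g : Hom D Y Z"
  have [simp]: "omap G = G0" by (simp add: G_def)
  show "amap G X Z (Comp D X Y Z g f)
    = Comp C (omap G X) (omap G Y) (omap G Z) (amap G Y Z g) (amap G X Y f)"
   using X Y Z f g
   by (intro inj[of "G0 X" "G0 Z"]) (simp_all add: G0 Gh cc category_comp[OF C] FD h_comp)
 qed
 have [simp]: "omap G = G0" by (simp add: G_def)
 have "is_iso (fun_cat D D) (comp_functor F G) id_functor (restrict e (Obj D))"
  unfolding is_iso_def
 proof (intro conjI bexI)
  show "restrict e (Obj D) : Hom (fun_cat D D) (comp_functor F G) id_functor"
   by (auto simp: fun_cat_def nat_trans_def comp_functor_def id_functor_def e Gh e_nat)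
  show "restrict e' (Obj D) : Hom (fun_cat D D) id_functor (comp_functor F G)"
   by (auto simp: fun_cat_def nat_trans_def comp_functor_def id_functor_def e' Gh e'_nat)
 qed (auto simp: fun_cat_def comp_functor_def id_functor_def ee1 ee2 fun_eq_iff)
 moreover
 \<comment> \<open>The unit at \<open>X\<close> is forced: its image under \<open>F\<close> has to
   be the inverse of the counit at \<open>omap F X\<close>.\<close>
 define u where "u X = lft X (G0 (omap F X)) (e' (omap F X))" for X
 define u' where "u' X = lft (G0 (omap F X)) X (e (omap F X))" for X
 have u: "u X : Hom C X (G0 (omap F X))" "amap F X (G0 (omap F X)) (u X) = e' (omap F X)"
  and u': "u' X : Hom C (G0 (omap F X)) X" "amap F (G0 (omap F X)) X (u' X) = e (omap F X)"
  if "X : Obj C" for X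
  unfolding u_def u'_def using that by (auto intro!: lft G0 FD e e')
 have "is_iso (fun_cat C C) id_functor (comp_functor G F) (restrict u (Obj C))"
  unfolding is_iso_def
 proof (intro conjI bexI)
  have "Comp C X Y (G0 (omap F Y)) (u Y) f
    = Comp C X (G0 (omap F X)) (G0 (omap F Y)) (amap G (omap F X) (omap F Y) (amap F X Y f)) (u X)"
   if "X : Obj C" "Y : Obj C" "f : Hom C X Y" for X Y f
   using that by (intro inj[of X "G0 (omap F Y)"])
    (simp_all add: FD G0 u Gh category_comp[OF C] FD e'_nat)
  then show "restrict u (Obj C) : Hom (fun_cat C C) id_functor (comp_functor G F)"
   by (auto simp: fun_cat_def nat_trans_def comp_functor_def id_functor_def u)
  have "Comp C (G0 (omap F X)) (G0 (omap F Y)) Y (u' Y) (amap G (omap F X) (omap F Y) (amap F X Y f))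
    = Comp C (G0 (omap F X)) X Y f (u' X)"
   if "X : Obj C" "Y : Obj C" "f : Hom C X Y" for X Y f
   using that by (intro inj[of "G0 (omap F X)" Y])
    (simp_all add: FD G0 u' Gh category_comp[OF C] FD e_nat)
  then show "restrict u' (Obj C) : Hom (fun_cat C C) (comp_functor G F) id_functor"
   by (auto simp: fun_cat_def nat_trans_def comp_functor_def id_functor_def u')
  have "Comp C X (G0 (omap F X)) X (u' X) (u X) = Id C X" if "X : Obj C" for X
   using that by (intro inj[of X X])
    (simp_all add: FD G0 u u' Gh category_comp[OF C] category_id[OF C] FD ee2)
  then show "Comp (fun_cat C C) id_functor (comp_functor G F) id_functor (restrict u' (Obj C)) (restrict u (Obj C))
    = Id (fun_cat C C) id_functor"
   by (auto simp: fun_cat_def comp_functor_def id_functor_def fun_eq_iff)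
  have "Comp C (G0 (omap F X)) X (G0 (omap F X)) (u X) (u' X) = Id C (G0 (omap F X))" if "X : Obj C" for X
   using that by (intro inj[of "G0 (omap F X)" "G0 (omap F X)"])
    (simp_all add: FD G0 u u' Gh category_comp[OF C] category_id[OF C] FD ee1)
  then show "Comp (fun_cat C C) (comp_functor G F) id_functor (comp_functor G F) (restrict u (Obj C)) (restrict u' (Obj C))
    = Id (fun_cat C C) (comp_functor G F)"
   by (auto simp: fun_cat_def comp_functor_def id_functor_def fun_eq_iff)
 qed
 ultimately show ?thesis
  unfolding is_equivalence_def using C D F G by blast
qed

section \<open>Linear algebra over the rationals\<close>

abbreviation rvs :: "'a qvs => bool" where
 "rvs V \<equiv> vectorspace class_ring V"

abbreviation mhom :: "'a qvs => 'b qvs => ('a => 'b) set" where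
 "mhom V W \<equiv> LinearCombinations.module_hom class_ring V W"

lemma rvs_closed [simp, intro]:
 assumes "rvs V"
 shows "\<zero>[V] : carrier V"
  and "x : carrier V ==> y : carrier V ==> x \<oplus>[V] y : carrier V"
  and "x : carrier V ==> r \<odot>[V] x : carrier V"
proof -
 interpret vectorspace class_ring V by fact
 show "\<zero>[V] : carrier V" "x : carrier V ==> y : carrier V ==> x \<oplus>[V] y : carrier V"
  "x : carrier V ==> r \<odot>[V] x : carrier V" by auto
qed

lemma rvs_simps:
 assumes "rvs V"
 shows "x : carrier V ==> \<zero>[V] \<oplus>[V] x = x"
  and "x : carrier V ==> x \<oplus>[V] \<zero>[V] = x"
  and "x : carrier V ==> 1 \<odot>[V] x = x"
  and "x : carrier V ==> 0 \<odot>[V] x = \<zero>[V]"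
  and "r \<odot>[V] \<zero>[V] = \<zero>[V]"
  and "x : carrier V ==> r \<odot>[V] (s \<odot>[V] x) = (r * s) \<odot>[V] x"
proof -
 interpret vectorspace class_ring V by fact
 show "x : carrier V ==> \<zero>[V] \<oplus>[V] x = x" "x : carrier V ==> x \<oplus>[V] \<zero>[V] = x" "x : carrier V ==> 1 \<odot>[V] x = x"
  "x : carrier V ==> 0 \<odot>[V] x = \<zero>[V]" "r \<odot>[V] \<zero>[V] = \<zero>[V]"
  using smult_one smult_l_null smult_r_null by auto
 show "x : carrier V ==> r \<odot>[V] (s \<odot>[V] x) = (r * s) \<odot>[V] x"
  using smult_assoc1[of r s x] by simp
qed

lemma rvs_distrib:
 assumes "rvs V"
 shows "x : carrier V ==> (r + s) \<odot>[V] x = r \<odot>[V] x \<oplus>[V] s \<odot>[V] x"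
  and "x : carrier V ==> y : carrier V ==> r \<odot>[V] (x \<oplus>[V] y) = r \<odot>[V] x \<oplus>[V] r \<odot>[V] y"
  and "x : carrier V ==> y : carrier V ==> z : carrier V ==> (x \<oplus>[V] y) \<oplus>[V] z = x \<oplus>[V] (y \<oplus>[V] z)"
  and "x : carrier V ==> y : carrier V ==> x \<oplus>[V] y = y \<oplus>[V] x"
proof -
 interpret vectorspace class_ring V by fact
 show "x : carrier V ==> (r + s) \<odot>[V] x = r \<odot>[V] x \<oplus>[V] s \<odot>[V] x"
  "x : carrier V ==> y : carrier V ==> r \<odot>[V] (x \<oplus>[V] y) = r \<odot>[V] x \<oplus>[V] r \<odot>[V] y"
  using smult_l_distr[of r s x] smult_r_distr[of r x y] by auto
 show "x : carrier V ==> y : carrier V ==> z : carrier V ==> (x \<oplus>[V] y) \<oplus>[V] z = x \<oplus>[V] (y \<oplus>[V] z)"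
  "x : carrier V ==> y : carrier V ==> x \<oplus>[V] y = y \<oplus>[V] x"
  by (simp_all add: a_ac)
qed

text \<open>Additive inverses come as multiples by -1: distributivity and the laws for the scalars 1
  and 0 show that they are inverses.\<close>

lemma rvsI:
 fixes V :: "'a qvs"
 assumes "\<zero>[V] : carrier V"
  and "!!x y. x : carrier V ==> y : carrier V ==> x \<oplus>[V] y : carrier V"
  and "!!r x. x : carrier V ==> r \<odot>[V] x : carrier V"
  and "!!x y z. x : carrier V ==> y : carrier V ==> z : carrier V ==> (x \<oplus>[V] y) \<oplus>[V] z = x \<oplus>[V] (y \<oplus>[V] z)"
  and "!!x y. x : carrier V ==> y : carrier V ==> x \<oplus>[V] y = y \<oplus>[V] x"
  and "!!x. x : carrier V ==> \<zero>[V] \<oplus>[V] x = x"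
  and distl: "!!r s x. x : carrier V ==> (r + s) \<odot>[V] x = r \<odot>[V] x \<oplus>[V] s \<odot>[V] x"
  and "!!r x y. x : carrier V ==> y : carrier V ==> r \<odot>[V] (x \<oplus>[V] y) = r \<odot>[V] x \<oplus>[V] r \<odot>[V] y"
  and "!!r s x. x : carrier V ==> (r * s) \<odot>[V] x = r \<odot>[V] (s \<odot>[V] x)"
  and one: "!!x. x : carrier V ==> 1 \<odot>[V] x = x"
  and zero: "!!x. x : carrier V ==> 0 \<odot>[V] x = \<zero>[V]"
 shows "rvs V"
proof -
 have "abelian_group V"
 proof (rule abelian_groupI)
  fix x assume x: "x : carrier V"
  have "(-1) \<odot>[V] x \<oplus>[V] x = \<zero>[V]"
   using distl[OF x, of "-1" 1] one[OF x] zero[OF x] by simp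
  then show "EX y:carrier V. y \<oplus>[V] x = \<zero>[V]" using assms(3)[OF x] by blast
 qed (use assms in auto)
 then have "module class_ring V"
  by (intro moduleI) (use assms in "auto simp: class_cring.cring_axioms")
 then show ?thesis using class_field by (simp add: vectorspace_def)
qed

text \<open>Functionals are plain functions constrained only on the carrier, in contrast to the
  extensional maps of \<open>lin\<close>; so a functional after a linear map is a functional again,
  without restriction.\<close>

definition dual :: "'a qvs => ('a => rat) set" where
 "dual V = {l. (ALL x:carrier V. ALL y:carrier V. l (x \<oplus>[V] y) = l x + l y) &
  (ALL r. ALL x:carrier V. l (r \<odot>[V] x) = r * l x)}"

lemma dualI:
 assumes "!!x y. x : carrier V ==> y : carrier V ==> l (x \<oplus>[V] y) = l x + l y"
  and "!!r x. x : carrier V ==> l (r \<odot>[V] x) = r * l x"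
 shows "l : dual V"
 using assms unfolding dual_def by blast

lemma dual_add [simp]: "l : dual V ==> x : carrier V ==> y : carrier V ==> l (x \<oplus>[V] y) = l x + l y"
 and dual_smult [simp]: "l : dual V ==> x : carrier V ==> l (r \<odot>[V] x) = r * l x"
 by (auto simp: dual_def)

lemma dual_zero [simp]: "rvs V ==> l : dual V ==> l \<zero>[V] = 0"
 using dual_smult[of l V "\<zero>[V]" 0] by (simp add: rvs_simps)

lemma mhomI:
 assumes "!!x. x : carrier V ==> f x : carrier W"
  and "!!x y. x : carrier V ==> y : carrier V ==> f (x \<oplus>[V] y) = f x \<oplus>[W] f y"
  and "!!r x. x : carrier V ==> f (r \<odot>[V] x) = r \<odot>[W] f x"
 shows "f : mhom V W"
 using assms by (auto simp: LinearCombinations.module_hom_def)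

lemma mhom_closed: "f : mhom V W ==> x : carrier V ==> f x : carrier W"
 and mhom_add: "f : mhom V W ==> x : carrier V ==> y : carrier V ==> f (x \<oplus>[V] y) = f x \<oplus>[W] f y"
 and mhom_smult: "f : mhom V W ==> x : carrier V ==> f (r \<odot>[V] x) = r \<odot>[W] f x"
 by (auto simp: LinearCombinations.module_hom_def)

lemma mhom_zero: "rvs V ==> rvs W ==> f : mhom V W ==> f \<zero>[V] = \<zero>[W]"
 using mhom_smult[of f V W "\<zero>[V]" 0] mhom_closed[of f V W "\<zero>[V]"] by (simp add: rvs_simps)

lemma mhom_comp: "f : mhom U V ==> g : mhom V W ==> (%x. g (f x)) : mhom U W"
 by (intro mhomI) (simp_all add: mhom_add mhom_smult mhom_closed)

lemma mhom_cong: "f : mhom V W ==> rvs V ==> (!!x. x : carrier V ==> g x = f x) ==> g : mhom V W"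
 by (intro mhomI) (simp_all add: mhom_add mhom_smult mhom_closed)

lemma dual_mhom: "f : mhom V W ==> l : dual W ==> (%x. l (f x)) : dual V"
 by (rule dualI) (simp_all add: mhom_add mhom_smult mhom_closed)

lemma lin_mhom: "f : lin V W ==> f : mhom V W"
 by (simp add: lin_def)

lemma lin_restrict: "f : mhom V W ==> rvs V ==> restrict f (carrier V) : lin V W"
 by (auto simp: lin_def intro: mhom_cong)

lemma lin_closed: "f : lin V W ==> x : carrier V ==> f x : carrier W"
 by (auto simp: lin_def mhom_closed)

lemma lin_compose: "f : lin U V ==> g : lin V W ==> rvs U ==> compose (carrier U) g f : lin U W"
 unfolding compose_def by (intro lin_restrict mhom_comp[of f U V g]) (auto simp: lin_def)

lemma lin_eqI:
 "f : lin V W ==> g : lin V W' ==> (!!x. x : carrier V ==> f x = g x) ==> f = g"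
 by (auto simp: lin_def intro: extensionalityI)

section \<open>Linear combinations with coefficients and vectors as separate families\<close>

definition lcomb :: "'a qvs => 'i set => ('i => rat) => ('i => 'a) => 'a" where
 "lcomb V A c x = (\<Oplus>\<^bsub>V\<^esub>i\<in>A. c i \<odot>[V] x i)"

lemma lcomb_infinite [simp]: "rvs V ==> infinite A ==> lcomb V A c x = \<zero>[V]"
proof -
 assume "rvs V" "infinite A"
 then interpret vectorspace class_ring V by simp
 show ?thesis unfolding lcomb_def by (rule finsum_infinite) fact
qed

lemma lcomb_empty [simp]: "rvs V ==> lcomb V {} c x = \<zero>[V]"
proof -
 assume "rvs V"
 then interpret vectorspace class_ring V .
 show ?thesis unfolding lcomb_def by simp
qed

lemma lcomb_insert:
 assumes "rvs V" "finite A" "a ~: A" "!!i. i : insert a A ==> x i : carrier V"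
 shows "lcomb V (insert a A) c x = c a \<odot>[V] x a \<oplus>[V] lcomb V A c x"
proof -
 interpret vectorspace class_ring V by fact
 show ?thesis unfolding lcomb_def using assms by (intro finsum_insert) auto
qed

lemma lcomb_closed [intro]:
 assumes "rvs V" "!!i. i : A ==> x i : carrier V"
 shows "lcomb V A c x : carrier V"
proof -
 interpret vectorspace class_ring V by fact
 show ?thesis unfolding lcomb_def using assms by (intro finsum_closed) auto
qed

lemma lcomb_cong:
 assumes "rvs V" "A = B" "!!i. i : B ==> x i : carrier V" "!!i. i : B ==> c i = d i" "!!i. i : B ==> x i = y i"
 shows "lcomb V A c x = lcomb V B d y"
proof -
 interpret vectorspace class_ring V by fact
 show ?thesis unfolding lcomb_def using assms by (intro finsum_cong') auto
qed

lemma lcomb_zero: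
 assumes "rvs V" "!!i. i : A ==> x i : carrier V"
 shows "lcomb V A (%i. 0) x = \<zero>[V]"
 using assms(2)
proof (induction A rule: infinite_finite_induct)
 case (insert a A)
 then show ?case using assms(1) by (subst lcomb_insert) (auto simp: rvs_simps)
qed (use assms in simp_all)

lemma lcomb_add:
 assumes "rvs V" "!!i. i : A ==> x i : carrier V"
 shows "lcomb V A (%i. c i + d i) x = lcomb V A c x \<oplus>[V] lcomb V A d x"
proof -
 interpret vectorspace class_ring V by fact
 have "lcomb V A (\<lambda>i. c i + d i) x = (\<Oplus>\<^bsub>V\<^esub>i\<in>A. c i \<odot>[V] x i \<oplus>[V] d i \<odot>[V] x i)"
  unfolding lcomb_def using assms by (intro finsum_cong') (auto simp: rvs_distrib(1))
 also have "... = lcomb V A c x \<oplus>[V] lcomb V A d x"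
  unfolding lcomb_def using assms by (intro finsum_addf) auto
 finally show ?thesis .
qed

lemma lcomb_smult:
 assumes "rvs V" "!!i. i : A ==> x i : carrier V"
 shows "lcomb V A (%i. r * c i) x = r \<odot>[V] lcomb V A c x"
 using assms(2)
proof (induction A rule: infinite_finite_induct)
 case (insert a A)
 then have "lcomb V A c x : carrier V" using assms by (intro lcomb_closed) auto
 then show ?case using assms(1) insert by (subst (1 2) lcomb_insert) (auto simp: rvs_simps rvs_distrib(2))
qed (use assms in "simp_all add: rvs_simps")

lemma lcomb_reindex:
 assumes "rvs V" "bij_betw h A B" "!!i. i : B ==> x i : carrier V"
 shows "lcomb V B c x = lcomb V A (%i. c (h i)) (%i. x (h i))"
proof -
 interpret vectorspace class_ring V by fact
 have "inj_on h A" "B = h ` A" using assms(2) by (auto simp: bij_betw_def)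
 then show ?thesis unfolding lcomb_def using assms(1,3)
  by (simp only: \<open>B = h ` A\<close>, intro finsum_reindex) auto
qed

lemma dual_lcomb:
 assumes "rvs V" "l : dual V" "!!i. i : A ==> x i : carrier V"
 shows "l (lcomb V A c x) = (SUM i:A. c i * l (x i))"
 using assms(3)
proof (induction A rule: infinite_finite_induct)
 case (insert a A)
 then have "lcomb V A c x : carrier V" using assms by (intro lcomb_closed) auto
 then show ?case using assms(1,2) insert by (subst lcomb_insert) auto
qed (use assms in simp_all)

lemma mhom_lcomb:
 assumes "rvs V" "rvs W" "f : mhom V W" "!!i. i : A ==> x i : carrier V"
 shows "f (lcomb V A c x) = lcomb W A c (%i. f (x i))"
 using assms(4)
proof (induction A rule: infinite_finite_induct)
 case (insert a A)
 then have "lcomb V A c x : carrier V" using assms by (intro lcomb_closed) auto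
 then show ?case using assms(1-3) insert
  by (subst (1 2) lcomb_insert) (auto simp: mhom_add mhom_smult mhom_closed)
qed (use assms in "simp_all add: mhom_zero")

section \<open>Subspaces, separation of points by functionals, and frames\<close>

definition lsub :: "'a qvs => 'a set => bool" where
 "lsub V K \<longleftrightarrow> K <= carrier V & \<zero>[V] : K & (ALL x:K. ALL y:K. x \<oplus>[V] y : K) & (ALL r. ALL x:K. r \<odot>[V] x : K)"

lemma lsub_lcomb:
 assumes "rvs V" "lsub V K" "!!i. i : A ==> x i : K"
 shows "lcomb V A c x : K"
 using assms(3)
proof (induction A rule: infinite_finite_induct)
 case (insert a A)
 then show ?case using assms(1,2)
  by (subst lcomb_insert) (auto simp: lsub_def)
qed (use assms in "simp_all add: lsub_def")

lemma lsub_carrier: "rvs V ==> lsub V (carrier V)"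
 by (simp add: lsub_def)

text \<open>Equations in a separated space can be checked in the rationals by applying functionals.
  The notion covers the spaces \<open>schur_space V W\<close> before their dimension is
  known.\<close>

definition separated :: "'a qvs => bool" where
 "separated V \<longleftrightarrow> (ALL x:carrier V. (ALL l:dual V. l x = 0) --> x = \<zero>[V])"

abbreviation svs :: "'a qvs => bool" where
 "svs V \<equiv> rvs V & separated V"

lemma eq_if_diff_zero:
 assumes "rvs V" "x : carrier V" "y : carrier V" "x \<oplus>[V] (-1) \<odot>[V] y = \<zero>[V]"
 shows "x = y"
proof -
 have "x = (x \<oplus>[V] (-1) \<odot>[V] y) \<oplus>[V] y"
  using assms(1-3) rvs_distrib(1)[OF assms(1,3), of "-1" 1, symmetric] by (simp add: rvs_distrib(3) rvs_simps)
 then show ?thesis using assms by (simp add: rvs_simps)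
qed

lemma separated_eqI:
 assumes "svs V" "x : carrier V" "y : carrier V" "!!l. l : dual V ==> l x = l y"
 shows "x = y"
proof (rule eq_if_diff_zero)
 show "x \<oplus>[V] (-1) \<odot>[V] y = \<zero>[V]"
 proof -
  have "l (x \<oplus>[V] (-1) \<odot>[V] y) = 0" if "l : dual V" for l using that assms by simp
  then show ?thesis using assms unfolding separated_def by blast
 qed
qed (use assms in auto)

text \<open>A basis with its coordinate functionals is a frame, but a frame may also consist of
  dependent vectors. The expansion of \<open>x\<close> is what trace-like sums over \<open>k\<close>
  use.\<close>

definition frame :: "'a qvs => nat => (nat => 'a) => (nat => 'a => rat) => bool" where
 "frame V n a l \<longleftrightarrow> a : {..<n} \<rightarrow> carrier V & l : {..<n} \<rightarrow> dual V &
  (ALL x:carrier V. x = lcomb V {..<n} (%k. l k x) a)"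

text \<open>Induction on the number of functionals that separate the points of \<open>K\<close>:
  either the last one vanishes on \<open>K\<close>, or it splits \<open>K\<close> into its kernel
  and a line. The class \<open>L\<close> of admissible functionals is carried along because the
  Riesz representation calls for a frame made of representable functionals.\<close>

lemma subspace_frame_exists:
 fixes n :: nat
 assumes V: "rvs V" and L: "L <= dual V"
  and L_closed: "!!l m c. l : L ==> m : L ==> (%x. l x + c * m x) : L"
  and "lsub V K" and "!!i. i < n ==> h i : L" and "!!x. x : K ==> (!!i. i < n ==> h i x = 0) ==> x = \<zero>[V]"
 shows "EX m a l. a : {..<m::nat} \<rightarrow> K & l : {..<m} \<rightarrow> L & (ALL x:K. x = lcomb V {..<m} (%k. l k x) a)"
 using assms(4-)
proof (induction n arbitrary: K)
 case 0
 then have "ALL x:K. x = lcomb V {..<0::nat} c a" for c a using V by simp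
 then show ?case by (intro exI[of _ 0]) auto
next
 case (Suc n)
 have K: "x : carrier V" if "x : K" for x using Suc.prems(1) that by (auto simp: lsub_def)
 note Kc = Suc.prems(1)[unfolded lsub_def]
 define l where "l = h n"
 have l: "l : L" "l : dual V" using Suc.prems(2)[of n] L by (auto simp: l_def)
 show ?case
 proof (cases "ALL x:K. l x = 0")
  case True
  show ?thesis
  proof (rule Suc.IH)
   fix x assume "x : K" "!!i. i < n ==> h i x = 0"
   then show "x = \<zero>[V]" using True Suc.prems(3)[of x] by (auto simp: l_def less_Suc_eq)
  qed (use Suc.prems in auto)
 next
  case False
  then obtain w where w: "w : K" "l w ~= 0" by blast
  define v where "v = (1 / l w) \<odot>[V] w"
  have v: "v : K" "l v = 1" using w Kc l K by (auto simp: v_def)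
  define K0 where "K0 = {x : K. l x = 0}"
  have K0: "lsub V K0" using Kc l V K by (auto simp: K0_def lsub_def)
  have "EX m a l. a : {..<m::nat} \<rightarrow> K0 & l : {..<m} \<rightarrow> L & (ALL x:K0. x = lcomb V {..<m} (%k. l k x) a)"
  proof (rule Suc.IH[OF K0])
   fix x assume "x : K0" "!!i. i < n ==> h i x = 0"
   then show "x = \<zero>[V]" using Suc.prems(3)[of x] by (auto simp: l_def less_Suc_eq K0_def)
  qed (use Suc.prems in auto)
  then obtain m a \<mu> where a: "a : {..<m::nat} \<rightarrow> K0" and \<mu>: "\<mu> : {..<m} \<rightarrow> L"
   and fr: "!!x. x : K0 ==> x = lcomb V {..<m} (%k. \<mu> k x) a" by blast
  define a' where "a' = a(m := v)"
  \<comment> \<open>The functionals of the kernel are corrected by multiples of \<open>l\<close> so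
    that they vanish at \<open>v\<close>; this is where closure of \<open>L\<close> enters.\<close>
  define \<mu>' where "\<mu>' k = (if k = m then l else (%x. \<mu> k x + (- \<mu> k v) * l x))" for k
  show ?thesis
  proof (intro exI conjI ballI)
   show "a' : {..<Suc m} \<rightarrow> K" using a v by (auto simp: a'_def K0_def less_Suc_eq Pi_iff)
   show "\<mu>' : {..<Suc m} \<rightarrow> L" using \<mu> l L_closed[OF _ l(1), of _ "- _"] by (auto simp: \<mu>'_def less_Suc_eq Pi_iff)
   fix x assume x: "x : K"
   define y where "y = x \<oplus>[V] (- l x) \<odot>[V] v"
   have y: "y : K0" using x v Kc l K by (auto simp: y_def K0_def)
   have "x = l x \<odot>[V] v \<oplus>[V] y"
   proof -
    let ?p = "l x \<odot>[V] v" and ?q = "(- l x) \<odot>[V] v"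
    have c: "x : carrier V" "?p : carrier V" "?q : carrier V" using V K[OF x] K[OF v(1)] by auto
    have "?p \<oplus>[V] y = (?p \<oplus>[V] x) \<oplus>[V] ?q" unfolding y_def by (rule rvs_distrib(3)[OF V c(2,1,3), symmetric])
    also have "?p \<oplus>[V] x = x \<oplus>[V] ?p" by (rule rvs_distrib(4)[OF V c(2,1)])
    also have "(x \<oplus>[V] ?p) \<oplus>[V] ?q = x \<oplus>[V] (?p \<oplus>[V] ?q)" by (rule rvs_distrib(3)[OF V c])
    finally have "?p \<oplus>[V] y = x \<oplus>[V] (?p \<oplus>[V] ?q)" .
    moreover have "... = x" using rvs_distrib(1)[OF V K[OF v(1)], symmetric, of "l x" "- l x"] K[OF x] K[OF v(1)] V
    by (simp add: rvs_simps)
    ultimately show ?thesis by simp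
   qed
   also have "y = lcomb V {..<m} (%k. \<mu>' k x) a'"
    using fr[OF y]
   proof (rule trans)
    have "\<mu> k y = \<mu>' k x" if "k < m" for k
    using that \<mu> L l v x K V by (auto simp: \<mu>'_def y_def Pi_iff subset_iff)
    then show "lcomb V {..<m} (%k. \<mu> k y) a = lcomb V {..<m} (%k. \<mu>' k x) a'"
    using a K by (intro lcomb_cong[OF V]) (auto simp: a'_def K0_def)
   qed
   also have "l x \<odot>[V] v \<oplus>[V] lcomb V {..<m} (%k. \<mu>' k x) a' = lcomb V {..<Suc m} (%k. \<mu>' k x) a'"
    unfolding lessThan_Suc
    by (subst lcomb_insert) (use V v a K in "auto simp: a'_def \<mu>'_def K0_def")
   finally show "x = lcomb V {..<Suc m} (%k. \<mu>' k x) a'" .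
  qed
 qed
qed

lemma frame_exists_in:
 assumes "rvs V" "L <= dual V" "!!l m c. l : L ==> m : L ==> (%x. l x + c * m x) : L"
  and "finite H" "H <= L" "!!x. x : carrier V ==> (!!l. l : H ==> l x = 0) ==> x = \<zero>[V]"
 obtains n a l where "frame V n a l" "l : {..<n} \<rightarrow> L"
proof -
 obtain h where h: "bij_betw h {..<card H} H" using ex_bij_betw_nat_finite[OF assms(4)] by (auto simp: atLeast0LessThan)
 have "EX m a l. a : {..<m::nat} \<rightarrow> carrier V & l : {..<m} \<rightarrow> L & (ALL x:carrier V. x = lcomb V {..<m} (%k. l k x) a)"
 proof (rule subspace_frame_exists[OF assms(1,2,3) lsub_carrier[OF assms(1)]])
  show "h i : L" if "i < card H" for i using h that assms(5) by (auto simp: bij_betw_def)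
  fix x assume x: "x : carrier V" "!!i. i < card H ==> h i x = 0"
  have "l x = 0" if "l : H" for l
  proof -
   from that obtain i where "i < card H" "l = h i" using h by (auto simp: bij_betw_def)
   then show ?thesis using x by simp
  qed
  then show "x = \<zero>[V]" using assms(6) x by blast
 qed
 then show ?thesis using that assms(2) unfolding frame_def by blast
qed

lemma frame_fdvs:
 assumes "rvs V" "frame V n a l"
 shows "fdvs V"
proof -
 interpret vectorspace class_ring V by fact
 have a: "a ` {..<n} <= carrier V" using assms by (auto simp: frame_def)
 interpret S: submodule class_ring "span (a ` {..<n})" V by (rule span_is_submodule[OF a])
 have "lsub V (span (a ` {..<n}))" using S.subset by (auto simp: lsub_def)
 then have "lcomb V {..<n} c a : span (a ` {..<n})" for c
  using in_own_span[OF a] by (intro lsub_lcomb[OF assms(1)]) auto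
 then have "carrier V <= span (a ` {..<n})" using assms(2) unfolding frame_def by (metis subsetI)
 then have "span (a ` {..<n}) = carrier V" using S.subset by auto
 then have "fin_dim" using a unfolding fin_dim_def by (intro exI[of _ "a ` {..<n}"]) auto
 then show ?thesis using assms by (simp add: fdvs_def)
qed

lemma fdvs_rvs: "fdvs V ==> rvs V"
 by (simp add: fdvs_def)

text \<open>Uniqueness of coordinates in a basis \<open>B\<close> makes the coordinate functions
  additive and homogeneous, hence functionals; an enumeration of \<open>B\<close> turns them into a
  frame.\<close>

lemma fdvs_frame:
 assumes "fdvs V"
 obtains n a l where "frame V n a l"
proof -
 have V: "rvs V" using assms by (rule fdvs_rvs)
 interpret vectorspace class_ring V by fact
 obtain B where B: "finite B" "basis B" using finite_basis_exists assms by (auto simp: fdvs_def)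
 then have BV: "B <= carrier V" by (auto simp: basis_def)
 define co where "co v = (THE a. a : B \<rightarrow>\<^sub>E carrier class_ring & lincomb a B = v)" for v
 have ex: "EX! a. a : B \<rightarrow>\<^sub>E carrier class_ring & lincomb a B = v" if "v : carrier V" for v
  using basis_criterion[OF B(1) BV] B(2) that by blast
 have co: "co v : B \<rightarrow>\<^sub>E carrier class_ring" "lincomb (co v) B = v" if "v : carrier V" for v
  using theI'[OF ex[OF that]] by (simp_all add: co_def)
 have co_eq: "co v = a" if "a : B \<rightarrow>\<^sub>E carrier class_ring" "lincomb a B = v" "v : carrier V" for a v
  using ex[OF that(3)] co[OF that(3)] that by blast
 have lc: "lincomb c B = lcomb V B c (%v. v)" for c by (simp add: lincomb_def lcomb_def)
 have lc_add: "lcomb V B (%b. c b + d b) (%v. v) = lcomb V B c (%v. v) \<oplus>[V] lcomb V B d (%v. v)" for c d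
  using BV by (intro lcomb_add[OF V]) auto
 have lc_smult: "lcomb V B (%b. r * c b) (%v. v) = r \<odot>[V] lcomb V B c (%v. v)" for r c
  using BV by (intro lcomb_smult[OF V]) auto
 have co_dual: "(%v. co v b) : dual V" if b: "b : B" for b
  unfolding dual_def
 proof (intro CollectI conjI ballI allI)
  fix x y assume xy: "x : carrier V" "y : carrier V"
  have "co (x \<oplus>[V] y) = (\<lambda>b\<in>B. co x b + co y b)"
  proof (rule co_eq)
   have "lincomb (\<lambda>b\<in>B. co x b + co y b) B = lcomb V B (%b. co x b + co y b) (%v. v)"
    unfolding lc by (rule lcomb_cong[OF V]) (use BV in auto)
   then show "lincomb (\<lambda>b\<in>B. co x b + co y b) B = x \<oplus>[V] y"
    using co(2)[OF xy(1)] co(2)[OF xy(2)] lc lc_add by simp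
  qed (use xy in auto)
  then show "co (x \<oplus>[V] y) b = co x b + co y b" using b by simp
 next
  fix r x assume x: "x : carrier V"
  have "co (r \<odot>[V] x) = (\<lambda>b\<in>B. r * co x b)"
  proof (rule co_eq)
   have "lincomb (\<lambda>b\<in>B. r * co x b) B = lcomb V B (%b. r * co x b) (%v. v)"
    unfolding lc by (rule lcomb_cong[OF V]) (use BV in auto)
   then show "lincomb (\<lambda>b\<in>B. r * co x b) B = r \<odot>[V] x"
    using co(2)[OF x] lc lc_smult by simp
  qed (use x in auto)
  then show "co (r \<odot>[V] x) b = r * co x b" using b by simp
 qed
 obtain h where h: "bij_betw h {..<card B} B" using ex_bij_betw_nat_finite[OF B(1)] by (auto simp: atLeast0LessThan)
 have "frame V (card B) h (%k v. co v (h k))"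
  unfolding frame_def
 proof (intro conjI ballI)
  show "h : {..<card B} \<rightarrow> carrier V" using h BV by (auto simp: bij_betw_def)
  show "(%k v. co v (h k)) : {..<card B} \<rightarrow> dual V" using h co_dual by (auto simp: bij_betw_def)
  fix x assume x: "x : carrier V"
  have "x = lcomb V B (co x) (%v. v)" using co(2)[OF x] lc by simp
  also have "... = lcomb V {..<card B} (%k. co x (h k)) h"
   using lcomb_reindex[OF V h, of "%v. v" "co x"] BV by (simp add: subset_iff)
  finally show "x = lcomb V {..<card B} (%k. co x (h k)) h" .
 qed
 then show ?thesis using that by blast
qed

lemma fdvs_finite_separating:
 assumes "fdvs V"
 obtains H where "finite H" "H <= dual V" "ALL x:carrier V. (ALL l:H. l x = 0) --> x = \<zero>[V]"
proof -
 have V: "rvs V" using assms by (rule fdvs_rvs)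
 obtain n a l where fr: "frame V n a l" using fdvs_frame[OF assms] .
 have 0: "lcomb V {..<n} (%k. 0) a = \<zero>[V]"
  using fr V by (intro lcomb_zero) (auto simp: frame_def)
 show ?thesis
 proof (rule that[of "l ` {..<n}"]; (intro ballI impI)?)
  fix x assume x: "x : carrier V" "ALL m:l ` {..<n}. m x = 0"
  then have "x = lcomb V {..<n} (%k. l k x) a" using fr by (auto simp: frame_def)
  also have "... = lcomb V {..<n} (%k. 0) a"
   using fr x by (intro lcomb_cong[OF V]) (auto simp: frame_def)
  finally show "x = \<zero>[V]" using 0 by simp
 qed (use fr in "auto simp: frame_def")
qed

lemma fdvs_separated: "fdvs V ==> separated V"
 unfolding separated_def by (erule fdvs_finite_separating) blast

lemma fdvs_svs: "fdvs V ==> svs V"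
 by (simp add: fdvs_rvs fdvs_separated)

text \<open>Finitely many functionals that separate points give a frame, hence a finite generating
  set. Several proofs of finite dimension below just name such functionals.\<close>

lemma fdvsI:
 assumes "rvs V" "finite H" "H <= dual V" "!!x. x : carrier V ==> (!!l. l : H ==> l x = 0) ==> x = \<zero>[V]"
 shows "fdvs V"
proof -
 obtain n a l where "frame V n a l" 
  by (rule frame_exists_in[OF assms(1) order.refl _ assms(2-4)])
   (auto intro!: dualI simp: algebra_simps)
 then show ?thesis using frame_fdvs assms(1) by blast
qed

lemma fdvs_injective:
 assumes "rvs V" "fdvs W" "f : mhom V W" "!!x. x : carrier V ==> f x = \<zero>[W] ==> x = \<zero>[V]"
 shows "fdvs V"
proof -
 obtain H where H: "finite H" "H <= dual W" "ALL x:carrier W. (ALL l:H. l x = 0) --> x = \<zero>[W]"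
  using fdvs_finite_separating[OF assms(2)] .
 show ?thesis
 proof (rule fdvsI[OF assms(1), of "(%l x. l (f x)) ` H"])
  show "(%l x. l (f x)) ` H <= dual V" using H dual_mhom[OF assms(3)] by auto
  fix x assume "x : carrier V" "!!l. l : (%l x. l (f x)) ` H ==> l x = 0"
  then have "f x : carrier W" "ALL l:H. l (f x) = 0" using assms(3) by (blast intro: mhom_closed)+
  then have "f x = \<zero>[W]" using H(3) by blast
  then show "x = \<zero>[V]" using assms(4) \<open>x : carrier V\<close> by blast
 qed (use H in auto)
qed

lemma frame_dual:
 assumes "rvs V" "frame V n a l" "m : dual V" "x : carrier V"
 shows "m x = (\<Sum>k<n. l k x * m (a k))"
proof -
 have "m x = m (lcomb V {..<n} (%k. l k x) a)" using assms by (auto simp: frame_def)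
 also have "... = (\<Sum>k<n. l k x * m (a k))"
  using assms by (intro dual_lcomb) (auto simp: frame_def)
 finally show ?thesis .
qed

text \<open>Coordinates in a frame embed \<open>V\<close> into lists of rationals, a countable type,
  and an infinite type contains a copy of every countable one.\<close>

lemma fdvs_inj_on_exists:
 fixes V :: "'a qvs"
 assumes "fdvs V" "infinite (UNIV :: 'b set)"
 obtains j :: "'a => 'b" where "inj_on j (carrier V)"
proof -
 obtain n a l where fr: "frame V n a l" using fdvs_frame[OF assms(1)] .
 obtain g :: "nat => 'b" where g: "inj g" using assms(2) infinite_countable_subset by blast
 define q where "q x = map (%k. l k x) [0..<n]" for x
 have "inj_on q (carrier V)"
 proof (rule inj_onI)
  fix x y assume xy: "x : carrier V" "y : carrier V" "q x = q y"
  then have *: "l k x = l k y" if "k < n" for k using that by (auto simp: q_def)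
  have "x = lcomb V {..<n} (%k. l k x) a" using fr xy by (auto simp: frame_def)
  also have "... = lcomb V {..<n} (%k. l k y) a"
   using fr * by (intro lcomb_cong[OF fdvs_rvs[OF assms(1)]]) (auto simp: frame_def)
  also have "... = y" using fr xy by (auto simp: frame_def)
  finally show "x = y" .
 qed
 then have "inj_on (%x. g (to_nat (q x))) (carrier V)"
  using inj_compose[OF g inj_to_nat] by (auto simp: inj_on_def inj_def)
 then show ?thesis using that by blast
qed

section \<open>Images and subspaces of vector spaces\<close>

lemma mk_qvs_simps [simp]:
 "carrier (mk_qvs A z p s) = A" "\<zero>[mk_qvs A z p s] = z"
 "x \<oplus>[mk_qvs A z p s] y = p x y" "r \<odot>[mk_qvs A z p s] x = s r x"
 by (simp_all add: mk_qvs_def)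

text \<open>The laws pass along a surjection that is compatible with the operations. This serves
  both for spaces moved to another type and for quotients.\<close>

lemma rvs_surjective_image:
 assumes M: "rvs M" and c: "carrier Q = q ` carrier M" and z: "\<zero>[Q] = q \<zero>[M]"
  and p: "!!x y. x : carrier M ==> y : carrier M ==> q x \<oplus>[Q] q y = q (x \<oplus>[M] y)"
  and s: "!!r x. x : carrier M ==> r \<odot>[Q] q x = q (r \<odot>[M] x)"
 shows "rvs Q" "q : mhom M Q"
proof -
 show "q : mhom M Q" by (rule mhomI) (simp_all add: c p s)
 show "rvs Q"
 proof (rule rvsI; unfold c z)
  fix x y assume "x : q ` carrier M" "y : q ` carrier M"
  then show "x \<oplus>[Q] y = y \<oplus>[Q] x" using rvs_distrib(4)[OF M] p by auto
 qed (use M in "auto simp: p s rvs_distrib(1-3) rvs_simps")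
qed

lemma rvs_lsub: "rvs V ==> lsub V K ==> rvs (V\<lparr>carrier := K\<rparr>)"
 unfolding lsub_def
 by (rule rvsI) (auto simp: subset_iff rvs_distrib(1-3) rvs_simps intro: rvs_distrib(4))

lemma dual_lsub: "K <= carrier V ==> dual V <= dual (V\<lparr>carrier := K\<rparr>)"
 by (auto intro!: dualI simp: subset_iff)

lemma svs_lsub: "svs V ==> lsub V K ==> svs (V\<lparr>carrier := K\<rparr>)"
 using rvs_lsub[of V K] dual_lsub[of K V] unfolding separated_def lsub_def
 by (simp, blast)

lemma mhom_lsub: "f : mhom V W ==> K <= carrier V ==> f : mhom (V\<lparr>carrier := K\<rparr>) W"
 by (rule mhomI) (auto simp: mhom_add mhom_smult mhom_closed subset_iff)

subsection \<open>Spaces of homomorphisms, products and direct sums\<close>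

lemma hom_vs_simps [simp]:
 "carrier (hom_vs V W) = lin V W" "\<zero>[hom_vs V W] = (\<lambda>v\<in>carrier V. \<zero>[W])"
 "f \<oplus>[hom_vs V W] g = (\<lambda>v\<in>carrier V. f v \<oplus>[W] g v)" "r \<odot>[hom_vs V W] f = (\<lambda>v\<in>carrier V. r \<odot>[W] f v)"
 by (simp_all add: hom_vs_def hom_subspace_def)

lemma hom_subspace_eq: "hom_subspace H V W = (hom_vs V W)\<lparr>carrier := H\<rparr>"
 by (simp add: hom_subspace_def hom_vs_def mk_qvs_def)

lemma lin_undefined: "f : lin V W ==> x ~: carrier V ==> f x = undefined"
 by (auto simp: lin_def extensional_def)

lemma lin_zero: "rvs V ==> rvs W ==> (\<lambda>v\<in>carrier V. \<zero>[W]) : lin V W"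
 by (intro lin_restrict mhomI) (auto simp: rvs_simps)

lemma lin_add: "rvs V ==> rvs W ==> f : lin V W ==> g : lin V W ==> (\<lambda>v\<in>carrier V. f v \<oplus>[W] g v) : lin V W"
proof (intro lin_restrict mhomI)
 assume *: "rvs V" "rvs W" "f : lin V W" "g : lin V W"
 note m = mhom_closed[OF lin_mhom[OF *(3)]] mhom_closed[OF lin_mhom[OF *(4)]]
 note a = mhom_add[OF lin_mhom[OF *(3)]] mhom_add[OF lin_mhom[OF *(4)]]
  mhom_smult[OF lin_mhom[OF *(3)]] mhom_smult[OF lin_mhom[OF *(4)]]
 have ac: "(a \<oplus>[W] b) \<oplus>[W] (c \<oplus>[W] d) = (a \<oplus>[W] c) \<oplus>[W] (b \<oplus>[W] d)"
  if "a : carrier W" "b : carrier W" "c : carrier W" "d : carrier W" for a b c d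
 proof -
  interpret vectorspace class_ring W by fact
  show ?thesis using that by (simp add: a_ac)
 qed
 fix x y r assume x: "x : carrier V"
 show "f x \<oplus>[W] g x : carrier W" using * m x by simp
 show "f (r \<odot>[V] x) \<oplus>[W] g (r \<odot>[V] x) = r \<odot>[W] (f x \<oplus>[W] g x)" using * m x a by (simp add: rvs_distrib(2))
 assume y: "y : carrier V"
 show "f (x \<oplus>[V] y) \<oplus>[W] g (x \<oplus>[V] y) = f x \<oplus>[W] g x \<oplus>[W] (f y \<oplus>[W] g y)"
  using x y m by (simp add: a ac)
qed

lemma lin_smult: "rvs V ==> rvs W ==> f : lin V W ==> (\<lambda>v\<in>carrier V. r \<odot>[W] f v) : lin V W"
proof (intro lin_restrict mhomI)
 assume *: "rvs V" "rvs W" "f : lin V W"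
 note m = mhom_closed[OF lin_mhom[OF *(3)]] mhom_add[OF lin_mhom[OF *(3)]] mhom_smult[OF lin_mhom[OF *(3)]]
 fix x y s assume x: "x : carrier V"
 show "r \<odot>[W] f x : carrier W" using * m x by simp
 show "r \<odot>[W] f (s \<odot>[V] x) = s \<odot>[W] (r \<odot>[W] f x)" using * m x by (simp add: rvs_simps mult.commute)
 assume y: "y : carrier V"
 show "r \<odot>[W] f (x \<oplus>[V] y) = r \<odot>[W] f x \<oplus>[W] r \<odot>[W] f y" using * m x y by (simp add: rvs_distrib(2))
qed

lemma rvs_hom_vs:
 assumes V: "rvs V" and W: "rvs W"
 shows "rvs (hom_vs V W)"
proof (rule rvsI; unfold hom_vs_simps)
 fix f g h r s assume f: "f : lin V W"
 note fc = lin_closed[OF f]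
 show "(\<lambda>v\<in>carrier V. r \<odot>[W] f v) : lin V W" by (rule lin_smult[OF V W f])
 show "(\<lambda>v\<in>carrier V. (\<lambda>v\<in>carrier V. \<zero>[W]) v \<oplus>[W] f v) = f"
  "(\<lambda>v\<in>carrier V. 1 \<odot>[W] f v) = f"
  using W fc by (auto simp: fun_eq_iff lin_undefined[OF f] rvs_simps)
 show "(\<lambda>v\<in>carrier V. 0 \<odot>[W] f v) = (\<lambda>v\<in>carrier V. \<zero>[W])"
  using W fc by (auto simp: fun_eq_iff rvs_simps)
 show "(\<lambda>v\<in>carrier V. (r * s) \<odot>[W] f v) = (\<lambda>v\<in>carrier V. r \<odot>[W] (\<lambda>v\<in>carrier V. s \<odot>[W] f v) v)"
  using W fc by (auto simp: fun_eq_iff rvs_simps)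
 show "(\<lambda>v\<in>carrier V. (r + s) \<odot>[W] f v)
  = (\<lambda>v\<in>carrier V. (\<lambda>v\<in>carrier V. r \<odot>[W] f v) v \<oplus>[W] (\<lambda>v\<in>carrier V. s \<odot>[W] f v) v)"
  using W fc by (auto simp: fun_eq_iff rvs_distrib(1))
 assume g: "g : lin V W"
 note gc = lin_closed[OF g]
 show "(\<lambda>v\<in>carrier V. f v \<oplus>[W] g v) : lin V W" by (rule lin_add[OF V W f g])
 show "(\<lambda>v\<in>carrier V. f v \<oplus>[W] g v) = (\<lambda>v\<in>carrier V. g v \<oplus>[W] f v)"
  using rvs_distrib(4)[OF W fc gc] by (auto simp: fun_eq_iff)
 show "(\<lambda>v\<in>carrier V. r \<odot>[W] (\<lambda>v\<in>carrier V. f v \<oplus>[W] g v) v)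
  = (\<lambda>v\<in>carrier V. (\<lambda>v\<in>carrier V. r \<odot>[W] f v) v \<oplus>[W] (\<lambda>v\<in>carrier V. r \<odot>[W] g v) v)"
  using W fc gc by (auto simp: fun_eq_iff rvs_distrib(2))
 assume h: "h : lin V W"
 show "(\<lambda>v\<in>carrier V. (\<lambda>v\<in>carrier V. f v \<oplus>[W] g v) v \<oplus>[W] h v)
  = (\<lambda>v\<in>carrier V. f v \<oplus>[W] (\<lambda>v\<in>carrier V. g v \<oplus>[W] h v) v)"
  using rvs_distrib(3)[OF W fc gc lin_closed[OF h]] by (auto simp: fun_eq_iff)
qed (rule lin_zero[OF V W])

lemma dual_eval: "l : dual W ==> v : carrier V ==> (%f. l (f v)) : dual (hom_vs V W)"
 by (rule dualI) (auto simp: lin_closed)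

lemma mhom_eval: "v : carrier V ==> (%f. f v) : mhom (hom_vs V W) W"
 by (rule mhomI) (auto simp: lin_closed)

lemma svs_hom_vs:
 assumes "rvs V" "svs W"
 shows "svs (hom_vs V W)"
proof
 show "rvs (hom_vs V W)" using assms rvs_hom_vs by auto
 show "separated (hom_vs V W)"
  unfolding separated_def
 proof (intro ballI impI)
  fix f assume f: "f : carrier (hom_vs V W)" and l: "ALL l:dual (hom_vs V W). l f = 0"
  have "f v = \<zero>[W]" if v: "v : carrier V" for v
  proof -
   have "ALL l:dual W. l (f v) = 0" using bspec[OF l dual_eval[OF _ v]] by blast
   moreover have "f v : carrier W" using f v lin_closed[of f V W v] by auto
   ultimately show ?thesis using assms(2) unfolding separated_def by blast
  qed
  then show "f = \<zero>[hom_vs V W]" using f by (auto simp: lin_def intro: extensionalityI)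
 qed
qed

text \<open>A homomorphism is determined by its values on a frame, and these by finitely many
  functionals of \<open>W\<close>; so the functionals \<open>h (f (a k))\<close> separate
  points.\<close>

lemma fdvs_hom_vs:
 assumes "fdvs V" "fdvs W"
 shows "fdvs (hom_vs V W)"
proof -
 have V: "rvs V" and W: "rvs W" using assms by (auto simp: fdvs_rvs)
 obtain n a l where fr: "frame V n a l" using fdvs_frame[OF assms(1)] .
 obtain H where H: "finite H" "H <= dual W" "ALL x:carrier W. (ALL l:H. l x = 0) --> x = \<zero>[W]"
  using fdvs_finite_separating[OF assms(2)] .
 have a: "a k : carrier V" if "k < n" for k using fr that by (auto simp: frame_def)
 show ?thesis
 proof (rule fdvsI[OF rvs_hom_vs[OF V W], of "(%(h, k) f. h (f (a k))) ` (H \<times> {..<n})"])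
  show "(%(h, k) f. h (f (a k))) ` (H \<times> {..<n}) <= dual (hom_vs V W)"
   using H(2) a dual_eval by fastforce
  fix f assume f: "f : carrier (hom_vs V W)" and *: "!!l. l : (%(h, k) f. h (f (a k))) ` (H \<times> {..<n}) ==> l f = 0"
  have "f (a k) = \<zero>[W]" if k: "k < n" for k
  proof -
   have "h (f (a k)) = 0" if "h : H" for h using *[of "%f. h (f (a k))"] k that by force
   then show ?thesis using H(3) lin_closed[of f V W "a k"] f a[OF k] by auto
  qed
  moreover have "f v = lcomb W {..<n} (%k. l k v) (%k. f (a k))" if "v : carrier V" for v
  proof -
   have "f v = f (lcomb V {..<n} (%k. l k v) a)" using fr that by (auto simp: frame_def)
   then show ?thesis using mhom_lcomb[OF V W lin_mhom, of f "{..<n}" a] f a by auto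
  qed
  moreover have "lcomb W {..<n} c (%k. \<zero>[W]) = \<zero>[W]" for c
   using lsub_lcomb[OF W, of "{\<zero>[W]}" "{..<n}" "%k. \<zero>[W]" c] W by (simp add: lsub_def rvs_simps)
  ultimately have "f v = \<zero>[W]" if "v : carrier V" for v
   using that lcomb_cong[OF W, of "{..<n}" "{..<n}" "%k. f (a k)" "%k. l k v" "%k. l k v" "%k. \<zero>[W]"] W by simp
  then show "f = \<zero>[hom_vs V W]" using f by (auto simp: lin_def intro: extensionalityI)
 qed (use H in auto)
qed

lemma fdvs_lsub: "fdvs V ==> lsub V K ==> fdvs (V\<lparr>carrier := K\<rparr>)"
 by (rule fdvs_injective[of _ V "%x. x"])
  (auto simp: rvs_lsub fdvs_rvs lsub_def intro!: mhomI)

lemma dprod_simps [simp]: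
 "carrier (dprod V) = {x. ALL i. x i : carrier (V i)}" "\<zero>[dprod V] = (%i. \<zero>[V i])"
 "x \<oplus>[dprod V] y = (%i. x i \<oplus>[V i] y i)" "r \<odot>[dprod V] x = (%i. r \<odot>[V i] x i)"
 by (simp_all add: dprod_def)

lemma dsum_simps [simp]:
 "carrier (dsum V) = {x. (ALL i. x i : carrier (V i)) & finite {i. x i ~= \<zero>[V i]}}" "\<zero>[dsum V] = (%i. \<zero>[V i])"
 "x \<oplus>[dsum V] y = (%i. x i \<oplus>[V i] y i)" "r \<odot>[dsum V] x = (%i. r \<odot>[V i] x i)"
 by (auto simp add: dprod_def dsum_def mk_qvs_def)

lemma rvs_dprod:
 assumes "!!i. rvs (V i)"
 shows "rvs (dprod V)"
 by (rule rvsI) (auto simp: fun_eq_iff assms rvs_distrib(1-3)[OF assms] rvs_simps[OF assms]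
   intro: rvs_distrib(4)[OF assms])

lemma rvs_dsum:
 assumes "!!i. rvs (V i)"
 shows "rvs (dsum V)"
proof -
 have "lsub (dprod V) (carrier (dsum V))"
  unfolding lsub_def
 proof (intro conjI ballI allI)
  fix x y r assume x: "x : carrier (dsum V)"
  have "{i. r \<odot>[V i] x i ~= \<zero>[V i]} <= {i. x i ~= \<zero>[V i]}" using assms by (auto simp: rvs_simps)
  then show "r \<odot>[dprod V] x : carrier (dsum V)" using x assms by (auto intro: finite_subset)
  assume y: "y : carrier (dsum V)"
  have "{i. x i \<oplus>[V i] y i ~= \<zero>[V i]} <= {i. x i ~= \<zero>[V i]} \<union> {i. y i ~= \<zero>[V i]}" using assms by (auto simp: rvs_simps)
  then show "x \<oplus>[dprod V] y : carrier (dsum V)" using x y assms by (auto intro: finite_subset)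
 qed (use assms in auto)
 from rvs_lsub[OF rvs_dprod this] assms show ?thesis by (auto simp: dsum_def)
qed

lemma mhom_dsum_proj: "(%x. x i) : mhom (dsum V) (V i)"
 and mhom_dprod_proj: "(%x. x i) : mhom (dprod V) (V i)"
 by (rule mhomI; simp)+

lemma svs_dsum:
 assumes "!!i. svs (V i)"
 shows "svs (dsum V)"
proof
 show "rvs (dsum V)" using assms by (intro rvs_dsum) auto
 show "separated (dsum V)"
  unfolding separated_def
 proof (intro ballI impI)
  fix x assume x: "x : carrier (dsum V)" and l: "ALL l:dual (dsum V). l x = 0"
  have "l (x i) = 0" if "l : dual (V i)" for i l
   using bspec[OF l dual_mhom[OF mhom_dsum_proj[of i V] that]] .
  then have "x i = \<zero>[V i]" for i using assms[of i] x unfolding separated_def dsum_simps by blast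
  then show "x = \<zero>[dsum V]" by auto
 qed
qed

definition dsum_inj :: "('i => 'a qvs) => 'i => 'a => 'i => 'a" where
 "dsum_inj V i v = (%j. if j = i then v else \<zero>[V j])"

lemma dsum_inj_closed: "(!!i. rvs (V i)) ==> v : carrier (V i) ==> dsum_inj V i v : carrier (dsum V)"
 by (auto simp: dsum_inj_def)

lemma dsum_inj_mhom: "(!!i. rvs (V i)) ==> dsum_inj V i : mhom (V i) (dsum V)"
 by (rule mhomI) (auto simp: dsum_inj_closed[simplified dsum_simps] dsum_inj_def fun_eq_iff rvs_simps)

lemma fdvs_dsumI:
 assumes V: "!!i. fdvs (V i)" and N: "finite N" "!!i. i ~: N ==> carrier (V i) <= {\<zero>[V i]}"
 shows "fdvs (dsum V)"
proof -
 have "EX H. finite H & H <= dual (V i) & (ALL x:carrier (V i). (ALL l:H. l x = 0) --> x = \<zero>[V i])" for i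
  using fdvs_finite_separating[OF V[of i]] by metis
 then obtain H where H: "!!i. finite (H i)" "!!i. H i <= dual (V i)"
  "!!i. ALL x:carrier (V i). (ALL l:H i. l x = 0) --> x = \<zero>[V i]" by metis
 show ?thesis
 proof (rule fdvsI[of _ "\<Union>i\<in>N. (\<lambda>l x. l (x i)) ` H i"])
  show "rvs (dsum V)" using V by (auto intro: rvs_dsum fdvs_rvs)
  show "finite (\<Union>i\<in>N. (\<lambda>l x. l (x i)) ` H i)" using H(1) N(1) by auto
  show "(\<Union>i\<in>N. (\<lambda>l x. l (x i)) ` H i) <= dual (dsum V)" using H(2) dual_mhom[OF mhom_dsum_proj] by fast
  fix x assume x: "x \<in> carrier (dsum V)" and *: "!!l. l \<in> (\<Union>i\<in>N. (\<lambda>l x. l (x i)) ` H i) ==> l x = 0"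
  have "x i = \<zero>[V i]" for i
  proof (cases "i : N")
   case True
   then have "ALL l:H i. l (x i) = 0" using * by blast
   then show ?thesis using H(3)[of i] x by simp
  qed (use N(2)[of i] x in auto)
  then show "x = \<zero>[dsum V]" by auto
 qed
qed

text \<open>Each of the finitely many frame vectors of the sum has finite support; outside the union
  of these supports every vector of the sum vanishes.\<close>

lemma fdvs_dsum_finite_support:
 assumes V: "!!i. rvs (V i)" and fd: "fdvs (dsum V)"
 obtains N where "finite N" "!!i x. x : carrier (dsum V) ==> i ~: N ==> x i = \<zero>[V i]"
  "!!i. i ~: N ==> carrier (V i) = {\<zero>[V i]}"
proof -
 obtain n a l where fr: "frame (dsum V) n a l" using fdvs_frame[OF fd] .
 define N where "N = (\<Union>k<n. {i. a k i ~= \<zero>[V i]})"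
 have N: "finite N" using fr by (auto simp: N_def frame_def)
 have z: "x i = \<zero>[V i]" if x: "x : carrier (dsum V)" and i: "i ~: N" for i x
 proof -
  have "lsub (dsum V) {x : carrier (dsum V). x i = \<zero>[V i]}"
  proof -
   have "{x : carrier (dsum V). x i = \<zero>[V i]} <= carrier (dsum V)" by auto
   moreover have "x \<oplus>[dsum V] y : {x : carrier (dsum V). x i = \<zero>[V i]}"
    if "x : {x : carrier (dsum V). x i = \<zero>[V i]}" "y : {x : carrier (dsum V). x i = \<zero>[V i]}" for x y
    using that rvs_closed(2)[OF rvs_dsum[of V, OF V], of x y] V[of i] by (simp del: dsum_simps(1) add: rvs_simps)
   moreover have "r \<odot>[dsum V] x : {x : carrier (dsum V). x i = \<zero>[V i]}"
    if "x : {x : carrier (dsum V). x i = \<zero>[V i]}" for x r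
    using that rvs_closed(3)[OF rvs_dsum[of V, OF V], of x r] V[of i] by (simp del: dsum_simps(1) add: rvs_simps)
   ultimately show ?thesis using V rvs_closed(1)[OF rvs_dsum[of V, OF V]] unfolding lsub_def by (simp del: dsum_simps(1) add: rvs_simps)
  qed
  then have "lcomb (dsum V) {..<n} (%k. l k x) a : {x : carrier (dsum V). x i = \<zero>[V i]}"
   by (rule lsub_lcomb[OF rvs_dsum[of V, OF V]]) (use fr i in "auto simp: N_def frame_def")
  then show ?thesis using fr x unfolding frame_def by (metis (mono_tags, lifting) mem_Collect_eq)
 qed
 have "v = \<zero>[V i]" if "i ~: N" "v : carrier (V i)" for i v
  using z[OF dsum_inj_closed[of V, OF V that(2)] that(1)] by (simp add: dsum_inj_def)
 then have "carrier (V i) = {\<zero>[V i]}" if "i ~: N" for i using that V[of i] by auto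
 then show ?thesis using that N z by blast
qed

subsection \<open>Transport of structure\<close>

text \<open>Duals of multilinear parts consist of functions on the values of \<open>F\<close>,
  whereas the modules to be constructed have their elements in the type \<open>'v\<close>; free
  objects are moved to the type \<open>'a\<close> in the same way.\<close>

lemma fdvs_transport:
 fixes V :: "'a qvs"
 assumes V: "fdvs V" and inf: "infinite (UNIV :: 'b set)"
 obtains V' :: "'b qvs" and j j' where "fdvs V'" "j : mhom V V'" "j' : mhom V' V"
  "!!x. x : carrier V ==> j' (j x) = x" "!!y. y : carrier V' ==> j (j' y) = y"
proof -
 obtain j :: "'a => 'b" where j: "inj_on j (carrier V)" using fdvs_inj_on_exists[OF V inf] .
 define j' where "j' = inv_into (carrier V) j"
 have j'j: "j' (j x) = x" if "x : carrier V" for x using j that by (simp add: j'_def)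
 define V' where "V' = mk_qvs (j ` carrier V) (j \<zero>[V]) (%x y. j (j' x \<oplus>[V] j' y)) (%r x. j (r \<odot>[V] j' x))"
 have V': "rvs V'" "j : mhom V V'"
  by (rule rvs_surjective_image[OF fdvs_rvs[OF V], of V' j]; auto simp: V'_def j'j)+
 have j'm: "j' : mhom V' V"
  using fdvs_rvs[OF V] by (intro mhomI) (auto simp: V'_def j'j)
 have jj': "j (j' y) = y" if "y : carrier V'" for y using that by (auto simp: V'_def j'j)
 have "fdvs V'"
 proof (rule fdvs_injective[OF V'(1) V j'm])
  fix x assume "x : carrier V'" "j' x = \<zero>[V]"
  then have "x = j \<zero>[V]" using jj' by metis
  then show "x = \<zero>[V']" by (simp add: V'_def)
 qed
 then show ?thesis using that V'(2) j'm j'j jj' by blast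
qed

lemma is_repD:
 assumes "is_rep G R"
 shows "fdvs (space R)" "g : carrier G ==> act R g : mhom (space R) (space R)"
  "v : cs R ==> act R \<one>[G] v = v"
  "g : carrier G ==> h : carrier G ==> v : cs R ==> act R (g \<otimes>[G] h) v = act R g (act R h v)"
  "g : carrier G ==> v : cs R ==> act R g v : cs R"
 using assms mhom_closed[of "act R g" "space R" "space R"] by (auto simp: is_rep_def)

lemma rep_transport:
 fixes R :: "('g, 'a) rep"
 assumes R: "is_rep G R" and inf: "infinite (UNIV :: 'b set)" and G: "group G"
 obtains R' :: "('g, 'b) rep" and j j' where "is_rep G R'" "j : mhom (space R) (space R')" "j' : mhom (space R') (space R)"
  "!!x. x : cs R ==> j' (j x) = x" "!!y. y : cs R' ==> j (j' y) = y"
  "!!g x. g : carrier G ==> x : cs R ==> j (act R g x) = act R' g (j x)"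
  "!!g y. g : carrier G ==> y : cs R' ==> j' (act R' g y) = act R g (j' y)"
proof -
 note RD = is_repD[OF R]
 obtain V' :: "'b qvs" and j j' where *: "fdvs V'" "j : mhom (space R) V'" "j' : mhom V' (space R)"
  "!!x. x : cs R ==> j' (j x) = x" "!!y. y : carrier V' ==> j (j' y) = y"
  using fdvs_transport[OF RD(1) inf] by blast
 define R' where "R' = \<lparr> space = V', act = (%g x. j (act R g (j' x))) \<rparr>"
 have "is_rep G R'"
  unfolding is_rep_def
 proof (intro conjI ballI)
  show "act R' g : mhom (space R') (space R')" if "g : carrier G" for g
   unfolding R'_def rep.simps by (intro mhom_comp[OF mhom_comp[OF *(3) RD(2)] *(2)] that)
 qed (use * RD monoid.m_closed[OF group.is_monoid[OF G]] in "auto simp: R'_def mhom_closed[OF *(3)] mhom_closed[OF *(2)]")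
 then show ?thesis
  by (rule that) (use * RD in "auto simp: R'_def mhom_closed[OF *(3)]")
qed

subsection \<open>Quotients and free spaces\<close>

lemma coset_mem: "z : N +>\<^bsub>M\<^esub> x \<longleftrightarrow> (EX n:N. z = n \<oplus>[M] x)"
 by (auto simp: a_r_coset_def')

lemma coset_eq_iff:
 assumes M: "rvs M" and N: "lsub M N" and x: "x : carrier M" and y: "y : carrier M"
 shows "N +>\<^bsub>M\<^esub> x = N +>\<^bsub>M\<^esub> y \<longleftrightarrow> (EX n:N. x = n \<oplus>[M] y)"
proof
 have NM: "N <= carrier M" and z: "\<zero>[M] : N" using N by (auto simp: lsub_def)
 have "x : N +>\<^bsub>M\<^esub> x" unfolding coset_mem using z M x by (metis rvs_simps(1))
 then show "N +>\<^bsub>M\<^esub> x = N +>\<^bsub>M\<^esub> y ==> EX n:N. x = n \<oplus>[M] y" by (simp add: coset_mem)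
 assume "EX n:N. x = n \<oplus>[M] y"
 then obtain n where n: "n : N" "x = n \<oplus>[M] y" by blast
 let ?n = "(-1) \<odot>[M] n"
 have n': "?n : N" using N n by (auto simp: lsub_def)
 have y_eq: "y = ?n \<oplus>[M] x"
 proof -
  have "?n \<oplus>[M] x = (?n \<oplus>[M] n) \<oplus>[M] y"
   using n n' NM y M by (simp add: rvs_distrib(3) subset_iff)
  also have "?n \<oplus>[M] n = \<zero>[M]"
   using rvs_distrib(1)[OF M, of n "-1" 1] n NM M by (auto simp: rvs_simps)
  finally show ?thesis using y M by (simp add: rvs_simps)
 qed
 have sub: "N +>\<^bsub>M\<^esub> a <= N +>\<^bsub>M\<^esub> b" if "m : N" "a = m \<oplus>[M] b" "b : carrier M" for a b m
 proof
  fix w assume "w : N +>\<^bsub>M\<^esub> a"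
  then obtain k where k: "k : N" "w = k \<oplus>[M] a" by (auto simp: coset_mem)
  then have "w = (k \<oplus>[M] m) \<oplus>[M] b"
   using rvs_distrib(3)[OF M subsetD[OF NM k(1)] subsetD[OF NM that(1)] that(3)] that(2) by simp
  moreover have "k \<oplus>[M] m : N" using k that N by (auto simp: lsub_def)
  ultimately show "w : N +>\<^bsub>M\<^esub> b" by (auto simp: coset_mem)
 qed
 show "N +>\<^bsub>M\<^esub> x = N +>\<^bsub>M\<^esub> y"
  using sub[OF n y] sub[OF n' y_eq x] by blast
qed

lemma quot_vs_props:
 assumes M: "rvs M" and N: "lsub M N"
 shows "rvs (quot_vs M N)" "(%x. N +>\<^bsub>M\<^esub> x) : mhom M (quot_vs M N)"
  "carrier (quot_vs M N) = (%x. N +>\<^bsub>M\<^esub> x) ` carrier M"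
proof -
 have NM: "N <= carrier M" and z: "\<zero>[M] : N" and Na: "!!x y. x : N ==> y : N ==> x \<oplus>[M] y : N"
  and Ns: "!!r x. x : N ==> r \<odot>[M] x : N" using N by (auto simp: lsub_def)
 show c: "carrier (quot_vs M N) = (%x. N +>\<^bsub>M\<^esub> x) ` carrier M"
  by (auto simp: quot_vs_def A_RCOSETS_def')
 have zz: "\<zero>[quot_vs M N] = N +>\<^bsub>M\<^esub> \<zero>[M]"
 proof -
  have "N +>\<^bsub>M\<^esub> \<zero>[M] = (%n. n) ` N"
   unfolding a_r_coset_def' using NM M by (auto simp: rvs_simps subset_iff)
  then show ?thesis by (simp add: quot_vs_def)
 qed
 have p: "(N +>\<^bsub>M\<^esub> x) \<oplus>[quot_vs M N] (N +>\<^bsub>M\<^esub> y) = N +>\<^bsub>M\<^esub> (x \<oplus>[M] y)" if x: "x : carrier M" and y: "y : carrier M" for x y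
 proof -
  interpret vectorspace class_ring M by fact
  have r: "(n \<oplus>[M] x) \<oplus>[M] (m \<oplus>[M] y) = (n \<oplus>[M] m) \<oplus>[M] (x \<oplus>[M] y)" if "n : N" "m : N" for n m
  proof -
   have "n : carrier M" "m : carrier M" using that NM by auto
   then show ?thesis using x y by (simp add: a_ac)
  qed
  show ?thesis
  proof
   show "(N +>\<^bsub>M\<^esub> x) \<oplus>[quot_vs M N] (N +>\<^bsub>M\<^esub> y) <= N +>\<^bsub>M\<^esub> (x \<oplus>[M] y)"
    unfolding quot_vs_def mk_qvs_simps set_add_def'
    using r Na by (auto simp: coset_mem; metis)
   show "N +>\<^bsub>M\<^esub> (x \<oplus>[M] y) <= (N +>\<^bsub>M\<^esub> x) \<oplus>[quot_vs M N] (N +>\<^bsub>M\<^esub> y)"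
   proof
    fix w assume "w : N +>\<^bsub>M\<^esub> (x \<oplus>[M] y)"
    then obtain n where n: "n : N" "w = n \<oplus>[M] (x \<oplus>[M] y)" by (auto simp: coset_mem)
    then have "w = (n \<oplus>[M] x) \<oplus>[M] (\<zero>[M] \<oplus>[M] y)" using r[OF n(1) z] n NM by auto
    then show "w : (N +>\<^bsub>M\<^esub> x) \<oplus>[quot_vs M N] (N +>\<^bsub>M\<^esub> y)"
    unfolding quot_vs_def mk_qvs_simps set_add_def' UN_iff singleton_iff
    using n(1) z by (intro bexI[of _ "n \<oplus>[M] x"] bexI[of _ "\<zero>[M] \<oplus>[M] y"]) (auto simp: coset_mem)
   qed
  qed
 qed
 have s: "r \<odot>[quot_vs M N] (N +>\<^bsub>M\<^esub> x) = N +>\<^bsub>M\<^esub> (r \<odot>[M] x)" if x: "x : carrier M" for r x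
 proof -
  have "N +>\<^bsub>M\<^esub> (r \<odot>[M] w) = N +>\<^bsub>M\<^esub> (r \<odot>[M] x)" if "w : N +>\<^bsub>M\<^esub> x" for w
  proof -
   from that obtain n where n: "n : N" "w = n \<oplus>[M] x" by (auto simp: coset_mem)
   then have "r \<odot>[M] w = (r \<odot>[M] n) \<oplus>[M] (r \<odot>[M] x)" "w : carrier M"
    using x NM M by (auto simp: rvs_distrib(2))
   then show ?thesis using coset_eq_iff[OF M N, of "r \<odot>[M] w" "r \<odot>[M] x"] Ns[OF n(1)] x M by blast
  qed
  moreover have "x : N +>\<^bsub>M\<^esub> x" unfolding coset_mem using z M x by (metis rvs_simps(1))
  ultimately have "(\<Union>w\<in>N +>\<^bsub>M\<^esub> x. N +>\<^bsub>M\<^esub> (r \<odot>[M] w)) = N +>\<^bsub>M\<^esub> (r \<odot>[M] x)" by blast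
  then show ?thesis by (simp add: quot_vs_def)
 qed
 show "rvs (quot_vs M N)" "(%x. N +>\<^bsub>M\<^esub> x) : mhom M (quot_vs M N)"
  using rvs_surjective_image[where q = "%x. N +>\<^bsub>M\<^esub> x", OF M c zz p s] by auto
qed

lemma quot_vs_lift:
 assumes M: "rvs M" and N: "lsub M N" and W: "rvs W" and f: "f : mhom M W" and fN: "!!n. n : N ==> f n = \<zero>[W]"
 shows "EX L:lin (quot_vs M N) W. ALL x:carrier M. L (N +>\<^bsub>M\<^esub> x) = f x"
proof -
 note Q = quot_vs_props[OF M N]
 have NM: "N <= carrier M" using N by (simp add: lsub_def)
 \<comment> \<open>Any representative of a coset gives the same value, since two of them differ by
   an element of \<open>N\<close>, where \<open>f\<close> vanishes.\<close>
 define L0 where "L0 A = f (SOME x. x : carrier M & A = N +>\<^bsub>M\<^esub> x)" for A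
 have L0: "L0 (N +>\<^bsub>M\<^esub> x) = f x" if x: "x : carrier M" for x
 proof -
  let ?y = "SOME y. y : carrier M & N +>\<^bsub>M\<^esub> x = N +>\<^bsub>M\<^esub> y"
  have y: "?y : carrier M" "N +>\<^bsub>M\<^esub> x = N +>\<^bsub>M\<^esub> ?y"
   using someI[of "%y. y : carrier M & N +>\<^bsub>M\<^esub> x = N +>\<^bsub>M\<^esub> y" x] x by auto
  then obtain n where "n : N" "x = n \<oplus>[M] ?y" using coset_eq_iff[OF M N x y(1)] by blast
  then have "f x = f ?y" using mhom_add[OF f, of n ?y] fN[of n] NM y(1) W mhom_closed[OF f y(1)] by (auto simp: rvs_simps)
  then show ?thesis by (simp add: L0_def)
 qed
 have "L0 : mhom (quot_vs M N) W"
 proof (rule mhomI; unfold Q(3))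
  fix A B r assume "A : (%x. N +>\<^bsub>M\<^esub> x) ` carrier M"
  then obtain x where x: "x : carrier M" "A = N +>\<^bsub>M\<^esub> x" by blast
  show "L0 A : carrier W" using x mhom_closed[OF f] by (simp add: L0)
  show "L0 (r \<odot>[quot_vs M N] A) = r \<odot>[W] L0 A"
   unfolding x(2) mhom_smult[OF Q(2) x(1), of r, symmetric] L0[OF x(1)]
    L0[OF rvs_closed(3)[OF M x(1)]] by (rule mhom_smult[OF f x(1)])
  assume "B : (%x. N +>\<^bsub>M\<^esub> x) ` carrier M"
  then obtain y where y: "y : carrier M" "B = N +>\<^bsub>M\<^esub> y" by blast
  show "L0 (A \<oplus>[quot_vs M N] B) = L0 A \<oplus>[W] L0 B"
   unfolding x(2) y(2) mhom_add[OF Q(2) x(1) y(1), symmetric] L0[OF x(1)] L0[OF y(1)]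
    L0[OF rvs_closed(2)[OF M x(1) y(1)]] by (rule mhom_add[OF f x(1) y(1)])
 qed
 then show ?thesis
  by (intro bexI[of _ "restrict L0 (carrier (quot_vs M N))"] lin_restrict Q) (auto simp: Q(3) L0)
qed

lemma free_vs_simps [simp]:
 "carrier (free_vs S) = {c. finite {s. c s ~= 0} & (ALL s. s ~: S --> c s = 0)}"
 "\<zero>[free_vs S] = (%s. 0)" "c \<oplus>[free_vs S] d = (%s. c s + d s)" "r \<odot>[free_vs S] c = (%s. r * c s)"
 by (simp_all add: free_vs_def)

lemma finite_support_add: "finite {s. c s ~= 0} ==> finite {s. d s ~= 0} ==> finite {s. c s + d s ~= (0::rat)}"
 by (rule finite_subset[of _ "{s. c s ~= 0} \<union> {s. d s ~= 0}"]) auto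

lemma rvs_free_vs: "rvs (free_vs S)"
 by (rule rvsI) (auto simp: finite_support_add algebra_simps)

lemma pt_closed: "s : S ==> pt s : carrier (free_vs S)"
 by (auto simp: pt_def)

lemma free_vs_expand:
 assumes c: "c : carrier (free_vs S)"
 shows "c = lcomb (free_vs S) {s. c s ~= 0} c pt"
proof
 fix t
 have d: "(%c. c t) : dual (free_vs S)" by (rule dualI) auto
 have "pt s : carrier (free_vs S)" if "c s ~= 0" for s using that c by (intro pt_closed) auto
 then have "lcomb (free_vs S) {s. c s ~= 0} c pt t = (\<Sum>s | c s ~= 0. c s * pt s t)"
  using dual_lcomb[OF rvs_free_vs d, of "{s. c s ~= 0}" pt c] by simp
 also have "... = (\<Sum>s | c s ~= 0. if s = t then c s else 0)" by (intro sum.cong) (auto simp: pt_def)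
 also have "... = c t" using c by (simp add: sum.delta)
 finally show "c t = lcomb (free_vs S) {s. c s ~= 0} c pt t" by simp
qed

lemma lcomb_mono_neutral:
 assumes W: "rvs W" and "finite B" "A <= B" "!!i. i : B ==> x i : carrier W" "!!i. i : B - A ==> c i = 0"
 shows "lcomb W A c x = lcomb W B c x"
proof -
 interpret vectorspace class_ring W by fact
 show ?thesis unfolding lcomb_def
  by (rule add.finprod_mono_neutral_cong_left) (use assms in "auto simp: rvs_simps")
qed

lemma free_vs_lift:
 assumes W: "rvs W" and mu: "!!s. s : S ==> mu s : carrier W"
 shows "EX f:mhom (free_vs S) W. ALL s:S. f (pt s) = mu s"
proof -
 define f where "f c = lcomb W {s. c s ~= 0} c mu" for c
 \<comment> \<open>The supports of \<open>c\<close>, of \<open>d\<close> and of their sum differ;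
   \<open>ext\<close> lets all three combinations run over one finite set.\<close>
 have ext: "f c = lcomb W A c mu" if "finite A" "{s. c s ~= 0} <= A" "A <= S" for A c
  unfolding f_def using that mu by (intro lcomb_mono_neutral[OF W]) auto
 have "f : mhom (free_vs S) W"
 proof (rule mhomI)
  fix c d r assume c: "c : carrier (free_vs S)"
  then have cS: "finite {s. c s ~= 0}" "{s. c s ~= 0} <= S" by auto
  have mc: "!!i. i : {s. c s ~= 0} ==> mu i : carrier W" using cS mu by auto
  show "f c : carrier W" unfolding f_def using mc by (intro lcomb_closed W)
  have "f (%s. r * c s) = lcomb W {s. c s ~= 0} (%s. r * c s) mu" by (rule ext) (use cS in auto)
  also have "... = r \<odot>[W] f c" unfolding f_def by (rule lcomb_smult[OF W mc])
  finally show "f (r \<odot>[free_vs S] c) = r \<odot>[W] f c" by simp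
  assume d: "d : carrier (free_vs S)"
  let ?A = "{s. c s ~= 0} \<union> {s. d s ~= 0}"
  have A: "finite ?A" "?A <= S" using c d by auto
  have "f (%s. c s + d s) = lcomb W ?A (%s. c s + d s) mu" by (rule ext) (use A in auto)
  also have "... = lcomb W ?A c mu \<oplus>[W] lcomb W ?A d mu" by (rule lcomb_add[OF W]) (use A mu in auto)
  also have "... = f c \<oplus>[W] f d" using ext[OF A(1) _ A(2), of c] ext[OF A(1) _ A(2), of d] by simp
  finally show "f (c \<oplus>[free_vs S] d) = f c \<oplus>[W] f d" by simp
 qed
 moreover have "f (pt s) = mu s" if "s : S" for s
 proof -
  have "f (pt s) = lcomb W (insert s {}) (pt s) mu" by (rule ext) (use that in "auto simp: pt_def")
  also have "... = mu s" using that mu W by (subst lcomb_insert) (auto simp: pt_def rvs_simps)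
  finally show ?thesis .
 qed
 ultimately show ?thesis by blast
qed

section \<open>Tensor products\<close>

definition multilinear :: "'k set => ('k => 'a qvs) => 'b qvs => (('k => 'a) => 'b) => bool" where
 "multilinear J X W \<mu> \<longleftrightarrow> (ALL w:tuples J X. \<mu> w : carrier W) &
  (ALL w:tuples J X. ALL k:J. ALL a:carrier (X k). ALL b:carrier (X k).
   \<mu> (w(k := a \<oplus>[X k] b)) = \<mu> (w(k := a)) \<oplus>[W] \<mu> (w(k := b))) &
  (ALL w:tuples J X. ALL k:J. ALL a:carrier (X k). ALL r.
   \<mu> (w(k := r \<odot>[X k] a)) = r \<odot>[W] \<mu> (w(k := a)))"

lemma tuples_upd: "w : tuples J X ==> k : J ==> a : carrier (X k) ==> w(k := a) : tuples J X"
 by (auto simp: tuples_def PiE_iff extensional_def)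

lemma tuples_mem: "w : tuples J X ==> k : J ==> w k : carrier (X k)"
 by (auto simp: tuples_def)

lemma span_lsub:
 assumes "rvs V" "S <= carrier V"
 shows "lsub V (LinearCombinations.module.span class_ring V S)" "S <= LinearCombinations.module.span class_ring V S"
proof -
 interpret vectorspace class_ring V by fact
 interpret S: submodule class_ring "span S" V by (rule span_is_submodule[OF assms(2)])
 show "lsub V (span S)" using S.subset by (auto simp: lsub_def)
 show "S <= span S" by (rule in_own_span[OF assms(2)])
qed

lemma span_zero:
 assumes V: "rvs V" and W: "rvs W" and S: "S <= carrier V" and f: "f : mhom V W" and z: "!!s. s : S ==> f s = \<zero>[W]"
  and x: "x : LinearCombinations.module.span class_ring V S"
 shows "f x = \<zero>[W]"
proof -
 interpret vectorspace class_ring V by fact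
 obtain A a where A: "A <= S" "x = lcomb V A a (%v. v)"
  using x unfolding span_def lincomb_def lcomb_def by blast
 then have "f x = lcomb W A a f" using mhom_lcomb[OF V W f, of A "%v. v" a] S by auto
 also have "... : {\<zero>[W]}" by (rule lsub_lcomb[OF W]) (use z A W in "auto simp: lsub_def rvs_simps")
 finally show ?thesis by simp
qed

context
 fixes J :: "'k set" and X :: "'k => 'a qvs"
 assumes X: "!!k. k : J ==> rvs (X k)"
begin

text \<open>Differences are rewritten as sums with the scalar -1, the form in which linear maps can
  be pushed through them.\<close>

lemma multilinear_relations_cases:
 assumes "c : multilinear_relations J X"
 obtains (add) w k a b where "w : tuples J X" "k : J" "a : carrier (X k)" "b : carrier (X k)"
   "c = (%t. (pt (w(k := a \<oplus>[X k] b)) t + (-1) * pt (w(k := a)) t) + (-1) * pt (w(k := b)) t)"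
  | (smult) w k r a where "w : tuples J X" "k : J" "a : carrier (X k)" 
   "c = (%t. pt (w(k := r \<odot>[X k] a)) t + (-r) * pt (w(k := a)) t)"
 using assms unfolding multilinear_relations_def
 by (elim UnE CollectE exE conjE; intro that; simp)

lemma relations_closed: "multilinear_relations J X <= carrier (free_vs (tuples J X))"
proof
 fix c assume c: "c : multilinear_relations J X"
 note F = rvs_closed[OF rvs_free_vs[of "tuples J X"], simplified free_vs_simps(3,4)]
 have p: "pt (w(k := a)) : carrier (free_vs (tuples J X))" if "w : tuples J X" "k : J" "a : carrier (X k)" for w k a
  using that by (intro pt_closed tuples_upd)
 from c show "c : carrier (free_vs (tuples J X))"
 proof (cases rule: multilinear_relations_cases)
  case (add w k a b)
  have "a \<oplus>[X k] b : carrier (X k)" using add X by auto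
  then show ?thesis unfolding add(5) by (intro F p add)
 next
  case (smult w k r a)
  have "r \<odot>[X k] a : carrier (X k)" using smult X by auto
  then show ?thesis unfolding smult(4) by (intro F p smult)
 qed
qed

lemma null_tensors_lsub: "lsub (free_vs (tuples J X)) (null_tensors J X)"
 unfolding null_tensors_def by (rule span_lsub(1)[OF rvs_free_vs relations_closed])

lemma rvs_tensor: "rvs (tensor J X)"
 unfolding tensor_def by (rule quot_vs_props(1)[OF rvs_free_vs null_tensors_lsub])

lemma pure_tensor_mhom: "(%c. null_tensors J X +>\<^bsub>free_vs (tuples J X)\<^esub> c) : mhom (free_vs (tuples J X)) (tensor J X)"
 unfolding tensor_def by (rule quot_vs_props(2)[OF rvs_free_vs null_tensors_lsub])

lemma pure_tensor_closed [intro]: "w : tuples J X ==> pure_tensor J X w : carrier (tensor J X)"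
 unfolding pure_tensor_def using mhom_closed[OF pure_tensor_mhom pt_closed] by simp

lemma multilinear_pure_tensor: "multilinear J X (tensor J X) (pure_tensor J X)"
 unfolding multilinear_def
proof (intro conjI ballI allI)
 let ?F = "free_vs (tuples J X)" and ?N = "null_tensors J X"
 let ?q = "%c. ?N +>\<^bsub>?F\<^esub> c"
 have RN: "multilinear_relations J X <= ?N"
  unfolding null_tensors_def by (rule span_lsub(2)[OF rvs_free_vs relations_closed])
 fix w k a b r assume w: "w : tuples J X" "k : J" "a : carrier (X k)"
 have p: "pt (w(k := x)) : carrier ?F" if "x : carrier (X k)" for x using that w by (intro pt_closed tuples_upd)
 have "(%t. pt (w(k := r \<odot>[X k] a)) t - r * pt (w(k := a)) t) : ?N"
  by (rule subsetD[OF RN], unfold multilinear_relations_def, rule UnI2, rule CollectI,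
    rule exI[of _ w], rule exI[of _ k], rule exI[of _ r], rule exI[of _ a]) (simp add: w)
 then have "?q (pt (w(k := r \<odot>[X k] a))) = ?q (r \<odot>[?F] pt (w(k := a)))"
  by (subst coset_eq_iff[OF rvs_free_vs null_tensors_lsub p[OF rvs_closed(3)[OF X[OF w(2)] w(3)]]
    rvs_closed(3)[OF rvs_free_vs p[OF w(3)]]])
   (erule bexI[rotated], simp)
 then show "pure_tensor J X (w(k := r \<odot>[X k] a)) = r \<odot>[tensor J X] pure_tensor J X (w(k := a))"
  unfolding pure_tensor_def using mhom_smult[OF pure_tensor_mhom p[OF w(3)]] by simp
 assume b: "b : carrier (X k)"
 have "(%t. pt (w(k := a \<oplus>[X k] b)) t - pt (w(k := a)) t - pt (w(k := b)) t) : ?N"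
  by (rule subsetD[OF RN], unfold multilinear_relations_def, rule UnI1, rule CollectI,
    rule exI[of _ w], rule exI[of _ k], rule exI[of _ a], rule exI[of _ b]) (simp add: w b)
 then have "?q (pt (w(k := a \<oplus>[X k] b))) = ?q (pt (w(k := a)) \<oplus>[?F] pt (w(k := b)))"
  by (subst coset_eq_iff[OF rvs_free_vs null_tensors_lsub p[OF rvs_closed(2)[OF X[OF w(2)] w(3) b]]
    rvs_closed(2)[OF rvs_free_vs p[OF w(3)] p[OF b]]])
   (erule bexI[rotated], simp)
 then show "pure_tensor J X (w(k := a \<oplus>[X k] b)) = pure_tensor J X (w(k := a)) \<oplus>[tensor J X] pure_tensor J X (w(k := b))"
  unfolding pure_tensor_def using mhom_add[OF pure_tensor_mhom p[OF w(3)] p[OF b]] by simp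
qed auto

text \<open>The universal property: the linear extension of \<open>mu\<close> to the free space
  kills the relations, hence their span, and descends to the quotient.\<close>

lemma tensor_lift:
 assumes W: "rvs W" and mu: "multilinear J X W mu"
 shows "EX L:lin (tensor J X) W. ALL w:tuples J X. L (pure_tensor J X w) = mu w"
proof -
 let ?F = "free_vs (tuples J X)" and ?N = "null_tensors J X"
 have mc: "!!w. w : tuples J X ==> mu w : carrier W" using mu by (simp add: multilinear_def)
 obtain f where f: "f : mhom ?F W" "ALL w:tuples J X. f (pt w) = mu w"
  using free_vs_lift[of W "tuples J X" mu, OF W mc] by blast
 note F = rvs_closed[OF rvs_free_vs[of "tuples J X"], simplified free_vs_simps(3,4)]
 have z: "f c = \<zero>[W]" if "c : multilinear_relations J X" for c
 proof -
  have p: "pt (w(k := a)) : carrier ?F" "f (pt (w(k := a))) = mu (w(k := a))" 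
   if "w : tuples J X" "k : J" "a : carrier (X k)" for w k a
   using that by (auto intro!: pt_closed tuples_upd bspec[OF f(2)] simp del: free_vs_simps(1))
  have cancel: "(x \<oplus>[W] y) \<oplus>[W] (-1) \<odot>[W] x \<oplus>[W] (-1) \<odot>[W] y = \<zero>[W]" if xy: "x : carrier W" "y : carrier W" for x y
  proof -
   interpret vectorspace class_ring W by fact
   have n: "v \<oplus>[W] (-1) \<odot>[W] v = \<zero>[W]" if "v : carrier W" for v
    using rvs_distrib(1)[OF W that, of 1 "-1", symmetric] that W by (simp add: rvs_simps)
   have c: "(-1) \<odot>[W] x : carrier W" "(-1) \<odot>[W] y : carrier W" using xy W by auto
   have "(x \<oplus>[W] y) \<oplus>[W] (-1) \<odot>[W] x \<oplus>[W] (-1) \<odot>[W] y = (x \<oplus>[W] (-1) \<odot>[W] x) \<oplus>[W] (y \<oplus>[W] (-1) \<odot>[W] y)"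
    using xy c by (simp add: a_ac)
   then show ?thesis using n xy W by (simp add: rvs_simps)
  qed
  from that show ?thesis
  proof (cases rule: multilinear_relations_cases)
   case 1: (add w k a b)
   have c: "c = (pt (w(k := a \<oplus>[X k] b)) \<oplus>[?F] (-1) \<odot>[?F] pt (w(k := a))) \<oplus>[?F] (-1) \<odot>[?F] pt (w(k := b))"
    using 1(5) by simp
   have ab: "a \<oplus>[X k] b : carrier (X k)" using 1 X by auto
   note pp = p[OF 1(1,2,3)] p[OF 1(1,2,4)] p[OF 1(1,2) ab]
   have "f c = mu (w(k := a \<oplus>[X k] b)) \<oplus>[W] (-1) \<odot>[W] mu (w(k := a)) \<oplus>[W] (-1) \<odot>[W] mu (w(k := b))"
    unfolding c using pp rvs_free_vs[of "tuples J X"]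
    by (simp add: mhom_add[OF f(1)] mhom_smult[OF f(1)] rvs_closed del: free_vs_simps)
   also have "mu (w(k := a \<oplus>[X k] b)) = mu (w(k := a)) \<oplus>[W] mu (w(k := b))"
    using mu 1 unfolding multilinear_def by blast
   also note cancel[OF mc[OF tuples_upd[OF 1(1,2,3)]] mc[OF tuples_upd[OF 1(1,2,4)]]]
   finally show ?thesis .
  next
   case 2: (smult w k r a)
   have c: "c = pt (w(k := r \<odot>[X k] a)) \<oplus>[?F] (-r) \<odot>[?F] pt (w(k := a))"
    using 2(4) by simp
   have ra: "r \<odot>[X k] a : carrier (X k)" using 2 X by auto
   note pp = p[OF 2(1,2,3)] p[OF 2(1,2) ra]
   have mw: "mu (w(k := a)) : carrier W" using 2 by (intro mc tuples_upd)
   have "f c = mu (w(k := r \<odot>[X k] a)) \<oplus>[W] (-r) \<odot>[W] mu (w(k := a))"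
    unfolding c using pp rvs_free_vs[of "tuples J X"]
    by (simp add: mhom_add[OF f(1)] mhom_smult[OF f(1)] rvs_closed del: free_vs_simps)
   also have "mu (w(k := r \<odot>[X k] a)) = r \<odot>[W] mu (w(k := a))"
    using mu 2 unfolding multilinear_def by blast
   also have "r \<odot>[W] mu (w(k := a)) \<oplus>[W] (-r) \<odot>[W] mu (w(k := a)) = \<zero>[W]"
    using rvs_distrib(1)[OF W mw, of r "-r", symmetric] mw W by (simp add: rvs_simps)
   finally show ?thesis .
  qed
 qed
 have "f n = \<zero>[W]" if "n : ?N" for n
  by (rule span_zero[OF rvs_free_vs W relations_closed f(1) z]) (use that in "simp_all add: null_tensors_def")
 then obtain L where L: "L : lin (quot_vs ?F ?N) W" "ALL x:carrier ?F. L (?N +>\<^bsub>?F\<^esub> x) = f x"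
  using quot_vs_lift[OF rvs_free_vs null_tensors_lsub W f(1)] by blast
 have "L (pure_tensor J X w) = mu w" if "w : tuples J X" for w
  using bspec[OF L(2) pt_closed[OF that]] f(2) that by (simp add: pure_tensor_def)
 then show ?thesis using L(1) unfolding tensor_def by blast
qed

text \<open>Pure tensors generate, so a property that cuts out a subspace has to be checked on them
  only. Uniqueness of linear maps and polynomiality of tensor powers are proved in this way.\<close>

lemma tensor_induct:
 assumes K: "lsub (tensor J X) K" and p: "!!w. w : tuples J X ==> pure_tensor J X w : K"
 shows "carrier (tensor J X) <= K"
proof
 let ?F = "free_vs (tuples J X)" and ?N = "null_tensors J X"
 fix z assume "z : carrier (tensor J X)"
 then obtain c where c: "c : carrier ?F" "z = ?N +>\<^bsub>?F\<^esub> c"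
  unfolding tensor_def quot_vs_props(3)[OF rvs_free_vs null_tensors_lsub] by (elim imageE)
 have cp: "pt s : carrier ?F" "s : tuples J X" if "c s ~= 0" for s
  using that c pt_closed[of s "tuples J X"] by auto
 have "z = ?N +>\<^bsub>?F\<^esub> lcomb ?F {s. c s ~= 0} c pt" using c(2) free_vs_expand[OF c(1)] by simp
 also have "... = lcomb (tensor J X) {s. c s ~= 0} c (pure_tensor J X)"
  unfolding pure_tensor_def by (rule mhom_lcomb[OF rvs_free_vs rvs_tensor pure_tensor_mhom]) (use cp in blast)
 also have "... : K" by (rule lsub_lcomb[OF rvs_tensor K]) (use cp p in auto)
 finally show "z : K" .
qed

lemma lsub_equalizer:
 assumes "rvs V" "rvs W" "f : mhom V W" "g : mhom V W"
 shows "lsub V {x : carrier V. f x = g x}"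
 using assms by (auto simp: lsub_def mhom_add mhom_smult mhom_zero)

lemma tensor_ext:
 assumes "rvs W" "f : mhom (tensor J X) W" "g : mhom (tensor J X) W"
  and "!!w. w : tuples J X ==> f (pure_tensor J X w) = g (pure_tensor J X w)"
  and "z : carrier (tensor J X)"
 shows "f z = g z"
proof -
 have "carrier (tensor J X) <= {x : carrier (tensor J X). f x = g x}"
  by (rule tensor_induct[OF lsub_equalizer[OF rvs_tensor assms(1-3)]]) (simp add: assms(4) pure_tensor_closed)
 then show ?thesis using assms(5) by blast
qed

text \<open>The pure tensors of frame vectors span, because the entries of a tuple can be expanded
  one slot at a time.\<close>

lemma fdvs_tensor:
 assumes J: "finite J" and fd: "!!k. k : J ==> fdvs (X k)"
 shows "fdvs (tensor J X)"
proof -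
 have "EX n a l. frame (X k) n a l" if "k : J" for k using fdvs_frame[OF fd[OF that]] by metis
 then obtain n a l where fr: "!!k. k : J ==> frame (X k) (n k) (a k) (l k)" by metis
 define B where "B = (\<Pi>\<^sub>E k\<in>J. a k ` {..<n k})"
 have "a k ` {..<n k} <= carrier (X k)" if "k : J" for k using fr[OF that] by (auto simp: frame_def)
 then have B: "finite B" "B <= tuples J X"
  unfolding B_def tuples_def by (auto intro!: finite_PiE J PiE_mono)
 let ?V = "tensor J X" and ?S = "pure_tensor J X ` B"
 have S: "?S <= carrier ?V" using B by auto
 interpret vectorspace class_ring ?V by (rule rvs_tensor)
 note span = span_lsub[OF rvs_tensor S]
 \<comment> \<open>\<open>M\<close> contains the slots whose entries are still arbitrary; outside
   \<open>M\<close> the entries are frame vectors.\<close>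
 have "pure_tensor J X w : span ?S" if "M <= J" "w : tuples J X" "!!k. k : J - M ==> w k : a k ` {..<n k}" for M w
  using finite_subset[OF that(1) J] that
 proof (induction M arbitrary: w rule: finite_induct)
  case empty
  then have "w : B" by (auto simp: B_def tuples_def PiE_iff)
  then show ?case using span(2) by blast
 next
  case (insert k M)
  then have k: "k : J" by auto
  have wk: "w k : carrier (X k)" by (rule tuples_mem[OF insert.prems(2) k])
  have fk: "(%x. pure_tensor J X (w(k := x))) : mhom (X k) ?V"
   using multilinear_pure_tensor insert.prems(2) k tuples_upd[OF insert.prems(2) k]
   by (intro mhomI) (auto simp: multilinear_def)
  have ak: "!!i. i < n k ==> a k i : carrier (X k)" and we: "w k = lcomb (X k) {..<n k} (%i. l k i (w k)) (a k)"
   using fr[OF k] wk by (auto simp: frame_def)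
  have "pure_tensor J X w = pure_tensor J X (w(k := lcomb (X k) {..<n k} (%i. l k i (w k)) (a k)))"
   using we by (metis fun_upd_triv)
  also have "... = lcomb ?V {..<n k} (%i. l k i (w k)) (%i. pure_tensor J X (w(k := a k i)))"
   by (rule mhom_lcomb[OF X[OF k] rvs_tensor fk]) (use ak in auto)
  also have "... : span ?S"
  proof (rule lsub_lcomb[OF rvs_tensor span(1)])
   fix i assume "i : {..<n k}"
   then show "pure_tensor J X (w(k := a k i)) : span ?S"
    using insert.prems ak k by (intro insert.IH tuples_upd) auto
  qed
  finally show ?case .
 qed
 from this[OF order.refl] have "pure_tensor J X w : span ?S" if "w : tuples J X" for w
  using that by simp
 then have "carrier ?V <= span ?S" by (intro tensor_induct span(1))
 then have "gen_set ?S" using span(1) by (auto simp: lsub_def)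
 then have "fin_dim" using S B(1) unfolding fin_dim_def by (intro exI[of _ ?S]) auto
 then show ?thesis by (simp add: fdvs_def rvs_tensor)
qed

end

section \<open>Extraction of coefficients\<close>

text \<open>Lagrange interpolation at the nodes 0, ..., \<open>d\<close>: the weight of node
  \<open>k\<close> is the coefficient of degree \<open>m\<close> in the Lagrange polynomial
  \<open>f k\<close>. Values summed against these weights give the coefficient of degree
  \<open>m\<close> of any polynomial of degree at most \<open>d\<close>.\<close>

lemma interpolation_weights_exist:
 "EX c :: nat => rat. ALL n<=d. (\<Sum>k\<le>d. c k * of_nat k ^ n) = (if n = m then 1 else 0)"
proof -
 define f :: "nat => rat poly" where
  "f k = (PROD j:{..d} - {k}. [:- of_nat j / (of_nat k - of_nat j), 1 / (of_nat k - of_nat j):])" for k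
 have deg: "degree (f k) \<le> d" if "k \<le> d" for k
 proof -
  have "degree (f k) \<le> (SUM j:{..d} - {k}. degree [:- of_nat j / (of_nat k - of_nat j), 1 / (of_nat k - of_nat j) :: rat:])"
   unfolding f_def by (rule order.trans[OF degree_prod_sum_le]) (auto simp: o_def)
  also have "... \<le> (SUM j:{..d} - {k}. 1)" by (rule sum_mono) auto
  also have "... = d" using that by simp
  finally show ?thesis .
 qed
 have ev: "poly (f k) (of_nat i) = (if i = k then 1 else 0)" if "i \<le> d" "k \<le> d" for i k
 proof (cases "i = k")
  case True
  have "poly (f k) (of_nat k) = (PROD j:{..d} - {k}. 1)"
   unfolding f_def poly_prod
  proof (rule prod.cong[OF refl])
   fix j assume "j : {..d} - {k}"
   then have "(of_nat k - of_nat j) / (of_nat k - of_nat j) = (1 :: rat)" by simp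
   then show "poly [:- of_nat j / (of_nat k - of_nat j), 1 / (of_nat k - of_nat j):] (of_nat k) = (1 :: rat)"
    unfolding diff_divide_distrib by simp
  qed
  then show ?thesis using True by simp
 next
  case False
  have "poly (f k) (of_nat i) = 0"
   unfolding f_def poly_prod by (rule prod_zero) (use that False in "auto intro!: bexI[of _ i] simp: field_simps")
  then show ?thesis using False by simp
 qed
 have "(\<Sum>k\<le>d. coeff (f k) m * of_nat k ^ n) = (if n = m then 1 else 0)" if n: "n \<le> d" for n
 proof -
  \<comment> \<open>Both sides have degree at most \<open>d\<close> and agree at the
    \<open>d + 1\<close> nodes.\<close>
  have "monom 1 n = (\<Sum>k\<le>d. Polynomial.smult (of_nat k ^ n) (f k))"
  proof (rule poly_eqI_degree[of "of_nat ` {..d}"])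
   fix x :: rat assume "x : of_nat ` {..d}"
   then obtain i where i: "i \<le> d" "x = of_nat i" by auto
   have "(\<Sum>k\<le>d. of_nat k ^ n * poly (f k) x) = (\<Sum>k\<le>d. if i = k then x ^ n else 0)"
    using i by (intro sum.cong) (auto simp: ev)
   then show "poly (monom 1 n) x = poly (\<Sum>k\<le>d. Polynomial.smult (of_nat k ^ n) (f k)) x"
    using i by (simp add: poly_monom poly_sum)
  next
   have "card (of_nat ` {..d} :: rat set) = Suc d" by (simp add: card_image)
   moreover have "degree (\<Sum>k\<le>d. Polynomial.smult (of_nat k ^ n) (f k)) \<le> d"
    by (rule degree_sum_le) (auto intro: order.trans[OF degree_smult_le] deg)
   ultimately show "degree (monom (1::rat) n) < card (of_nat ` {..d} :: rat set)"
    "degree (\<Sum>k\<le>d. Polynomial.smult (of_nat k ^ n) (f k)) < card (of_nat ` {..d} :: rat set)"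
    using n by (simp_all add: degree_monom_eq)
  qed
  then have "coeff (monom 1 n) m = coeff (\<Sum>k\<le>d. Polynomial.smult (of_nat k ^ n) (f k)) m" by simp
  then show ?thesis by (simp add: coeff_sum mult.commute)
 qed
 then show ?thesis by (intro exI[of _ "%k. coeff (f k) m"]) auto
qed

section \<open>Coefficients of polynomials in several variables from values on a grid\<close>

definition weight :: "nat => nat => nat => rat" where
 "weight d m = (SOME c. ALL n<=d. (\<Sum>k\<le>d. c k * of_nat k ^ n) = (if n = m then 1 else 0))"

lemma weight_sum: "n \<le> d ==> (\<Sum>k\<le>d. weight d m k * of_nat k ^ n) = (if n = m then 1 else 0)"
 using someI_ex[OF interpolation_weights_exist[of d m]] unfolding weight_def by blast

definition nodes :: "nat => 's set => ('s => nat) set" where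
 "nodes d S = (\<Pi>\<^sub>E s\<in>S. {..d})"

definition node_weight :: "nat => 's set => ('s => nat) => ('s => nat) => rat" where
 "node_weight d S e t = (PROD s:S. weight d (e s) (t s))"

abbreviation node :: "('s => nat) => 's => rat" where
 "node t \<equiv> (%s. of_nat (t s))"

text \<open>Evaluated at a polynomial \<open>p\<close> of degree at most \<open>d\<close> in each variable, this is the coefficient
  of \<open>p\<close> at the monomial with exponents \<open>e\<close>; being a combination of values of \<open>p\<close>, it can also be
  formed for polynomial maps with values in a vector space.\<close>

definition coefficient :: "nat => 's set => ('s => nat) => (('s => rat) => rat) => rat" where
 "coefficient d S e p = (SUM t:nodes d S. node_weight d S e t * p (node t))"

lemma finite_nodes: "finite S ==> finite (nodes d S)"
 by (auto simp: nodes_def intro: finite_PiE)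

lemma coefficient_sum: "coefficient d S e (%t. SUM i:I. c i * p i t) = (SUM i:I. c i * coefficient d S e (p i))"
 by (simp add: coefficient_def sum_distrib_left sum_distrib_right mult.left_commute sum.swap[of _ I])

text \<open>The sum over the grid factors into sums in one variable, each of which is 0 or 1 by the
  choice of the weights.\<close>

lemma coefficient_monomial:
 assumes "finite S" "!!s. s : S ==> n s \<le> d"
 shows "coefficient d S e (%t. PROD s:S. t s ^ n s) = (if ALL s:S. n s = e s then 1 else 0)"
proof -
 have "coefficient d S e (%t. PROD s:S. t s ^ n s) = (SUM t:nodes d S. PROD s:S. weight d (e s) (t s) * of_nat (t s) ^ n s)"
  by (simp add: coefficient_def node_weight_def prod.distrib)
 also have "... = (PROD s:S. \<Sum>k\<le>d. weight d (e s) k * of_nat k ^ n s)"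
  unfolding nodes_def using assms(1) by (rule prod_sum_PiE[symmetric]) auto
 also have "... = (PROD s:S. if n s = e s then 1 else 0)"
  by (rule prod.cong) (use assms(2) in "auto simp: weight_sum")
 also have "... = (if ALL s:S. n s = e s then 1 else 0)"
  using assms(1) by (auto intro!: prod.neutral prod_zero)
 finally show ?thesis .
qed

abbreviation multicoeff :: "nat => 's set => (('s => rat) => rat) => rat" where
 "multicoeff d S \<equiv> coefficient d S (%_. 1)"

lemma prod_fibers:
 fixes t :: "'s => rat"
 assumes "finite X" "finite S" "b : X \<rightarrow> S"
 shows "(PROD x:X. t (b x)) = (PROD s:S. t s ^ card {x : X. b x = s})"
proof -
 have "(PROD s:S. t s ^ card {x : X. b x = s}) = (PROD s:S. PROD x:{x : X. b x = s}. t (b x))"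
  by (rule prod.cong) auto
 also have "... = (PROD x:X. t (b x))"
  by (rule prod.group) (use assms in auto)
 finally show ?thesis by simp
qed

text \<open>The exponent of \<open>t s\<close> in this monomial is the size of the fibre of
  \<open>b\<close> over \<open>s\<close>, and all fibres are singletons exactly if \<open>b\<close>
  is a bijection. The bound on \<open>card X\<close> keeps the exponents in the range of the
  interpolation.\<close>

lemma multicoeff_monomial:
 assumes "finite X" "finite S" "b : X \<rightarrow> S" "card X \<le> d"
 shows "multicoeff d S (%t. PROD x:X. t (b x)) = (if bij_betw b X S then 1 else 0)"
proof -
 have "card {x : X. b x = s} \<le> d" for s
  using card_mono[of X "{x : X. b x = s}"] assms by auto
 then have "multicoeff d S (%t. PROD x:X. t (b x)) = (if ALL s:S. card {x : X. b x = s} = 1 then 1 else 0)"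
  using assms by (simp add: prod_fibers coefficient_monomial)
 moreover have "(ALL s:S. card {x : X. b x = s} = 1) \<longleftrightarrow> bij_betw b X S"
 proof
  assume *: "ALL s:S. card {x : X. b x = s} = 1"
  have "inj_on b X"
  proof (rule inj_onI)
   fix x y assume xy: "x : X" "y : X" "b x = b y"
   then have "card {z : X. b z = b y} = 1" using * assms by auto
   then obtain z where z: "{z : X. b z = b y} = {z}" by (auto simp: card_1_singleton_iff)
   have "x : {z}" "y : {z}" unfolding z[symmetric] using xy by auto
   then show "x = y" by simp
  qed
  moreover have "s : b ` X" if "s : S" for s
  proof -
   have "card {x : X. b x = s} ~= 0" using * that by simp
   then have "{x : X. b x = s} ~= {}" by (metis card.empty)
   then show ?thesis by auto
  qed
  ultimately show "bij_betw b X S" using assms by (auto simp: bij_betw_def)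
 next
  assume *: "bij_betw b X S"
  have "card {x : X. b x = s} = 1" if "s : S" for s
  proof -
   obtain x where "x : X" "b x = s" using * \<open>s : S\<close> by (auto simp: bij_betw_def)
   then have "{x : X. b x = s} = {x}" using * by (auto simp: bij_betw_def inj_on_def)
   then show ?thesis by simp
  qed
  then show "ALL s:S. card {x : X. b x = s} = 1" by blast
 qed
 ultimately show ?thesis by simp
qed

lemma multicoeff_prod: "finite S ==> 1 \<le> d ==> multicoeff d S (%t. PROD s:S. t s) = 1"
 using coefficient_monomial[of S "%_. 1" d "%_. 1"] by simp

section \<open>Polynomial functions in finitely many variables of bounded total degree\<close>

lemma finite_exponents: "finite (exponents r d)"
proof (rule finite_subset)
 show "exponents r d <= {e. ALL i. (i : {..<r} --> e i : {..d}) & (i ~: {..<r} --> e i = 0)}"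
 proof
  fix e assume e: "e : exponents r d"
  have "e i \<le> d" if "i < r" for i
   using member_le_sum[of i "{..<r}" e] that e by (auto simp: exponents_def)
  then show "e : {e. ALL i. (i : {..<r} --> e i : {..d}) & (i ~: {..<r} --> e i = 0)}"
   using e by (auto simp: exponents_def)
 qed
qed (rule finite_set_of_finite_funs; simp)

lemma exponents_le: "e : exponents r d ==> i < r ==> e i \<le> d"
 using member_le_sum[of i "{..<r}" e] by (auto simp: exponents_def)

lemma exponents_eq_iff:
 assumes "e : exponents r d" "e' : exponents r d'"
 shows "(ALL i:{..<r}. e i = e' i) \<longleftrightarrow> e = e'"
proof
 assume *: "ALL i:{..<r}. e i = e' i"
 have "e i = e' i" for i
  using * assms by (cases "i < r") (auto simp: exponents_def)
 then show "e = e'" by blast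
qed simp

definition polyfun :: "nat => nat => ((nat => rat) => rat) => bool" where
 "polyfun r d p \<longleftrightarrow> (EX a. ALL x. p x = (SUM e:exponents r d. a e * (\<Prod>i<r. x i ^ e i)))"

lemma polyfun_sum:
 assumes "!!i. i : I ==> polyfun r d (p i)"
 shows "polyfun r d (%x. SUM i:I. c i * p i x)"
proof -
 define a where "a i = (SOME a. ALL x. p i x = (SUM e:exponents r d. a e * (\<Prod>j<r. x j ^ e j)))" for i
 have a: "p i x = (SUM e:exponents r d. a i e * (\<Prod>j<r. x j ^ e j))" if "i : I" for i x
  using someI_ex[OF assms[OF that, unfolded polyfun_def]] unfolding a_def by (rule spec)
 have "(SUM i:I. c i * p i x) = (SUM e:exponents r d. (SUM i:I. c i * a i e) * (\<Prod>j<r. x j ^ e j))" for x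
 proof -
  have "(SUM i:I. c i * p i x) = (SUM i:I. SUM e:exponents r d. c i * a i e * (\<Prod>j<r. x j ^ e j))"
   by (rule sum.cong) (simp_all add: a sum_distrib_left mult.assoc)
  also have "... = (SUM e:exponents r d. SUM i:I. c i * a i e * (\<Prod>j<r. x j ^ e j))" by (rule sum.swap)
  finally show ?thesis by (simp add: sum_distrib_right)
 qed
 then show ?thesis unfolding polyfun_def by (intro exI allI)
qed

lemma polyfun_monomial:
 assumes "finite Y" "b : Y \<rightarrow> {..<r}" "card Y \<le> d"
 shows "polyfun r d (%x. PROD y:Y. x (b y))"
proof -
 define e where "e s = card {y : Y. b y = s}" for s
 have "(\<Sum>s<r. e s) = card Y"
 proof -
  have "card Y = (SUM y:Y. 1)" by simp
  also have "... = (\<Sum>s<r. SUM y:{y : Y. b y = s}. 1)" by (rule sum.group[symmetric]) (use assms in auto)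
  finally show ?thesis by (simp add: e_def)
 qed
 moreover have "e i = 0" if "i \<ge> r" for i
 proof -
  have "b y < r" if "y : Y" for y using assms(2) that by auto
  then have "{y : Y. b y = i} = {}" using that by (metis (mono_tags, lifting) Collect_empty_eq not_le)
  then show ?thesis by (simp only: e_def card.empty)
 qed
 ultimately have e: "e : exponents r d" using assms(3) by (auto simp: exponents_def)
 have "(PROD y:Y. x (b y)) = (SUM f:exponents r d. (if f = e then 1 else 0) * (\<Prod>i<r. x i ^ f i))" for x :: "nat => rat"
 proof -
  have "(SUM f:exponents r d. (if f = e then 1 else 0) * (\<Prod>i<r. x i ^ f i)) = (SUM f:exponents r d. if f = e then (\<Prod>i<r. x i ^ e i) else 0)"
   by (rule sum.cong) auto
  also have "... = (\<Prod>i<r. x i ^ e i)" using e finite_exponents by (simp add: sum.delta)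
  finally show ?thesis using assms prod_fibers[of Y "{..<r}" b x] by (simp add: e_def)
 qed
 then show ?thesis unfolding polyfun_def by (intro exI allI)
qed

lemma polyfun_mono:
 assumes "polyfun r d p" "d \<le> d'"
 shows "polyfun r d' p"
proof -
 obtain a where a: "!!x. p x = (SUM e:exponents r d. a e * (\<Prod>i<r. x i ^ e i))" using assms by (auto simp: polyfun_def)
 have "exponents r d <= exponents r d'" using assms by (auto simp: exponents_def)
 then have "p x = (SUM e:exponents r d'. (if e : exponents r d then a e else 0) * (\<Prod>i<r. x i ^ e i))" for x
  unfolding a by (intro sum.mono_neutral_cong_left finite_exponents) auto
 then show ?thesis unfolding polyfun_def by (intro exI allI)
qed

text \<open>Coefficients are fixed combinations of values at grid points. This passes to
  vector-valued functions, whose coefficients are defined by the same combinations.\<close>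

lemma polyfun_coefficient:
 assumes "polyfun r d p"
 shows "p x = (SUM e:exponents r d. coefficient d {..<r} e p * (\<Prod>i<r. x i ^ e i))"
proof -
 obtain a where a: "!!x. p x = (SUM e:exponents r d. a e * (\<Prod>i<r. x i ^ e i))" using assms by (auto simp: polyfun_def)
 have "coefficient d {..<r} e p = a e" if e: "e : exponents r d" for e
 proof -
  have "coefficient d {..<r} e p = (SUM f:exponents r d. a f * coefficient d {..<r} e (%x. \<Prod>i<r. x i ^ f i))"
   unfolding coefficient_sum[symmetric] a ..
  also have "... = (SUM f:exponents r d. if f = e then a f else 0)"
  proof (rule sum.cong[OF refl])
   fix f assume f: "f : exponents r d"
   have "coefficient d {..<r} e (%x. \<Prod>i<r. x i ^ f i) = (if ALL s:{..<r}. f s = e s then 1 else 0)"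
    by (rule coefficient_monomial) (use exponents_le[OF f] in auto)
   then show "a f * coefficient d {..<r} e (%x. \<Prod>i<r. x i ^ f i) = (if f = e then a f else 0)"
    unfolding exponents_eq_iff[OF f e] by simp
  qed
  finally show ?thesis using e finite_exponents by (simp add: sum.delta)
 qed
 then show ?thesis unfolding a[of x] by (intro sum.cong) simp_all
qed

text \<open>The coefficient vectors are interpolated from values of \<open>phi\<close>. A functional
  commutes with interpolation, so the difference of the two sides is killed by the separating family
  \<open>L\<close>; one degree \<open>d\<close> serves all functionals in \<open>L\<close>.\<close>

lemma polyfun_vector:
 assumes B: "rvs B" and L: "L <= dual B" and sep: "!!x. x : carrier B ==> (!!l. l : L ==> l x = 0) ==> x = \<zero>[B]"
  and phi: "!!x. phi x : carrier B" and pf: "!!l. l : L ==> polyfun r d (%x. l (phi x))"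
 shows "EX c:exponents r d \<rightarrow> carrier B. ALL x. phi x = lcomb B (exponents r d) (%e. \<Prod>i<r. x i ^ e i) c"
proof -
 define c where "c e = lcomb B (nodes d {..<r}) (node_weight d {..<r} e) (%t. phi (node t))" for e
 have c: "c e : carrier B" for e unfolding c_def using phi B by (intro lcomb_closed)
 have "phi x = lcomb B (exponents r d) (%e. \<Prod>i<r. x i ^ e i) c" for x
 proof (rule eq_if_diff_zero[OF B phi])
  let ?y = "lcomb B (exponents r d) (%e. \<Prod>i<r. x i ^ e i) c"
  show y: "?y : carrier B" using c B by (intro lcomb_closed)
  show "phi x \<oplus>[B] (-1) \<odot>[B] ?y = \<zero>[B]"
  proof (rule sep)
   show "phi x \<oplus>[B] (-1) \<odot>[B] ?y : carrier B" using phi y B by auto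
   fix l assume l: "l : L"
   then have ld: "l : dual B" using L by auto
   have lc: "l (c e) = coefficient d {..<r} e (%x. l (phi x))" for e
    unfolding c_def coefficient_def using phi by (intro dual_lcomb[OF B ld])
   have "l (phi x) = (SUM e:exponents r d. l (c e) * (\<Prod>i<r. x i ^ e i))"
    unfolding lc by (rule polyfun_coefficient[OF pf[OF l]])
   also have "... = l ?y" using c by (subst dual_lcomb[OF B ld]) (auto simp: mult.commute)
   finally show "l (phi x \<oplus>[B] (-1) \<odot>[B] ?y) = 0" using ld phi y B by simp
  qed
 qed
 then show ?thesis using c by blast
qed

text \<open>Polarization: substituting for the variable \<open>a\<close> a sum of \<open>e a\<close>
  new variables and taking the multilinear coefficient isolates the monomial with exponents
  \<open>e\<close>. The constant \<open>N\<close> counts bijective choices of summands, a product of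
  factorials; it is positive, hence invertible in the rationals.\<close>

lemma multicoeff_power_sums:
 assumes S: "finite S" "al : S \<rightarrow> {..<r}" and e: "e : exponents r d" "!!a. a < r ==> card {s : S. al s = a} = e a"
  and dd: "d \<le> d'"
 shows "EX N>0. ALL e':exponents r d. multicoeff d' S (%t. \<Prod>a<r. (\<Sum>s | s : S & al s = a. t s) ^ e' a) = (if e' = e then N else 0)"
proof -
 \<comment> \<open>\<open>Y f\<close> has one point for every factor in the product of powers, and
   \<open>Q f\<close> consists of the choices of one summand from each factor.\<close>
 define Y where "Y f = (SIGMA a:{..<r}. {..<f a :: nat})" for f
 define Q where "Q f = (\<Pi>\<^sub>E y\<in>Y f. {s : S. al s = fst y})" for f
 have finY: "finite (Y f)" for f by (auto simp: Y_def)
 have finQ: "finite (Q f)" for f using finY S by (auto simp: Q_def intro!: finite_PiE)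
 have cardY: "card (Y f) = (\<Sum>a<r. f a)" for f by (simp add: Y_def)
 have Qm: "b (a, k) : S" "al (b (a, k)) = a" if "b : Q f" "(a, k) : Y f" for b f a k
  using that unfolding Q_def by (auto dest!: PiE_mem)
 have *: "multicoeff d' S (%t. \<Prod>a<r. (\<Sum>s | s : S & al s = a. t s) ^ f a) = of_nat (card {b : Q f. bij_betw b (Y f) S})"
  if f: "f : exponents r d" for f
 proof -
  have "(\<Prod>a<r. (\<Sum>s | s : S & al s = a. t s) ^ f a) = (SUM b:Q f. 1 * (PROD y:Y f. t (b y)))" for t :: "_ => rat"
  proof -
   have "(\<Prod>a<r. (\<Sum>s | s : S & al s = a. t s) ^ f a) = (\<Prod>a<r. \<Prod>k<f a. \<Sum>s | s : S & al s = a. t s)" by simp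
   also have "... = (PROD (a,k):Y f. \<Sum>s | s : S & al s = a. t s)"
    unfolding Y_def by (rule prod.Sigma) auto
   also have "... = (PROD y:Y f. SUM s:{s : S. al s = fst y}. t s)" by (rule prod.cong) auto
   also have "... = (SUM b:(\<Pi>\<^sub>E y\<in>Y f. {s : S. al s = fst y}). PROD y:Y f. t (b y))"
    by (rule prod_sum_PiE[OF finY]) (use S in auto)
   finally show ?thesis by (simp add: Q_def)
  qed
  then have "multicoeff d' S (%t. \<Prod>a<r. (\<Sum>s | s : S & al s = a. t s) ^ f a)
   = (SUM b:Q f. 1 * multicoeff d' S (%t. PROD y:Y f. t (b y)))"
   by (simp only: coefficient_sum)
  also have "... = (SUM b:Q f. if bij_betw b (Y f) S then 1 else 0)"
  proof (rule sum.cong[OF refl])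
   fix b assume b: "b : Q f"
   have "b : Y f \<rightarrow> S" using Qm[OF b] by auto
   moreover have "card (Y f) \<le> d'" using f dd cardY by (simp add: exponents_def)
   ultimately show "1 * multicoeff d' S (%t. PROD y:Y f. t (b y)) = (if bij_betw b (Y f) S then 1 else 0)"
    using multicoeff_monomial[OF finY S(1)] by simp
  qed
  also have "... = of_nat (card {b : Q f. bij_betw b (Y f) S})"
   by (simp add: sum.inter_filter[OF finQ, symmetric])
  finally show ?thesis .
 qed
 \<comment> \<open>A bijective choice maps the \<open>f a\<close> factors with index
   \<open>a\<close> onto the fibre over \<open>a\<close>, which has \<open>e a\<close>
   elements.\<close>
 have fib: "f = e" if f: "f : exponents r d" and b: "b : Q f" "bij_betw b (Y f) S" for f b
 proof -
  have "f a = e a" if a: "a < r" for a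
  proof -
   have "bij_betw (%k. b (a, k)) {..<f a} {s : S. al s = a}"
   proof (rule bij_betwI')
    fix k k' assume "k : {..<f a}" "k' : {..<f a}"
    then have "(a, k) : Y f" "(a, k') : Y f" using a by (auto simp: Y_def)
    then show "(b (a, k) = b (a, k')) = (k = k')" using b(2) by (auto simp: bij_betw_def inj_on_def)
   next
    fix k assume "k : {..<f a}"
    then show "b (a, k) : {s : S. al s = a}" using Qm[OF b(1)] a by (auto simp: Y_def)
   next
    fix s assume s: "s : {s : S. al s = a}"
    then obtain a' k where ak: "(a', k) : Y f" "s = b (a', k)" using b(2) by (auto simp: bij_betw_def)
    then have "a' = a" using Qm(2)[OF b(1) ak(1)] s by auto
    then show "EX k:{..<f a}. s = b (a, k)" using ak by (auto simp: Y_def)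
   qed
   from bij_betw_same_card[OF this] show ?thesis using e(2)[OF a] by simp
  qed
  then show ?thesis using exponents_eq_iff[OF f e(1)] by auto
 qed
 have "EX h. bij_betw h {..<e a} {s : S. al s = a}" if "a < r" for a
  using ex_bij_betw_nat_finite[of "{s : S. al s = a}"] S(1) e(2)[OF that] by (auto simp: atLeast0LessThan)
 then obtain h where h: "!!a. a < r ==> bij_betw (h a) {..<e a} {s : S. al s = a}" by metis
 \<comment> \<open>Enumerations of the fibres combine into one bijective choice, so the count for
   \<open>e\<close> is not zero.\<close>
 define b0 where "b0 = (\<lambda>(a, k)\<in>Y e. h a k)"
 have b0: "b0 (a, k) = h a k" "h a k : S" "al (h a k) = a" if "a < r" "k < e a" for a k
  using that bij_betwE[OF h[OF that(1)]] by (auto simp: b0_def Y_def)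
 have "b0 : Q e" using b0 by (auto simp: Q_def Y_def b0_def)
 moreover have "bij_betw b0 (Y e) S"
 proof (rule bij_betwI')
  fix x y assume "x : Y e" "y : Y e"
  then obtain a k a' k' where xy: "x = (a, k)" "y = (a', k')" "a < r" "k < e a" "a' < r" "k' < e a'" by (auto simp: Y_def)
  show "(b0 x = b0 y) = (x = y)"
  proof
   assume "b0 x = b0 y"
   then have *: "h a k = h a' k'" using xy b0 by simp
   then have "a = a'" using b0(3)[OF xy(3,4)] b0(3)[OF xy(5,6)] by simp
   then show "x = y" using * xy h[OF xy(3)] by (auto simp: bij_betw_def inj_on_def)
  qed simp
 next
  fix x assume "x : Y e"
  then show "b0 x : S" using b0 by (auto simp: Y_def)
 next
  fix s assume s: "s : S"
  then have a: "al s < r" using S(2) by auto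
  then obtain k where "k < e (al s)" "h (al s) k = s" 
  proof -
   have "s : h (al s) ` {..<e (al s)}" using h[OF a] s by (simp add: bij_betw_def)
   then show ?thesis using that by auto
  qed
  then show "EX x:Y e. s = b0 x" using a b0(1) by (intro bexI[of _ "(al s, k)"]) (auto simp: Y_def)
 qed
 ultimately have "{b : Q e. bij_betw b (Y e) S} ~= {}" by auto
 then have N: "0 < card {b : Q e. bij_betw b (Y e) S}" using finQ by (simp add: card_gt_0_iff)
 show ?thesis
 proof (intro exI conjI ballI)
  show "(0::rat) < of_nat (card {b : Q e. bij_betw b (Y e) S})" using N by simp
  fix f assume f: "f : exponents r d"
  have z: "card {b : Q f. bij_betw b (Y f) S} = 0" if "f ~= e"
  proof -
   have "{b : Q f. bij_betw b (Y f) S} = {}" using fib[OF f] that by auto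
   then show ?thesis by (simp only: card.empty)
  qed
  show "multicoeff d' S (%t. \<Prod>a<r. (\<Sum>s | s : S & al s = a. t s) ^ f a)
   = (if f = e then of_nat (card {b : Q e. bij_betw b (Y e) S}) else 0)"
   unfolding *[OF f] using z by (cases "f = e") simp_all
 qed
qed

section \<open>Tensor powers of graded representations\<close>

lemma multilinearD:
 assumes "multilinear J X W mu" "w : tuples J X"
 shows "mu w : carrier W"
  and "k : J ==> a : carrier (X k) ==> b : carrier (X k) ==> mu (w(k := a \<oplus>[X k] b)) = mu (w(k := a)) \<oplus>[W] mu (w(k := b))"
  and "k : J ==> a : carrier (X k) ==> mu (w(k := r \<odot>[X k] a)) = r \<odot>[W] mu (w(k := a))"
 using assms unfolding multilinear_def by simp_all

lemma multilinear_mhom: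
 assumes "multilinear J X W mu" "w : tuples J X" "k : J"
 shows "(%a. mu (w(k := a))) : mhom (X k) W"
 using multilinearD[OF assms(1)] tuples_upd[OF assms(2,3)] assms(2,3) by (intro mhomI) simp_all

text \<open>One statement covers both uses: the group action, which permutes slots and acts on
  entries, and the functoriality of tensor powers, where \<open>p\<close> is the identity.\<close>

lemma multilinear_permuted:
 fixes X Y :: "'k => 'a qvs"
 assumes X: "!!k. k : J ==> rvs (X k)" and Y: "!!k. k : J ==> rvs (Y k)"
  and p: "bij_betw p J J" and f: "!!k. k : J ==> f k : mhom (X (p k)) (Y k)"
  and h: "!!w k. w : tuples J X ==> k : J ==> h w k = f k (w (p k))"
  and he: "!!w k. w : tuples J X ==> k ~: J ==> h w k = undefined"
 shows "multilinear J X (tensor J Y) (%w. pure_tensor J Y (h w))"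
  and "w : tuples J X ==> h w : tuples J Y"
proof -
 have pJ: "p k : J" if "k : J" for k using p that by (auto simp: bij_betw_def)
 show hw: "h w : tuples J Y" if "w : tuples J X" for w
  unfolding tuples_def using that f pJ
 proof (intro PiE_I)
  fix k assume "k : J"
  then show "h w k : carrier (Y k)"
   using h[OF that] mhom_closed[OF f tuples_mem[OF that pJ]] by simp
 qed (rule he[OF that])
 \<comment> \<open>Changing the entry of \<open>w\<close> at \<open>k\<close> changes
   \<open>h w\<close> only at the slot \<open>k'\<close> with \<open>p k' = k\<close>.\<close>
 have upd: "EX k':J. p k' = k & (ALL a:carrier (X k). h (w(k := a)) = (h w)(k' := f k' a))" if w: "w : tuples J X" and k: "k : J" for w k
 proof -
  have "k : p ` J" using p k by (simp add: bij_betw_def)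
  then obtain k' where k': "k' : J" "p k' = k" by blast
  have "h (w(k := a)) = (h w)(k' := f k' a)" if a: "a : carrier (X k)" for a
  proof
   fix m
   note wa = tuples_upd[OF w k a]
   show "h (w(k := a)) m = ((h w)(k' := f k' a)) m"
   proof (cases "m : J")
    case True
    then have "p m = k \<longleftrightarrow> m = k'" using p k' by (auto simp: bij_betw_def inj_on_def)
    then show ?thesis using True h[OF wa True] h[OF w True] by auto
   next
    case False
    then show ?thesis using he[OF wa] he[OF w] k' by auto
   qed
  qed
  then show ?thesis using k' by blast
 qed
 show "multilinear J X (tensor J Y) (%w. pure_tensor J Y (h w))"
  unfolding multilinear_def
 proof (intro conjI ballI allI)
  fix w assume w: "w : tuples J X"
  show "pure_tensor J Y (h w) : carrier (tensor J Y)" using hw[OF w] Y by (intro pure_tensor_closed)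
  fix k a r assume k: "k : J" and a: "a : carrier (X k)"
  obtain k' where k': "k' : J" "p k' = k" "!!a. a : carrier (X k) ==> h (w(k := a)) = (h w)(k' := f k' a)"
   using upd[OF w k] by blast
  have fk: "f k' : mhom (X k) (Y k')" using f[OF k'(1)] k'(2) by simp
  have hk: "(%a. pure_tensor J Y ((h w)(k' := a))) : mhom (Y k') (tensor J Y)"
   by (rule multilinear_mhom[OF multilinear_pure_tensor[of J Y, OF Y] hw[OF w] k'(1)])
  have sa: "r \<odot>[X k] a : carrier (X k)" using X[OF k] a by simp
  show "pure_tensor J Y (h (w(k := r \<odot>[X k] a))) = r \<odot>[tensor J Y] pure_tensor J Y (h (w(k := a)))"
   unfolding k'(3)[OF sa] k'(3)[OF a] mhom_smult[OF fk a] by (rule mhom_smult[OF hk mhom_closed[OF fk a]])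
  fix b assume b: "b : carrier (X k)"
  have ab: "a \<oplus>[X k] b : carrier (X k)" using X[OF k] a b by simp
  show "pure_tensor J Y (h (w(k := a \<oplus>[X k] b))) = pure_tensor J Y (h (w(k := a))) \<oplus>[tensor J Y] pure_tensor J Y (h (w(k := b)))"
   unfolding k'(3)[OF ab] k'(3)[OF a] k'(3)[OF b] mhom_add[OF fk a b]
   by (rule mhom_add[OF hk mhom_closed[OF fk a] mhom_closed[OF fk b]])
 qed
qed

text \<open>Existence comes from the universal property, uniqueness from generation by pure tensors;
  so the definite description in \<open>tensor_map\<close> denotes.\<close>

lemma tensor_map_props:
 assumes X: "!!k. k : J ==> rvs (X k)" and Y: "!!k. k : J ==> rvs (Y k)"
  and mu: "multilinear J X (tensor J Y) (%w. pure_tensor J Y (h w))"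
 shows "tensor_map J X Y h : lin (tensor J X) (tensor J Y)"
  and "w : tuples J X ==> tensor_map J X Y h (pure_tensor J X w) = pure_tensor J Y (h w)"
proof -
 note TY = rvs_tensor[of J Y, OF Y]
 let ?P = "%L. L : lin (tensor J X) (tensor J Y) & (ALL w:tuples J X. L (pure_tensor J X w) = pure_tensor J Y (h w))"
 have "EX L. ?P L" using tensor_lift[of J X, OF X TY mu] by blast
 moreover have "L = L'" if "?P L" "?P L'" for L L'
 proof (rule lin_eqI)
  show "L : lin (tensor J X) (tensor J Y)" "L' : lin (tensor J X) (tensor J Y)" using that by auto
  fix z assume z: "z : carrier (tensor J X)"
  show "L z = L' z"
   by (rule tensor_ext[of J X, OF X TY lin_mhom lin_mhom _ z]) (use that in auto)
 qed
 ultimately have "EX! L. ?P L" by blast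
 from theI'[OF this] show "tensor_map J X Y h : lin (tensor J X) (tensor J Y)"
  "w : tuples J X ==> tensor_map J X Y h (pure_tensor J X w) = pure_tensor J Y (h w)"
  unfolding tensor_map_def by blast+
qed

text \<open>A functional is applied so that the multilinear expansion is a sum of rationals, to
  which the extraction of coefficients applies directly.\<close>

lemma tensor_functional_expand:
 assumes X: "!!k. k : J ==> rvs (X k)" and J: "finite J" and l: "l : dual (tensor J X)"
  and A: "!!k. k : J ==> finite (A k)" and x: "!!k a. k : J ==> a : A k ==> x k a : carrier (X k)"
 shows "l (pure_tensor J X (\<lambda>k\<in>J. lcomb (X k) (A k) (c k) (x k)))
  = (SUM b:Pi\<^sub>E J A. (PROD k:J. c k (b k)) * l (pure_tensor J X (\<lambda>k\<in>J. x k (b k))))"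
proof -
 let ?T = "tensor J X"
 \<comment> \<open>\<open>M\<close> contains the slots already expanded; the others carry the
   entries of an arbitrary tuple \<open>w\<close>.\<close>
 have main: "l (pure_tensor J X (\<lambda>k\<in>J. if k : M then lcomb (X k) (A k) (c k) (x k) else w k))
  = (SUM b:Pi\<^sub>E M A. (PROD k:M. c k (b k)) * l (pure_tensor J X (\<lambda>k\<in>J. if k : M then x k (b k) else w k)))"
  if "M <= J" "w : tuples J X" for M w
  using finite_subset[OF that(1) J] that
 proof (induction M arbitrary: w rule: finite_induct)
  case empty
  then show ?case by simp
 next
  case (insert k M)
  then have k: "k : J" "M <= J" by auto
  let ?v = "lcomb (X k) (A k) (c k) (x k)"
  have v: "?v : carrier (X k)" using x k X by (intro lcomb_closed) auto
  let ?u = "%g. (\<lambda>m\<in>J. if m : M then x m (g m) else w m)"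
  have u: "?u g : tuples J X" if "g : Pi\<^sub>E M A" for g
   using that x insert.prems(2) k by (auto simp: tuples_def PiE_iff)
  have step: "l (pure_tensor J X ((?u g)(k := ?v))) = (SUM a:A k. c k a * l (pure_tensor J X ((?u g)(k := x k a))))"
   if "g : Pi\<^sub>E M A" for g
  proof -
   have fk: "(%y. pure_tensor J X ((?u g)(k := y))) : mhom (X k) ?T"
    by (rule multilinear_mhom[OF multilinear_pure_tensor[of J X, OF X] u[OF that] k(1)])
   have "l (pure_tensor J X ((?u g)(k := ?v))) = l (lcomb ?T (A k) (c k) (%a. pure_tensor J X ((?u g)(k := x k a))))"
    by (rule arg_cong[of _ _ l], rule mhom_lcomb[OF X[OF k(1)] rvs_tensor[of J X, OF X] fk]) (use x k in auto)
   also have "... = (SUM a:A k. c k a * l (pure_tensor J X ((?u g)(k := x k a))))"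
    by (rule dual_lcomb[OF rvs_tensor[of J X, OF X] l]) (use x k in "auto intro!: mhom_closed[OF fk]")
   finally show ?thesis .
  qed
  have "(\<lambda>m\<in>J. if m : insert k M then lcomb (X m) (A m) (c m) (x m) else w m)
   = (\<lambda>m\<in>J. if m : M then lcomb (X m) (A m) (c m) (x m) else (w(k := ?v)) m)"
   using insert.hyps by (auto simp: fun_eq_iff)
  note eq = this
  have "l (pure_tensor J X (\<lambda>m\<in>J. if m : insert k M then lcomb (X m) (A m) (c m) (x m) else w m))
   = (SUM g:Pi\<^sub>E M A. (PROD m:M. c m (g m)) * l (pure_tensor J X (\<lambda>m\<in>J. if m : M then x m (g m) else (w(k := ?v)) m)))"
   unfolding eq by (rule insert.IH[OF k(2) tuples_upd[OF insert.prems(2) k(1) v]])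
  also have "... = (SUM g:Pi\<^sub>E M A. SUM a:A k. (PROD m:M. c m (g m)) * (c k a * l (pure_tensor J X ((?u g)(k := x k a)))))"
  proof (rule sum.cong[OF refl])
   fix g assume g: "g : Pi\<^sub>E M A"
   have "(\<lambda>m\<in>J. if m : M then x m (g m) else (w(k := ?v)) m) = (?u g)(k := ?v)"
    using insert.hyps k by (auto simp: fun_eq_iff)
   then show "(PROD m:M. c m (g m)) * l (pure_tensor J X (\<lambda>m\<in>J. if m : M then x m (g m) else (w(k := ?v)) m))
    = (SUM a:A k. (PROD m:M. c m (g m)) * (c k a * l (pure_tensor J X ((?u g)(k := x k a)))))"
    using step[OF g] by (simp add: sum_distrib_left)
  qed
  also have "... = (SUM (a, g):A k \<times> Pi\<^sub>E M A. (PROD m:M. c m (g m)) * (c k a * l (pure_tensor J X ((?u g)(k := x k a)))))"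
   by (subst sum.swap, rule sum.cartesian_product)
  \<comment> \<open>A choice on \<open>insert k M\<close> is a choice at \<open>k\<close> together
    with a choice on \<open>M\<close>.\<close>
  also have "... = (SUM b:Pi\<^sub>E (insert k M) A. (PROD m:insert k M. c m (b m)) * l (pure_tensor J X (\<lambda>m\<in>J. if m : insert k M then x m (b m) else w m)))"
   unfolding PiE_insert_eq
  proof (subst sum.reindex[OF inj_combinator[OF insert.hyps(2)]], rule sum.cong[OF refl])
   fix y assume "y : A k \<times> Pi\<^sub>E M A"
   then obtain a g where y: "y = (a, g)" and ag: "a : A k" "g : Pi\<^sub>E M A" by auto
   let ?b = "g(k := a)"
   have "(\<lambda>m\<in>J. if m : insert k M then x m (?b m) else w m) = (?u g)(k := x k a)"
    using insert.hyps k by (auto simp: fun_eq_iff)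
   moreover have "(PROD m:M. c m (?b m)) = (PROD m:M. c m (g m))"
    using insert.hyps by (intro prod.cong) auto
   then have "(PROD m:insert k M. c m (?b m)) = c k a * (PROD m:M. c m (g m))"
    using insert.hyps by simp
   ultimately have "(PROD m:M. c m (g m)) * (c k a * l (pure_tensor J X ((?u g)(k := x k a))))
    = (PROD m:insert k M. c m (?b m)) * l (pure_tensor J X (\<lambda>m\<in>J. if m : insert k M then x m (?b m) else w m))"
    by (simp only: mult_ac)
   then show "(%(a, g). (PROD m:M. c m (g m)) * (c k a * l (pure_tensor J X ((?u g)(k := x k a))))) y
    = ((%b. (PROD m:insert k M. c m (b m)) * l (pure_tensor J X (\<lambda>m\<in>J. if m : insert k M then x m (b m) else w m)))
    \<circ> (%(y, g). g(k := y))) y"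
    unfolding y o_def prod.case .
  qed
  finally show ?case .
 qed
 have w: "(\<lambda>k\<in>J. lcomb (X k) (A k) (c k) (x k)) : tuples J X"
  unfolding tuples_def using X x by (auto intro!: lcomb_closed)
 have "(\<lambda>k\<in>J. if k : J then f k else g k) = (\<lambda>k\<in>J. f k)" for f g :: "_ => 'b" by auto
 with main[OF order.refl w] show ?thesis by simp
qed

subsection \<open>The groups \<open>S\<^sub>nu\<close>\<close>

lemma sym_group_simps [simp]:
 "p : carrier (sym_group n) \<longleftrightarrow> p permutes {1..n}" "p \<otimes>[sym_group n] q = p \<circ> q" "\<one>[sym_group n] = id"
 by (simp_all add: sym_group_def)

lemma finite_sym_group: "finite (carrier (sym_group n))"
 by (simp add: sym_group_def finite_permutations)

lemma wreath_simps [simp]: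
 "carrier (wreath i m) = {p. p permutes {1..m}} \<times> ({1..m} \<rightarrow>\<^sub>E {p. p permutes {1..i}})"
 "(p, s) \<otimes>[wreath i m] (q, t) = (p \<circ> q, \<lambda>j\<in>{1..m}. s (q j) \<circ> t j)" "\<one>[wreath i m] = (id, \<lambda>j\<in>{1..m}. id)"
 by (simp_all add: wreath_def sym_group_def)

lemma group_wreath: "group (wreath i m)"
proof (rule groupI)
 fix x y assume "x : carrier (wreath i m)" "y : carrier (wreath i m)"
 then show "x \<otimes>[wreath i m] y : carrier (wreath i m)"
  by (cases x; cases y) (auto simp: permutes_compose permutes_in_image PiE_iff simp del: atLeastAtMost_iff)
next
 show "\<one>[wreath i m] : carrier (wreath i m)" by (auto simp: permutes_id)
next
 fix x y z assume "x : carrier (wreath i m)" "y : carrier (wreath i m)" "z : carrier (wreath i m)"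
 then show "x \<otimes>[wreath i m] y \<otimes>[wreath i m] z = x \<otimes>[wreath i m] (y \<otimes>[wreath i m] z)"
  by (cases x; cases y; cases z) (auto simp: permutes_in_image comp_assoc fun_eq_iff simp del: atLeastAtMost_iff)
next
 fix x assume "x : carrier (wreath i m)"
 then obtain p s where x: "x = (p, s)" "p permutes {1..m}" "s : {1..m} \<rightarrow>\<^sub>E {p. p permutes {1..i}}" by auto
 have se: "s j = undefined" if "j ~: {1..m}" for j using x(3) that by (rule PiE_arb)
 show "\<one>[wreath i m] \<otimes>[wreath i m] x = x"
  using x(2) se by (auto simp: x(1) permutes_in_image fun_eq_iff simp del: atLeastAtMost_iff)
 let ?q = "inv_into UNIV p"
 \<comment> \<open>Inverse of the map \<open>(a, j) \<mapsto> (s j a, p j)\<close>: what lies over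
   \<open>j\<close> comes from over \<open>?q j\<close>, so it is moved back by the inverse of
   \<open>s (?q j)\<close>.\<close>
 let ?y = "(?q, \<lambda>j\<in>{1..m}. inv_into UNIV (s (?q j)))"
 have q: "?q permutes {1..m}" using x(2) by (rule permutes_inv)
 have "?y : carrier (wreath i m)"
 proof -
  have "inv_into UNIV (s (?q j)) permutes {1..i}" if "j : {1..m}" for j
  proof (rule permutes_inv)
   have "?q j : {1..m}" using iffD2[OF permutes_in_image[OF q] that] .
   from PiE_mem[OF x(3) this] show "s (?q j) permutes {1..i}" by simp
  qed
  then show ?thesis using q by simp
 qed
 moreover have "?y \<otimes>[wreath i m] x = \<one>[wreath i m]"
 proof -
  have "inv_into UNIV (s (?q (p j))) \<circ> s j = id" if "j : {1..m}" for j
  proof -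
   have "s j permutes {1..i}" using PiE_mem[OF x(3) that] by simp
   then show ?thesis using permutes_inverses[OF x(2)] by (simp add: permutes_inv_o)
  qed
  then have "(\<lambda>j\<in>{1..m}. (\<lambda>j\<in>{1..m}. inv_into UNIV (s (?q j))) (p j) \<circ> s j) = (\<lambda>j\<in>{1..m}. id)"
   using permutes_in_image[OF x(2)] by (intro restrict_ext) simp
  then show ?thesis using x(2) by (simp add: x(1) permutes_inv_o)
 qed
 ultimately show "EX y:carrier (wreath i m). y \<otimes>[wreath i m] x = \<one>[wreath i m]" by blast
qed

lemma group_S_nu: "group (S_nu nu)"
 unfolding S_nu_def by (rule product_group) (rule group_wreath)

text \<open>Only the finitely many \<open>i\<close> that occur in \<open>nu\<close> give nontrivial
  factors, since \<open>wreath i 0\<close> is trivial for each \<open>i\<close>.\<close>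

lemma finite_S_nu: "finite (SG nu)"
proof -
 have triv: "trivial_group (wreath i 0)" for i
  by (auto simp: trivial_group_def group_wreath permutes_def fun_eq_iff)
 have "{i. i : UNIV & \<not> trivial_group (wreath i (count nu i))} <= set_mset nu"
 proof (intro subsetI, rule ccontr)
  fix i assume "i : {i. i : UNIV & \<not> trivial_group (wreath i (count nu i))}" "i ~:# nu"
  then show False using triv by (simp add: not_in_iff)
 qed
 moreover have "finite (carrier (wreath i m))" for i m
  by (auto intro!: finite_PiE finite_permutations)
 ultimately show ?thesis
  unfolding S_nu_def by (subst finite_product_group) (auto intro: group_wreath finite_subset)
qed

lemma S_nu_mem:
 assumes "g : SG nu"
 shows "fst (g i) permutes {1..count nu i}"
  and "j : {1..count nu i} ==> snd (g i) j permutes {1..i}"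
  and "j ~: {1..count nu i} ==> snd (g i) j = undefined"
proof -
 have "g i : carrier (wreath i (count nu i))" using assms by (auto simp: S_nu_def)
 then obtain p s where "g i = (p, s)" "p permutes {1..count nu i}" "s : {1..count nu i} \<rightarrow>\<^sub>E {p. p permutes {1..i}}" by auto
 then have gi: "g i = (p, s)" and p: "p permutes {1..count nu i}" and s: "s : {1..count nu i} \<rightarrow>\<^sub>E {p. p permutes {1..i}}" .
 show "fst (g i) permutes {1..count nu i}" using gi p by simp
 show "j : {1..count nu i} ==> snd (g i) j permutes {1..i}" using PiE_mem[OF s, of j] gi by simp
 show "j ~: {1..count nu i} ==> snd (g i) j = undefined" using PiE_arb[OF s, of j] gi by simp
qed

lemma S_nu_mult: "(g \<otimes>[S_nu nu] h) i = (fst (g i) \<circ> fst (h i), \<lambda>j\<in>{1..count nu i}. snd (g i) (fst (h i) j) \<circ> snd (h i) j)"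
 by (cases "g i"; cases "h i") (simp add: S_nu_def)

lemma S_nu_one: "\<one>[S_nu nu] i = (id, \<lambda>j\<in>{1..count nu i}. id)"
 by (simp add: S_nu_def)

lemma slots_iff: "(i, j) : slots nu \<longleftrightarrow> j : {1..count nu i}"
 by (auto simp: slots_def)

text \<open>Indexing by the parts of \<open>nu\<close> instead of all natural numbers makes
  finiteness and the cardinality \<open>size nu\<close> visible.\<close>

lemma slots_eq: "slots nu = (SIGMA i:set_mset nu. {1..count nu i})"
proof -
 have "i \<in># nu" if "j : {1..count nu i}" for i j
  using that by (intro count_inI) auto
 then show ?thesis by (auto simp: slots_def)
qed

lemma finite_slots: "finite (slots nu)"
 by (simp add: slots_eq)

lemma card_slots: "card (slots nu) = size nu"
 by (simp add: slots_eq size_multiset_overloaded_eq)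

subsection \<open>Graded representations\<close>

lemma rep_homD:
 assumes "f : rep_hom G R R'"
 shows "f : lin (space R) (space R')" "f : mhom (space R) (space R')"
  "g : carrier G ==> v : cs R ==> f (act R g v) = act R' g (f v)"
  "v : cs R ==> f v : cs R'"
 using assms by (auto simp: rep_hom_def lin_mhom lin_closed)

lemma rep_homI:
 assumes "f : lin (space R) (space R')"
  and "!!g v. g : carrier G ==> v : cs R ==> f (act R g v) = act R' g (f v)"
 shows "f : rep_hom G R R'"
 using assms by (auto simp: rep_hom_def)

lemma rep_hom_id: "is_rep G R ==> (\<lambda>v\<in>cs R. v) : rep_hom G R R"
 by (auto intro!: rep_homI lin_restrict mhomI simp: is_repD fdvs_rvs[OF is_repD(1)])

lemma rep_hom_compose:
 assumes "is_rep G R" "f : rep_hom G R R'" "g : rep_hom G R' R''"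
 shows "compose (cs R) g f : rep_hom G R R''"
 using assms
 by (intro rep_homI lin_compose[of f _ "space R'"]) (auto simp: rep_homD is_repD fdvs_rvs compose_def)

lemma rep_hom_undefined: "f : rep_hom G R R' ==> v ~: cs R ==> f v = undefined"
 by (rule lin_undefined[OF rep_homD(1)])

lemma pgraded_simps [simp]:
 "Obj (pgraded_cat G) = {W. ALL i. is_rep (G i) (W i)}"
 "Hom (pgraded_cat G) W W' = {f. ALL i. f i : rep_hom (G i) (W i) (W' i)}"
 "Id (pgraded_cat G) W = (%i. \<lambda>v\<in>cs (W i). v)"
 "Comp (pgraded_cat G) U V W g f = (%i. compose (cs (U i)) (g i) (f i))"
 by (simp_all add: pgraded_cat_def)

lemma graded_simps [simp]:
 "Obj (graded_cat G) = {W. (ALL i. is_rep (G i) (W i)) & fdvs (dsum (%i. space (W i)))}"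
 "Hom (graded_cat G) = Hom (pgraded_cat G)"
 "Id (graded_cat G) = Id (pgraded_cat G)"
 "Comp (graded_cat G) = Comp (pgraded_cat G)"
 by (simp_all add: graded_cat_def)

lemma is_category_pgraded: "is_category (pgraded_cat G)"
 unfolding is_category_def
proof (intro conjI ballI)
 fix X assume X: "X : Obj (pgraded_cat G)"
 show "Id (pgraded_cat G) X : Hom (pgraded_cat G) X X" using X by (auto simp: rep_hom_id)
 fix Y f assume "f : Hom (pgraded_cat G) X Y"
 then have f: "!!i. f i : rep_hom (G i) (X i) (Y i)" by simp
 note fd = rep_homD(4)[OF f] rep_hom_undefined[OF f]
 show "Comp (pgraded_cat G) X X Y f (Id (pgraded_cat G) X) = f" "Comp (pgraded_cat G) X Y Y (Id (pgraded_cat G) Y) f = f"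
  using fd by (auto simp: fun_eq_iff compose_def)
 fix Z g assume "g : Hom (pgraded_cat G) Y Z"
 then have g: "!!i. g i : rep_hom (G i) (Y i) (Z i)" by simp
 show "Comp (pgraded_cat G) X Y Z g f : Hom (pgraded_cat G) X Z"
  using X f g by (auto intro: rep_hom_compose)
 fix U h assume "h : Hom (pgraded_cat G) Z U"
 show "Comp (pgraded_cat G) X Y U (Comp (pgraded_cat G) Y Z U h g) f
  = Comp (pgraded_cat G) X Z U h (Comp (pgraded_cat G) X Y Z g f)"
  using fd by (auto simp: fun_eq_iff compose_def)
qed

lemma is_category_graded: "is_category (graded_cat G)"
 unfolding graded_cat_def by (rule is_category_full_subcat[OF is_category_pgraded])

section \<open>Tensor powers as representations, and their functoriality\<close>

abbreviation srep :: "'a smod => bool" where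
 "srep W \<equiv> ALL i. is_rep (sym_group i) (W i)"

lemma factors_rvs: "srep W ==> rvs (factors W k)"
 by (auto simp: factors_def split: prod.split intro: fdvs_rvs is_repD)

lemma factors_fdvs: "srep W ==> fdvs (factors W k)"
 by (auto simp: factors_def split: prod.split intro: is_repD)

lemma fdvs_tensor_power: "srep W ==> fdvs (tpow nu W)"
 by (rule fdvs_tensor[OF factors_rvs finite_slots factors_fdvs])

lemma svs_tensor_power: "srep W ==> svs (tpow nu W)"
 by (rule fdvs_svs[OF fdvs_tensor_power])

abbreviation ptuples :: "nat multiset => 'a smod => (nat \<times> nat => 'a) set" where
 "ptuples nu W \<equiv> tuples (slots nu) (factors W)"

lemma ptuples_mem: "w : ptuples nu W ==> (i, j) : slots nu ==> w (i, j) : cs (W i)"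
 using tuples_mem[of w "slots nu" "factors W" "(i, j)"] by (simp add: factors_def)

lemma ptuples_undefined: "w : ptuples nu W ==> s ~: slots nu ==> w s = undefined"
 unfolding tuples_def by (rule PiE_arb)

lemma ptuplesI:
 "(!!i j. (i, j) : slots nu ==> w (i, j) : cs (W i)) ==> (!!s. s ~: slots nu ==> w s = undefined) ==> w : ptuples nu W"
 unfolding tuples_def by (intro PiE_I) (auto simp: factors_def split: prod.split)

definition map_tuple :: "(nat => 'a => 'b) => nat multiset => (nat \<times> nat => 'a) => nat \<times> nat => 'b" where
 "map_tuple f nu w = (\<lambda>(i, j)\<in>slots nu. f i (w (i, j)))"

lemma map_tuple_simps [simp]:
 "(i, j) : slots nu ==> map_tuple f nu w (i, j) = f i (w (i, j))" "s ~: slots nu ==> map_tuple f nu w s = undefined"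
 by (simp_all add: map_tuple_def)

lemma act_tuple_simps:
 "(i, j) : slots nu ==> wreath_act_tuple W nu g w (i, j)
  = act (W i) (snd (g i) (inv_into UNIV (fst (g i)) j)) (w (i, inv_into UNIV (fst (g i)) j))"
 "s ~: slots nu ==> wreath_act_tuple W nu g w s = undefined"
 by (simp_all add: wreath_act_tuple_def Let_def)

lemma S_nu_inv_slot:
 assumes "g : SG nu" "(i, j) : slots nu"
 shows "(i, inv_into UNIV (fst (g i)) j) : slots nu"
  "snd (g i) (inv_into UNIV (fst (g i)) j) permutes {1..i}"
proof -
 have "inv_into UNIV (fst (g i)) j : {1..count nu i}"
  using iffD2[OF permutes_in_image[OF permutes_inv[OF S_nu_mem(1)[OF assms(1)]]]] assms(2) unfolding slots_iff .
 then show "(i, inv_into UNIV (fst (g i)) j) : slots nu"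
  "snd (g i) (inv_into UNIV (fst (g i)) j) permutes {1..i}"
  using S_nu_mem(2)[OF assms(1)] unfolding slots_iff by blast+
qed

lemma act_tuple_closed:
 assumes "srep W" "g : SG nu" "w : ptuples nu W"
 shows "wreath_act_tuple W nu g w : ptuples nu W"
proof (rule ptuplesI)
 fix i j assume ij: "(i, j) : slots nu"
 note * = S_nu_inv_slot[OF assms(2) ij]
 show "wreath_act_tuple W nu g w (i, j) : cs (W i)"
  unfolding act_tuple_simps(1)[OF ij] using assms(1) * ptuples_mem[OF assms(3) *(1)]
  by (intro is_repD(5)[of "sym_group i"]) auto
qed (simp add: act_tuple_simps)

text \<open>The entry at \<open>j\<close> is found by undoing first the permutation of
  \<open>g\<close>, then that of \<open>h\<close>; the inverse permutation in the action on tuples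
  is what makes this a left action.\<close>

lemma act_tuple_mult:
 assumes W: "srep W" and g: "g : SG nu" and h: "h : SG nu" and w: "w : ptuples nu W"
 shows "wreath_act_tuple W nu (g \<otimes>[S_nu nu] h) w = wreath_act_tuple W nu g (wreath_act_tuple W nu h w)"
proof
 fix s :: "nat \<times> nat"
 obtain i j where s: "s = (i, j)" by (cases s)
 show "wreath_act_tuple W nu (g \<otimes>[S_nu nu] h) w s = wreath_act_tuple W nu g (wreath_act_tuple W nu h w) s"
 proof (cases "s : slots nu")
  case True
  then have ij: "(i, j) : slots nu" using s by simp
  let ?p = "fst (g i)" and ?q = "fst (h i)"
  have pq: "?p permutes {1..count nu i}" "?q permutes {1..count nu i}" using S_nu_mem(1) g h by auto
  define j1 where "j1 = inv_into UNIV ?p j"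
  define j2 where "j2 = inv_into UNIV ?q j1"
  have j1: "(i, j1) : slots nu" "snd (g i) j1 permutes {1..i}" using S_nu_inv_slot[OF g ij] by (auto simp: j1_def)
  have j2: "(i, j2) : slots nu" "snd (h i) j2 permutes {1..i}" using S_nu_inv_slot[OF h j1(1)] by (auto simp: j2_def)
  have inv: "inv_into UNIV (?p \<circ> ?q) j = j2"
   using o_inv_distrib[OF permutes_bij[OF pq(1)] permutes_bij[OF pq(2)]] by (simp add: j2_def j1_def)
  have qj: "?q j2 = j1" unfolding j2_def by (rule permutes_inverses[OF pq(2)])
  have m: "j2 : {1..count nu i}" using j2 by (simp add: slots_iff)
  have "wreath_act_tuple W nu (g \<otimes>[S_nu nu] h) w s = act (W i) (snd (g i) j1 \<circ> snd (h i) j2) (w (i, j2))"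
   using ij m by (simp add: s act_tuple_simps S_nu_mult inv qj)
  also have "... = act (W i) (snd (g i) j1) (act (W i) (snd (h i) j2) (w (i, j2)))"
   using is_repD(4)[OF W[rule_format], of "snd (g i) j1" i "snd (h i) j2" "w (i, j2)"] j1 j2 ptuples_mem[OF w j2(1)] by simp
  also have "... = wreath_act_tuple W nu g (wreath_act_tuple W nu h w) s"
   using ij j1 by (simp add: s act_tuple_simps j1_def[symmetric] j2_def[symmetric])
  finally show ?thesis .
 qed (simp add: act_tuple_simps)
qed

lemma act_tuple_one:
 assumes W: "srep W" and w: "w : ptuples nu W"
 shows "wreath_act_tuple W nu \<one>[S_nu nu] w = w"
proof
 fix s :: "nat \<times> nat"
 obtain i j where s: "s = (i, j)" by (cases s)
 show "wreath_act_tuple W nu \<one>[S_nu nu] w s = w s"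
 proof (cases "s : slots nu")
  case True
  then have "j : {1..count nu i}" "(i, j) : slots nu" using s by (auto simp: slots_iff)
  then show ?thesis using is_repD(3)[OF W[rule_format], of "w (i, j)" i] ptuples_mem[OF w, of i j]
   by (simp add: s act_tuple_simps S_nu_one inv_id)
 qed (use ptuples_undefined[OF w] in "simp add: act_tuple_simps")
qed

abbreviation shom :: "'a smod => 'b smod => (nat => 'a => 'b) set" where
 "shom W W' \<equiv> {f. ALL i. f i : rep_hom (sym_group i) (W i) (W' i)}"

lemma map_tuple_closed: "f : shom W W' ==> w : ptuples nu W ==> map_tuple f nu w : ptuples nu W'"
 by (rule ptuplesI) (auto intro: rep_homD(4) ptuples_mem)

lemma map_tuple_act:
 assumes f: "f : shom W W'" and g: "g : SG nu" and w: "w : ptuples nu W"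
 shows "map_tuple f nu (wreath_act_tuple W nu g w) = wreath_act_tuple W' nu g (map_tuple f nu w)"
proof
 fix s :: "nat \<times> nat"
 obtain i j where s: "s = (i, j)" by (cases s)
 show "map_tuple f nu (wreath_act_tuple W nu g w) s = wreath_act_tuple W' nu g (map_tuple f nu w) s"
 proof (cases "s : slots nu")
  case True
  then have ij: "(i, j) : slots nu" using s by simp
  note * = S_nu_inv_slot[OF g ij]
  have "f i : rep_hom (sym_group i) (W i) (W' i)" using f by auto
  from rep_homD(3)[OF this, of "snd (g i) (inv_into UNIV (fst (g i)) j)" "w (i, inv_into UNIV (fst (g i)) j)"]
  show ?thesis using ij * ptuples_mem[OF w *(1)] by (simp add: s act_tuple_simps)
 qed (simp add: act_tuple_simps)
qed

lemma tensor_power_space [simp]: "space (tensor_power W nu) = tpow nu W"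
 by (simp add: tensor_power_def)

lemma tensor_power_act:
 assumes W: "srep W" and g: "g : SG nu"
 shows "act (tensor_power W nu) g : lin (tpow nu W) (tpow nu W)"
  and "w : ptuples nu W ==> act (tensor_power W nu) g (pten nu W w)
   = pten nu W (wreath_act_tuple W nu g w)"
proof -
 note X = factors_rvs[OF W]
 let ?p = "%(i, j). (i, inv_into UNIV (fst (g i)) j)"
 let ?f = "%(i, j). act (W i) (snd (g i) (inv_into UNIV (fst (g i)) j))"
 have "multilinear (slots nu) (factors W) (tpow nu W) (%w. pten nu W (wreath_act_tuple W nu g w))"
 proof (rule multilinear_permuted(1)[where p = ?p and f = ?f])
  show "bij_betw ?p (slots nu) (slots nu)"
  proof (rule bij_betw_byWitness[where f' = "%(i, j). (i, fst (g i) j)"])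
   show "ALL a:slots nu. (%(i, j). (i, fst (g i) j)) (?p a) = a" "ALL a:slots nu. ?p ((%(i, j). (i, fst (g i) j)) a) = a"
    using permutes_inverses[OF S_nu_mem(1)[OF g]] by auto
   show "?p ` slots nu <= slots nu" using S_nu_inv_slot[OF g] by auto
   show "(%(i, j). (i, fst (g i) j)) ` slots nu <= slots nu"
   proof clarify
    fix i j assume "(i, j) : slots nu"
    then show "(i, fst (g i) j) : slots nu"
    unfolding slots_iff using permutes_in_image[OF S_nu_mem(1)[OF g]] by blast
   qed
  qed
  fix k assume k: "k : slots nu"
  show "?f k : mhom (factors W (?p k)) (factors W k)"
   using k W S_nu_inv_slot[OF g] by (cases k) (auto simp: factors_def intro!: is_repD(2))
  fix w assume w: "w : ptuples nu W"
  show "wreath_act_tuple W nu g w k = ?f k (w (?p k))" using k by (cases k) (simp add: act_tuple_simps)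
 qed (use X act_tuple_simps in auto)
 from tensor_map_props[OF X X this]
 show "act (tensor_power W nu) g : lin (tpow nu W) (tpow nu W)"
 "w : ptuples nu W ==> act (tensor_power W nu) g (pten nu W w)
   = pten nu W (wreath_act_tuple W nu g w)"
  by (simp_all add: tensor_power_def)
qed

lemma is_rep_tensor_power:
 assumes W: "srep W"
 shows "is_rep (S_nu nu) (tensor_power W nu)"
proof -
 note X = factors_rvs[OF W] and T = tensor_power_act[OF W]
 let ?T = "tpow nu W"
 note TV = rvs_tensor[of "slots nu" "factors W", OF X]
 interpret group "S_nu nu" by (rule group_S_nu)
 show ?thesis
  unfolding is_rep_def tensor_power_space
 proof (intro conjI ballI)
  show "fdvs ?T" by (rule fdvs_tensor_power[OF W])
  fix v assume v: "v : carrier ?T"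
  show "act (tensor_power W nu) \<one>[S_nu nu] v = v"
   by (rule tensor_ext[of "slots nu" "factors W", OF X TV lin_mhom[OF T(1)[OF one_closed]] _ _ v])
    (auto simp: T(2) act_tuple_one[OF W] intro!: mhomI)
  fix g h assume g: "g : SG nu" and h: "h : SG nu"
  show "act (tensor_power W nu) (g \<otimes>[S_nu nu] h) v = act (tensor_power W nu) g (act (tensor_power W nu) h v)"
   by (rule tensor_ext[of "slots nu" "factors W", OF X TV lin_mhom[OF T(1)[OF m_closed[OF g h]]]
    mhom_comp[OF lin_mhom[OF T(1)[OF h]] lin_mhom[OF T(1)[OF g]]] _ v])
    (simp add: T(2) act_tuple_mult[OF W] g h act_tuple_closed[OF W])
 qed (use T(1) lin_mhom in blast)
qed

lemma tensor_power_map_props: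
 assumes W: "srep W" and W': "srep W'" and f: "f : shom W W'"
 shows "tensor_power_map W W' f nu : lin (tpow nu W) (tpow nu W')"
  and "w : ptuples nu W ==> tensor_power_map W W' f nu (pten nu W w)
   = pten nu W' (map_tuple f nu w)"
proof -
 have "multilinear (slots nu) (factors W) (tpow nu W') (%w. pten nu W' (map_tuple f nu w))"
 proof (rule multilinear_permuted(1)[where p = "%k. k" and f = "%(i, j). f i"])
  fix k assume "k : slots nu"
  show "(%(i, j). f i) k : mhom (factors W k) (factors W' k)"
   using f by (cases k) (auto simp: factors_def intro: rep_homD(2))
  fix w
  show "map_tuple f nu w k = (%(i, j). f i) k (w k)" using \<open>k : slots nu\<close> by (cases k) simp
 qed (use factors_rvs[OF W] factors_rvs[OF W'] in "auto simp: bij_betw_def")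
 from tensor_map_props[OF factors_rvs[OF W] factors_rvs[OF W'] this]
 show "tensor_power_map W W' f nu : lin (tpow nu W) (tpow nu W')"
 "w : ptuples nu W ==> tensor_power_map W W' f nu (pten nu W w)
   = pten nu W' (map_tuple f nu w)"
  by (simp_all add: tensor_power_map_def map_tuple_def)
qed

lemma tensor_power_map_rep_hom:
 assumes W: "srep W" and W': "srep W'" and f: "f : shom W W'"
 shows "tensor_power_map W W' f nu : rep_hom (S_nu nu) (tensor_power W nu) (tensor_power W' nu)"
proof (rule rep_homI; unfold tensor_power_space)
 note T = tensor_power_map_props[OF W W' f, where nu = nu]
 show "tensor_power_map W W' f nu : lin (tpow nu W) (tpow nu W')" by (rule T(1))
 fix g v assume g: "g : SG nu" and v: "v : carrier (tpow nu W)"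
 show "tensor_power_map W W' f nu (act (tensor_power W nu) g v) = act (tensor_power W' nu) g (tensor_power_map W W' f nu v)"
  by (rule tensor_ext[of "slots nu" "factors W", OF factors_rvs[OF W] rvs_tensor[of "slots nu" "factors W'", OF factors_rvs[OF W']]
    mhom_comp[OF lin_mhom[OF tensor_power_act(1)[OF W g]] lin_mhom[OF T(1)]]
    mhom_comp[OF lin_mhom[OF T(1)] lin_mhom[OF tensor_power_act(1)[OF W' g]]] _ v])
   (simp add: tensor_power_act(2)[OF W g] tensor_power_act(2)[OF W' g] T(2) act_tuple_closed[OF W g]
    map_tuple_closed[OF f] map_tuple_act[OF f g])
qed

lemma tensor_power_map_ext:
 assumes W: "srep W" and W': "srep W'" and f: "f : shom W W'"
  and L: "L : mhom (tpow nu W) (tpow nu W')"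
  and eq: "!!w. w : ptuples nu W ==> L (pten nu W w) = pten nu W' (map_tuple f nu w)"
  and v: "v : carrier (tpow nu W)"
 shows "tensor_power_map W W' f nu v = L v"
 by (rule tensor_ext[of "slots nu" "factors W", OF factors_rvs[OF W] rvs_tensor[of "slots nu" "factors W'", OF factors_rvs[OF W']]
    lin_mhom[OF tensor_power_map_props(1)[OF W W' f]] L _ v])
  (simp add: tensor_power_map_props(2)[OF W W' f] eq)

lemma tensor_power_map_id:
 assumes W: "srep W" and v: "v : carrier (tpow nu W)"
 shows "tensor_power_map W W (%i. \<lambda>v\<in>cs (W i). v) nu v = v"
proof (rule tensor_power_map_ext[OF W W _ _ _ v, where L = "%v. v"])
 show "(%i. \<lambda>v\<in>cs (W i). v) : shom W W" using W by (auto intro: rep_hom_id)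
 fix w assume w: "w : ptuples nu W"
 have "map_tuple (%i. \<lambda>v\<in>cs (W i). v) nu w s = w s" for s
  using ptuples_mem[OF w] ptuples_undefined[OF w] by (cases s; cases "s : slots nu") auto
 then have "map_tuple (%i. \<lambda>v\<in>cs (W i). v) nu w = w" by blast
 then show "pten nu W w = pten nu W (map_tuple (%i. \<lambda>v\<in>cs (W i). v) nu w)" by simp
qed (auto intro!: mhomI)

lemma shom_compose:
 assumes "srep U" "f : shom U V" "g : shom V W"
 shows "(%i. compose (cs (U i)) (g i) (f i)) : shom U W"
 using assms by (auto intro: rep_hom_compose)

lemma map_tuple_comp:
 assumes "f : shom U V" "w : ptuples nu U"
 shows "map_tuple (%i. compose (cs (U i)) (g i) (f i)) nu w = map_tuple g nu (map_tuple f nu w)"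
proof
 fix s
 show "map_tuple (%i. compose (cs (U i)) (g i) (f i)) nu w s = map_tuple g nu (map_tuple f nu w) s"
  using ptuples_mem[OF assms(2)] by (cases s; cases "s : slots nu") (auto simp: compose_def)
qed

lemma tensor_power_map_comp:
 assumes U: "srep U" and V: "srep V" and W: "srep W" and f: "f : shom U V" and g: "g : shom V W"
  and v: "v : carrier (tpow nu U)"
 shows "tensor_power_map U W (%i. compose (cs (U i)) (g i) (f i)) nu v
  = tensor_power_map V W g nu (tensor_power_map U V f nu v)"
proof (rule tensor_power_map_ext[OF U W shom_compose[OF U f g] _ _ v])
 show "(%v. tensor_power_map V W g nu (tensor_power_map U V f nu v)) : mhom (tpow nu U) (tpow nu W)"
  by (rule mhom_comp[OF lin_mhom[OF tensor_power_map_props(1)[OF U V f]] lin_mhom[OF tensor_power_map_props(1)[OF V W g]]])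
qed (simp add: tensor_power_map_props(2)[OF U V f] tensor_power_map_props(2)[OF V W g] map_tuple_closed[OF f] map_tuple_comp[OF f])

section \<open>The objects representing multilinear functionals\<close>

definition idx :: "nat multiset => nat => (perm \<times> nat) set" where
 "idx nu i = {p. p permutes {1..i}} \<times> {1..count nu i}"

lemma finite_idx: "finite (idx nu i)"
 by (simp add: idx_def finite_permutations)

lemma idx_iff: "(p, j) : idx nu i \<longleftrightarrow> p permutes {1..i} & (i, j) : slots nu"
 by (simp add: idx_def slots_iff)

text \<open>\<open>P i\<close> is a free \<open>\<rat>[S\<^sub>i]\<close>-module with basis \<open>e (i, 1), \<dots>, e (i, nu\<^sub>i)\<close>, and \<open>c i p j\<close> is the
  coordinate of the basis vector \<open>p \<cdot> e (i, j)\<close> over \<open>\<rat>\<close>.\<close>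

definition free_smod ::
 "nat multiset => 'a smod \<times> (nat \<times> nat => 'a) \<times> (nat => perm \<times> nat => 'a => rat) => bool" where
 "free_smod nu = (%(P, e, c). P : Obj SVect &
  (ALL i j. (i, j) : slots nu --> e (i, j) : cs (P i)) &
  (ALL i. ALL x:idx nu i. c i x : dual (space (P i))) &
  (ALL i. ALL z:cs (P i). z = lcomb (space (P i)) (idx nu i) (%x. c i x z) (%(p, j). act (P i) p (e (i, j)))) &
  (ALL i. ALL x:idx nu i. ALL p j. (p, j) : idx nu i --> c i x (act (P i) p (e (i, j))) = (if x = (p, j) then 1 else 0)))"

text \<open>Left translation of functions on the labels: because of the inverse in the argument,
  \<open>p\<close> sends \<open>pt (q, j)\<close> to \<open>pt (p \<circ> q, j)\<close>.\<close>

definition regular_rep :: "nat multiset => nat => (perm, perm \<times> nat => rat) rep" where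
 "regular_rep nu i = \<lparr> space = free_vs (idx nu i), act = (%p c. %(q, j). c (inv_into UNIV p \<circ> q, j)) \<rparr>"

lemma regular_rep_simps [simp]:
 "space (regular_rep nu i) = free_vs (idx nu i)" "act (regular_rep nu i) p c (q, j) = c (inv_into UNIV p \<circ> q, j)"
 by (simp_all add: regular_rep_def)

lemma permutes_comp_inv_eq: "p permutes S ==> inv_into UNIV p \<circ> q = r \<longleftrightarrow> q = p \<circ> r"
 by (metis comp_assoc id_comp permutes_inv_o(1) permutes_inv_o(2))

lemma permutes_inv_comp_permutes:
 assumes "p permutes S"
 shows "(inv_into UNIV p \<circ> q) permutes S \<longleftrightarrow> q permutes S"
proof
 assume "(inv_into UNIV p \<circ> q) permutes S"
 from permutes_compose[OF this assms] show "q permutes S"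
  by (metis permutes_comp_inv_eq[OF assms])
qed (simp add: permutes_compose permutes_inv assms)

lemma regular_rep_closed:
 assumes p: "p permutes {1..i}" and c: "c : carrier (free_vs (idx nu i))"
 shows "act (regular_rep nu i) p c : carrier (free_vs (idx nu i))"
proof -
 have "act (regular_rep nu i) p c x = 0" if "x ~: idx nu i" for x
  using that c permutes_inv_comp_permutes[OF p] by (cases x) (auto simp: idx_iff)
 moreover from this have "{x. act (regular_rep nu i) p c x ~= 0} <= idx nu i" by blast
 then have "finite {x. act (regular_rep nu i) p c x ~= 0}" by (rule finite_subset[OF _ finite_idx])
 ultimately show ?thesis unfolding free_vs_simps(1) by blast
qed

lemma is_rep_regular_rep: "is_rep (sym_group i) (regular_rep nu i)"
 unfolding is_rep_def
proof (intro conjI ballI)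
 show "fdvs (space (regular_rep nu i))"
  unfolding regular_rep_simps
 proof (rule fdvsI[OF rvs_free_vs, of "(%x c. c x) ` idx nu i"])
  show "finite ((%x c. c x) ` idx nu i)" using finite_idx by blast
  show "(%x c. c x) ` idx nu i <= dual (free_vs (idx nu i))" by (auto intro!: dualI)
  fix c :: "perm \<times> nat => rat" assume c: "c : carrier (free_vs (idx nu i))" "!!l. l : (%x c. c x) ` idx nu i ==> l c = 0"
  have "c x = 0" for x
  proof (cases "x : idx nu i")
   case True
   from c(2)[OF imageI[OF this]] show ?thesis .
  qed (use c(1) in "cases x; simp")
  then show "c = \<zero>[free_vs (idx nu i)]" by auto
 qed
 fix p assume p: "p : carrier (sym_group i)"
 then show "act (regular_rep nu i) p : mhom (space (regular_rep nu i)) (space (regular_rep nu i))"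
  using regular_rep_closed[of p i] by (intro mhomI) (auto simp del: free_vs_simps(1))
 fix q v assume q: "q : carrier (sym_group i)"
 show "act (regular_rep nu i) (p \<otimes>[sym_group i] q) v = act (regular_rep nu i) p (act (regular_rep nu i) q v)"
  using p q by (auto simp: fun_eq_iff o_inv_distrib permutes_bij comp_assoc)
qed (auto simp: fun_eq_iff inv_id)

lemma regular_rep_gen:
 assumes "p permutes {1..i}"
 shows "act (regular_rep nu i) p (pt (id, j)) = pt (p, j)"
 using permutes_comp_inv_eq[OF assms, of _ id] by (auto simp: pt_def fun_eq_iff)

lemma free_vs_expand_finite:
 assumes "finite S" "c : carrier (free_vs S)"
 shows "c = lcomb (free_vs S) S c pt"
proof -
 have sub: "{s. c s ~= 0} <= S" using assms(2) by auto
 have "c = lcomb (free_vs S) {s. c s ~= 0} c pt" by (rule free_vs_expand[OF assms(2)])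
 also have "... = lcomb (free_vs S) S c pt"
  by (rule lcomb_mono_neutral[OF rvs_free_vs assms(1) sub pt_closed]) simp_all
 finally show ?thesis .
qed

text \<open>In degree \<open>i\<close> this is a sum of \<open>count nu i\<close> copies of the
  regular representation, moved to the type \<open>'a\<close>. It vanishes for \<open>i\<close>
  outside \<open>nu\<close>, so the total space is finite-dimensional.\<close>

lemma free_smod_exists:
 assumes inf: "infinite (UNIV :: 'a set)"
 shows "EX d :: 'a smod \<times> _. free_smod nu d"
proof -
 have "EX R :: (perm, 'a) rep. EX j j'. is_rep (sym_group i) R & j : mhom (free_vs (idx nu i)) (space R) &
   j' : mhom (space R) (free_vs (idx nu i)) & (ALL x:carrier (free_vs (idx nu i)). j' (j x) = x) &
   (ALL y:cs R. j (j' y) = y) &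
   (ALL g:carrier (sym_group i). ALL x:carrier (free_vs (idx nu i)). j (act (regular_rep nu i) g x) = act R g (j x))" for i
  by (rule rep_transport[OF is_rep_regular_rep[of i nu] inf sym_group_is_group], unfold regular_rep_simps(1)) blast
 then obtain P :: "'a smod" and j j' where P: "!!i. is_rep (sym_group i) (P i)" and j: "!!i. j i : mhom (free_vs (idx nu i)) (space (P i))"
  and j': "!!i. j' i : mhom (space (P i)) (free_vs (idx nu i))" and j'j: "!!i. ALL x:carrier (free_vs (idx nu i)). j' i (j i x) = x"
  and jj': "!!i. ALL y:cs (P i). j i (j' i y) = y"
  and ja: "!!i. ALL g:carrier (sym_group i). ALL x:carrier (free_vs (idx nu i)). j i (act (regular_rep nu i) g x) = act (P i) g (j i x)"
  by metis
 define e where "e = (%(i, m). j i (pt (id, m)))"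
 define c where "c i x z = j' i z x" for i x z
 have idm: "(id, m) : idx nu i" if "(p, m) : idx nu i" for p m i using that by (simp add: idx_def permutes_id)
 have ae: "act (P i) p (e (i, m)) = j i (pt (p, m))" if "(p, m) : idx nu i" for i p m
 proof -
  have p: "p permutes {1..i}" using that by (simp add: idx_iff)
  then have pc: "p : carrier (sym_group i)" by simp
  have "j i (act (regular_rep nu i) p (pt (id, m))) = act (P i) p (j i (pt (id, m)))"
   by (rule bspec[OF bspec[OF ja pc] pt_closed[OF idm[OF that]]])
  then show ?thesis by (simp add: e_def regular_rep_gen[OF p])
 qed
 have P0: "cs (P i) <= {\<zero>[space (P i)]}" if "i ~: set_mset nu" for i
 proof
  fix z assume z: "z : cs (P i)"
  have "idx nu i = {}" using that by (simp add: idx_def not_in_iff)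
  then have "j' i z = \<zero>[free_vs (idx nu i)]" using mhom_closed[OF j' z] by (auto simp: fun_eq_iff)
  then have "j i (j' i z) = \<zero>[space (P i)]" using mhom_zero[OF rvs_free_vs fdvs_rvs[OF is_repD(1)[OF P]] j[of i]] by simp
  then show "z : {\<zero>[space (P i)]}" using jj' z by simp
 qed
 have "free_smod nu (P, e, c)"
  unfolding free_smod_def prod.case
 proof (intro conjI allI ballI impI)
  show "P : Obj SVect"
   using P fdvs_dsumI[of "%i. space (P i)", OF is_repD(1)[OF P] finite_set_mset P0] by simp
  show "e (i, m) : cs (P i)" if "(i, m) : slots nu" for i m
   unfolding e_def prod.case using that by (intro mhom_closed[OF j] pt_closed) (simp add: idx_iff permutes_id)
  fix i
  show "c i x : dual (space (P i))" if "x : idx nu i" for x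
   unfolding c_def using mhom_add[OF j'[of i]] mhom_smult[OF j'[of i]] by (intro dualI) simp_all
  show "z = lcomb (space (P i)) (idx nu i) (%x. c i x z) (%(p, m). act (P i) p (e (i, m)))"
   if z: "z : cs (P i)" for z
  proof -
   have "z = j i (lcomb (free_vs (idx nu i)) (idx nu i) (j' i z) pt)"
    using jj' z free_vs_expand_finite[OF finite_idx mhom_closed[OF j' z]] by simp
   also have "... = lcomb (space (P i)) (idx nu i) (j' i z) (%x. j i (pt x))"
    by (rule mhom_lcomb[OF rvs_free_vs fdvs_rvs[OF is_repD(1)[OF P]] j pt_closed])
   also have "... = lcomb (space (P i)) (idx nu i) (%x. c i x z) (%(p, m). act (P i) p (e (i, m)))"
    by (rule lcomb_cong[OF fdvs_rvs[OF is_repD(1)[OF P]]])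
    (auto simp: c_def ae intro!: mhom_closed[OF j] pt_closed simp del: free_vs_simps(1))
   finally show ?thesis .
  qed
  show "c i x (act (P i) p (e (i, m))) = (if x = (p, m) then 1 else 0)"
   if "x : idx nu i" "(p, m) : idx nu i" for x p m
   using bspec[OF j'j[of i] pt_closed[OF that(2)]] by (simp add: c_def ae[OF that(2)] pt_def)
 qed
 then show ?thesis by blast
qed

section \<open>The free objects and the morphisms out of them\<close>

definition proj_data :: "nat multiset => 'a smod \<times> (nat \<times> nat => 'a) \<times> (nat => perm \<times> nat => 'a => rat)" where
 "proj_data nu = (SOME d. free_smod nu d)"

definition Proj :: "nat multiset => 'a smod" where "Proj nu = fst (proj_data nu)"
definition gen :: "nat multiset => nat \<times> nat => 'a" where "gen nu = fst (snd (proj_data nu))"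
definition gcoord :: "nat multiset => nat => perm \<times> nat => 'a => rat" where "gcoord nu = snd (snd (proj_data nu))"

lemma lcomb_delta:
 assumes "rvs V" "finite A" "b : A" "!!a. a : A ==> x a : carrier V"
 shows "lcomb V A (%a. if a = b then r else 0) x = r \<odot>[V] x b"
proof -
 have "lcomb V {b} (%a. if a = b then r else 0) x = lcomb V A (%a. if a = b then r else 0) x"
  by (rule lcomb_mono_neutral) (use assms in auto)
 moreover have "lcomb V {b} (%a. if a = b then r else 0) x = r \<odot>[V] x b"
  using assms by (subst lcomb_insert) (auto simp: rvs_simps)
 ultimately show ?thesis by simp
qed

text \<open>The morphism from \<open>Proj nu\<close> to \<open>W\<close> that sends the generator in
  slot \<open>s\<close> to \<open>w s\<close>. By freeness, tuples in \<open>W\<close> and morphisms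
  out of \<open>Proj nu\<close> are the same data.\<close>

definition ev :: "nat multiset => 'a smod => (nat \<times> nat => 'a) => nat => 'a => 'a" where
 "ev nu W w i = (\<lambda>z\<in>cs (Proj nu i). lcomb (space (W i)) (idx nu i) (%x. gcoord nu i x z) (%(p, j). act (W i) p (w (i, j))))"

definition gtup :: "nat multiset => nat \<times> nat => 'a" where
 "gtup nu = (\<lambda>s\<in>slots nu. gen nu s)"

definition scale_tuple :: "nat multiset => 'a smod => (nat \<times> nat => rat) => (nat \<times> nat => 'a) => nat \<times> nat => 'a" where
 "scale_tuple nu W t w = (\<lambda>s\<in>slots nu. t s \<odot>[factors W s] w s)"

definition diag :: "nat multiset => (nat \<times> nat => rat) => nat => 'a => 'a" where
 "diag nu t = ev nu (Proj nu) (scale_tuple nu (Proj nu) t (gtup nu))"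

text \<open>The group acts on the tuple of generators. A later morphism replaces generators inside
  the earlier tuple, so these endomorphisms multiply in the reverse order.\<close>

definition gmor :: "nat multiset => (nat => wr) => nat => 'a => 'a" where
 "gmor nu g = ev nu (Proj nu) (wreath_act_tuple (Proj nu) nu g (gtup nu))"

abbreviation scomp :: "'a smod => (nat => 'b => 'c) => (nat => 'a => 'b) => nat => 'a => 'c" where
 "scomp U g f \<equiv> (%i. compose (cs (U i)) (g i) (f i))"

lemma scale_tuple_closed: "srep W ==> w : ptuples nu W ==> scale_tuple nu W t w : ptuples nu W"
proof (rule ptuplesI)
 assume W: "srep W" and w: "w : ptuples nu W"
 fix i j assume "(i, j) : slots nu"
 then show "scale_tuple nu W t w (i, j) : cs (W i)"
  using ptuples_mem[OF w] fdvs_rvs[OF is_repD(1)[OF W[rule_format]], of i] by (simp add: scale_tuple_def factors_def)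
qed (simp add: scale_tuple_def)

context
 assumes inf: "infinite (UNIV :: 'a set)"
begin

lemma free_smod_Proj: "free_smod nu (Proj nu :: 'a smod, gen nu, gcoord nu)"
 using someI_ex[OF free_smod_exists[OF inf, of nu]] by (simp add: Proj_def gen_def gcoord_def proj_data_def)

lemma Proj_Obj: "(Proj nu :: 'a smod) : Obj SVect"
 and Proj_srep: "srep (Proj nu :: 'a smod)"
 and gen_closed: "(i, j) : slots nu ==> gen nu (i, j) : cs (Proj nu i :: (perm, 'a) rep)"
 and gcoord_dual: "x : idx nu i ==> gcoord nu i x : dual (space (Proj nu i :: (perm, 'a) rep))"
 and gcoord_expand: "z : cs (Proj nu i :: (perm, 'a) rep) ==>
  z = lcomb (space (Proj nu i)) (idx nu i) (%x. gcoord nu i x z) (%(p, j). act (Proj nu i) p (gen nu (i, j)))"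
 and gcoord_gen: "x : idx nu i ==> (p, j) : idx nu i ==>
  gcoord nu i x (act (Proj nu i :: (perm, 'a) rep) p (gen nu (i, j))) = (if x = (p, j) then 1 else 0)"
 using free_smod_Proj[of nu] unfolding free_smod_def by auto

lemma Proj_rvs: "rvs (space (Proj nu i :: (perm, 'a) rep))"
 using Proj_srep by (intro fdvs_rvs is_repD) auto

lemma act_gen_closed: "(p, j) : idx nu i ==> act (Proj nu i) p (gen nu (i, j)) : cs (Proj nu i :: (perm, 'a) rep)"
 using Proj_srep by (intro is_repD(5)[of "sym_group i"] gen_closed) (auto simp: idx_iff)

lemma gtup_closed: "gtup nu : ptuples nu (Proj nu :: 'a smod)"
 by (rule ptuplesI) (auto simp: gtup_def gen_closed)

lemma Proj_ext:
 assumes W: "rvs W" and f: "f : mhom (space (Proj nu i :: (perm, 'a) rep)) W" and g: "g : mhom (space (Proj nu i)) W"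
  and eq: "!!p j. (p, j) : idx nu i ==> f (act (Proj nu i) p (gen nu (i, j))) = g (act (Proj nu i) p (gen nu (i, j)))"
  and z: "z : cs (Proj nu i)"
 shows "f z = g z"
proof -
 have *: "h z = lcomb W (idx nu i) (%x. gcoord nu i x z) (%x. h (case x of (p, j) => act (Proj nu i) p (gen nu (i, j))))"
  if "h : mhom (space (Proj nu i)) W" for h
  by (subst gcoord_expand[OF z], rule mhom_lcomb[OF Proj_rvs W that]) (auto intro: act_gen_closed)
 show ?thesis
  unfolding *[OF f] *[OF g] using f by (intro lcomb_cong[OF W refl]) (auto simp: eq intro!: mhom_closed[OF g] act_gen_closed)
qed

lemma ev_act_gen:
 assumes W: "srep W" and w: "w : ptuples nu W" and x: "(p, j) : idx nu i"
 shows "ev nu W w i (act (Proj nu i) p (gen nu (i, j))) = act (W i) p (w (i, j) :: 'a)"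
proof -
 have Wi: "is_rep (sym_group i) (W i)" using W by simp
 have m: "act (W i) q (w (i, k)) : cs (W i)" if "(q, k) : idx nu i" for q k
  using that by (intro is_repD(5)[OF Wi] ptuples_mem[OF w]) (auto simp: idx_iff)
 have "ev nu W w i (act (Proj nu i) p (gen nu (i, j)))
  = lcomb (space (W i)) (idx nu i) (%y. if y = (p, j) then 1 else 0) (%(q, k). act (W i) q (w (i, k)))"
  unfolding ev_def restrict_apply'[OF act_gen_closed[OF x]]
  by (rule lcomb_cong[OF fdvs_rvs[OF is_repD(1)[OF Wi]]]) (auto simp: gcoord_gen x m)
 also have "... = act (W i) p (w (i, j))"
  using m[OF x] fdvs_rvs[OF is_repD(1)[OF Wi]]
  by (subst lcomb_delta[OF fdvs_rvs[OF is_repD(1)[OF Wi]] finite_idx x]) (auto simp: m rvs_simps)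
 finally show ?thesis .
qed

lemma ev_gen:
 assumes W: "srep W" and w: "w : ptuples nu W" and s: "(i, j) : slots nu"
 shows "ev nu W w i (gen nu (i, j)) = (w (i, j) :: 'a)"
proof -
 have x: "(id, j) : idx nu i" using s by (simp add: idx_iff permutes_id)
 have "act (Proj nu i) id (gen nu (i, j)) = (gen nu (i, j) :: 'a)" "act (W i) id (w (i, j)) = w (i, j)"
  using is_repD(3)[OF Proj_srep[rule_format] gen_closed[OF s]] is_repD(3)[OF W[rule_format] ptuples_mem[OF w s]] by simp_all
 then show ?thesis using ev_act_gen[OF W w x] by simp
qed

lemma ev_hom:
 assumes W: "srep (W :: 'a smod)" and w: "w : ptuples nu W"
 shows "ev nu W w : shom (Proj nu) W"
proof (intro CollectI allI rep_homI)
 fix i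
 have Wi: "is_rep (sym_group i) (W i)" using W by simp
 have Pi: "is_rep (sym_group i) (Proj nu i :: (perm, 'a) rep)" using Proj_srep by simp
 note Wv = fdvs_rvs[OF is_repD(1)[OF Wi]]
 have m: "act (W i) q (w (i, k)) : cs (W i)" if "(q, k) : idx nu i" for q k
  using that by (intro is_repD(5)[OF Wi] ptuples_mem[OF w]) (auto simp: idx_iff)
 have m': "(case x of (q, k) => act (W i) q (w (i, k))) : cs (W i)" if "x : idx nu i" for x
  using that m by (cases x) auto
 show l: "ev nu W w i : lin (space (Proj nu i)) (space (W i))"
  unfolding ev_def
 proof (rule lin_restrict[OF _ Proj_rvs], rule mhomI)
  fix x y r assume x: "x : cs (Proj nu i :: (perm, 'a) rep)"
  let ?L = "%x. lcomb (space (W i)) (idx nu i) (%k. gcoord nu i k x) (%(p, j). act (W i) p (w (i, j)))"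
  show "?L x : cs (W i)" by (rule lcomb_closed[OF Wv m'])
  have "?L (r \<odot>[space (Proj nu i)] x) = lcomb (space (W i)) (idx nu i) (%k. r * gcoord nu i k x) (%(p, j). act (W i) p (w (i, j)))"
   by (rule lcomb_cong[OF Wv refl m']) (auto simp: dual_smult[OF gcoord_dual x])
  then show "?L (r \<odot>[space (Proj nu i)] x) = r \<odot>[space (W i)] ?L x" using lcomb_smult[OF Wv m'] by simp
  assume y: "y : cs (Proj nu i :: (perm, 'a) rep)"
  have "?L (x \<oplus>[space (Proj nu i)] y) = lcomb (space (W i)) (idx nu i) (%k. gcoord nu i k x + gcoord nu i k y) (%(p, j). act (W i) p (w (i, j)))"
   by (rule lcomb_cong[OF Wv refl m']) (auto simp: dual_add[OF gcoord_dual x y])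
  then show "?L (x \<oplus>[space (Proj nu i)] y) = ?L x \<oplus>[space (W i)] ?L y" using lcomb_add[OF Wv m'] by simp
 qed
 fix q z assume q: "q : carrier (sym_group i)" and z: "z : cs (Proj nu i :: (perm, 'a) rep)"
 show "ev nu W w i (act (Proj nu i) q z) = act (W i) q (ev nu W w i z)"
 proof (rule Proj_ext[OF Wv mhom_comp[OF is_repD(2)[OF Pi q] lin_mhom[OF l]] mhom_comp[OF lin_mhom[OF l] is_repD(2)[OF Wi q]] _ z])
  fix p j assume x: "(p, j) : idx nu i"
  then have p: "p : carrier (sym_group i)" and s: "(i, j) : slots nu" by (auto simp: idx_iff)
  have qp: "(q \<circ> p, j) : idx nu i" using x q by (auto simp: idx_iff permutes_compose)
  show "ev nu W w i (act (Proj nu i) q (act (Proj nu i) p (gen nu (i, j)))) = act (W i) q (ev nu W w i (act (Proj nu i) p (gen nu (i, j))))"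
   by (simp only: is_repD(4)[OF Pi q p gen_closed[OF s], symmetric, unfolded sym_group_simps]
    is_repD(4)[OF Wi q p ptuples_mem[OF w s], symmetric, unfolded sym_group_simps]
    ev_act_gen[OF W w x] ev_act_gen[OF W w qp])
 qed
qed

lemma ev_unique:
 assumes W: "srep (W :: 'a smod)" and f: "f : shom (Proj nu) W" and w: "w : ptuples nu W"
  and eq: "!!i j. (i, j) : slots nu ==> f i (gen nu (i, j)) = w (i, j)"
 shows "f = ev nu W w"
proof
 fix i
 have Wi: "is_rep (sym_group i) (W i)" using W by simp
 have fi: "f i : rep_hom (sym_group i) (Proj nu i) (W i)" and evi: "ev nu W w i : rep_hom (sym_group i) (Proj nu i) (W i)"
  using f ev_hom[OF W w] by auto
 show "f i = ev nu W w i"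
 proof (rule lin_eqI[OF rep_homD(1)[OF fi] rep_homD(1)[OF evi]])
  fix z assume z: "z : cs (Proj nu i :: (perm, 'a) rep)"
  show "f i z = ev nu W w i z"
  proof (rule Proj_ext[OF fdvs_rvs[OF is_repD(1)[OF Wi]] rep_homD(2)[OF fi] rep_homD(2)[OF evi] _ z])
   fix p j assume x: "(p, j) : idx nu i"
   then have p: "p : carrier (sym_group i)" and s: "(i, j) : slots nu" by (auto simp: idx_iff)
   show "f i (act (Proj nu i) p (gen nu (i, j))) = ev nu W w i (act (Proj nu i) p (gen nu (i, j)))"
    using rep_homD(3)[OF fi p gen_closed[OF s]] eq[OF s] by (simp add: ev_act_gen[OF W w x])
  qed
 qed
qed

lemma ev_comp:
 assumes W: "srep (W :: 'a smod)" and W': "srep (W' :: 'a smod)" and f: "f : shom W W'" and w: "w : ptuples nu W"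
 shows "scomp (Proj nu) f (ev nu W w) = ev nu W' (map_tuple f nu w)"
proof (rule ev_unique[OF W' shom_compose[OF Proj_srep ev_hom[OF W w] f] map_tuple_closed[OF f w]])
 fix i j assume s: "(i, j) : slots nu"
 show "compose (cs (Proj nu i)) (f i) (ev nu W w i) (gen nu (i, j)) = map_tuple f nu w (i, j)"
  using s gen_closed[OF s] by (simp add: compose_def ev_gen[OF W w s])
qed

lemma map_tuple_ev_gtup:
 assumes W: "srep (W :: 'a smod)" and w: "w : ptuples nu W"
 shows "map_tuple (ev nu W w) nu (gtup nu) = w"
proof
 fix s show "map_tuple (ev nu W w) nu (gtup nu) s = w s"
  using ev_gen[OF W w] ptuples_undefined[OF w] by (cases s; cases "s : slots nu") (auto simp: gtup_def)
qed

lemma diag_hom: "diag nu t : shom (Proj nu :: 'a smod) (Proj nu)"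
 unfolding diag_def by (intro ev_hom Proj_srep scale_tuple_closed gtup_closed)

lemma gmor_hom: "g : SG nu ==> gmor nu g : shom (Proj nu :: 'a smod) (Proj nu)"
 unfolding gmor_def by (intro ev_hom Proj_srep act_tuple_closed gtup_closed)

text \<open>Precomposition with \<open>diag nu t\<close> scales the entries of the tuple. On the
  multilinear part this becomes homogeneity of degree one in every entry.\<close>

lemma ev_diag:
 assumes W: "srep (W :: 'a smod)" and w: "w : ptuples nu W"
 shows "scomp (Proj nu) (ev nu W w) (diag nu t) = ev nu W (scale_tuple nu W t w)"
proof -
 have "map_tuple (ev nu W w) nu (scale_tuple nu (Proj nu) t (gtup nu)) = scale_tuple nu W t w"
 proof
  fix s :: "nat \<times> nat"
  obtain i j where s: "s = (i, j)" by (cases s)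
  have "ev nu W w i : rep_hom (sym_group i) (Proj nu i) (W i)" using ev_hom[OF W w] by auto
  note m = mhom_smult[OF rep_homD(2)[OF this] gen_closed]
  show "map_tuple (ev nu W w) nu (scale_tuple nu (Proj nu) t (gtup nu)) s = scale_tuple nu W t w s"
   using ev_gen[OF W w] m by (cases "s : slots nu") (auto simp: s gtup_def scale_tuple_def factors_def)
 qed
 then show ?thesis
  unfolding diag_def by (subst ev_comp[OF Proj_srep W ev_hom[OF W w] scale_tuple_closed[OF Proj_srep gtup_closed]]) simp
qed

lemma ev_gmor:
 assumes W: "srep (W :: 'a smod)" and w: "w : ptuples nu W" and g: "g : SG nu"
 shows "scomp (Proj nu) (ev nu W w) (gmor nu g) = ev nu W (wreath_act_tuple W nu g w)"
 unfolding gmor_def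
 by (subst ev_comp[OF Proj_srep W ev_hom[OF W w] act_tuple_closed[OF Proj_srep g gtup_closed]])
  (simp add: map_tuple_act[OF ev_hom[OF W w] g gtup_closed] map_tuple_ev_gtup[OF W w])

lemma gmor_gmor:
 assumes g: "g : SG nu" and h: "h : SG nu"
 shows "scomp (Proj nu :: 'a smod) (gmor nu g) (gmor nu h) = gmor nu (h \<otimes>[S_nu nu] g)"
 unfolding gmor_def[of nu g] ev_gmor[OF Proj_srep act_tuple_closed[OF Proj_srep g gtup_closed] h]
 by (simp add: gmor_def act_tuple_mult[OF Proj_srep h g gtup_closed])

lemma ev_gtup: "ev nu (Proj nu) (gtup nu) = (%i. \<lambda>v\<in>cs (Proj nu i :: (perm, 'a) rep). v)"
 using Proj_srep gen_closed
 by (intro ev_unique[symmetric] gtup_closed) (auto simp: rep_hom_id gtup_def)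

lemma diag_one: "diag nu (%_. 1) = (%i. \<lambda>v\<in>cs (Proj nu i :: (perm, 'a) rep). v)"
proof -
 have "scale_tuple nu (Proj nu) (%_. 1) (gtup nu) = (gtup nu :: nat \<times> nat => 'a)"
  using rvs_simps(3)[OF Proj_rvs gen_closed] by (auto simp: scale_tuple_def gtup_def factors_def fun_eq_iff)
 then show ?thesis by (simp add: diag_def ev_gtup)
qed

lemma diag_diag: "scomp (Proj nu) (diag nu t) (diag nu u) = (diag nu (%s. t s * u s) :: nat => 'a => 'a)"
proof -
 have "scale_tuple nu (Proj nu) u (scale_tuple nu (Proj nu) t (gtup nu)) = (scale_tuple nu (Proj nu) (%s. t s * u s) (gtup nu) :: nat \<times> nat => 'a)"
  using rvs_simps(6)[OF Proj_rvs gen_closed]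
  by (auto simp: scale_tuple_def gtup_def factors_def fun_eq_iff mult.commute)
 then show ?thesis
  unfolding diag_def[of nu t] ev_diag[OF Proj_srep scale_tuple_closed[OF Proj_srep gtup_closed]] by (simp add: diag_def)
qed

text \<open>Moving a scaling past a permutation of the slots permutes the scalars. Their product is
  unchanged, and therefore the \<open>gmor nu g\<close> preserve the multilinear part.\<close>

lemma gmor_diag_gmor:
 assumes g: "g : SG nu"
 shows "scomp (Proj nu) (diag nu t) (gmor nu g) = (scomp (Proj nu) (gmor nu g) (diag nu (%(i, j). t (i, inv_into UNIV (fst (g i)) j))) :: nat => 'a => 'a)"
proof -
 note st = scale_tuple_closed[OF Proj_srep gtup_closed] and at = act_tuple_closed[OF Proj_srep g gtup_closed]
 have "wreath_act_tuple (Proj nu) nu g (scale_tuple nu (Proj nu) t (gtup nu))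
  = (scale_tuple nu (Proj nu) (%(i, j). t (i, inv_into UNIV (fst (g i)) j)) (wreath_act_tuple (Proj nu) nu g (gtup nu)) :: nat \<times> nat => 'a)"
 proof
  fix s :: "nat \<times> nat"
  obtain i j where s: "s = (i, j)" by (cases s)
  show "wreath_act_tuple (Proj nu) nu g (scale_tuple nu (Proj nu) t (gtup nu)) s
   = (scale_tuple nu (Proj nu) (%(i, j). t (i, inv_into UNIV (fst (g i)) j)) (wreath_act_tuple (Proj nu) nu g (gtup nu)) s :: 'a)"
  proof (cases "s : slots nu")
   case True
   then have ij: "(i, j) : slots nu" using s by simp
   note * = S_nu_inv_slot[OF g ij]
   have "snd (g i) (inv_into UNIV (fst (g i)) j) : carrier (sym_group i)" using * by simp
   from mhom_smult[OF is_repD(2)[OF Proj_srep[rule_format] this] gen_closed[OF *(1)]]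
   show ?thesis using ij * by (simp add: s act_tuple_simps scale_tuple_def gtup_def factors_def)
  qed (simp add: act_tuple_simps scale_tuple_def)
 qed
 then show ?thesis
  unfolding diag_def[of nu t] ev_gmor[OF Proj_srep st g] 
  unfolding gmor_def ev_diag[OF Proj_srep at] by simp
qed

end

subsection \<open>The multilinear part of the tensor powers\<close>

text \<open>The rationals as a space over themselves, so that functionals on tensor products can be
  obtained from the universal property.\<close>

definition rat_vs :: "rat qvs" where
 "rat_vs = mk_qvs UNIV 0 (+) (*)"

lemma rvs_rat_vs: "rvs rat_vs"
 by (rule rvsI) (auto simp: rat_vs_def algebra_simps)

lemma lin_rat_vs_dual:
 assumes "L : lin V rat_vs"
 shows "L : dual V"
 using mhom_add[OF lin_mhom[OF assms]] mhom_smult[OF lin_mhom[OF assms]]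
 by (intro dualI) (simp_all add: rat_vs_def)

lemma multilinear_prod_functionals:
 assumes J: "finite J" and l: "!!k. k : J ==> l k : dual (X k)" and X: "!!k. k : J ==> rvs (X k)"
 shows "multilinear J X rat_vs (%w. PROD k:J. l k (w k))"
proof -
 have upd: "(PROD m:J. l m ((w(k := a)) m)) = l k a * (PROD m:J - {k}. l m (w m))" if k: "k : J" for w k a
 proof -
  have "(PROD m:J - {k}. l m ((w(k := a)) m)) = (PROD m:J - {k}. l m (w m))" by (rule prod.cong) auto
  then show ?thesis using prod.remove[OF J k, of "%m. l m ((w(k := a)) m)"] by simp
 qed
 show ?thesis
  unfolding multilinear_def
 proof (intro conjI ballI allI)
  fix w k a b r assume k: "k : J" and a: "a : carrier (X k)"
  show "(PROD m:J. l m ((w(k := r \<odot>[X k] a)) m)) = r \<odot>[rat_vs] (PROD m:J. l m ((w(k := a)) m))"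
   unfolding upd[OF k] by (simp add: rat_vs_def dual_smult[OF l[OF k] a])
  assume b: "b : carrier (X k)"
  show "(PROD m:J. l m ((w(k := a \<oplus>[X k] b)) m)) = (PROD m:J. l m ((w(k := a)) m)) \<oplus>[rat_vs] (PROD m:J. l m ((w(k := b)) m))"
   unfolding upd[OF k] by (simp add: rat_vs_def dual_add[OF l[OF k] a b] distrib_right)
 qed (simp add: rat_vs_def)
qed

lemma lcomb_scale:
 assumes "rvs V" "!!i. i : A ==> x i : carrier V"
 shows "lcomb V A c (%i. t i \<odot>[V] x i) = lcomb V A (%i. c i * t i) x"
proof -
 interpret vectorspace class_ring V by fact
 show ?thesis unfolding lcomb_def using assms by (intro finsum_cong') (auto simp: rvs_simps)
qed

lemma lcomb_functionals_mhom:
 assumes W: "rvs W" and l: "!!i. i : A ==> l i : dual V" and y: "!!i. i : A ==> y i : carrier W"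
 shows "(%z. lcomb W A (%i. l i z) y) : mhom V W"
proof (rule mhomI)
 fix x z r assume x: "x : carrier V"
 show "lcomb W A (%i. l i x) y : carrier W" by (rule lcomb_closed[OF W y])
 have "lcomb W A (%i. l i (r \<odot>[V] x)) y = lcomb W A (%i. r * l i x) y"
  by (rule lcomb_cong[OF W refl y]) (simp_all add: dual_smult[OF l x])
 then show "lcomb W A (%i. l i (r \<odot>[V] x)) y = r \<odot>[W] lcomb W A (%i. l i x) y"
  using lcomb_smult[OF W y] by simp
 assume z: "z : carrier V"
 have "lcomb W A (%i. l i (x \<oplus>[V] z)) y = lcomb W A (%i. l i x + l i z) y"
  by (rule lcomb_cong[OF W refl y]) (simp_all add: dual_add[OF l x z])
 then show "lcomb W A (%i. l i (x \<oplus>[V] z)) y = lcomb W A (%i. l i x) y \<oplus>[W] lcomb W A (%i. l i z) y"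
  using lcomb_add[OF W y] by simp
qed

lemma lcomb_maps_mhom:
 assumes V: "rvs V" and W: "rvs W" and f: "!!i. i : A ==> f i : mhom V W"
 shows "(%z. lcomb W A c (%i. f i z)) : mhom V W"
proof -
 interpret W: vectorspace class_ring W by fact
 note fd = mhom_closed[OF f] mhom_add[OF f] mhom_smult[OF f]
 show ?thesis
 proof (rule mhomI)
  fix x z r assume x: "x : carrier V"
  show "lcomb W A c (%i. f i x) : carrier W" by (rule lcomb_closed[OF W fd(1)[OF _ x]])
  have "lcomb W A c (%i. f i (r \<odot>[V] x)) = lcomb W A c (%i. r \<odot>[W] f i x)"
   by (rule lcomb_cong[OF W refl]) (simp_all add: fd(3)[OF _ x] fd(1)[OF _ x] W)
  also have "... = lcomb W A (%i. c i * r) (%i. f i x)" by (rule lcomb_scale[OF W fd(1)[OF _ x]])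
  also have "... = r \<odot>[W] lcomb W A c (%i. f i x)"
   unfolding mult.commute[of _ r] by (rule lcomb_smult[OF W fd(1)[OF _ x]])
  finally show "lcomb W A c (%i. f i (r \<odot>[V] x)) = r \<odot>[W] lcomb W A c (%i. f i x)" .
  assume z: "z : carrier V"
  have "lcomb W A c (\<lambda>i. f i (x \<oplus>[V] z)) = (\<Oplus>\<^bsub>W\<^esub>i\<in>A. c i \<odot>[W] f i x \<oplus>[W] c i \<odot>[W] f i z)"
   unfolding lcomb_def using W
   by (intro W.finsum_cong') (auto simp: fd(2)[OF _ x z] fd(1)[OF _ x] fd(1)[OF _ z] rvs_distrib(2))
  also have "... = lcomb W A c (%i. f i x) \<oplus>[W] lcomb W A c (%i. f i z)"
   unfolding lcomb_def using W by (intro W.finsum_addf) (auto simp: fd(1)[OF _ x] fd(1)[OF _ z])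
  finally show "lcomb W A c (%i. f i (x \<oplus>[V] z)) = lcomb W A c (%i. f i x) \<oplus>[W] lcomb W A c (%i. f i z)" .
 qed
qed

lemma lsub_lcombs:
 assumes V: "rvs V" and y: "!!i. i : A ==> y i : carrier V"
 shows "lsub V (range (%c. lcomb V A c y))"
 unfolding lsub_def
proof (intro conjI ballI allI)
 show "range (%c. lcomb V A c y) <= carrier V" by (auto intro!: lcomb_closed[of V A y, OF V y])
 show "\<zero>[V] : range (%c. lcomb V A c y)" by (rule range_eqI[where x = "%_. 0"], rule lcomb_zero[of V A y, OF V y, symmetric])
 fix x z r assume "x : range (%c. lcomb V A c y)"
 then obtain c where c: "x = lcomb V A c y" by blast
 show "r \<odot>[V] x : range (%c. lcomb V A c y)" unfolding c
  by (rule range_eqI[where x = "%i. r * c i"], rule lcomb_smult[of V A y, OF V y, symmetric])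
 assume "z : range (%c. lcomb V A c y)"
 then obtain d where d: "z = lcomb V A d y" by blast
 show "x \<oplus>[V] z : range (%c. lcomb V A c y)" unfolding c d
  by (rule range_eqI[where x = "%i. c i + d i"], rule lcomb_add[of V A y, OF V y, symmetric])
qed

lemma tpow_rvs: "srep W ==> rvs (tpow nu W)"
 using svs_tensor_power by blast

lemma pten_closed: "srep W ==> w : ptuples nu W ==> pten nu W w : carrier (tpow nu W)"
 by (intro pure_tensor_closed factors_rvs)

lemma tpow_ext:
 assumes "srep W" "rvs V" "f : mhom (tpow nu W) V" "g : mhom (tpow nu W) V"
  and "!!w. w : ptuples nu W ==> f (pten nu W w) = g (pten nu W w)" and "z : carrier (tpow nu W)"
 shows "f z = g z"
 by (rule tensor_ext[of "slots nu" "factors W", OF factors_rvs[OF assms(1)] assms(2-6)])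

section \<open>Pure tensors of basis vectors of the free objects\<close>

definition slot_map :: "(nat \<times> nat => perm \<times> nat) => nat \<times> nat => nat \<times> nat" where
 "slot_map b k = (fst k, snd (b k))"

definition basis_tuple :: "nat multiset => nat multiset => (nat \<times> nat => perm \<times> nat) => nat \<times> nat => 'a" where
 "basis_tuple nu nu' b = (\<lambda>k\<in>slots nu'. act (Proj nu (fst k)) (fst (b k)) (gen nu (slot_map b k)))"

abbreviation basis_labels :: "nat multiset => nat multiset => (nat \<times> nat => perm \<times> nat) set" where
 "basis_labels nu nu' \<equiv> (\<Pi>\<^sub>E k\<in>slots nu'. idx nu (fst k))"

text \<open>Labels that use every generator of \<open>Proj nu\<close> exactly once. Their pure
  tensors span the part of the tensor power on which scaling the generators multiplies by the
  product of all scalars.\<close>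

definition bijective_labels :: "nat multiset => nat multiset => (nat \<times> nat => perm \<times> nat) set" where
 "bijective_labels nu nu' = {b : basis_labels nu nu'. bij_betw (slot_map b) (slots nu') (slots nu)}"

lemma slot_map_closed: "b : basis_labels nu nu' ==> k : slots nu' ==> slot_map b k : slots nu"
 using PiE_mem[of b "slots nu'" "%k. idx nu (fst k)" k] by (cases "b k") (auto simp: idx_iff slot_map_def)

text \<open>A label keeps the degree of a slot, so a bijection of slots preserves the number of
  slots in each degree, which is the multiplicity of that part.\<close>

lemma bijective_labels_empty:
 assumes "nu' ~= nu"
 shows "bijective_labels nu nu' = {}"
proof (rule ccontr)
 assume "bijective_labels nu nu' ~= {}"
 then obtain b where b: "bij_betw (slot_map b) (slots nu') (slots nu)" by (auto simp: bijective_labels_def)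
 have "count nu' i = count nu i" for i
 proof -
  have c: "card {s : slots \<mu>. fst s = i} = count \<mu> i" for \<mu>
  proof -
   have "{s : slots \<mu>. fst s = i} = Pair i ` {1..count \<mu> i}" by (auto simp: slots_def)
   then show ?thesis by (simp add: card_image inj_on_def)
  qed
  have "slot_map b ` {s : slots nu'. fst s = i} = {s : slots nu. fst s = i}"
  proof
   show "slot_map b ` {s : slots nu'. fst s = i} <= {s : slots nu. fst s = i}"
    using bij_betwE[OF b] by (auto simp: slot_map_def)
   show "{s : slots nu. fst s = i} <= slot_map b ` {s : slots nu'. fst s = i}"
   proof
    fix s assume s: "s : {s : slots nu. fst s = i}"
    then have "s : slot_map b ` slots nu'" using b by (simp add: bij_betw_def)
    then obtain s' where "s' : slots nu'" "s = slot_map b s'" by blast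
    then show "s : slot_map b ` {s : slots nu'. fst s = i}" using s by (auto simp: slot_map_def)
   qed
  qed
  moreover have "inj_on (slot_map b) {s : slots nu'. fst s = i}"
   by (rule inj_on_subset[OF bij_betw_imp_inj_on[OF b]]) auto
  ultimately show ?thesis using card_image[of "slot_map b" "{s : slots nu'. fst s = i}"] c by simp
 qed
 then show False using assms by (auto intro: multiset_eqI)
qed

text \<open>The coordinate of the tensor of all generators, with identity permutations, in the basis
  of pure tensors of basis vectors.\<close>

definition ucoord :: "nat multiset => 'a tens => rat" where
 "ucoord nu = (SOME l. l : dual (tpow nu (Proj nu :: 'a smod)) &
  (ALL w:ptuples nu (Proj nu :: 'a smod). l (pten nu (Proj nu) w) = (PROD k:slots nu. gcoord nu (fst k) (id, snd k) (w k))))"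

text \<open>The translates of the tensor of all generators; the group permutes them freely.\<close>

definition uten :: "nat multiset => (nat => wr) => 'a tens" where
 "uten nu g = pten nu (Proj nu) (wreath_act_tuple (Proj nu) nu g (gtup nu))"

context
 assumes inf: "infinite (UNIV :: 'a set)"
begin

lemmas Psrep = Proj_srep[OF inf] and Pgtup = gtup_closed[OF inf]

lemma ucoord_props:
 shows "ucoord nu : dual (tpow nu (Proj nu :: 'a smod))"
  and "w : ptuples nu (Proj nu :: 'a smod) ==> ucoord nu (pten nu (Proj nu) w) = (PROD k:slots nu. gcoord nu (fst k) (id, snd k) (w k))"
proof -
 let ?P = "Proj nu :: 'a smod"
 have d: "gcoord nu (fst k) (id, snd k) : dual (factors ?P k)" if "k : slots nu" for k
  using gcoord_dual[OF inf, of "(id, snd k)" nu "fst k"] that by (cases k) (simp add: factors_def idx_iff permutes_id)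
 note ml = multilinear_prod_functionals[of "slots nu" "%k. gcoord nu (fst k) (id, snd k)" "factors ?P", OF finite_slots d factors_rvs[OF Psrep]]
 obtain L where L: "L : lin (tpow nu ?P) rat_vs" "ALL w:ptuples nu ?P. L (pten nu ?P w) = (PROD k:slots nu. gcoord nu (fst k) (id, snd k) (w k))"
  using tensor_lift[of "slots nu" "factors ?P", OF factors_rvs[OF Psrep] rvs_rat_vs ml] by blast
 from someI[of "%l. l : dual (tpow nu ?P) & (ALL w:ptuples nu ?P. l (pten nu ?P w) = (PROD k:slots nu. gcoord nu (fst k) (id, snd k) (w k)))",
   OF conjI[OF lin_rat_vs_dual[OF L(1)] L(2)]]
 show "ucoord nu : dual (tpow nu ?P)"
  "w : ptuples nu ?P ==> ucoord nu (pten nu ?P w) = (PROD k:slots nu. gcoord nu (fst k) (id, snd k) (w k))"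
  unfolding ucoord_def by blast+
qed

lemma uten_closed: "g : SG nu ==> uten nu g : carrier (tpow nu (Proj nu :: 'a smod))"
 unfolding uten_def by (intro pten_closed Psrep act_tuple_closed Pgtup)

lemma act_uten:
 assumes "g : SG nu" "h : SG nu"
 shows "act (tensor_power (Proj nu :: 'a smod) nu) h (uten nu g) = uten nu (h \<otimes>[S_nu nu] g)"
 unfolding uten_def
 by (simp add: tensor_power_act(2)[OF Psrep assms(2)] act_tuple_closed[OF Psrep assms(1) Pgtup]
   act_tuple_mult[OF Psrep assms(2,1) Pgtup])

text \<open>Only the identity leaves every generator in its slot and untwisted; any other element
  makes one factor of the product vanish.\<close>

lemma ucoord_uten:
 assumes g: "g : SG nu"
 shows "ucoord nu (uten nu g :: 'a tens) = (if g = \<one>[S_nu nu] then 1 else 0)"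
proof -
 let ?P = "Proj nu :: 'a smod"
 have val: "gcoord nu (fst k) (id, snd k) (wreath_act_tuple ?P nu g (gtup nu) k)
  = (if snd (g (fst k)) (inv_into UNIV (fst (g (fst k))) (snd k)) = id & inv_into UNIV (fst (g (fst k))) (snd k) = snd k then 1 else 0)"
  if k: "k : slots nu" for k
 proof -
  obtain i j where ij: "k = (i, j)" "(i, j) : slots nu" using k by (cases k) auto
  note * = S_nu_inv_slot[OF g ij(2)]
  show ?thesis
   using ij * gcoord_gen[OF inf, of "(id, j)" nu i "snd (g i) (inv_into UNIV (fst (g i)) j)" "inv_into UNIV (fst (g i)) j"]
   by (auto simp: act_tuple_simps gtup_def idx_iff permutes_id)
 qed
 have "ucoord nu (uten nu g :: 'a tens) = (PROD k:slots nu. if snd (g (fst k)) (inv_into UNIV (fst (g (fst k))) (snd k)) = id & inv_into UNIV (fst (g (fst k))) (snd k) = snd k then 1 else 0)"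
  unfolding uten_def ucoord_props(2)[OF act_tuple_closed[OF Psrep g Pgtup]] by (rule prod.cong[OF refl val])
 also have "... = (if g = \<one>[S_nu nu] then 1 else 0)"
 proof (cases "g = \<one>[S_nu nu]")
  case True
  then show ?thesis by (auto simp: S_nu_one inv_id slots_iff intro!: prod.neutral)
 next
  case False
  have "EX k:slots nu. \<not> (snd (g (fst k)) (inv_into UNIV (fst (g (fst k))) (snd k)) = id & inv_into UNIV (fst (g (fst k))) (snd k) = snd k)"
  proof (rule ccontr)
   assume "\<not> ?thesis"
   then have *: "inv_into UNIV (fst (g i)) j = j" "snd (g i) j = id" if "j : {1..count nu i}" for i j
    using that unfolding slots_iff[symmetric] by force+
   have "g i = \<one>[S_nu nu] i" for i
   proof -
    note p = S_nu_mem(1)[OF g, of i]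
    have "fst (g i) j = j" for j
    proof (cases "j : {1..count nu i}")
    case True
    then show ?thesis using *(1)[OF True] permutes_inverses(1)[OF p, of j] by simp
    qed (rule permutes_not_in[OF p])
    moreover have "snd (g i) j = (\<lambda>j\<in>{1..count nu i}. id) j" for j
    using *(2)[of j i] S_nu_mem(3)[OF g, of j i] by (cases "j : {1..count nu i}") auto
    ultimately show ?thesis by (simp add: S_nu_one prod_eq_iff fun_eq_iff)
   qed
   then show False using False by blast
  qed
  then show ?thesis using finite_slots[of nu] False by (auto intro: prod_zero)
 qed
 finally show ?thesis .
qed

lemma basis_tuple_closed:
 assumes b: "b : basis_labels nu nu'"
 shows "basis_tuple nu nu' b : ptuples nu' (Proj nu :: 'a smod)"
proof (rule ptuplesI)
 fix i j assume ij: "(i, j) : slots nu'"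
 then have "b (i, j) : idx nu i" using PiE_mem[OF b ij] by simp
 then show "basis_tuple nu nu' b (i, j) : cs (Proj nu i :: (perm, 'a) rep)"
  using ij act_gen_closed[OF inf, of "fst (b (i, j))" "snd (b (i, j))"] by (simp add: basis_tuple_def slot_map_def)
qed (simp add: basis_tuple_def)

text \<open>Bijective labels and elements of the wreath products are the same data: a permutation of
  the slots in every degree, and a permutation in \<open>S_i\<close> for every slot.\<close>

lemma bijective_label_tuple:
 assumes "b : bijective_labels nu nu"
 shows "EX g:SG nu. pten nu (Proj nu) (basis_tuple nu nu b) = (uten nu g :: 'a tens)"
proof -
 have b: "b : basis_labels nu nu" and bb: "bij_betw (slot_map b) (slots nu) (slots nu)"
  using assms by (auto simp: bijective_labels_def)
 have bm: "fst (b (i, j)) permutes {1..i}" "snd (b (i, j)) : {1..count nu i}" if "j : {1..count nu i}" for i j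
 proof -
  have "(i, j) : slots nu" using that by (simp add: slots_iff)
  from PiE_mem[OF b this] show "fst (b (i, j)) permutes {1..i}" "snd (b (i, j)) : {1..count nu i}"
   by (cases "b (i, j)"; simp add: idx_def)+
 qed
 \<comment> \<open>Continued by the identity outside the slots, as \<open>permutes\<close>
   demands.\<close>
 define t where "t i j = (if j : {1..count nu i} then snd (b (i, j)) else j)" for i j
 have t: "t i permutes {1..count nu i}" for i
 proof (rule bij_imp_permutes)
  have "inj_on (t i) {1..count nu i}"
  proof (rule inj_onI)
   fix j j' assume jj: "j : {1..count nu i}" "j' : {1..count nu i}" "t i j = t i j'"
   then have "slot_map b (i, j) = slot_map b (i, j')" by (simp add: t_def slot_map_def)
   moreover have "(i, j) : slots nu" "(i, j') : slots nu" using jj by (simp_all add: slots_iff)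
   ultimately show "j = j'" using bb by (auto simp: bij_betw_def dest: inj_onD)
  qed
  moreover have "t i ` {1..count nu i} <= {1..count nu i}" using bm(2)[of _ i] by (auto simp: t_def)
  ultimately show "bij_betw (t i) {1..count nu i} {1..count nu i}"
   using endo_inj_surj[of "{1..count nu i}" "t i"] by (simp add: bij_betw_def)
  show "t i x = x" if "x ~: {1..count nu i}" for x unfolding t_def using that by (rule if_not_P)
 qed
 \<comment> \<open>The new factor at \<open>j\<close> has to come from position
   \<open>t i j\<close>, whereas the action moves factors forward; hence the inverse of
   \<open>t i\<close>, also in the index of the twists.\<close>
 define g where "g i = (inv_into UNIV (t i), \<lambda>j\<in>{1..count nu i}. fst (b (i, inv_into UNIV (t i) j)))" for i
 have ti: "inv_into UNIV (t i) j : {1..count nu i}" if "j : {1..count nu i}" for i j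
  using iffD2[OF permutes_in_image[OF permutes_inv[OF t]] that] .
 have "g : SG nu"
  unfolding S_nu_def carrier_product_group
 proof (rule PiE_I)
  fix i
  show "g i : carrier (wreath i (count nu i))"
   using permutes_inv[OF t[of i]] bm(1)[OF ti] by (simp add: g_def)
 qed simp
 moreover have "basis_tuple nu nu b = (wreath_act_tuple (Proj nu) nu g (gtup nu) :: _ => 'a)"
 proof
  fix k :: "nat \<times> nat"
  obtain i j where k: "k = (i, j)" by (cases k)
  show "basis_tuple nu nu b k = (wreath_act_tuple (Proj nu) nu g (gtup nu) k :: 'a)"
  proof (cases "k : slots nu")
   case True
   then have ij: "(i, j) : slots nu" "j : {1..count nu i}" using k by (simp_all add: slots_iff)
   have inv: "inv_into UNIV (inv_into UNIV (t i)) j = t i j" by (simp add: inv_inv_eq[OF permutes_bij[OF t]])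
   have tj: "t i j : {1..count nu i}" "t i j = snd (b (i, j))" using bm(2)[OF ij(2)] ij(2) by (simp_all add: t_def)
   have "(i, t i j) : slots nu" using tj(1) by (simp add: slots_iff)
   moreover have "inv_into UNIV (t i) (snd (b (i, j))) = j"
    using permutes_inverses(2)[OF t, of i j] unfolding tj(2) .
   ultimately show ?thesis
    using ij tj by (simp add: k basis_tuple_def act_tuple_simps g_def inv gtup_def slot_map_def)
  qed (simp add: basis_tuple_def act_tuple_simps)
 qed
 ultimately show ?thesis unfolding uten_def by (intro bexI[of _ g]) simp_all
qed

lemma diag_expand:
 assumes z: "z : cs (Proj nu i :: (perm, 'a) rep)"
 shows "diag nu t i z = lcomb (space (Proj nu i)) (idx nu i) (%x. gcoord nu i x z * t (i, snd x))
  (%x. act (Proj nu i) (fst x) (gen nu (i, snd x)))"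
proof -
 let ?P = "Proj nu :: 'a smod"
 have "diag nu t i z = lcomb (space (?P i)) (idx nu i) (%x. gcoord nu i x z) (%(p, j). act (?P i) p (scale_tuple nu ?P t (gtup nu) (i, j)))"
  using z by (simp add: diag_def ev_def)
 also have "... = lcomb (space (?P i)) (idx nu i) (%x. gcoord nu i x z) (%x. t (i, snd x) \<odot>[space (?P i)] act (?P i) (fst x) (gen nu (i, snd x)))"
 proof (rule lcomb_cong[OF Proj_rvs[OF inf] refl _ refl])
  fix x assume "x : idx nu i"
  then obtain p j where x: "x = (p, j)" "(p, j) : idx nu i" by (cases x) auto
  then have s: "(i, j) : slots nu" and p: "p : carrier (sym_group i)" by (auto simp: idx_iff)
  show e: "(case x of (p, j) => act (?P i) p (scale_tuple nu ?P t (gtup nu) (i, j)))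
   = t (i, snd x) \<odot>[space (?P i)] act (?P i) (fst x) (gen nu (i, snd x))"
   using mhom_smult[OF is_repD(2)[OF Psrep[rule_format] p] gen_closed[OF inf s]] s
   by (simp add: x scale_tuple_def factors_def gtup_def)
  show "(case x of (p, j) => act (?P i) p (scale_tuple nu ?P t (gtup nu) (i, j))) : cs (?P i)"
   unfolding e using act_gen_closed[OF inf x(2)] Proj_rvs[OF inf] by (simp add: x(1))
 qed
 also have "... = lcomb (space (?P i)) (idx nu i) (%x. gcoord nu i x z * t (i, snd x)) (%x. act (?P i) (fst x) (gen nu (i, snd x)))"
  by (rule lcomb_scale[OF Proj_rvs[OF inf]]) (auto intro: act_gen_closed[OF inf])
 finally show ?thesis .
qed

text \<open>Expanding every entry in the basis of \<open>Proj nu\<close> exhibits the value as a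
  polynomial in the scalars: a label contributes the product of the scalars at the slots that it
  uses.\<close>

lemma diag_pure_functional:
 assumes w: "w : ptuples nu' (Proj nu :: 'a smod)" and l: "l : dual (tpow nu' (Proj nu))"
 shows "l (pten nu' (Proj nu) (map_tuple (diag nu t) nu' w))
  = (SUM b:basis_labels nu nu'. ((PROD k:slots nu'. gcoord nu (fst k) (b k) (w k)) * l (pten nu' (Proj nu) (basis_tuple nu nu' b)))
    * (PROD k:slots nu'. t (slot_map b k)))"
proof -
 let ?P = "Proj nu :: 'a smod"
 have "map_tuple (diag nu t) nu' w = (\<lambda>k\<in>slots nu'. lcomb (factors ?P k) (idx nu (fst k))
   (%x. gcoord nu (fst k) x (w k) * t (fst k, snd x)) (%x. act (?P (fst k)) (fst x) (gen nu (fst k, snd x))))"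
 proof
  fix k show "map_tuple (diag nu t) nu' w k = (\<lambda>k\<in>slots nu'. lcomb (factors ?P k) (idx nu (fst k))
   (%x. gcoord nu (fst k) x (w k) * t (fst k, snd x)) (%x. act (?P (fst k)) (fst x) (gen nu (fst k, snd x)))) k"
   using diag_expand[OF ptuples_mem[OF w]] by (cases k; cases "k : slots nu'") (simp_all add: factors_def)
 qed
 then have "l (pten nu' ?P (map_tuple (diag nu t) nu' w))
  = (SUM b:basis_labels nu nu'. (PROD k:slots nu'. gcoord nu (fst k) (b k) (w k) * t (fst k, snd (b k)))
   * l (pten nu' ?P (\<lambda>k\<in>slots nu'. act (?P (fst k)) (fst (b k)) (gen nu (fst k, snd (b k))))))"
  by (simp only:, intro tensor_functional_expand[of "slots nu'" "factors ?P" l "%k. idx nu (fst k)"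
    "%k x. act (?P (fst k)) (fst x) (gen nu (fst k, snd x))" "%k x. gcoord nu (fst k) x (w k) * t (fst k, snd x)",
    OF factors_rvs[OF Psrep] finite_slots l finite_idx])
   (auto simp: factors_def split: prod.splits intro: act_gen_closed[OF inf])
 then show ?thesis by (simp add: prod.distrib mult_ac basis_tuple_def slot_map_def)
qed

text \<open>Extraction of the multilinear coefficient gives an operator \<open>\<pi>\<close> that
  can be computed in two ways: on pure tensors it keeps only the bijective labels, and on a vector
  of the given weight it is the identity.\<close>

lemma weight_vector_labels:
 assumes z: "z : carrier (tpow nu' (Proj nu :: 'a smod))"
  and wt: "!!t. tensor_power_map (Proj nu) (Proj nu) (diag nu t) nu' z = (PROD s:slots nu. t s) \<odot>[tpow nu' (Proj nu)] z"
 shows "z : range (%c. lcomb (tpow nu' (Proj nu)) (bijective_labels nu nu') c (%b. pten nu' (Proj nu) (basis_tuple nu nu' b)))"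
proof -
 let ?P = "Proj nu :: 'a smod"
 let ?T = "tpow nu' ?P" and ?B = "bijective_labels nu nu'" and ?y = "%b. pten nu' ?P (basis_tuple nu nu' b)"
 let ?K = "range (%c. lcomb ?T ?B c ?y)"
 have T: "svs ?T" by (rule svs_tensor_power[OF Psrep])
 have y: "?y b : carrier ?T" if "b : basis_labels nu nu'" for b
  using that by (intro pten_closed Psrep basis_tuple_closed)
 have yB: "?y b : carrier ?T" if "b : ?B" for b using that y by (simp add: bijective_labels_def)
 have K: "lsub ?T ?K" using T yB by (intro lsub_lcombs) auto
 \<comment> \<open>The degree is \<open>size nu'\<close>; the successor ensures
   \<open>1 \<le> d\<close>, so that exponent 1 is in range even for empty
   \<open>nu'\<close>.\<close>
 define d where "d = Suc (size nu')"
 define \<pi> where "\<pi> z = lcomb ?T (nodes d (slots nu)) (node_weight d (slots nu) (%_. 1)) (%t. tensor_power_map ?P ?P (diag nu (node t)) nu' z)" for z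
 have Tm: "tensor_power_map ?P ?P (diag nu t) nu' : mhom ?T ?T" for t
  by (rule lin_mhom[OF tensor_power_map_props(1)[OF Psrep Psrep diag_hom[OF inf]]])
 have \<pi>m: "\<pi> : mhom ?T ?T" unfolding \<pi>_def using T Tm by (intro lcomb_maps_mhom) auto
 have "\<pi> (pten nu' ?P w) : ?K" if w: "w : ptuples nu' ?P" for w
 proof -
  let ?A = "%b. PROD k:slots nu'. gcoord nu (fst k) (b k) (w k)"
  have "\<pi> (pten nu' ?P w) = lcomb ?T ?B ?A ?y"
  proof (rule separated_eqI[OF T])
   show "\<pi> (pten nu' ?P w) : carrier ?T" by (rule mhom_closed[OF \<pi>m pten_closed[OF Psrep w]])
   show "lcomb ?T ?B ?A ?y : carrier ?T" using T yB by (intro lcomb_closed) auto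
   fix l assume l: "l : dual ?T"
   have "l (\<pi> (pten nu' ?P w)) = (SUM t:nodes d (slots nu). node_weight d (slots nu) (%_. 1) t * l (tensor_power_map ?P ?P (diag nu (node t)) nu' (pten nu' ?P w)))"
    unfolding \<pi>_def using T l by (intro dual_lcomb) (auto intro: mhom_closed[OF Tm] pten_closed[OF Psrep w])
   also have "... = multicoeff d (slots nu) (%t. SUM b:basis_labels nu nu'. (?A b * l (?y b)) * (PROD k:slots nu'. t (slot_map b k)))"
    unfolding coefficient_def
    by (simp only: tensor_power_map_props(2)[OF Psrep Psrep diag_hom[OF inf] w] diag_pure_functional[OF w l])
   also have "... = (SUM b:basis_labels nu nu'. (?A b * l (?y b)) * multicoeff d (slots nu) (%t. PROD k:slots nu'. t (slot_map b k)))"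
    by (rule coefficient_sum)
   also have "... = (SUM b:basis_labels nu nu'. if bij_betw (slot_map b) (slots nu') (slots nu) then ?A b * l (?y b) else 0)"
   proof (rule sum.cong[OF refl])
    fix b assume b: "b : basis_labels nu nu'"
    have "multicoeff d (slots nu) (%t. PROD k:slots nu'. t (slot_map b k)) = (if bij_betw (slot_map b) (slots nu') (slots nu) then 1 else 0)"
    by (rule multicoeff_monomial[OF finite_slots finite_slots]) (auto simp: d_def card_slots slot_map_closed[OF b])
    then show "(?A b * l (?y b)) * multicoeff d (slots nu) (%t. PROD k:slots nu'. t (slot_map b k))
    = (if bij_betw (slot_map b) (slots nu') (slots nu) then ?A b * l (?y b) else 0)" by simp
   qed
   also have "... = (SUM b:?B. ?A b * l (?y b))"
    unfolding bijective_labels_def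
    by (rule sum.inter_filter[symmetric]) (auto intro!: finite_PiE finite_slots finite_idx)
   also have "... = l (lcomb ?T ?B ?A ?y)" using T l yB by (intro dual_lcomb[symmetric]) auto
   finally show "l (\<pi> (pten nu' ?P w)) = l (lcomb ?T ?B ?A ?y)" .
  qed
  then show ?thesis by blast
 qed
 moreover have "lsub ?T {x : carrier ?T. \<pi> x : ?K}"
  using T K mhom_zero[OF _ _ \<pi>m] by (auto simp: lsub_def mhom_add[OF \<pi>m] mhom_smult[OF \<pi>m])
 ultimately have "carrier ?T <= {x : carrier ?T. \<pi> x : ?K}"
  by (intro tensor_induct[of "slots nu'" "factors ?P", OF factors_rvs[OF Psrep]]) (simp_all add: pten_closed[OF Psrep])
 then have "\<pi> z : ?K" using z by blast
 moreover have "\<pi> z = z"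
 proof (rule separated_eqI[OF T mhom_closed[OF \<pi>m z] z])
  fix l assume l: "l : dual ?T"
  have "l (\<pi> z) = (SUM t:nodes d (slots nu). node_weight d (slots nu) (%_. 1) t * l (tensor_power_map ?P ?P (diag nu (node t)) nu' z))"
   unfolding \<pi>_def using T l z by (intro dual_lcomb) (auto intro: mhom_closed[OF Tm])
  also have "... = multicoeff d (slots nu) (%t. PROD s:slots nu. t s) * l z"
   unfolding coefficient_def wt dual_smult[OF l z] by (simp add: sum_distrib_right mult.assoc)
  also have "multicoeff d (slots nu) (%t. PROD s:slots nu. t s) = 1"
   by (rule multicoeff_prod[OF finite_slots]) (simp add: d_def)
  finally show "l (\<pi> z) = l z" by (simp only: mult_1)
 qed
 ultimately show ?thesis by simp
qed

lemma weight_vector_zero: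
 assumes "z : carrier (tpow nu' (Proj nu :: 'a smod))"
  and "!!t. tensor_power_map (Proj nu) (Proj nu) (diag nu t) nu' z = (PROD s:slots nu. t s) \<odot>[tpow nu' (Proj nu)] z"
  and "nu' ~= nu"
 shows "z = \<zero>[tpow nu' (Proj nu)]"
 using weight_vector_labels[OF assms(1,2)] tpow_rvs[OF Psrep] by (auto simp: bijective_labels_empty[OF assms(3)])

text \<open>The right-hand side is a linear operator \<open>?R\<close> on the whole tensor power
  that fixes every \<open>uten nu h\<close>, and weight vectors are combinations of these.\<close>

lemma weight_vector_expand:
 assumes z: "z : carrier (tpow nu (Proj nu :: 'a smod))"
  and wt: "!!t. tensor_power_map (Proj nu) (Proj nu) (diag nu t) nu z = (PROD s:slots nu. t s) \<odot>[tpow nu (Proj nu)] z"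
 shows "z = lcomb (tpow nu (Proj nu)) (SG nu) (%g. ucoord nu (act (tensor_power (Proj nu) nu) (inv[S_nu nu] g) z)) (uten nu)"
proof -
 let ?P = "Proj nu :: 'a smod"
 let ?T = "tpow nu ?P" and ?G = "SG nu"
 interpret G: group "S_nu nu" by (rule group_S_nu)
 have T: "rvs ?T" by (rule tpow_rvs[OF Psrep])
 note rep = is_rep_tensor_power[OF Psrep, of nu nu]
 let ?R = "%z. lcomb ?T ?G (%g. ucoord nu (act (tensor_power ?P nu) (inv[S_nu nu] g) z)) (uten nu)"
 have R: "?R : mhom ?T ?T"
  using is_repD(2)[OF rep] by (intro lcomb_functionals_mhom[OF T] dual_mhom[OF _ ucoord_props(1)] uten_closed) auto
 have Ru: "?R (uten nu h) = uten nu h" if h: "h : ?G" for h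
 proof -
  have "?R (uten nu h) = lcomb ?T ?G (%g. if g = h then 1 else 0) (uten nu)"
  proof (rule lcomb_cong[OF T refl uten_closed])
   fix g assume g: "g : ?G"
   have "inv[S_nu nu] g \<otimes>[S_nu nu] h = \<one>[S_nu nu] \<longleftrightarrow> g = h"
    using g h by (metis G.inv_closed G.inv_equality G.inv_inv G.l_inv)
   then show "ucoord nu (act (tensor_power ?P nu) (inv[S_nu nu] g) (uten nu h)) = (if g = h then 1 else 0)"
    using g h by (simp add: act_uten ucoord_uten)
  qed simp_all
  also have "... = uten nu h"
   using lcomb_delta[OF T finite_S_nu h uten_closed, where r = 1] uten_closed[OF h] T by (simp add: rvs_simps)
  finally show ?thesis .
 qed
 obtain c where c: "z = lcomb ?T (bijective_labels nu nu) c (%b. pten nu ?P (basis_tuple nu nu b))"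
  using weight_vector_labels[OF z wt] by blast
 have "z : {x : carrier ?T. x = ?R x}"
  unfolding c
 proof (rule lsub_lcomb[OF T])
  show "lsub ?T {x : carrier ?T. x = ?R x}"
   by (rule lsub_equalizer[OF factors_rvs[OF Psrep] T T _ R]) (auto intro: mhomI)
  fix b assume "b : bijective_labels nu nu"
  then obtain g where "g : ?G" "pten nu ?P (basis_tuple nu nu b) = uten nu g" using bijective_label_tuple by blast
  then show "pten nu ?P (basis_tuple nu nu b) : {x : carrier ?T. x = ?R x}" using Ru uten_closed by simp
 qed
 then show ?thesis by simp
qed

end

section \<open>Locally polynomial functors\<close>

lemma Vect_simps [simp]:
 "Obj Vect = {V. fdvs V}" "Hom Vect = lin" "Id Vect V = (\<lambda>v\<in>carrier V. v)" "Comp Vect U V W g f = compose (carrier U) g f"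
 by (simp_all add: Vect_def)

text \<open>The category in which \<open>F_functor V\<close> takes its values for every family
  \<open>V\<close>, with no condition on dimensions.\<close>

definition SVS :: "('a qvs, 'a => 'a) cat" where
 "SVS = Vect\<lparr>Obj := {V. svs V}\<rparr>"

lemma SVS_simps [simp]:
 "Obj SVS = {V. svs V}" "Hom SVS = lin" "Id SVS V = (\<lambda>v\<in>carrier V. v)" "Comp SVS U V W g f = compose (carrier U) g f"
 by (simp_all add: SVS_def)

lemma is_category_Vect: "is_category Vect"
 unfolding is_category_def Vect_simps
proof (intro conjI ballI)
 fix X :: "'a qvs" assume "X : {V. fdvs V}"
 then have X: "rvs X" using fdvs_rvs by simp
 show "(\<lambda>v\<in>carrier X. v) : lin X X" by (intro lin_restrict X mhomI) simp_all
 fix Y :: "'a qvs" and f assume f: "f : lin X Y"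
 note fd = lin_closed[OF f] lin_undefined[OF f]
 show "compose (carrier X) f (\<lambda>v\<in>carrier X. v) = f" "compose (carrier X) (\<lambda>v\<in>carrier Y. v) f = f"
  using fd by (auto simp: compose_def fun_eq_iff)
 fix Z :: "'a qvs" and g assume g: "g : lin Y Z"
 show "compose (carrier X) g f : lin X Z" by (rule lin_compose[OF f g X])
 fix W :: "'a qvs" and h
 show "compose (carrier X) (compose (carrier Y) h g) f = compose (carrier X) h (compose (carrier X) g f)"
  using fd by (auto simp: compose_def fun_eq_iff)
qed

text \<open>The degree may depend on the vector \<open>x\<close>.  In this form the condition is also satisfied by the
  functors \<open>F\<^sub>V\<close> for families \<open>V\<close> with infinitely many nonzero members, before anything is known about
  the dimensions of their values.\<close>

definition lpf :: "('a, 'b) svect_functor => bool" where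
 "lpf F \<longleftrightarrow> is_functor SVect SVS F &
  (ALL U:Obj SVect. ALL U':Obj SVect. ALL x:carrier (omap F U). EX d. ALL r. ALL a:{..<r} \<rightarrow> shom U U'.
   EX c:exponents r d \<rightarrow> carrier (omap F U'). ALL t.
    amap F U U' (lcomb (shv U U') {..<r} t a) x
    = lcomb (omap F U') (exponents r d) (%e. \<Prod>i<r. t i ^ e i) c)"

section \<open>Spaces of equivariant maps and of morphisms of graded representations\<close>

lemma rep_hom_vs_eq: "rep_hom_vs G R R' = (hom_vs (space R) (space R'))\<lparr>carrier := rep_hom G R R'\<rparr>"
 by (simp add: rep_hom_vs_def hom_subspace_eq)

lemma rep_hom_vs_simps [simp]:
 "carrier (rep_hom_vs G R R') = rep_hom G R R'" "\<zero>[rep_hom_vs G R R'] = (\<lambda>v\<in>cs R. \<zero>[space R'])"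
 "f \<oplus>[rep_hom_vs G R R'] g = (\<lambda>v\<in>cs R. f v \<oplus>[space R'] g v)"
 "r \<odot>[rep_hom_vs G R R'] f = (\<lambda>v\<in>cs R. r \<odot>[space R'] f v)"
 by (simp_all add: rep_hom_vs_eq)

lemma rep_hom_lsub:
 assumes R: "is_rep G R" and R': "is_rep G R'"
 shows "lsub (hom_vs (space R) (space R')) (rep_hom G R R')"
proof -
 note V = fdvs_rvs[OF is_repD(1)[OF R]] and W = fdvs_rvs[OF is_repD(1)[OF R']]
 note V5 = is_repD(5)[OF R] and m = is_repD(2)[OF R']
 show ?thesis
  unfolding lsub_def hom_vs_simps
 proof (intro conjI ballI allI)
  show "rep_hom G R R' <= lin (space R) (space R')" by (auto dest: rep_homD(1))
  show "(\<lambda>v\<in>cs R. \<zero>[space R']) : rep_hom G R R'"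
   by (rule rep_homI[OF lin_zero[OF V W]]) (simp add: V5 mhom_zero[OF W W m])
  fix f g r assume f: "f : rep_hom G R R'"
  note fd = rep_homD[OF f]
  show "(\<lambda>v\<in>cs R. r \<odot>[space R'] f v) : rep_hom G R R'"
   by (rule rep_homI[OF lin_smult[OF V W fd(1)]]) (simp add: V5 fd mhom_smult[OF m])
  assume g: "g : rep_hom G R R'"
  note gd = rep_homD[OF g]
  show "(\<lambda>v\<in>cs R. f v \<oplus>[space R'] g v) : rep_hom G R R'"
   by (rule rep_homI[OF lin_add[OF V W fd(1) gd(1)]]) (simp add: V5 fd gd mhom_add[OF m])
 qed
qed

lemma svs_rep_hom_vs: "is_rep G R ==> is_rep G R' ==> svs (rep_hom_vs G R R')"
 unfolding rep_hom_vs_eq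
 by (rule svs_lsub[OF svs_hom_vs rep_hom_lsub]) (auto intro: fdvs_rvs is_repD fdvs_separated)

lemma fdvs_rep_hom_vs: "is_rep G R ==> is_rep G R' ==> fdvs (rep_hom_vs G R R')"
 unfolding rep_hom_vs_eq
 by (rule fdvs_lsub[OF fdvs_hom_vs rep_hom_lsub]) (auto intro: is_repD)

lemma carrier_graded_hom_vs: "carrier (shv U U') = shom U U'"
 by (simp add: graded_hom_vs_def)

lemma rvs_graded_hom_vs: "srep U ==> srep U' ==> rvs (shv U U')"
 unfolding graded_hom_vs_def by (rule rvs_dprod) (use svs_rep_hom_vs in blast)

lemma shom_eval_mhom: "v : cs (U i) ==> (%f. f i v) : mhom (shv U U') (space (U' i))"
 by (rule mhomI) (auto simp: graded_hom_vs_def intro: rep_homD(4)[of _ "sym_group i" "U i" "U' i"])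

lemma shom_lcomb_eval:
 assumes U: "srep U" and U': "srep U'" and a: "!!k. k : A ==> a k : shom U U'" and v: "v : cs (U i)"
 shows "lcomb (shv U U') A t a i v = lcomb (space (U' i)) A t (%k. a k i v)"
 by (rule mhom_lcomb[OF rvs_graded_hom_vs[OF U U'] fdvs_rvs[OF is_repD(1)[OF U'[rule_format]]] shom_eval_mhom[of v U i U', OF v]])
  (use a in "simp add: carrier_graded_hom_vs")

lemma shom_lcomb_closed:
 assumes U: "srep U" and U': "srep U'" and a: "!!k. k : A ==> a k : shom U U'"
 shows "lcomb (shv U U') A t a : shom U U'"
 using lcomb_closed[of "shv U U'" A a t, OF rvs_graded_hom_vs[OF U U']] a
 unfolding carrier_graded_hom_vs by blast

lemma shom_eqI:
 assumes f: "f : shom U U'" and g: "g : shom U U'"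
  and eq: "!!i v. v : cs (U i) ==> f i v = g i v"
 shows "f = g"
proof
 fix i
 have "f i : rep_hom (sym_group i) (U i) (U' i)" "g i : rep_hom (sym_group i) (U i) (U' i)" using f g by auto
 then show "f i = g i" by (intro lin_eqI[OF rep_homD(1) rep_homD(1)] eq)
qed

lemma SVect_srep: "U : Obj SVect ==> srep U"
 by simp

lemma is_functor_SVSI:
 assumes "is_functor SVect Vect F"
 shows "is_functor SVect SVS F"
 using assms unfolding is_functor_def by (auto simp: fdvs_svs)

text \<open>Evaluation at \<open>x\<close> is linear in the homomorphism, so it turns a polynomial
  family of homomorphisms into a polynomial family of vectors of the same degree.\<close>

lemma lpf_of_polynomial:
 fixes F :: "('a, 'b) svect_functor"
 assumes F: "is_functor SVect Vect F" and P: "polynomial_functor F"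
 shows "lpf F"
 unfolding lpf_def
proof (intro conjI ballI is_functor_SVSI[OF F])
 fix U U' :: "'a smod" and x assume U: "U : Obj SVect" and U': "U' : Obj SVect" and x: "x : carrier (omap F U)"
 have FU: "fdvs (omap F U)" "fdvs (omap F U')" using is_functorD(1)[OF F U] is_functorD(1)[OF F U'] by simp_all
 let ?A = "shv U U'" and ?B = "hom_vs (omap F U) (omap F U')"
 obtain d where d: "polynomial_map_le d ?A ?B (amap F U U')"
  using P U U' unfolding polynomial_functor_def polynomial_map_def by blast
 note dd = d[unfolded polynomial_map_le_def carrier_graded_hom_vs hom_vs_simps(1), folded lcomb_def, THEN conjunct2]
 show "EX d. ALL r. ALL a:{..<r} \<rightarrow> shom U U'. EX c:exponents r d \<rightarrow> carrier (omap F U'). ALL t.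
    amap F U U' (lcomb ?A {..<r} t a) x = lcomb (omap F U') (exponents r d) (%e. \<Prod>i<r. t i ^ e i) c"
 proof (intro exI[of _ d] allI ballI)
  fix r :: nat and a assume "a : {..<r} \<rightarrow> shom U U'"
  then obtain c where c: "c : exponents r d \<rightarrow> lin (omap F U) (omap F U')"
   and eq: "ALL t. amap F U U' (lcomb ?A {..<r} t a) = lcomb ?B (exponents r d) (%e. \<Prod>i<r. t i ^ e i) c"
   using dd by blast
  have cc: "c e : carrier ?B" if "e : exponents r d" for e using c that by auto
  show "EX c:exponents r d \<rightarrow> carrier (omap F U'). ALL t. amap F U U' (lcomb ?A {..<r} t a) x = lcomb (omap F U') (exponents r d) (%e. \<Prod>i<r. t i ^ e i) c"
  proof (intro bexI[of _ "%e. c e x"] allI)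
   show "(%e. c e x) : exponents r d \<rightarrow> carrier (omap F U')" using c x by (auto intro: lin_closed)
   fix t
   show "amap F U U' (lcomb ?A {..<r} t a) x = lcomb (omap F U') (exponents r d) (%e. \<Prod>i<r. t i ^ e i) (%e. c e x)"
    unfolding eq[rule_format]
    by (rule mhom_lcomb[OF rvs_hom_vs[OF fdvs_rvs[OF FU(1)] fdvs_rvs[OF FU(2)]] fdvs_rvs[OF FU(2)] mhom_eval[of x "omap F U" "omap F U'", OF x] cc])
  qed
 qed
qed

section \<open>The functors \<open>F\<^sub>V\<close>\<close>

abbreviation nrep :: "'v s2mod => bool" where
 "nrep V \<equiv> ALL nu. is_rep (S_nu nu) (V nu)"

lemma polyfun_smult: "polyfun r d p ==> polyfun r d (%x. c * p x)"
 using polyfun_sum[of "{()}" r d "%_. p" "%_. c"] by simp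

lemma polyfun_add: "polyfun r d p ==> polyfun r d q ==> polyfun r d (%x. p x + q x)"
 using polyfun_sum[of "UNIV :: bool set" r d "%b. if b then p else q" "%_. 1"] by (simp add: UNIV_bool add.commute)

lemma polyfun_zero: "polyfun r d (%x. 0)"
 unfolding polyfun_def by (intro exI[of _ "%_. 0"]) simp

text \<open>On a pure tensor, multilinear expansion gives monomials with one factor per slot, thus
  of degree \<open>size nu\<close>; the tensors with polynomial behaviour form a subspace.\<close>

lemma tensor_power_polyfun:
 assumes U: "srep (U :: 'a smod)" and U': "srep (U' :: 'a smod)" and a: "!!k. k < r ==> a k : shom U U'"
  and l: "l : dual (tpow nu U')" and z: "z : carrier (tpow nu U)"
 shows "polyfun r (size nu) (%t. l (tensor_power_map U U' (lcomb (shv U U') {..<r} t a) nu z))"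
proof -
 let ?L = "%t. lcomb (shv U U') {..<r} t a"
 have L: "?L t : shom U U'" for t by (rule shom_lcomb_closed[OF U U']) (use a in simp)
 note Tm = lin_mhom[OF tensor_power_map_props(1)[OF U U' L, where nu = nu]]
 note T = tpow_rvs[OF U, of nu] and T' = tpow_rvs[OF U', of nu]
 let ?K = "{z : carrier (tpow nu U). polyfun r (size nu) (%t. l (tensor_power_map U U' (?L t) nu z))}"
 have "lsub (tpow nu U) ?K"
  unfolding lsub_def
 proof (intro conjI ballI allI)
  show "?K <= carrier (tpow nu U)" by blast
  show "\<zero>[tpow nu U] : ?K" using T dual_zero[OF T' l] by (simp add: mhom_zero[OF T T' Tm] polyfun_zero)
  fix x y c assume x: "x : ?K"
  then show "c \<odot>[tpow nu U] x : ?K"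
   using T by (simp add: mhom_smult[OF Tm] dual_smult[OF l] mhom_closed[OF Tm] polyfun_smult)
  assume y: "y : ?K"
  show "x \<oplus>[tpow nu U] y : ?K"
   using T x y by (simp add: mhom_add[OF Tm] dual_add[OF l] mhom_closed[OF Tm] polyfun_add)
 qed
 moreover have "pten nu U w : ?K" if w: "w : ptuples nu U" for w
 proof -
  have "l (tensor_power_map U U' (?L t) nu (pten nu U w))
   = (SUM b:slots nu \<rightarrow>\<^sub>E {..<r}. l (pten nu U' (\<lambda>k\<in>slots nu. a (b k) (fst k) (w k))) * (PROD k:slots nu. t (b k)))" for t
  proof -
   have "map_tuple (?L t) nu w = (\<lambda>k\<in>slots nu. lcomb (factors U' k) {..<r} t (%m. a m (fst k) (w k)))"
   proof
    fix k show "map_tuple (?L t) nu w k = (\<lambda>k\<in>slots nu. lcomb (factors U' k) {..<r} t (%m. a m (fst k) (w k))) k"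
    using shom_lcomb_eval[of U U' "{..<r}" a, OF U U' _ ptuples_mem[OF w]] a
    by (cases k; cases "k : slots nu") (simp_all add: factors_def)
   qed
   then have "l (tensor_power_map U U' (?L t) nu (pten nu U w))
    = l (pten nu U' (\<lambda>k\<in>slots nu. lcomb (factors U' k) {..<r} t (%m. a m (fst k) (w k))))"
    by (simp only: tensor_power_map_props(2)[OF U U' L w])
   also have "... = (SUM b:slots nu \<rightarrow>\<^sub>E {..<r}. (PROD k:slots nu. t (b k)) * l (pten nu U' (\<lambda>k\<in>slots nu. a (b k) (fst k) (w k))))"
   proof (rule tensor_functional_expand[of "slots nu" "factors U'" l "%_. {..<r}" "%k m. a m (fst k) (w k)" "%_. t", OF factors_rvs[OF U'] finite_slots l])
    fix k m assume k: "k : slots nu" and m: "m : {..<r}"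
    obtain i j where ij: "k = (i, j)" by (cases k)
    have ai: "a m i : rep_hom (sym_group i) (U i) (U' i)" using a m by auto
    show "a m (fst k) (w k) : carrier (factors U' k)"
    using rep_homD(4)[OF ai ptuples_mem[OF w]] k by (simp add: ij factors_def)
   qed simp
   finally show ?thesis by (simp only: mult.commute)
  qed
  moreover have "polyfun r (size nu) (%t. SUM b:slots nu \<rightarrow>\<^sub>E {..<r}. l (pten nu U' (\<lambda>k\<in>slots nu. a (b k) (fst k) (w k))) * (PROD k:slots nu. t (b k)))"
   by (intro polyfun_sum polyfun_monomial finite_slots) (auto simp: card_slots)
  ultimately show ?thesis using pten_closed[OF U w] by simp
 qed
 ultimately have "carrier (tpow nu U) <= ?K" by (rule tensor_induct[of "slots nu" "factors U", OF factors_rvs[OF U]])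
 then show ?thesis using z by blast
qed

section \<open>Elements of \<open>schur_space V W\<close> and functoriality in
  \<open>W\<close>\<close>

lemma schur_space_carrier:
 "x : cF V W \<longleftrightarrow> (ALL nu. x nu : rep_hom (S_nu nu) (V nu) (tensor_power W nu)) &
  finite {nu. x nu ~= (\<lambda>v\<in>cs (V nu). \<zero>[tpow nu W])}"
 by (simp add: schur_space_def)

lemma schur_space_simps:
 "\<zero>[schur_space V W] = (%nu. \<lambda>v\<in>cs (V nu). \<zero>[tpow nu W])"
 "x \<oplus>[schur_space V W] y = (%nu. \<lambda>v\<in>cs (V nu). x nu v \<oplus>[tpow nu W] y nu v)"
 "r \<odot>[schur_space V W] x = (%nu. \<lambda>v\<in>cs (V nu). r \<odot>[tpow nu W] x nu v)"
 by (simp_all add: schur_space_def)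

lemma schur_mem:
 assumes "x : cF V W"
 shows "x nu : rep_hom (S_nu nu) (V nu) (tensor_power W nu)" "x nu : mhom (space (V nu)) (tpow nu W)"
  "v : cs (V nu) ==> x nu v : carrier (tpow nu W)" "v ~: cs (V nu) ==> x nu v = undefined"
proof -
 show x: "x nu : rep_hom (S_nu nu) (V nu) (tensor_power W nu)" using assms by (simp add: schur_space_carrier)
 show "x nu : mhom (space (V nu)) (tpow nu W)" "v : cs (V nu) ==> x nu v : carrier (tpow nu W)"
  "v ~: cs (V nu) ==> x nu v = undefined"
  using rep_homD[OF x] rep_hom_undefined[OF x] by simp_all
qed

lemma schur_eval_mhom: "v : cs (V nu) ==> (%x. x nu v) : mhom (schur_space V W) (tpow nu W)"
 by (rule mhomI) (auto simp: schur_mem schur_space_simps)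

lemma schur_eqI:
 assumes "x : cF V W" "y : cF V W"
  and "!!nu v. v : cs (V nu) ==> x nu v = y nu v"
 shows "x = y"
proof (intro ext)
 fix nu v show "x nu v = y nu v"
  using assms(3) schur_mem(4)[OF assms(1)] schur_mem(4)[OF assms(2)] by (cases "v : cs (V nu)") auto
qed

lemma F_functor_simps:
 "omap (F_functor V) W = schur_space V W"
 "amap (F_functor V) W W' f = (\<lambda>x\<in>cF V W. %nu. compose (cs (V nu)) (tensor_power_map W W' f nu) (x nu))"
 by (simp_all add: F_functor_def)

lemma F_functor_eval:
 "x : cF V W ==> v : cs (V nu) ==> amap (F_functor V) W W' f x nu v = tensor_power_map W W' f nu (x nu v)"
 by (simp add: F_functor_simps compose_def)

context
 fixes V :: "'v s2mod"
 assumes V: "nrep V"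
begin

lemma svs_schur_component: "srep W ==> svs (rep_hom_vs (S_nu nu) (V nu) (tensor_power W nu))"
 using V by (intro svs_rep_hom_vs is_rep_tensor_power) auto

lemma svs_schur_space: "srep W ==> svs (schur_space V W)"
 unfolding schur_space_def by (rule svs_dsum) (rule svs_schur_component)

text \<open>A separating family of functionals each of which looks at a single tensor power, where
  the action of morphisms is explicit.\<close>

definition schur_dual :: "'a smod => (('v, 'a) schur => rat) set" where
 "schur_dual W = {(%x. l (x nu v)) | l nu v. l : dual (tpow nu W) & v : cs (V nu)}"

lemma schur_dual_subset: "schur_dual W <= dual (schur_space V W)"
 unfolding schur_dual_def using dual_mhom[OF schur_eval_mhom] by auto

lemma schur_dual_separating:
 assumes W: "srep W" and x: "x : cF V W" and z: "!!l. l : schur_dual W ==> l x = 0"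
 shows "x = \<zero>[schur_space V W]"
proof (rule schur_eqI[OF x])
 show "\<zero>[schur_space V W] : cF V W" using svs_schur_space[OF W] by blast
 fix nu v assume v: "v : cs (V nu)"
 have "l (x nu v) = 0" if "l : dual (tpow nu W)" for l
  using z[of "%x. l (x nu v)"] that v unfolding schur_dual_def by blast
 then show "x nu v = \<zero>[schur_space V W] nu v"
  using svs_tensor_power[OF W, of nu] schur_mem(3)[OF x v] v unfolding separated_def by (simp add: schur_space_simps)
qed

text \<open>A morphism acts on each component separately, so a vanishing component stays zero and
  the support cannot grow.\<close>

lemma F_functor_closed:
 assumes W: "srep W" and W': "srep W'" and f: "f : shom W W'" and x: "x : cF V W"
 shows "amap (F_functor V) W W' f x : cF V W'"
  and "x nu = (\<lambda>v\<in>cs (V nu). \<zero>[tpow nu W]) ==>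
   amap (F_functor V) W W' f x nu = (\<lambda>v\<in>cs (V nu). \<zero>[tpow nu W'])"
proof -
 let ?y = "amap (F_functor V) W W' f x"
 have y: "?y nu = compose (cs (V nu)) (tensor_power_map W W' f nu) (x nu)" for nu using x by (simp add: F_functor_simps)
 have "?y nu : rep_hom (S_nu nu) (V nu) (tensor_power W' nu)" for nu
  unfolding y by (rule rep_hom_compose[OF V[rule_format] schur_mem(1)[OF x] tensor_power_map_rep_hom[OF W W' f]])
 moreover show z: "?y nu = (\<lambda>v\<in>cs (V nu). \<zero>[tpow nu W'])" if "x nu = (\<lambda>v\<in>cs (V nu). \<zero>[tpow nu W])" for nu
  unfolding y that using mhom_zero[OF tpow_rvs[OF W] tpow_rvs[OF W'] lin_mhom[OF tensor_power_map_props(1)[OF W W' f]]]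
  by (auto simp: compose_def fun_eq_iff)
 moreover have "finite {nu. ?y nu ~= (\<lambda>v\<in>cs (V nu). \<zero>[tpow nu W'])}"
  by (rule finite_subset[of _ "{nu. x nu ~= (\<lambda>v\<in>cs (V nu). \<zero>[tpow nu W])}"])
   (use z x in "auto simp: schur_space_carrier")
 ultimately show "?y : cF V W'" by (simp add: schur_space_carrier)
qed

lemma is_functor_F_functor: "is_functor SVect SVS (F_functor V :: ('v, 'a) sfr)"
 unfolding is_functor_def
proof (intro conjI ballI)
 fix W :: "'a smod" assume "W : Obj SVect"
 then have W: "srep W" by simp
 have rW: "rvs (schur_space V W)" using svs_schur_space[OF W] by blast
 show "omap (F_functor V) W : Obj SVS" using svs_schur_space[OF W] by (simp add: F_functor_simps)
 have idh: "(%i. \<lambda>v\<in>cs (W i). v) : shom W W" using W by (auto intro: rep_hom_id)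
 show "amap (F_functor V) W W (Id SVect W) = Id SVS (omap (F_functor V) W)"
 proof
  fix x
  show "amap (F_functor V) W W (Id SVect W) x = Id SVS (omap (F_functor V) W) x"
  proof (cases "x : cF V W")
   case True
   have "amap (F_functor V) W W (Id SVect W) x = x"
    by (rule schur_eqI[OF _ True]) (use F_functor_closed(1)[OF W W idh True] in
    \<open>simp_all add: F_functor_eval[OF True] tensor_power_map_id[OF W] schur_mem(3)[OF True]\<close>)
   then show ?thesis using True by (simp add: F_functor_simps)
  qed (simp add: F_functor_simps)
 qed
 fix W' :: "'a smod" and f assume "W' : Obj SVect" and "f : Hom SVect W W'"
 then have W': "srep W'" and f: "f : shom W W'" by simp_all
 note Tm = lin_mhom[OF tensor_power_map_props(1)[OF W W' f]]
 show l: "amap (F_functor V) W W' f : Hom SVS (omap (F_functor V) W) (omap (F_functor V) W')"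
  unfolding SVS_simps F_functor_simps(1)
 proof -
  let ?m = "amap (F_functor V) W W' f"
  note cl = F_functor_closed(1)[OF W W' f]
  have rW': "rvs (schur_space V W')" using svs_schur_space[OF W'] by blast
  have "?m : mhom (schur_space V W) (schur_space V W')"
  proof (rule mhomI[OF cl])
   fix x y r assume x: "x : cF V W"
   show "?m (r \<odot>[schur_space V W] x) = r \<odot>[schur_space V W'] ?m x"
   proof (rule schur_eqI[OF cl[OF rvs_closed(3)[OF rW x]] rvs_closed(3)[OF rW' cl[OF x]]])
    fix nu v assume v: "v : cs (V nu)"
    show "?m (r \<odot>[schur_space V W] x) nu v = (r \<odot>[schur_space V W'] ?m x) nu v"
    unfolding F_functor_eval[OF rvs_closed(3)[OF rW x] v]
    using v by (simp add: schur_space_simps F_functor_eval[OF x v] mhom_smult[OF Tm schur_mem(3)[OF x v]])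
   qed
   assume y: "y : cF V W"
   show "?m (x \<oplus>[schur_space V W] y) = ?m x \<oplus>[schur_space V W'] ?m y"
   proof (rule schur_eqI[OF cl[OF rvs_closed(2)[OF rW x y]] rvs_closed(2)[OF rW' cl[OF x] cl[OF y]]])
    fix nu v assume v: "v : cs (V nu)"
    show "?m (x \<oplus>[schur_space V W] y) nu v = (?m x \<oplus>[schur_space V W'] ?m y) nu v"
    unfolding F_functor_eval[OF rvs_closed(2)[OF rW x y] v]
    using v by (simp add: schur_space_simps F_functor_eval[OF x v] F_functor_eval[OF y v]
    mhom_add[OF Tm schur_mem(3)[OF x v] schur_mem(3)[OF y v]])
   qed
  qed
  then show "?m : lin (schur_space V W) (schur_space V W')"
   unfolding lin_def by (simp add: F_functor_simps)
 qed
 fix W'' :: "'a smod" and g assume "W'' : Obj SVect" and "g : Hom SVect W' W''"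
 then have W'': "srep W''" and g: "g : shom W' W''" by simp_all
 note gf = shom_compose[OF W f g]
 show "amap (F_functor V) W W'' (Comp SVect W W' W'' g f)
  = Comp SVS (omap (F_functor V) W) (omap (F_functor V) W') (omap (F_functor V) W'') (amap (F_functor V) W' W'' g) (amap (F_functor V) W W' f)"
  unfolding SVS_simps graded_simps pgraded_simps F_functor_simps(1)
 proof
  fix x
  show "amap (F_functor V) W W'' (%i. compose (cs (W i)) (g i) (f i)) x
   = compose (cF V W) (amap (F_functor V) W' W'' g) (amap (F_functor V) W W' f) x"
  proof (cases "x : cF V W")
   case True
   note fx = F_functor_closed(1)[OF W W' f True]
   have "amap (F_functor V) W W'' (%i. compose (cs (W i)) (g i) (f i)) x
    = amap (F_functor V) W' W'' g (amap (F_functor V) W W' f x)"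
    by (rule schur_eqI[OF F_functor_closed(1)[OF W W'' gf True] F_functor_closed(1)[OF W' W'' g fx]])
    (simp add: F_functor_eval[OF True] F_functor_eval[OF fx] tensor_power_map_comp[OF W W' W'' f g] schur_mem(3)[OF True])
   then show ?thesis using True by (simp add: compose_def)
  qed (simp add: F_functor_simps compose_def)
 qed
qed

lemma F_functor_polyfun:
 assumes U: "srep (U :: 'a smod)" and U': "srep (U' :: 'a smod)" and a: "a : {..<r} \<rightarrow> shom U U'"
  and x: "x : cF V U" and d: "!!nu. x nu ~= (\<lambda>v\<in>cs (V nu). \<zero>[tpow nu U]) ==> size nu \<le> d"
  and l: "l : schur_dual U'"
 shows "polyfun r d (%t. l (amap (F_functor V) U U' (lcomb (shv U U') {..<r} t a) x))"
proof -
 let ?L = "%t. lcomb (shv U U') {..<r} t a"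
 have ak: "a k : shom U U'" if "k < r" for k using a that by auto
 have L: "?L t : shom U U'" for t by (rule shom_lcomb_closed[OF U U']) (use ak in simp)
 obtain l0 nu v where l0: "l0 : dual (tpow nu U')" and v: "v : cs (V nu)" and l_eq: "l = (%x. l0 (x nu v))"
  using l unfolding schur_dual_def by blast
 show ?thesis
 proof (cases "x nu = (\<lambda>v\<in>cs (V nu). \<zero>[tpow nu U])")
  case True
  have "l (amap (F_functor V) U U' (?L t) x) = 0" for t
   unfolding l_eq F_functor_closed(2)[OF U U' L x True] using v dual_zero[OF tpow_rvs[OF U'] l0] by simp
  then show ?thesis by (simp add: polyfun_zero)
 next
  case False
  from polyfun_mono[OF tensor_power_polyfun[OF U U' ak l0 schur_mem(3)[OF x v]] d[OF False]]
  show ?thesis unfolding l_eq F_functor_eval[OF x v] by simp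
 qed
qed

lemma lpf_F_functor: "lpf (F_functor V :: ('v, 'a) sfr)"
 unfolding lpf_def
proof (intro conjI ballI is_functor_F_functor)
 fix U U' :: "'a smod" and x assume "U : Obj SVect" "U' : Obj SVect" and "x : carrier (omap (F_functor V) U)"
 then have U: "srep U" and U': "srep U'" and x: "x : cF V U" by (simp_all add: F_functor_simps)
 define N where "N = {nu. x nu ~= (\<lambda>v\<in>cs (V nu). \<zero>[tpow nu U])}"
 have N: "finite N" using x by (simp add: schur_space_carrier N_def)
 \<comment> \<open>A bound for the sizes on the support of \<open>x\<close>. As it varies with
   \<open>x\<close>, the degree in \<open>lpf\<close> is allowed to do so.\<close>
 define d where "d = (SUM nu:N. size nu)"
 have d: "size nu \<le> d" if "x nu ~= (\<lambda>v\<in>cs (V nu). \<zero>[tpow nu U])" for nu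
  unfolding d_def using that N by (intro member_le_sum) (auto simp: N_def)
 show "EX d. ALL r. ALL a:{..<r} \<rightarrow> shom U U'. EX c:exponents r d \<rightarrow> carrier (omap (F_functor V) U'). ALL t.
    amap (F_functor V) U U' (lcomb (shv U U') {..<r} t a) x
    = lcomb (omap (F_functor V) U') (exponents r d) (%e. \<Prod>i<r. t i ^ e i) c"
 proof (intro exI[of _ d] allI ballI, unfold F_functor_simps(1))
  fix r :: nat and a assume a: "a : {..<r} \<rightarrow> shom U U'"
  have L: "lcomb (shv U U') {..<r} t a : shom U U'" for t
   by (rule shom_lcomb_closed[OF U U']) (use a in auto)
  show "EX c:exponents r d \<rightarrow> cF V U'. ALL t.
    amap (F_functor V) U U' (lcomb (shv U U') {..<r} t a) x
    = lcomb (schur_space V U') (exponents r d) (%e. \<Prod>i<r. t i ^ e i) c"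
  proof (rule polyfun_vector[OF _ schur_dual_subset schur_dual_separating[OF U']])
   show "rvs (schur_space V U')" using svs_schur_space[OF U'] by blast
  qed (use F_functor_closed(1)[OF U U' L x] F_functor_polyfun[OF U U' a x d] in auto)
 qed
qed

text \<open>If one bound \<open>d\<close> serves all \<open>x\<close>, the whole homomorphism is
  polynomial in the morphism: the functionals \<open>l (g x)\<close> separate the points of the
  space of homomorphisms, and each of them is polynomial of degree \<open>d\<close>.\<close>

lemma polynomial_map_le_F_functor:
 assumes U: "srep (U :: 'a smod)" and U': "srep (U' :: 'a smod)"
  and d: "!!x nu. x : cF V U ==> x nu ~= (\<lambda>v\<in>cs (V nu). \<zero>[tpow nu U]) ==> size nu \<le> d"
  and Uo: "U : Obj SVect" "U' : Obj SVect"
 shows "polynomial_map_le d (shv U U') (hom_vs (omap (F_functor V) U) (omap (F_functor V) U')) (amap (F_functor V) U U')"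
 unfolding polynomial_map_le_def carrier_graded_hom_vs hom_vs_simps(1) lcomb_def[symmetric] F_functor_simps(1)
proof (intro conjI allI ballI)
 let ?B = "hom_vs (schur_space V U) (schur_space V U')"
 have rU: "rvs (schur_space V U)" "rvs (schur_space V U')" using svs_schur_space[OF U] svs_schur_space[OF U'] by blast+
 have lin: "amap (F_functor V) U U' f : lin (schur_space V U) (schur_space V U')" if "f : shom U U'" for f
  using is_functorD(2)[OF is_functor_F_functor Uo, of f] that by (simp add: F_functor_simps(1))
 then show "amap (F_functor V) U U' : shom U U' \<rightarrow> lin (schur_space V U) (schur_space V U')" by blast
 fix r :: nat and a assume a: "a : {..<r} \<rightarrow> shom U U'"
 have L: "lcomb (shv U U') {..<r} t a : shom U U'" for t
  by (rule shom_lcomb_closed[OF U U']) (use a in auto)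
 have D: "(%g. l (g x)) : dual ?B" if "l : schur_dual U'" "x : cF V U" for l x
  by (rule dual_eval[OF subsetD[OF schur_dual_subset that(1)] that(2)])
 have "EX c:exponents r d \<rightarrow> carrier ?B. ALL t.
    amap (F_functor V) U U' (lcomb (shv U U') {..<r} t a)
    = lcomb ?B (exponents r d) (%e. \<Prod>i<r. t i ^ e i) c"
 proof (rule polyfun_vector[where L = "{(%g. l (g x)) | l x. l : schur_dual U' & x : cF V U}"])
  show "rvs ?B" by (rule rvs_hom_vs[OF rU])
  show "{(%g. l (g x)) | l x. l : schur_dual U' & x : cF V U} <= dual ?B" using D by blast
  show "amap (F_functor V) U U' (lcomb (shv U U') {..<r} t a) : carrier ?B" for t using lin[OF L] by simp
  show "polyfun r d (%t. m (amap (F_functor V) U U' (lcomb (shv U U') {..<r} t a)))"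
   if "m : {(%g. l (g x)) | l x. l : schur_dual U' & x : cF V U}" for m
  proof -
   from that obtain l x where m: "m = (%g. l (g x))" and l: "l : schur_dual U'" and x: "x : cF V U" by blast
   show ?thesis unfolding m by (rule F_functor_polyfun[OF U U' a x d[OF x] l])
  qed
  fix g assume g: "g : carrier ?B" and z: "!!m. m : {(%g. l (g x)) | l x. l : schur_dual U' & x : cF V U} ==> m g = 0"
  have gl: "g : lin (schur_space V U) (schur_space V U')" using g by simp
  have "g x = \<zero>[schur_space V U']" if x: "x : cF V U" for x
  proof (rule schur_dual_separating[OF U' lin_closed[OF gl x]])
   fix l assume "l : schur_dual U'"
   then show "l (g x) = 0" using z[of "%g. l (g x)"] x by blast
  qed
  then show "g = \<zero>[?B]" using lin_undefined[OF gl] by (auto simp: fun_eq_iff)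
 qed
 then show "EX c:exponents r d \<rightarrow> lin (schur_space V U) (schur_space V U'). ALL t.
    amap (F_functor V) U U' (lcomb (shv U U') {..<r} t a)
    = lcomb ?B (exponents r d) (%e. \<Prod>i<r. t i ^ e i) c" by simp
qed

end

section \<open>Subfunctors are determined by their multilinear parts\<close>

abbreviation sfun :: "('a, 'b) svect_functor => bool" where
 "sfun F \<equiv> is_functor SVect SVS F"

abbreviation idm :: "'a smod => nat => 'a => 'a" where
 "idm W \<equiv> (%i. \<lambda>v\<in>cs (W i). v)"

lemma sfunD:
 assumes F: "sfun (F :: ('a, 'b) svect_functor)" and U: "U : Obj SVect"
 shows "svs (omap F U)" "rvs (omap F U)"
  and "U' : Obj SVect ==> f : shom U U' ==> amap F U U' f : lin (omap F U) (omap F U')"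
  and "U' : Obj SVect ==> f : shom U U' ==> amap F U U' f : mhom (omap F U) (omap F U')"
  and "U' : Obj SVect ==> f : shom U U' ==> x : carrier (omap F U) ==> amap F U U' f x : carrier (omap F U')"
  and "x : carrier (omap F U) ==> amap F U U (idm U) x = x"
  and "U' : Obj SVect ==> U'' : Obj SVect ==> f : shom U U' ==> g : shom U' U'' ==> x : carrier (omap F U) ==>
   amap F U U'' (scomp U g f) x = amap F U' U'' g (amap F U U' f x)"
proof -
 show "svs (omap F U)" "rvs (omap F U)" using is_functorD(1)[OF F U] by simp_all
 show l: "U' : Obj SVect ==> f : shom U U' ==> amap F U U' f : lin (omap F U) (omap F U')" for U' f
  using is_functorD(2)[OF F U, of U' f] by simp
 then show "U' : Obj SVect ==> f : shom U U' ==> amap F U U' f : mhom (omap F U) (omap F U')" by (blast intro: lin_mhom)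
 from l show "U' : Obj SVect ==> f : shom U U' ==> x : carrier (omap F U) ==> amap F U U' f x : carrier (omap F U')"
  by (blast intro: lin_closed)
 show "x : carrier (omap F U) ==> amap F U U (idm U) x = x"
  using is_functorD(3)[OF F U] by simp
 show "amap F U U'' (scomp U g f) x = amap F U' U'' g (amap F U U' f x)"
  if "U' : Obj SVect" "U'' : Obj SVect" "f : shom U U'" "g : shom U' U''" "x : carrier (omap F U)"
  using is_functorD(4)[OF F U that(1,2), of f g] that by (simp add: compose_def)
qed

lemma lpf_sfun: "lpf F ==> sfun F"
 by (simp add: lpf_def)

definition mlpart :: "nat multiset => ('a, 'b) svect_functor => 'b set" where
 "mlpart nu F = {y : carrier (omap F (Proj nu)). ALL t. amap F (Proj nu) (Proj nu) (diag nu t) y = (PROD s:slots nu. t s) \<odot>[omap F (Proj nu)] y}"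

text \<open>The multilinear coefficient of \<open>F (diag nu t) y\<close>, as a function of
  \<open>t\<close>, written as a combination of values. Hence it stays in every subfunctor that
  contains \<open>y\<close>.\<close>

definition mlproj :: "nat multiset => ('a, 'b) svect_functor => nat => 'b => 'b" where
 "mlproj nu F d y = lcomb (omap F (Proj nu)) (nodes d (slots nu)) (node_weight d (slots nu) (%_. 1))
  (%n. amap F (Proj nu) (Proj nu) (diag nu (node n)) y)"

definition subfun :: "('a, 'b) svect_functor => ('a smod => 'b set) => bool" where
 "subfun F N \<longleftrightarrow> (ALL W:Obj SVect. lsub (omap F W) (N W)) &
  (ALL U:Obj SVect. ALL U':Obj SVect. ALL f:shom U U'. ALL x:N U. amap F U U' f x : N U')"

text \<open>The map of rank one \<open>w \<mapsto> tht w \<cdot> v\<close>, summed over its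
  conjugates by the symmetric group in degree \<open>i\<close> and extended by zero to the other
  degrees. Division by the group order is left to the coefficients.\<close>

definition avg :: "'a smod => 'a smod => nat => 'a => ('a => rat) => nat => 'a => 'a" where
 "avg W W' i v tht j = (\<lambda>w\<in>cs (W j). if j = i
  then lcomb (space (W' j)) (carrier (sym_group j)) (%p. tht (act (W j) (inv_into UNIV p) w)) (%p. act (W' j) p v)
  else \<zero>[space (W' j)])"

text \<open>For a monomial with exponents \<open>e\<close> in variables of degrees
  \<open>i a\<close>, the multiset \<open>nu\<close> receives one part \<open>i a\<close> for every
  factor of the variable \<open>a\<close>, and each slot remembers its variable. Different variables
  may share a degree, hence the explicit enumeration of each degree.\<close>

lemma labelling_exists:
 fixes i :: "nat => nat" and e :: "nat => nat"
 shows "EX nu al. al : slots nu \<rightarrow> {..<r} & (ALL s:slots nu. i (al s) = fst s) & (ALL a<r. card {s : slots nu. al s = a} = e a)"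
proof -
 define T where "T = (SIGMA a:{..<r}. {..<e a})"
 have T: "finite T" by (simp add: T_def)
 define nu where "nu = image_mset (%x. i (fst x)) (mset_set T)"
 have cnt: "count nu k = card {x : T. i (fst x) = k}" for k
  unfolding nu_def count_image_mset using T by (simp add: vimage_def Int_def conj_commute)
 have "EX b. bij_betw b {1..count nu k} {x : T. i (fst x) = k}" for k
  unfolding cnt using T by (intro finite_same_card_bij) auto
 then obtain b where b: "!!k. bij_betw (b k) {1..count nu k} {x : T. i (fst x) = k}" by metis
 define bt where "bt s = b (fst s) (snd s)" for s
 have bm: "bt s : T & i (fst (bt s)) = fst s" if "s : slots nu" for s
  using bij_betwE[OF b[of "fst s"]] that by (cases s) (auto simp: slots_iff bt_def)
 have inj: "inj_on bt (slots nu)"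
 proof (rule inj_onI)
  fix s s' assume s: "s : slots nu" "s' : slots nu" "bt s = bt s'"
  then have f: "fst s = fst s'" using bm by metis
  have "snd s = snd s'"
   using bij_betw_imp_inj_on[OF b[of "fst s"]] s f by (cases s; cases s') (auto simp: slots_iff bt_def dest: inj_onD)
  then show "s = s'" using f by (simp add: prod_eq_iff)
 qed
 have surj: "T <= bt ` slots nu"
 proof
  fix x assume x: "x : T"
  then have "x : b (i (fst x)) ` {1..count nu (i (fst x))}" using b[of "i (fst x)"] by (auto simp: bij_betw_def)
  then obtain j where "j : {1..count nu (i (fst x))}" "x = b (i (fst x)) j" by blast
  then show "x : bt ` slots nu" by (intro image_eqI[of _ _ "(i (fst x), j)"]) (simp_all add: bt_def slots_iff)
 qed
 show ?thesis
 proof (intro exI[of _ nu] exI[of _ "%s. fst (bt s)"] conjI ballI allI impI)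
  show "(%s. fst (bt s)) : slots nu \<rightarrow> {..<r}" using bm by (force simp: T_def)
  show "i (fst (bt s)) = fst s" if "s : slots nu" for s using bm[OF that] by blast
  fix a assume a: "a < r"
  have "bt ` {s : slots nu. fst (bt s) = a} = {x : T. fst x = a}" using bm surj by auto
  moreover have "{x : T. fst x = a} = Pair a ` {..<e a}" using a by (auto simp: T_def)
  moreover have "card (bt ` {s : slots nu. fst (bt s) = a}) = card {s : slots nu. fst (bt s) = a}"
   by (rule card_image) (auto intro: inj_on_subset[OF inj])
  ultimately show "card {s : slots nu. fst (bt s) = a} = e a" by (simp add: card_image inj_on_def)
 qed
qed

section \<open>Averages of maps of rank one\<close>

lemma avg_lcomb_closed:
 assumes W': "srep W'" and v: "v : cs (W' i)"
 shows "lcomb (space (W' i)) (carrier (sym_group i)) c (%p. act (W' i) p v) : cs (W' i)"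
 using W' v by (intro lcomb_closed fdvs_rvs is_repD(1)[of "sym_group i"] is_repD(5)[of "sym_group i"]) auto

lemma avg_hom:
 assumes W: "srep (W :: 'a smod)" and W': "srep (W' :: 'a smod)" and v: "v : cs (W' i)" and th: "tht : dual (space (W i))"
 shows "avg W W' i v tht : shom W W'"
proof (intro CollectI allI)
 fix j
 note R = W[rule_format, of j] and R' = W'[rule_format, of j]
 note V = fdvs_rvs[OF is_repD(1)[OF R]] and V' = fdvs_rvs[OF is_repD(1)[OF R']]
 show "avg W W' i v tht j : rep_hom (sym_group j) (W j) (W' j)"
 proof (cases "j = i")
  case True
  note vj = v[folded True] and thj = th[folded True]
  let ?G = "carrier (sym_group j)"
  let ?m = "%w. lcomb (space (W' j)) ?G (%p. tht (act (W j) (inv_into UNIV p) w)) (%p. act (W' j) p v)"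
  have pv: "act (W' j) p v : cs (W' j)" if "p : ?G" for p using is_repD(5)[OF R' that vj] .
  have m: "?m : mhom (space (W j)) (space (W' j))"
   by (intro lcomb_functionals_mhom[OF V'] dual_mhom[OF is_repD(2)[OF R] thj] pv) (simp_all add: permutes_inv)
  have e: "avg W W' i v tht j = restrict ?m (cs (W j))" by (simp add: avg_def True)
  show ?thesis
   unfolding e
  proof (rule rep_homI[OF lin_restrict[OF m V]])
   fix g w assume g: "g : ?G" and w: "w : cs (W j)"
   have gp: "g permutes {1..j}" using g by simp
   \<comment> \<open>Substituting \<open>g \<circ> p\<close> for \<open>p\<close> moves
     \<open>g\<close> out of the sum.\<close>
   have "?m (act (W j) g w) = lcomb (space (W' j)) ?G (%p. tht (act (W j) (inv_into UNIV (g \<circ> p)) (act (W j) g w))) (%p. act (W' j) (g \<circ> p) v)"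
   proof (rule lcomb_reindex[OF V' _ pv])
    show "bij_betw ((\<circ>) g) ?G ?G"
    proof (rule bij_betw_byWitness[where f' = "(\<circ>) (inv_into UNIV g)"])
    show "ALL a:?G. inv_into UNIV g \<circ> (g \<circ> a) = a" using permutes_inv_o(2)[OF gp] by (metis comp_assoc id_comp)
    show "ALL a:?G. g \<circ> (inv_into UNIV g \<circ> a) = a" using permutes_inv_o(1)[OF gp] by (metis comp_assoc id_comp)
    qed (use permutes_compose[OF _ gp] permutes_compose[OF _ permutes_inv[OF gp]] in "auto simp del: One_nat_def")
   qed
   also have "... = lcomb (space (W' j)) ?G (%p. tht (act (W j) (inv_into UNIV p) w)) (%p. act (W' j) g (act (W' j) p v))"
   proof (rule lcomb_cong[OF V' refl])
    fix p assume p: "p : ?G"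
    then have pp: "p permutes {1..j}" by simp
    have gp': "g \<circ> p : ?G" "inv_into UNIV (g \<circ> p) : ?G" using gp pp by (simp_all add: permutes_compose permutes_inv)
    show "act (W' j) (g \<circ> p) v : cs (W' j)" by (rule pv[OF gp'(1)])
    show "act (W' j) (g \<circ> p) v = act (W' j) g (act (W' j) p v)" using is_repD(4)[OF R' g p vj] by simp
    have "inv_into UNIV (g \<circ> p) \<circ> g = inv_into UNIV p"
    using permutes_inv_o(2)[OF gp] by (simp add: o_inv_distrib permutes_bij[OF gp] permutes_bij[OF pp] comp_assoc)
    then show "tht (act (W j) (inv_into UNIV (g \<circ> p)) (act (W j) g w)) = tht (act (W j) (inv_into UNIV p) w)"
    using is_repD(4)[OF R gp'(2) g w] by simp
   qed
   also have "... = act (W' j) g (?m w)" by (rule mhom_lcomb[OF V' V' is_repD(2)[OF R' g] pv, symmetric])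
   finally show "restrict ?m (cs (W j)) (act (W j) g w) = act (W' j) g (restrict ?m (cs (W j)) w)"
    using is_repD(5)[OF R g w] w by simp
  qed
 next
  case False
  then have e: "avg W W' i v tht j = (\<lambda>w\<in>cs (W j). \<zero>[space (W' j)])" by (simp add: avg_def)
  show ?thesis unfolding e
   by (rule rep_homI[OF lin_zero[OF V V']]) (simp add: is_repD(5)[OF R] mhom_zero[OF V' V' is_repD(2)[OF R']])
 qed
qed

text \<open>A morphism out of the target only changes the vector \<open>v\<close>. So an average
  whose vector is a generator of \<open>Proj nu\<close> is carried by \<open>ev\<close> to an
  average whose vector is an entry of the tuple.\<close>

lemma avg_natural:
 assumes W': "srep (W' :: 'a smod)" and W'': "srep (W'' :: 'a smod)" and f: "f : shom W' W''"
  and v: "v : cs (W' i)" and w: "w : cs (W j)"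
 shows "f j (avg W W' i v tht j w) = avg W W'' i (f i v) tht j w"
proof -
 have fj: "f j : rep_hom (sym_group j) (W' j) (W'' j)" using f by blast
 note R' = W'[rule_format, of j] and R'' = W''[rule_format, of j]
 note V' = fdvs_rvs[OF is_repD(1)[OF R']] and V'' = fdvs_rvs[OF is_repD(1)[OF R'']]
 show ?thesis
 proof (cases "j = i")
  case True
  note vj = v[folded True]
  let ?G = "carrier (sym_group j)"
  have "f j (lcomb (space (W' j)) ?G (%p. tht (act (W j) (inv_into UNIV p) w)) (%p. act (W' j) p v))
   = lcomb (space (W'' j)) ?G (%p. tht (act (W j) (inv_into UNIV p) w)) (%p. f j (act (W' j) p v))"
   by (rule mhom_lcomb[OF V' V'' rep_homD(2)[OF fj] is_repD(5)[OF R' _ vj]])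
  also have "... = lcomb (space (W'' j)) ?G (%p. tht (act (W j) (inv_into UNIV p) w)) (%p. act (W'' j) p (f j v))"
   by (rule lcomb_cong[OF V'' refl rep_homD(4)[OF fj is_repD(5)[OF R' _ vj]] refl rep_homD(3)[OF fj _ vj]])
  finally show ?thesis using w True by (simp add: avg_def)
 next
  case False
  then show ?thesis using w mhom_zero[OF V' V'' rep_homD(2)[OF fj]] by (simp add: avg_def)
 qed
qed

text \<open>Multiplication by \<open>t\<close> is itself an equivariant map, so this is an instance
  of naturality.\<close>

lemma avg_smult:
 assumes W': "srep (W' :: 'a smod)" and v: "v : cs (W' i)" and w: "w : cs (W j)"
 shows "avg W W' i (t \<odot>[space (W' i)] v) tht j w = t \<odot>[space (W' j)] avg W W' i v tht j w"
proof -
 have "(%i. \<lambda>v\<in>cs (W' i). t \<odot>[space (W' i)] v) : shom W' W'"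
 proof (intro CollectI allI rep_homI)
  fix i
  note R' = W'[rule_format, of i] 
  note V' = fdvs_rvs[OF is_repD(1)[OF R']]
  show "(\<lambda>v\<in>cs (W' i). t \<odot>[space (W' i)] v) : lin (space (W' i)) (space (W' i))"
   by (rule lin_restrict[OF mhomI V']) (simp_all add: V' rvs_distrib[OF V'] rvs_simps[OF V'] mult.commute)
  fix g v assume gv: "g : carrier (sym_group i)" "v : cs (W' i)"
  then show "(\<lambda>v\<in>cs (W' i). t \<odot>[space (W' i)] v) (act (W' i) g v) = act (W' i) g ((\<lambda>v\<in>cs (W' i). t \<odot>[space (W' i)] v) v)"
   using is_repD(5)[OF R' gv] mhom_smult[OF is_repD(2)[OF R' gv(1)] gv(2)] by simp
 qed
 note nat = avg_natural[where W = W and W' = W' and W'' = W' and i = i and j = j and v = v and w = w and tht = tht, OF W' W' this v w]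
 have "avg W W' i v tht j w : cs (W' j)"
  using w avg_lcomb_closed[OF W', of v j] v fdvs_rvs[OF is_repD(1)[OF W'[rule_format, of j]]] by (auto simp: avg_def)
 then show ?thesis using nat v by simp
qed

text \<open>A frame of each \<open>W i\<close> decomposes the identity of \<open>W\<close> into averages.\<close>

lemma identity_averages:
 assumes Wo: "(W :: 'a smod) : Obj SVect"
 shows "EX r i v tht c. (ALL a<r::nat. v a : cs (W (i a)) & tht a : dual (space (W (i a)))) &
  lcomb (shv W W) {..<r} c (%a. avg W W (i a) (v a) (tht a)) = idm W"
proof -
 have W: "srep W" and fd: "fdvs (dsum (%i. space (W i)))" using Wo by simp_all
 note V = fdvs_rvs[OF is_repD(1)[OF W[rule_format]]]
 obtain N where N: "finite N" and N0: "!!i. i ~: N ==> cs (W i) = {\<zero>[space (W i)]}"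
  using fdvs_dsum_finite_support[of "%i. space (W i)", OF V fd] by metis
 have "ALL i. EX n v l. frame (space (W i)) n v l" using fdvs_frame[OF is_repD(1)[OF W[rule_format]]] by metis
 then obtain n v l where fr: "!!i. frame (space (W i)) (n i) (v i) (l i)" by metis
 define A where "A = (SIGMA i:N. {..<n i})"
 have A: "finite A" using N by (simp add: A_def)
 obtain h where h: "bij_betw h {..<card A} A" using ex_bij_betw_nat_finite[OF A] by (auto simp: atLeast0LessThan)
 let ?i = "%a. fst (h a)" and ?v = "%a. v (fst (h a)) (snd (h a))" and ?l = "%a. l (fst (h a)) (snd (h a))"
 \<comment> \<open>Summed over a frame, the averages in degree \<open>i\<close> give the identity
   once for every group element.\<close>
 define c :: "nat => rat" where "c a = 1 / of_nat (card (carrier (sym_group (?i a))))" for a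
 have frm: "v i k : cs (W i)" "l i k : dual (space (W i))" if "(i, k) : A" for i k
  using fr[of i] that by (auto simp: frame_def A_def)
 have vl: "?v a : cs (W (?i a)) & ?l a : dual (space (W (?i a)))" if "a < card A" for a
  using frm[of "?i a" "snd (h a)"] bij_betwE[OF h] that by simp
 have av: "avg W W (?i a) (?v a) (?l a) : shom W W" if "a : {..<card A}" for a
  using vl[of a] that by (intro avg_hom W) auto
 have "lcomb (shv W W) {..<card A} c (%a. avg W W (?i a) (?v a) (?l a)) = idm W"
 proof (rule shom_eqI[OF shom_lcomb_closed[OF W W av]])
  show "idm W : shom W W" using W by (auto intro: rep_hom_id)
  fix j w assume w: "w : cs (W j)"
  note R = W[rule_format, of j]
  let ?G = "carrier (sym_group j)"
  have avj: "avg W W (?i a) (?v a) (?l a) j w : cs (W j)" if "a : {..<card A}" for a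
   using rep_homD(4)[of _ "sym_group j" "W j" "W j", OF _ w] av[OF that] by blast
  have "lcomb (space (W j)) {..<card A} c (%a. avg W W (?i a) (?v a) (?l a) j w) = w"
  proof (rule separated_eqI[OF fdvs_svs[OF is_repD(1)[OF R]] lcomb_closed[OF V avj] w])
   fix m assume m: "m : dual (space (W j))"
   let ?f = "%x. 1 / of_nat (card (carrier (sym_group (fst x)))) * m (avg W W (fst x) (v (fst x) (snd x)) (l (fst x) (snd x)) j w)"
   have "m (lcomb (space (W j)) {..<card A} c (%a. avg W W (?i a) (?v a) (?l a) j w)) = (\<Sum>a<card A. ?f (h a))"
    unfolding c_def by (rule dual_lcomb[OF V m avj])
   also have "... = (SUM x:A. ?f x)" by (rule sum.reindex_bij_betw[OF h])
   also have "... = (SUM i:N. \<Sum>k<n i. ?f (i, k))" unfolding A_def using N by (subst sum.Sigma) (auto simp: case_prod_beta)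
   also have "... = (SUM i:N. if i = j then m w else 0)"
   proof (rule sum.cong[OF refl])
    fix i assume i: "i : N"
    show "(\<Sum>k<n i. ?f (i, k)) = (if i = j then m w else 0)"
    proof (cases "i = j")
    case True
    have pv: "act (W j) p (v j k) : cs (W j)" if "p : ?G" "k < n j" for p k
    using is_repD(5)[OF R that(1)] frm(1)[of j k] that i True by (auto simp: A_def)
    have "m (avg W W j (v j k) (l j k) j w) = (SUM p:?G. l j k (act (W j) (inv_into UNIV p) w) * m (act (W j) p (v j k)))" if "k < n j" for k
    using w dual_lcomb[where V = "space (W j)" and A = ?G and x = "%p. act (W j) p (v j k)" and c = "%p. l j k (act (W j) (inv_into UNIV p) w)", OF V m pv[OF _ that]]
    by (simp add: avg_def)
    then have "(\<Sum>k<n i. m (avg W W j (v j k) (l j k) j w)) = (SUM p:?G. \<Sum>k<n j. l j k (act (W j) (inv_into UNIV p) w) * m (act (W j) p (v j k)))"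
    using True by (subst sum.swap) simp
    also have "... = (SUM p:?G. m w)"
    proof (rule sum.cong[OF refl])
    fix p assume p: "p : ?G"
    then have pi: "inv_into UNIV p : ?G" and pp: "p permutes {1..j}" by (simp_all add: permutes_inv)
    have "(\<Sum>k<n j. l j k (act (W j) (inv_into UNIV p) w) * m (act (W j) p (v j k))) = m (act (W j) p (act (W j) (inv_into UNIV p) w))"
    by (rule frame_dual[OF V fr dual_mhom[OF is_repD(2)[OF R p] m] is_repD(5)[OF R pi w], symmetric])
    also have "... = m w"
    using is_repD(4)[OF R p pi w] is_repD(3)[OF R w] permutes_inv_o(1)[OF pp] by simp
    finally show "(\<Sum>k<n j. l j k (act (W j) (inv_into UNIV p) w) * m (act (W j) p (v j k))) = m w" .
    qed
    also have "... = of_nat (card ?G) * m w" by simp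
    finally have "(\<Sum>k<n i. m (avg W W j (v j k) (l j k) j w)) = of_nat (card ?G) * m w" .
    moreover have "card ?G ~= 0" using finite_sym_group[of j] permutes_id[of "{1..j}"] by (simp only: card_eq_0_iff) (auto simp del: permutes_id)
    ultimately show ?thesis using True by (simp add: sum_divide_distrib[symmetric])
    next
    case False
    then show ?thesis using w dual_zero[OF V m] by (simp add: avg_def)
    qed
   qed
   also have "... = m w" using N N0[of j] w dual_zero[OF V m] by (auto simp: sum.delta)
   finally show "m (lcomb (space (W j)) {..<card A} c (%a. avg W W (?i a) (?v a) (?l a) j w)) = m w" .
  qed
  then show "lcomb (shv W W) {..<card A} c (%a. avg W W (?i a) (?v a) (?l a)) j w = idm W j w"
   using w shom_lcomb_eval[where A = "{..<card A}" and t = c, OF W W av w] by simp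
 qed
 then show ?thesis using vl by (intro exI[of _ "card A"] exI[of _ ?i] exI[of _ ?v] exI[of _ ?l] exI[of _ c]) blast
qed

text \<open>The scalar form of \<open>lpf\<close>, with room to enlarge the degree: one degree can
  then serve several purposes at once.\<close>

lemma lpf_polyfun:
 assumes F: "lpf (F :: ('a, 'b) svect_functor)" and U: "U : Obj SVect" and U': "U' : Obj SVect" and x: "x : carrier (omap F U)"
 shows "EX d. ALL r a d' l. a : {..<r} \<rightarrow> shom U U' --> d \<le> d' --> l : dual (omap F U') -->
  polyfun r d' (%t. l (amap F U U' (lcomb (shv U U') {..<r} t a) x))"
proof -
 obtain d where d: "ALL r::nat. ALL a:{..<r} \<rightarrow> shom U U'. EX c:exponents r d \<rightarrow> carrier (omap F U'). ALL t.
    amap F U U' (lcomb (shv U U') {..<r} t a) x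
    = lcomb (omap F U') (exponents r d) (%e. \<Prod>i<r. t i ^ e i) c"
  using F U U' x unfolding lpf_def by blast
 show ?thesis
 proof (intro exI[of _ d] allI impI)
  fix r :: nat and a d' l assume a: "a : {..<r} \<rightarrow> shom U U'" and dd: "d \<le> d'" and l: "l : dual (omap F U')"
  obtain c where c: "c : exponents r d \<rightarrow> carrier (omap F U')"
   and eq: "ALL t. amap F U U' (lcomb (shv U U') {..<r} t a) x
    = lcomb (omap F U') (exponents r d) (%e. \<Prod>i<r. t i ^ e i) c" using d a by blast
  have "polyfun r d (%t. l (amap F U U' (lcomb (shv U U') {..<r} t a) x))"
   unfolding polyfun_def
  proof (intro exI[of _ "%e. l (c e)"] allI)
   fix t
   have "l (lcomb (omap F U') (exponents r d) (%e. \<Prod>i<r. t i ^ e i) c) = (SUM e:exponents r d. (\<Prod>i<r. t i ^ e i) * l (c e))"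
    by (rule dual_lcomb[OF sfunD(2)[OF lpf_sfun[OF F] U'] l]) (use c in auto)
   then show "l (amap F U U' (lcomb (shv U U') {..<r} t a) x) = (SUM e:exponents r d. l (c e) * (\<Prod>i<r. t i ^ e i))"
    by (simp only: eq[rule_format] mult.commute)
  qed
  then show "polyfun r d' (%t. l (amap F U U' (lcomb (shv U U') {..<r} t a) x))"
   using dd by (rule polyfun_mono)
 qed
qed

context
 assumes inf: "infinite (UNIV :: 'a set)"
begin

section \<open>The projection to the multilinear part\<close>

lemma mlproj_closed:
 assumes F: "sfun (F :: ('a, 'b) svect_functor)" and y: "y : carrier (omap F (Proj nu))"
 shows "mlproj nu F d y : carrier (omap F (Proj nu))"
 unfolding mlproj_def
 by (intro lcomb_closed sfunD(2)[OF F Proj_Obj[OF inf]] sfunD(5)[OF F Proj_Obj[OF inf] Proj_Obj[OF inf] diag_hom[OF inf] y])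

lemma lsub_mlpart:
 assumes F: "sfun (F :: ('a, 'b) svect_functor)"
 shows "lsub (omap F (Proj nu)) (mlpart nu F)"
proof -
 note P = Proj_Obj[OF inf, of nu]
 note D = sfunD(4)[OF F P P diag_hom[OF inf]] and V = sfunD(2)[OF F P]
 show ?thesis
  unfolding lsub_def mlpart_def
  by (auto simp: V mhom_zero[OF V V D] mhom_add[OF D] mhom_smult[OF D] rvs_simps[OF V] rvs_distrib[OF V] mult.commute)
qed

text \<open>\<open>diag nu t\<close> is linear in \<open>t\<close>: it is a combination of the
  idempotents that keep one generator and kill the others. The enumeration \<open>sl\<close> of the
  slots brings this into the shape required by \<open>lpf\<close>.\<close>

lemma diag_lcomb:
 assumes sl: "bij_betw sl {..<r::nat} (slots nu)"
 shows "diag nu t = lcomb (shv (Proj nu :: 'a smod) (Proj nu)) {..<r} (%a. t (sl a)) (%a. diag nu (%s. if s = sl a then 1 else 0))"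
  (is "_ = lcomb ?H _ _ ?E")
proof (rule shom_eqI[OF diag_hom[OF inf]])
 note P = Psrep[OF inf, of nu]
 have E: "?E a : shom (Proj nu :: 'a smod) (Proj nu)" for a by (rule diag_hom[OF inf])
 show H: "lcomb ?H {..<r} (%a. t (sl a)) ?E : shom (Proj nu :: 'a smod) (Proj nu)" by (rule shom_lcomb_closed[OF P P E])
 fix i z assume z: "z : cs (Proj nu i :: (perm, 'a) rep)"
 note V = Proj_rvs[OF inf, of nu i]
 have hm: "f i : mhom (space (Proj nu i)) (space (Proj nu i))" if "f : shom (Proj nu :: 'a smod) (Proj nu)" for f
  using that by (blast intro: rep_homD(2))
 show "diag nu t i z = lcomb ?H {..<r} (%a. t (sl a)) ?E i z"
 proof (rule Proj_ext[OF inf V hm[OF diag_hom[OF inf]] hm[OF H] _ z])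
  fix p j assume pj: "(p, j) : idx nu i"
  then have s: "(i, j) : slots nu" and p: "p : carrier (sym_group i)" by (auto simp: idx_iff)
  let ?g = "act (Proj nu i) p (gen nu (i, j)) :: 'a"
  note gc = act_gen_closed[OF inf pj]
  have dg: "diag nu t' i ?g = t' (i, j) \<odot>[space (Proj nu i)] ?g" for t'
   unfolding diag_def ev_act_gen[OF inf P scale_tuple_closed[OF P gtup_closed[OF inf]] pj]
   using s mhom_smult[OF is_repD(2)[OF P[rule_format] p] gen_closed[OF inf s]] by (simp add: scale_tuple_def factors_def gtup_def)
  have "(i, j) : sl ` {..<r}" using sl s by (simp add: bij_betw_def)
  then obtain a where a: "a < r" "sl a = (i, j)" by (metis imageE lessThan_iff)
  have e: "(i, j) = sl b \<longleftrightarrow> b = a" if "b < r" for b using sl a that by (auto simp: bij_betw_def dest: inj_onD)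
  have "lcomb ?H {..<r} (%a. t (sl a)) ?E i ?g = lcomb (space (Proj nu i)) {..<r} (%a. t (sl a)) (%a. (if (i, j) = sl a then 1 else 0) \<odot>[space (Proj nu i)] ?g)"
   by (simp only: shom_lcomb_eval[OF P P E gc] dg)
  also have "... = lcomb (space (Proj nu i)) {..<r} (%b. t (sl b) * (if (i, j) = sl b then 1 else 0)) (%_. ?g)"
   by (rule lcomb_scale[OF V gc])
  also have "... = lcomb (space (Proj nu i)) {..<r} (%b. if b = a then t (i, j) else 0) (%_. ?g)"
   by (rule lcomb_cong[OF V refl gc]) (use a(2) e in auto)
  also have "... = t (i, j) \<odot>[space (Proj nu i)] ?g" using a(1) gc by (intro lcomb_delta V) auto
  finally show "diag nu t i ?g = lcomb ?H {..<r} (%a. t (sl a)) ?E i ?g" by (simp only: dg)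
 qed
qed

text \<open>Applying \<open>F (diag nu u)\<close> multiplies each coefficient of
  \<open>F (diag nu t) y\<close> by the corresponding monomial in \<open>u\<close>. Once
  \<open>d\<close> is large enough, interpolation leaves only the exponents that are 1 everywhere,
  whose monomial is the product of all scalars.\<close>

lemma mlproj_mlpart:
 assumes F: "lpf (F :: ('a, 'b) svect_functor)" and y: "y : carrier (omap F (Proj nu))"
 shows "EX d0. ALL d>=d0. mlproj nu F d y : mlpart nu F"
proof -
 note P = Proj_Obj[OF inf, of nu] and Fs = lpf_sfun[OF F]
 note V = sfunD(1)[OF Fs P] and D = diag_hom[OF inf]
 let ?V = "omap F (Proj nu)" and ?S = "slots nu" and ?d = "%t. amap F (Proj nu) (Proj nu) (diag nu t)"
 obtain sl where sl: "bij_betw sl {..<size nu} ?S"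
  using ex_bij_betw_nat_finite[OF finite_slots[of nu]] by (auto simp: atLeast0LessThan card_slots)
 define al where "al = the_inv_into {..<size nu} sl"
 have al: "al : ?S \<rightarrow> {..<size nu}" using bij_betwE[OF bij_betw_the_inv_into[OF sl]] by (auto simp: al_def)
 have fib: "{s : ?S. al s = a} = {sl a}" if "a < size nu" for a
  using sl that by (auto simp: al_def bij_betw_def the_inv_into_f_f f_the_inv_into_f)
 obtain d where d: "ALL r a d' l. a : {..<r} \<rightarrow> shom (Proj nu) (Proj nu) --> d \<le> d' --> l : dual ?V -->
  polyfun r d' (%t. l (amap F (Proj nu) (Proj nu) (lcomb (shv (Proj nu) (Proj nu)) {..<r} t a) y))"
  using lpf_polyfun[OF F P P y] by blast
 show ?thesis
 proof (intro exI[of _ "d + size nu"] allI impI)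
  fix d' assume "d + size nu \<le> d'"
  then have d': "d \<le> d'" "size nu \<le> d'" by simp_all
  let ?w = "node_weight d' ?S (%_. 1)"
  \<comment> \<open>Exponent 1 at every slot; the value 0 beyond \<open>size nu\<close> is what
    membership in \<open>exponents\<close> demands.\<close>
  let ?one = "%a. if a < size nu then 1 else 0 :: nat"
  have one: "?one : exponents (size nu) d'" using d'(2) by (simp add: exponents_def)
  \<comment> \<open>Polarization with singleton fibres, in which no variable is split.\<close>
  obtain N where N: "ALL e':exponents (size nu) d'. multicoeff d' ?S (%t. \<Prod>a<size nu. (\<Sum>s | s : ?S & al s = a. t s) ^ e' a) = (if e' = ?one then N else 0)"
   using multicoeff_power_sums[OF finite_slots al one _ order_refl] fib by auto
  have mc: "multicoeff d' ?S (%t. \<Prod>a<size nu. t (sl a) ^ e a) = (if e = ?one then N else 0)" if "e : exponents (size nu) d'" for e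
  proof -
   have "(\<Prod>a<size nu. (\<Sum>s | s : ?S & al s = a. t s) ^ e a) = (\<Prod>a<size nu. t (sl a) ^ e a)" for t :: "nat \<times> nat => rat"
    by (rule prod.cong[OF refl]) (simp add: fib)
   with bspec[OF N that] show ?thesis by simp
  qed
  have key: "EX C. ALL u. l (?d u (mlproj nu F d' y)) = C * (PROD s:?S. u s)" if l: "l : dual ?V" for l
  proof -
   have "polyfun (size nu) d' (%t. l (amap F (Proj nu) (Proj nu) (lcomb (shv (Proj nu) (Proj nu)) {..<size nu} t (%a. diag nu (%s. if s = sl a then 1 else 0))) y))"
    by (rule d[rule_format, OF Pi_I d'(1) l]) (rule D)
   then obtain c where c: "!!t. l (amap F (Proj nu) (Proj nu) (lcomb (shv (Proj nu) (Proj nu)) {..<size nu} t (%a. diag nu (%s. if s = sl a then 1 else 0))) y)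
    = (SUM e:exponents (size nu) d'. c e * (\<Prod>i<size nu. t i ^ e i))"
    unfolding polyfun_def by metis
   have p: "l (?d t y) = (SUM e:exponents (size nu) d'. c e * (\<Prod>i<size nu. t (sl i) ^ e i))" for t
    unfolding diag_lcomb[OF sl, of t] by (rule c)
   have "l (?d u (mlproj nu F d' y)) = (c ?one * N) * (PROD s:?S. u s)" for u
   proof -
    have "?d u (mlproj nu F d' y) = lcomb ?V (nodes d' ?S) ?w (%n. ?d u (?d (node n) y))"
    unfolding mlproj_def
    by (rule mhom_lcomb[OF sfunD(2)[OF Fs P] sfunD(2)[OF Fs P] sfunD(4)[OF Fs P P D] sfunD(5)[OF Fs P P D y]])
    moreover have "?d u (?d (node n) y) = ?d (%s. u s * node n s) y" for n
    by (simp only: sfunD(7)[OF Fs P P P D D y, symmetric] diag_diag[OF inf])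
    ultimately have "?d u (mlproj nu F d' y) = lcomb ?V (nodes d' ?S) ?w (%n. ?d (%s. u s * node n s) y)" by simp
    then have "l (?d u (mlproj nu F d' y)) = (SUM n:nodes d' ?S. ?w n * l (?d (%s. u s * node n s) y))"
    using dual_lcomb[OF sfunD(2)[OF Fs P] l sfunD(5)[OF Fs P P D y]] by simp
    also have "... = multicoeff d' ?S (%t. SUM e:exponents (size nu) d'. (c e * (\<Prod>i<size nu. u (sl i) ^ e i)) * (\<Prod>i<size nu. t (sl i) ^ e i))"
    unfolding coefficient_def p by (simp add: power_mult_distrib prod.distrib mult.assoc)
    also have "... = (SUM e:exponents (size nu) d'. (c e * (\<Prod>i<size nu. u (sl i) ^ e i)) * multicoeff d' ?S (%t. \<Prod>i<size nu. t (sl i) ^ e i))"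
    by (rule coefficient_sum)
    also have "... = (SUM e:exponents (size nu) d'. if e = ?one then (c e * (\<Prod>i<size nu. u (sl i) ^ e i)) * N else 0)"
    by (rule sum.cong[OF refl]) (simp only: mc[rule_format] mult_zero_right simp_thms split: if_split, blast?)
    also have "... = (c ?one * (\<Prod>i<size nu. u (sl i) ^ ?one i)) * N"
    by (subst sum.delta[OF finite_exponents]) (simp only: one if_True)
    also have "(\<Prod>i<size nu. u (sl i) ^ ?one i) = (PROD s:?S. u s)"
    using prod.reindex_bij_betw[OF sl, of u] by simp
    finally show ?thesis by (simp only: mult_ac)
   qed
   then show ?thesis by blast
  qed
  note mp = mlproj_closed[OF Fs y, of d']
  have "?d t (mlproj nu F d' y) = (PROD s:?S. t s) \<odot>[?V] mlproj nu F d' y" for t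
  proof (rule separated_eqI[OF V sfunD(5)[OF Fs P P D mp]])
   show "(PROD s:?S. t s) \<odot>[?V] mlproj nu F d' y : carrier ?V" using V mp by simp
   fix l assume l: "l : dual ?V"
   obtain C where C: "!!u. l (?d u (mlproj nu F d' y)) = C * (PROD s:?S. u s)" using key[OF l] by blast
   \<comment> \<open>Setting all scalars to 1 identifies the constant.\<close>
   have "l (mlproj nu F d' y) = C"
    using C[of "%_. 1"] sfunD(6)[OF Fs P mp] by (simp add: diag_one[OF inf])
   then show "l (?d t (mlproj nu F d' y)) = l ((PROD s:?S. t s) \<odot>[?V] mlproj nu F d' y)"
    using C[of t] l mp by simp
  qed
  then show "mlproj nu F d' y : mlpart nu F" using mp by (simp add: mlpart_def)
 qed
qed

text \<open>A combination of averages of \<open>W\<close> whose coefficients are sums of scalars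
  over fibres factors through the scaling of the generators of \<open>Proj nu\<close>. Applying a
  functor to this factorization polarizes it.\<close>

lemma ev_avg_lcomb:
 assumes Wo: "(W :: 'a smod) : Obj SVect" and al: "al : slots nu \<rightarrow> {..<r::nat}" "!!s. s : slots nu ==> i (al s) = fst s"
  and v: "!!a. a < r ==> v a : cs (W (i a))" and th: "!!a. a < r ==> tht a : dual (space (W (i a)))"
 defines "q \<equiv> lcomb (shv W (Proj nu)) (slots nu) (%_. 1) (%s. avg W (Proj nu) (fst s) (gen nu s) (tht (al s)))"
  and "w \<equiv> (\<lambda>s\<in>slots nu. v (al s))"
 shows "q : shom W (Proj nu)" "w : ptuples nu W"
  "scomp W (ev nu W w) (scomp W (diag nu t) q)
   = lcomb (shv W W) {..<r} (%a. \<Sum>s | s : slots nu & al s = a. t s) (%a. avg W W (i a) (v a) (tht a))"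
proof -
 have W: "srep W" using Wo by simp
 note P = Psrep[OF inf, of nu] and D = diag_hom[OF inf, of nu]
 let ?P = "Proj nu :: 'a smod"
 have alr: "al s < r" if "s : slots nu" for s using al(1) that by auto
 have gs: "gen nu s : cs (?P (fst s))" if "s : slots nu" for s using gen_closed[OF inf, of "fst s" "snd s" nu] that by simp
 have ths: "tht (al s) : dual (space (W (fst s)))" if "s : slots nu" for s using th[OF alr[OF that]] al(2)[OF that] by simp
 have as: "avg W ?P (fst s) (gen nu s) (tht (al s)) : shom W ?P" if "s : slots nu" for s by (rule avg_hom[OF W P gs[OF that] ths[OF that]])
 show q: "q : shom W ?P" unfolding q_def by (rule shom_lcomb_closed[OF W P as])
 have ws: "w s = v (al s)" "v (al s) : cs (W (fst s))" if "s : slots nu" for s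
  using that v[OF alr[OF that]] al(2)[OF that] by (simp_all add: w_def)
 show w: "w : ptuples nu W"
 proof (rule ptuplesI)
  show "w (i', j') : cs (W i')" if "(i', j') : slots nu" for i' j' using ws[OF that] by simp
 qed (simp add: w_def)
 let ?u = "scale_tuple nu W t w"
 note u = scale_tuple_closed[OF W w, of t]
 have "scomp W (ev nu W w) (scomp W (diag nu t) q) = scomp W (scomp ?P (ev nu W w) (diag nu t)) q"
 proof
  fix j
  have "q j : rep_hom (sym_group j) (W j) (?P j)" using q by blast
  from rep_homD(4)[OF this]
  show "scomp W (ev nu W w) (scomp W (diag nu t) q) j = scomp W (scomp ?P (ev nu W w) (diag nu t)) q j"
   by (auto simp: compose_def fun_eq_iff)
 qed
 also have "scomp ?P (ev nu W w) (diag nu t) = ev nu W ?u" by (rule ev_diag[OF inf W w])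
 also have "scomp W (ev nu W ?u) q = lcomb (shv W W) {..<r} (%a. \<Sum>s | s : slots nu & al s = a. t s) (%a. avg W W (i a) (v a) (tht a))"
  (is "_ = ?rhs")
 proof (rule shom_eqI)
  show "scomp W (ev nu W ?u) q : shom W W" by (rule shom_compose[OF W q ev_hom[OF inf W u]])
  have av: "avg W W (i a) (v a) (tht a) : shom W W" if "a : {..<r}" for a using that by (intro avg_hom W v th) auto
  show "?rhs : shom W W" by (rule shom_lcomb_closed[OF W W av])
  fix j z assume z: "z : cs (W j)"
  note Vj = fdvs_rvs[OF is_repD(1)[OF W[rule_format, of j]]] and VPj = fdvs_rvs[OF is_repD(1)[OF P[rule_format, of j]]]
  have hm: "f j : mhom (space (?P j)) (space (W j))" if "f : shom ?P W" for f using that by (blast intro: rep_homD(2))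
  have asj: "avg W ?P (fst s) (gen nu s) (tht (al s)) j z : cs (?P j)" if "s : slots nu" for s
   using rep_homD(4)[of _ "sym_group j" "W j" "?P j", OF _ z] as[OF that] by blast
  have avj: "avg W W (i a) (v a) (tht a) j z : cs (W j)" if "a : {..<r}" for a
   using rep_homD(4)[of _ "sym_group j" "W j" "W j", OF _ z] av[OF that] by blast
  have avs: "avg W W (i (al s)) (v (al s)) (tht (al s)) j z : cs (W j)" if "s : slots nu" for s
   using avj[of "al s"] alr[OF that] by simp
  \<comment> \<open>Naturality replaces the generator by the scaled entry of the tuple, and the
    scalar is then pulled out of the average.\<close>
  have tm: "ev nu W ?u j (avg W ?P (fst s) (gen nu s) (tht (al s)) j z) = t s \<odot>[space (W j)] avg W W (i (al s)) (v (al s)) (tht (al s)) j z"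
   if s: "s : slots nu" for s
  proof -
   have "ev nu W ?u j (avg W ?P (fst s) (gen nu s) (tht (al s)) j z) = avg W W (fst s) (ev nu W ?u (fst s) (gen nu s)) (tht (al s)) j z"
    by (rule avg_natural[where W = W and W' = ?P and W'' = W and i = "fst s" and j = j and v = "gen nu s" and w = z and tht = "tht (al s)", OF P W ev_hom[OF inf W u] gs[OF s] z])
   also have "ev nu W ?u (fst s) (gen nu s) = t s \<odot>[space (W (fst s))] v (al s)"
    using ev_gen[OF inf W u, of "fst s" "snd s"] s ws(1)[OF s] by (cases s) (simp add: scale_tuple_def factors_def)
   finally show ?thesis using avg_smult[where W = W and W' = W and i = "fst s" and j = j and v = "v (al s)" and w = z, OF W ws(2)[OF s] z] al(2)[OF s] by simp
  qed
  have qj: "q j z = lcomb (space (?P j)) (slots nu) (%_. 1) (%s. avg W ?P (fst s) (gen nu s) (tht (al s)) j z)"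
   unfolding q_def by (rule shom_lcomb_eval[OF W P as z])
  have rj: "?rhs j z = lcomb (space (W j)) {..<r} (%a. \<Sum>s | s : slots nu & al s = a. t s) (%a. avg W W (i a) (v a) (tht a) j z)"
   by (rule shom_lcomb_eval[OF W W av z])
  have "ev nu W ?u j (q j z) = lcomb (space (W j)) (slots nu) (%_. 1) (%s. ev nu W ?u j (avg W ?P (fst s) (gen nu s) (tht (al s)) j z))"
   unfolding qj by (rule mhom_lcomb[OF VPj Vj hm[OF ev_hom[OF inf W u]] asj])
  also have "... = lcomb (space (W j)) (slots nu) (%_. 1) (%s. t s \<odot>[space (W j)] avg W W (i (al s)) (v (al s)) (tht (al s)) j z)"
   by (rule lcomb_cong[OF Vj refl _ refl tm]) (simp_all add: tm avs Vj)
  also have "... = lcomb (space (W j)) (slots nu) t (%s. avg W W (i (al s)) (v (al s)) (tht (al s)) j z)"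
   by (simp add: lcomb_scale[OF Vj avs])
  also have "... = lcomb (space (W j)) {..<r} (%a. \<Sum>s | s : slots nu & al s = a. t s) (%a. avg W W (i a) (v a) (tht a) j z)"
  proof (rule separated_eqI[OF fdvs_svs[OF is_repD(1)[OF W[rule_format, of j]]] lcomb_closed[OF Vj avs] lcomb_closed[OF Vj avj]])
   fix l assume l: "l : dual (space (W j))"
   have "l (lcomb (space (W j)) (slots nu) t (%s. avg W W (i (al s)) (v (al s)) (tht (al s)) j z))
    = (SUM s:slots nu. t s * l (avg W W (i (al s)) (v (al s)) (tht (al s)) j z))" by (rule dual_lcomb[OF Vj l avs])
   also have "... = (\<Sum>a<r. \<Sum>s | s : slots nu & al s = a. t s * l (avg W W (i (al s)) (v (al s)) (tht (al s)) j z))"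
    using al(1) by (intro sum.group[symmetric] finite_slots) auto
   also have "... = (\<Sum>a<r. (\<Sum>s | s : slots nu & al s = a. t s) * l (avg W W (i a) (v a) (tht a) j z))"
    by (simp add: sum_distrib_right)
   also have "... = l (lcomb (space (W j)) {..<r} (%a. \<Sum>s | s : slots nu & al s = a. t s) (%a. avg W W (i a) (v a) (tht a) j z))"
    by (rule dual_lcomb[OF Vj l avj, symmetric])
   finally show "l (lcomb (space (W j)) (slots nu) t (%s. avg W W (i (al s)) (v (al s)) (tht (al s)) j z))
    = l (lcomb (space (W j)) {..<r} (%a. \<Sum>s | s : slots nu & al s = a. t s) (%a. avg W W (i a) (v a) (tht a) j z))" .
  qed
  finally show "scomp W (ev nu W ?u) q j z = ?rhs j z"
   using z by (simp only: compose_eq rj)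
 qed
 finally show "scomp W (ev nu W w) (scomp W (diag nu t) q) = ?rhs" .
qed

text \<open>Applying \<open>F\<close> to the decomposition of the identity writes \<open>x\<close>
  as a combination of coefficients \<open>c e\<close>. The factorization through
  \<open>Proj nu\<close> shows that \<open>c e\<close>, up to a product of factorials, is the image
  of an element of \<open>N (Proj nu)\<close> that lies in the multilinear part, hence in
  \<open>N'\<close>.\<close>

lemma subfunctor_le:
 assumes F: "lpf (F :: ('a, 'b) svect_functor)" and N: "subfun F N" and N': "subfun F N'"
  and ml: "!!nu. N (Proj nu) \<inter> mlpart nu F <= N' (Proj nu)" and W: "W : Obj SVect"
 shows "N W <= N' W"
proof
 fix x assume xN: "x : N W"
 note Fs = lpf_sfun[OF F]
 note V = sfunD(2)[OF Fs W] and sV = sfunD(1)[OF Fs W]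
 have Wr: "srep W" using W by simp
 have sub: "lsub (omap F U) (N U)" "lsub (omap F U) (N' U)" if "U : Obj SVect" for U
  using N N' that by (simp_all add: subfun_def)
 have st: "amap F U U' f y : N U'" if "U : Obj SVect" "U' : Obj SVect" "f : shom U U'" "y : N U" for U U' f y
  using N that unfolding subfun_def by blast
 have st': "amap F U U' f y : N' U'" if "U : Obj SVect" "U' : Obj SVect" "f : shom U U'" "y : N' U" for U U' f y
  using N' that unfolding subfun_def by blast
 have x: "x : carrier (omap F W)" using xN sub(1)[OF W] by (auto simp: lsub_def)
 obtain r i v tht b where vth: "ALL a<r::nat. v a : cs (W (i a)) & tht a : dual (space (W (i a)))"
  and idl: "lcomb (shv W W) {..<r} b (%a. avg W W (i a) (v a) (tht a)) = idm W"
  using identity_averages[OF W] by blast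
 let ?\<rho> = "%a. avg W W (i a) (v a) (tht a)"
 have \<rho>: "?\<rho> : {..<r} \<rightarrow> shom W W" using vth by (intro Pi_I avg_hom Wr) auto
 obtain d where d: "ALL r::nat. ALL a:{..<r} \<rightarrow> shom W W. EX c:exponents r d \<rightarrow> carrier (omap F W). ALL t.
    amap F W W (lcomb (shv W W) {..<r} t a) x
    = lcomb (omap F W) (exponents r d) (%e. \<Prod>i<r. t i ^ e i) c"
  using F W x unfolding lpf_def by blast
 from bspec[OF spec[OF d] \<rho>] obtain c where c: "c : exponents r d \<rightarrow> carrier (omap F W)"
  and eq: "!!t. amap F W W (lcomb (shv W W) {..<r} t ?\<rho>) x = lcomb (omap F W) (exponents r d) (%e. \<Prod>i<r. t i ^ e i) c"
  by blast
 have cN: "c e : N' W" if e: "e : exponents r d" for e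
 proof -
  obtain nu al where al: "al : slots nu \<rightarrow> {..<r}" "ALL s:slots nu. i (al s) = fst s" and fib: "ALL a<r. card {s : slots nu. al s = a} = e a"
   using labelling_exists[of r i e] by blast
  define q where "q = lcomb (shv W (Proj nu)) (slots nu) (%_. 1) (%s. avg W (Proj nu) (fst s) (gen nu s) (tht (al s)))"
  define w where "w = (\<lambda>s\<in>slots nu. v (al s))"
  note ea = ev_avg_lcomb[OF W al(1), of i v tht, folded q_def w_def]
  have q: "q : shom W (Proj nu)" and w: "w : ptuples nu W"
   and comp: "!!t. scomp W (ev nu W w) (scomp W (diag nu t) q)
    = lcomb (shv W W) {..<r} (%a. \<Sum>s | s : slots nu & al s = a. t s) ?\<rho>"
   using al(2) vth by (intro ea; simp)+
  note P = Proj_Obj[OF inf, of nu] and D = diag_hom[OF inf, of nu] and E = ev_hom[OF inf Wr w]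
  let ?y = "amap F W (Proj nu) q x"
  have yN: "?y : N (Proj nu)" by (rule st[OF W P q xN])
  have y: "?y : carrier (omap F (Proj nu))" by (rule sfunD(5)[OF Fs W P q x])
  obtain d0 where d0: "ALL d>=d0. mlproj nu F d ?y : mlpart nu F" using mlproj_mlpart[OF F y] by blast
  \<comment> \<open>\<open>d\<close> makes the extraction of coefficients correct for the expansion
    of \<open>x\<close>; \<open>d0\<close> puts the projection into the multilinear part.\<close>
  define d' where "d' = max d d0"
  obtain n where n: "n > 0" and mc: "ALL e':exponents r d. multicoeff d' (slots nu) (%t. \<Prod>a<r. (\<Sum>s | s : slots nu & al s = a. t s) ^ e' a) = (if e' = e then n else 0)"
   using multicoeff_power_sums[OF finite_slots al(1) e _ max.cobounded1[of d d0], folded d'_def] fib by blast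
  \<comment> \<open>A combination of values of \<open>F\<close> at an element of the
    subfunctor.\<close>
  have "mlproj nu F d' ?y : N (Proj nu)"
   unfolding mlproj_def by (intro lsub_lcomb[OF sfunD(2)[OF Fs P] sub(1)[OF P]] st[OF P P D yN])
  moreover have "mlproj nu F d' ?y : mlpart nu F" using d0 by (simp add: d'_def)
  ultimately have "mlproj nu F d' ?y : N' (Proj nu)" using ml by blast
  then have z: "amap F (Proj nu) W (ev nu W w) (mlproj nu F d' ?y) : N' W" by (rule st'[OF P W E])
  \<comment> \<open>\<open>n\<close> is the multiplicity produced by polarization; all other
    coefficients of the expansion disappear.\<close>
  have "c e = (1 / n) \<odot>[omap F W] amap F (Proj nu) W (ev nu W w) (mlproj nu F d' ?y)"
  proof (rule separated_eqI[OF sV])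
   note mp = mlproj_closed[OF Fs y, of d']
   note emp = sfunD(5)[OF Fs P W E mp]
   show "c e : carrier (omap F W)" using c e by blast
   show "(1 / n) \<odot>[omap F W] amap F (Proj nu) W (ev nu W w) (mlproj nu F d' ?y) : carrier (omap F W)"
    using V emp by simp
   fix l assume l: "l : dual (omap F W)"
   let ?N = "nodes d' (slots nu)" and ?wt = "node_weight d' (slots nu) (%_. 1)"
   have fx: "amap F (Proj nu) W (ev nu W w) (amap F (Proj nu) (Proj nu) (diag nu t) ?y)
    = lcomb (omap F W) (exponents r d) (%e. \<Prod>a<r. (\<Sum>s | s : slots nu & al s = a. t s) ^ e a) c" for t
   proof -
    have "amap F (Proj nu) (Proj nu) (diag nu t) ?y = amap F W (Proj nu) (scomp W (diag nu t) q) x"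
    by (rule sfunD(7)[OF Fs W P P q D x, symmetric])
    then show ?thesis
    using sfunD(7)[OF Fs W P W shom_compose[OF Wr q D] E x, of t] by (simp only: comp eq)
   qed
   have lc: "l (lcomb (omap F W) (exponents r d) k c) = (SUM e:exponents r d. k e * l (c e))" for k
    by (rule dual_lcomb[OF V l]) (use c in auto)
   have "amap F (Proj nu) W (ev nu W w) (mlproj nu F d' ?y)
    = lcomb (omap F W) ?N ?wt (%n. amap F (Proj nu) W (ev nu W w) (amap F (Proj nu) (Proj nu) (diag nu (node n)) ?y))"
    unfolding mlproj_def by (rule mhom_lcomb[OF sfunD(2)[OF Fs P] V sfunD(4)[OF Fs P W E] sfunD(5)[OF Fs P P D y]])
   then have "l (amap F (Proj nu) W (ev nu W w) (mlproj nu F d' ?y))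
    = (SUM n:?N. ?wt n * l (amap F (Proj nu) W (ev nu W w) (amap F (Proj nu) (Proj nu) (diag nu (node n)) ?y)))"
    using dual_lcomb[OF V l sfunD(5)[OF Fs P W E sfunD(5)[OF Fs P P D y]]] by simp
   also have "... = multicoeff d' (slots nu) (%t. SUM e:exponents r d. l (c e) * (\<Prod>a<r. (\<Sum>s | s : slots nu & al s = a. t s) ^ e a))"
    unfolding coefficient_def fx lc by (simp only: mult.commute[of "l _"])
   also have "... = (SUM e:exponents r d. l (c e) * multicoeff d' (slots nu) (%t. \<Prod>a<r. (\<Sum>s | s : slots nu & al s = a. t s) ^ e a))"
    by (rule coefficient_sum)
   also have "... = (SUM e':exponents r d. if e' = e then l (c e') * n else 0)"
    by (rule sum.cong[OF refl]) (simp only: mc[rule_format] mult_zero_right simp_thms split: if_split, blast?)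
   also have "... = l (c e) * n" by (subst sum.delta[OF finite_exponents]) (simp only: e if_True)
   finally show "l (c e) = l ((1 / n) \<odot>[omap F W] amap F (Proj nu) W (ev nu W w) (mlproj nu F d' ?y))"
    using n l emp by simp
  qed
  then show ?thesis using z sub(2)[OF W] by (simp add: lsub_def)
 qed
 \<comment> \<open>At the scalars \<open>b\<close> the combination of averages is the identity of
   \<open>W\<close>, so the polynomial takes the value \<open>x\<close>.\<close>
 have "x = lcomb (omap F W) (exponents r d) (%e. \<Prod>i<r. b i ^ e i) c"
  using eq[of b] sfunD(6)[OF Fs W x] by (simp only: idl)
 then show "x : N' W" using lsub_lcomb[OF V sub(2)[OF W] cN] by simp
qed

end

section \<open>Full faithfulness\<close>

abbreviation nhom :: "'v s2mod => 'w s2mod => (nat multiset => 'v => 'w) set" where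
 "nhom V V' \<equiv> {f. ALL nu. f nu : rep_hom (S_nu nu) (V nu) (V' nu)}"

text \<open>Frobenius reciprocity: a functional on \<open>V nu\<close> becomes an equivariant map
  into the span of the \<open>uten nu g\<close>, a copy of the regular representation. The
  components at other multisets are zero.\<close>

definition mlvec :: "'v s2mod => nat multiset => ('v => rat) => ('v, 'a) schur" where
 "mlvec V nu l = (%nu'. \<lambda>v\<in>cs (V nu'). if nu' = nu
  then lcomb (tpow nu' (Proj nu)) (SG nu) (%g. l (act (V nu) (inv[S_nu nu] g) v)) (uten nu)
  else \<zero>[tpow nu' (Proj nu)])"

text \<open>Scaling is treated as a combination with one summand in each slot, so that the general
  multilinear expansion applies.\<close>

lemma pten_scale_tuple:
 assumes W: "srep W" and w: "w : ptuples nu W"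
 shows "pten nu W (scale_tuple nu W t w) = (PROD s:slots nu. t s) \<odot>[tpow nu W] pten nu W w"
proof (rule separated_eqI[OF svs_tensor_power[OF W]])
 show "pten nu W (scale_tuple nu W t w) : carrier (tpow nu W)" by (rule pten_closed[OF W scale_tuple_closed[OF W w]])
 show "(PROD s:slots nu. t s) \<odot>[tpow nu W] pten nu W w : carrier (tpow nu W)"
  using tpow_rvs[OF W] pten_closed[OF W w] by blast
 fix l assume l: "l : dual (tpow nu W)"
 have wc: "w k : carrier (factors W k)" if "k : slots nu" for k
  using ptuples_mem[OF w, of "fst k" "snd k"] that by (cases k) (simp add: factors_def)
 have "scale_tuple nu W t w = (\<lambda>k\<in>slots nu. lcomb (factors W k) {()} (%_. t k) (%_. w k))"
  unfolding scale_tuple_def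
 proof (rule restrict_ext)
  fix k assume k: "k : slots nu"
  have "lcomb (factors W k) {()} (%_. t k) (%_. w k) = t k \<odot>[factors W k] w k"
   using factors_rvs[OF W, of k] wc[OF k] by (subst lcomb_insert) (auto simp: rvs_simps)
  then show "t k \<odot>[factors W k] w k = lcomb (factors W k) {()} (%_. t k) (%_. w k)" by simp
 qed
 moreover have "w = (\<lambda>k\<in>slots nu. w k)" using ptuples_undefined[OF w] by (auto simp: fun_eq_iff)
 moreover have "slots nu \<rightarrow>\<^sub>E {()} = {\<lambda>k\<in>slots nu. ()}" by (auto simp: fun_eq_iff PiE_def extensional_def)
 ultimately have "l (pten nu W (scale_tuple nu W t w)) = (PROD s:slots nu. t s) * l (pten nu W w)"
  using tensor_functional_expand[of "slots nu" "factors W" l "%_. {()}" "%k _. w k" "%k _. t k", OF factors_rvs[OF W] finite_slots l _ wc]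
  by simp
 then show "l (pten nu W (scale_tuple nu W t w)) = l ((PROD s:slots nu. t s) \<odot>[tpow nu W] pten nu W w)"
  using dual_smult[OF l pten_closed[OF W w]] by simp
qed

lemma lcomb_group_reindex:
 assumes V: "rvs V" and x: "!!g. g : SG nu ==> x g : carrier V" and h: "h : SG nu"
 shows "lcomb V (SG nu) c x = lcomb V (SG nu) (%g. c (h \<otimes>[S_nu nu] g)) (%g. x (h \<otimes>[S_nu nu] g))"
  and "lcomb V (SG nu) c x = lcomb V (SG nu) (%g. c (g \<otimes>[S_nu nu] h)) (%g. x (g \<otimes>[S_nu nu] h))"
proof -
 interpret G: group "S_nu nu" by (rule group_S_nu)
 show "lcomb V (SG nu) c x = lcomb V (SG nu) (%g. c (h \<otimes>[S_nu nu] g)) (%g. x (h \<otimes>[S_nu nu] g))"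
  by (rule lcomb_reindex[OF V bij_betw_byWitness[where f' = "%g. inv[S_nu nu] h \<otimes>[S_nu nu] g"] x])
   (use h in "auto simp: G.m_assoc[symmetric]")
 show "lcomb V (SG nu) c x = lcomb V (SG nu) (%g. c (g \<otimes>[S_nu nu] h)) (%g. x (g \<otimes>[S_nu nu] h))"
  by (rule lcomb_reindex[OF V bij_betw_byWitness[where f' = "%g. g \<otimes>[S_nu nu] inv[S_nu nu] h"] x])
   (use h in "auto simp: G.m_assoc")
qed

lemma schur_functor_simps:
 "omap schur_functor = F_functor"
 "amap schur_functor V V' phi = (\<lambda>W\<in>Obj SVect. \<lambda>x\<in>cF V W. %nu. compose (cs (V' nu)) (x nu) (phi nu))"
 by (simp_all add: schur_functor_def)

lemma schur_amap_eval:
 assumes "W : Obj SVect" "x : cF V W"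
 shows "amap schur_functor V V' phi W x nu = compose (cs (V' nu)) (x nu) (phi nu)"
  "v : cs (V' nu) ==> amap schur_functor V V' phi W x nu v = x nu (phi nu v)"
 using assms by (simp_all add: schur_functor_simps compose_def)

lemma nat_transD:
 fixes F G :: "('a, 'b) svect_functor"
 assumes "eta : nat_trans SVect Vect F G" and "W : Obj SVect"
 shows "eta W : lin (omap F W) (omap G W)" "eta W : mhom (omap F W) (omap G W)"
  and "x : carrier (omap F W) ==> eta W x : carrier (omap G W)"
  and "W' : Obj SVect ==> f : shom W W' ==> x : carrier (omap F W) ==> eta W' (amap F W W' f x) = amap G W W' f (eta W x)"
proof -
 show l: "eta W : lin (omap F W) (omap G W)" using assms by (simp add: nat_trans_def)
 then show "eta W : mhom (omap F W) (omap G W)" by (rule lin_mhom)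
 show "x : carrier (omap F W) ==> eta W x : carrier (omap G W)" by (rule lin_closed[OF l])
 assume "W' : Obj SVect" "f : shom W W'" and x: "x : carrier (omap F W)"
 then have "compose (carrier (omap F W)) (eta W') (amap F W W' f) = compose (carrier (omap F W)) (amap G W W' f) (eta W)"
  using assms by (simp add: nat_trans_def)
 from fun_cong[OF this, of x] show "eta W' (amap F W W' f x) = amap G W W' f (eta W x)" by (simp only: compose_eq[OF x])
qed

lemma subfun_carrier:
 assumes F: "sfun F"
 shows "subfun F (%W. carrier (omap F W))"
 unfolding subfun_def
 by (intro conjI ballI lsub_carrier sfunD(2)[OF F] sfunD(5)[OF F])

lemma nat_transI:
 fixes F G :: "('a, 'b) svect_functor"
 assumes "!!W. W : Obj SVect ==> eta W : lin (omap F W) (omap G W)" "eta : extensional (Obj SVect)"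
  and "!!W W' f x. W : Obj SVect ==> W' : Obj SVect ==> f : shom W W' ==> x : carrier (omap F W) ==>
   eta W' (amap F W W' f x) = amap G W W' f (eta W x)"
 shows "eta : nat_trans SVect Vect F G"
 unfolding nat_trans_def
proof (intro CollectI conjI ballI)
 show "eta : extensional (Obj SVect)" by (rule assms(2))
 show "eta W : Hom Vect (omap F W) (omap G W)" if "W : Obj SVect" for W :: "'a smod" using assms(1)[OF that] by simp
 fix W W' :: "'a smod" and f assume W: "W : Obj SVect" "W' : Obj SVect" and "f : Hom SVect W W'"
 then have f: "f : shom W W'" by simp
 show "Comp Vect (omap F W) (omap F W') (omap G W') (eta W') (amap F W W' f)
   = Comp Vect (omap F W) (omap G W) (omap G W') (amap G W W' f) (eta W)"
  using assms(3)[OF W f] by (auto simp: compose_def fun_eq_iff)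
qed

context
 assumes inf: "infinite (UNIV :: 'a set)"
begin

section \<open>The multilinear part of \<open>F_functor V\<close>\<close>

lemma diag_uten:
 assumes g: "g : SG nu"
 shows "tensor_power_map (Proj nu) (Proj nu) (diag nu t) nu (uten nu g) = (PROD s:slots nu. t s) \<odot>[tpow nu (Proj nu)] (uten nu g :: 'a tens)"
proof -
 let ?P = "Proj nu :: 'a smod"
 note P = Psrep[OF inf, of nu] and D = diag_hom[OF inf, of nu t] and u = Pgtup[OF inf, of nu]
 have "tensor_power_map ?P ?P (diag nu t) nu (uten nu g) = pten nu ?P (map_tuple (diag nu t) nu (wreath_act_tuple ?P nu g (gtup nu)))"
  unfolding uten_def by (rule tensor_power_map_props(2)[OF P P D act_tuple_closed[OF P g u]])
 also have "... = pten nu ?P (wreath_act_tuple ?P nu g (scale_tuple nu ?P t (gtup nu)))"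
  using map_tuple_ev_gtup[OF inf P scale_tuple_closed[OF P u], of t] unfolding map_tuple_act[OF D g u] by (simp add: diag_def)
 also have "... = act (tensor_power ?P nu) g (pten nu ?P (scale_tuple nu ?P t (gtup nu)))"
  by (rule tensor_power_act(2)[OF P g scale_tuple_closed[OF P u], symmetric])
 also have "... = (PROD s:slots nu. t s) \<odot>[tpow nu ?P] act (tensor_power ?P nu) g (pten nu ?P (gtup nu))"
  unfolding pten_scale_tuple[OF P u] by (rule mhom_smult[OF lin_mhom[OF tensor_power_act(1)[OF P g]] pten_closed[OF P u]])
 finally show ?thesis by (simp only: tensor_power_act(2)[OF P g u] uten_def)
qed

text \<open>\<open>gmor nu h\<close> multiplies on the right and so commutes with the left
  multiplication by which the group acts on the tensor power.\<close>

lemma gmor_uten: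
 assumes g: "g : SG nu" and h: "h : SG nu"
 shows "tensor_power_map (Proj nu) (Proj nu) (gmor nu h) nu (uten nu g) = (uten nu (g \<otimes>[S_nu nu] h) :: 'a tens)"
proof -
 let ?P = "Proj nu :: 'a smod"
 note P = Psrep[OF inf, of nu] and D = gmor_hom[OF inf h] and u = Pgtup[OF inf, of nu]
 have "tensor_power_map ?P ?P (gmor nu h) nu (uten nu g) = pten nu ?P (map_tuple (gmor nu h) nu (wreath_act_tuple ?P nu g (gtup nu)))"
  unfolding uten_def by (rule tensor_power_map_props(2)[OF P P D act_tuple_closed[OF P g u]])
 also have "... = pten nu ?P (wreath_act_tuple ?P nu g (wreath_act_tuple ?P nu h (gtup nu)))"
  using map_tuple_ev_gtup[OF inf P act_tuple_closed[OF P h u]] unfolding map_tuple_act[OF D g u] by (simp add: gmor_def)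
 finally show ?thesis by (simp only: act_tuple_mult[OF P g h u] uten_def)
qed

lemma Prvs: "rvs (tpow nu' (Proj nu :: 'a smod))"
 by (rule tpow_rvs[OF Psrep[OF inf]])

lemma tpm_mhom: "f : shom (Proj nu) (Proj nu) ==> tensor_power_map (Proj nu) (Proj nu) f nu' : mhom (tpow nu' (Proj nu :: 'a smod)) (tpow nu' (Proj nu))"
 by (rule lin_mhom[OF tensor_power_map_props(1)[OF Psrep[OF inf] Psrep[OF inf]]])

context
 fixes V :: "'v s2mod"
 assumes V: "nrep V"
begin

lemma Vact:
 assumes "g : SG nu"
 shows "v : cs (V nu) ==> act (V nu) g v : cs (V nu)"
  and "act (V nu) g : mhom (space (V nu)) (space (V nu))"
  and "v : cs (V nu) ==> act (V nu) (inv[S_nu nu] g) v : cs (V nu)"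
  and "act (V nu) (inv[S_nu nu] g) : mhom (space (V nu)) (space (V nu))"
  and "h : SG nu ==> v : cs (V nu) ==> act (V nu) (g \<otimes>[S_nu nu] h) v = act (V nu) g (act (V nu) h v)"
proof -
 interpret G: group "S_nu nu" by (rule group_S_nu)
 note R = V[rule_format, of nu]
 show "v : cs (V nu) ==> act (V nu) g v : cs (V nu)"
  "act (V nu) g : mhom (space (V nu)) (space (V nu))"
  using is_repD(5)[OF R assms] is_repD(2)[OF R assms] by blast+
 note i = G.inv_closed[OF assms]
 show "v : cs (V nu) ==> act (V nu) (inv[S_nu nu] g) v : cs (V nu)"
  "act (V nu) (inv[S_nu nu] g) : mhom (space (V nu)) (space (V nu))"
  using is_repD(5)[OF R i] is_repD(2)[OF R i] by blast+
 show "h : SG nu ==> v : cs (V nu) ==> act (V nu) (g \<otimes>[S_nu nu] h) v = act (V nu) g (act (V nu) h v)"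
  using is_repD(4)[OF R assms] by blast
qed

lemma mlvec_eval:
 "v : cs (V nu) ==> mlvec V nu l nu v
  = lcomb (tpow nu (Proj nu :: 'a smod)) (SG nu) (%g. l (act (V nu) (inv[S_nu nu] g) v)) (uten nu)"
 "v : cs (V nu') ==> nu' ~= nu ==> mlvec V nu l nu' v = \<zero>[tpow nu' (Proj nu :: 'a smod)]"
 by (simp_all add: mlvec_def)

lemma mlvec_closed:
 assumes l: "l : dual (space (V nu))"
 shows "mlvec V nu l : cF V (Proj nu :: 'a smod)"
 unfolding schur_space_carrier
proof (intro conjI allI)
 interpret G: group "S_nu nu" by (rule group_S_nu)
 show "finite {nu'. (mlvec V nu l :: ('v, 'a) schur) nu' ~= (\<lambda>v\<in>cs (V nu'). \<zero>[tpow nu' (Proj nu)])}"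
  by (rule finite_subset[of _ "{nu}"]) (auto simp: mlvec_def)
 fix nu'
 have rV: "rvs (space (V nu'))" by (rule fdvs_rvs[OF is_repD(1)[OF V[rule_format]]])
 note rep = is_rep_tensor_power[OF Psrep[OF inf, of nu], of nu']
 show "(mlvec V nu l :: ('v, 'a) schur) nu' : rep_hom (S_nu nu') (V nu') (tensor_power (Proj nu) nu')"
 proof (cases "nu' = nu")
  case False
  then have e: "(mlvec V nu l :: ('v, 'a) schur) nu' = (\<lambda>v\<in>cs (V nu'). \<zero>[tpow nu' (Proj nu)])"
   by (simp add: mlvec_def)
  show ?thesis unfolding e
  proof (rule rep_homI, unfold tensor_power_space)
   show "(\<lambda>v\<in>cs (V nu'). \<zero>[tpow nu' (Proj nu :: 'a smod)]) : lin (space (V nu')) (tpow nu' (Proj nu))"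
    by (rule lin_zero[OF rV Prvs])
  qed (use mhom_zero[OF Prvs Prvs is_repD(2)[OF rep, unfolded tensor_power_space]] Vact in simp)
 next
  case True
  let ?T = "tpow nu (Proj nu :: 'a smod)" and ?G = "SG nu"
  let ?m = "%v. lcomb ?T ?G (%g. l (act (V nu) (inv[S_nu nu] g) v)) (uten nu)"
  note rep = rep[unfolded True]
  have e: "mlvec V nu l nu' = restrict ?m (cs (V nu))" using True by (simp add: mlvec_def)
  show ?thesis unfolding e unfolding True
  proof (rule rep_homI, unfold tensor_power_space)
   show "restrict ?m (cs (V nu)) : lin (space (V nu)) ?T"
    using rV[unfolded True] by (intro lin_restrict lcomb_functionals_mhom Prvs uten_closed[OF inf] dual_mhom[OF Vact(4) l])
   fix h v assume h: "h : ?G" and v: "v : cs (V nu)"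
   have "act (tensor_power (Proj nu) nu) h (?m v) = lcomb ?T ?G (%g. l (act (V nu) (inv[S_nu nu] g) v)) (%g. act (tensor_power (Proj nu) nu) h (uten nu g))"
    by (rule mhom_lcomb[OF Prvs Prvs is_repD(2)[OF rep h, unfolded tensor_power_space] uten_closed[OF inf]])
   also have "... = lcomb ?T ?G (%g. l (act (V nu) (inv[S_nu nu] (h \<otimes>[S_nu nu] g)) (act (V nu) h v))) (%g. uten nu (h \<otimes>[S_nu nu] g))"
   proof (rule lcomb_cong[OF Prvs refl])
    fix g assume g: "g : ?G"
    show u: "act (tensor_power (Proj nu) nu) h (uten nu g) = (uten nu (h \<otimes>[S_nu nu] g) :: 'a tens)" by (rule act_uten[OF inf g h])
    show "act (tensor_power (Proj nu) nu) h (uten nu g) : carrier ?T" unfolding u using g h by (intro uten_closed[OF inf] G.m_closed)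
    have "inv[S_nu nu] (h \<otimes>[S_nu nu] g) \<otimes>[S_nu nu] h = inv[S_nu nu] g" using g h by (simp add: G.inv_mult_group G.m_assoc)
    then show "l (act (V nu) (inv[S_nu nu] g) v) = l (act (V nu) (inv[S_nu nu] (h \<otimes>[S_nu nu] g)) (act (V nu) h v))"
    using Vact(5)[OF G.inv_closed[OF G.m_closed[OF h g]] h v] by simp
   qed
   also have "... = ?m (act (V nu) h v)" by (rule lcomb_group_reindex(1)[OF Prvs uten_closed[OF inf] h, symmetric])
   finally show "restrict ?m (cs (V nu)) (act (V nu) h v) = act (tensor_power (Proj nu) nu) h (restrict ?m (cs (V nu)) v)"
    using v Vact(1)[OF h v] by simp
  qed
 qed
qed

lemma mlvec_cong:
 assumes "!!v. v : cs (V nu) ==> l v = m v"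
 shows "mlvec V nu l = (mlvec V nu m :: ('v, 'a) schur)"
proof (intro ext)
 fix nu' v
 show "mlvec V nu l nu' v = (mlvec V nu m :: ('v, 'a) schur) nu' v"
 proof (cases "nu' = nu & v : cs (V nu')")
  case True
  then have v: "v : cs (V nu)" by blast
  have "(mlvec V nu l :: ('v, 'a) schur) nu v = mlvec V nu m nu v"
   unfolding mlvec_eval(1)[OF v] by (rule lcomb_cong[OF Prvs refl uten_closed[OF inf] assms[OF Vact(3)[OF _ v]] refl])
  then show ?thesis using True by simp
 qed (auto simp: mlvec_def)
qed

lemma F_functor_mlvec:
 assumes l: "l : dual (space (V nu))" and f: "f : shom (Proj nu :: 'a smod) (Proj nu)" and v: "v : cs (V nu)"
 shows "amap (F_functor V) (Proj nu) (Proj nu) f (mlvec V nu l) nu v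
   = lcomb (tpow nu (Proj nu)) (SG nu) (%g. l (act (V nu) (inv[S_nu nu] g) v)) (%g. tensor_power_map (Proj nu) (Proj nu) f nu (uten nu g))"
 unfolding F_functor_eval[OF mlvec_closed[OF l] v] mlvec_eval(1)[OF v]
 by (rule mhom_lcomb[OF Prvs Prvs tpm_mhom[OF f] uten_closed[OF inf]])

lemma F_functor_mlvec_zero:
 assumes l: "l : dual (space (V nu))" and f: "f : shom (Proj nu :: 'a smod) (Proj nu)" and v: "v : cs (V nu')" "nu' ~= nu"
 shows "amap (F_functor V) (Proj nu) (Proj nu) f (mlvec V nu l) nu' v = \<zero>[tpow nu' (Proj nu)]"
 unfolding F_functor_eval[OF mlvec_closed[OF l] v(1)] mlvec_eval(2)[OF v]
 by (rule mhom_zero[OF Prvs Prvs tpm_mhom[OF f]])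

lemma schur_rvs: "rvs (schur_space V (Proj nu :: 'a smod))"
 using svs_schur_space[OF V Psrep[OF inf]] by blast

lemma F_functor_Proj_closed:
 "f : shom (Proj nu :: 'a smod) (Proj nu) ==> x : cF V (Proj nu) ==>
  amap (F_functor V) (Proj nu) (Proj nu) f x : cF V (Proj nu)"
 by (rule F_functor_closed(1)[OF V Psrep[OF inf] Psrep[OF inf]])

lemma mlvec_mlpart:
 assumes l: "l : dual (space (V nu))"
 shows "mlvec V nu l : mlpart nu (F_functor V :: ('v, 'a) sfr)"
 unfolding mlpart_def F_functor_simps(1)
proof (intro CollectI conjI allI mlvec_closed[OF l])
 fix t :: "nat \<times> nat => rat"
 note D = diag_hom[OF inf, of nu t]
 show "amap (F_functor V) (Proj nu) (Proj nu) (diag nu t) (mlvec V nu l) = (PROD s:slots nu. t s) \<odot>[schur_space V (Proj nu :: 'a smod)] mlvec V nu l"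
 proof (rule schur_eqI[OF F_functor_Proj_closed[OF D mlvec_closed[OF l]] rvs_closed(3)[OF schur_rvs mlvec_closed[OF l]]])
  fix nu' v assume v: "v : cs (V nu')"
  show "amap (F_functor V) (Proj nu) (Proj nu) (diag nu t) (mlvec V nu l) nu' v = ((PROD s:slots nu. t s) \<odot>[schur_space V (Proj nu :: 'a smod)] mlvec V nu l) nu' v"
  proof (cases "nu' = nu")
   case False
   then show ?thesis
    using v F_functor_mlvec_zero[OF l D v] mlvec_eval(2)[OF v False] by (simp add: schur_space_simps rvs_simps[OF Prvs])
  next
   case True
   note v = v[unfolded True]
   let ?T = "tpow nu (Proj nu :: 'a smod)" and ?G = "SG nu"
   let ?c = "%g. l (act (V nu) (inv[S_nu nu] g) v)"
   have "lcomb ?T ?G ?c (%g. tensor_power_map (Proj nu) (Proj nu) (diag nu t) nu (uten nu g))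
    = lcomb ?T ?G ?c (%g. (PROD s:slots nu. t s) \<odot>[?T] uten nu g)"
    by (rule lcomb_cong[OF Prvs refl mhom_closed[OF tpm_mhom[OF D] uten_closed[OF inf]] refl diag_uten])
   also have "... = lcomb ?T ?G (%g. (PROD s:slots nu. t s) * ?c g) (uten nu)"
    unfolding mult.commute[of "PROD s:slots nu. t s"] by (rule lcomb_scale[OF Prvs uten_closed[OF inf]])
   also have "... = (PROD s:slots nu. t s) \<odot>[?T] lcomb ?T ?G ?c (uten nu)" by (rule lcomb_smult[OF Prvs uten_closed[OF inf]])
   finally show ?thesis
    using v F_functor_mlvec[OF l D v] mlvec_eval(1)[OF v, of l] True by (simp add: schur_space_simps)
  qed
 qed
qed

text \<open>\<open>ucoord\<close> sees only the summand of the identity element; so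
  \<open>mlvec\<close> determines \<open>l\<close> on the carrier.\<close>

lemma ucoord_mlvec:
 assumes v: "v : cs (V nu)"
 shows "ucoord nu ((mlvec V nu l :: ('v, 'a) schur) nu v) = l v"
proof -
 interpret G: group "S_nu nu" by (rule group_S_nu)
 have "ucoord nu ((mlvec V nu l :: ('v, 'a) schur) nu v) = (SUM g:SG nu. l (act (V nu) (inv[S_nu nu] g) v) * ucoord nu (uten nu g :: 'a tens))"
  unfolding mlvec_eval(1)[OF v] by (rule dual_lcomb[OF Prvs ucoord_props(1)[OF inf] uten_closed[OF inf]])
 also have "... = (SUM g:SG nu. if g = \<one>[S_nu nu] then l (act (V nu) (inv[S_nu nu] g) v) else 0)"
  by (rule sum.cong[OF refl]) (simp add: ucoord_uten[OF inf])
 also have "... = l v"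
  using finite_S_nu[of nu] is_repD(3)[OF V[rule_format] v] by (simp add: sum.delta)
 finally show ?thesis .
qed

lemma ucoord_dual:
 assumes x: "x : cF V (Proj nu :: 'a smod)"
 shows "(%v. ucoord nu (x nu v)) : dual (space (V nu))"
 by (rule dual_mhom[OF schur_mem(2)[OF x] ucoord_props(1)[OF inf]])

text \<open>A vector of weight \<open>nu\<close> vanishes in the tensor powers for other multisets,
  and in the one for \<open>nu\<close> it is recovered from its coordinates; equivariance then moves
  the group from the tensor power to \<open>V nu\<close>. Together with \<open>ucoord_mlvec\<close>
  this makes the multilinear part the dual of \<open>V nu\<close>.\<close>

lemma mlpart_mlvec:
 assumes "x : mlpart nu (F_functor V :: ('v, 'a) sfr)"
 shows "x = mlvec V nu (%v. ucoord nu (x nu v))"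
proof -
 have x: "x : cF V (Proj nu)"
  and wt: "!!t. amap (F_functor V) (Proj nu) (Proj nu) (diag nu t) x = (PROD s:slots nu. t s) \<odot>[schur_space V (Proj nu)] x"
  using assms by (simp_all add: mlpart_def F_functor_simps(1))
 interpret G: group "S_nu nu" by (rule group_S_nu)
 have wv: "tensor_power_map (Proj nu) (Proj nu) (diag nu t) nu' (x nu' v) = (PROD s:slots nu. t s) \<odot>[tpow nu' (Proj nu)] x nu' v"
  if "v : cs (V nu')" for t nu' v
  using F_functor_eval[OF x that, of "Proj nu" "diag nu t"] that unfolding wt by (simp add: schur_space_simps)
 show ?thesis
 proof (rule schur_eqI[OF x mlvec_closed[OF ucoord_dual[OF x]]])
  fix nu' v assume v: "v : cs (V nu')"
  show "x nu' v = mlvec V nu (%v. ucoord nu (x nu v)) nu' v"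
  proof (cases "nu' = nu")
   case False
   show ?thesis using weight_vector_zero[OF inf schur_mem(3)[OF x v] wv[OF v] False] mlvec_eval(2)[OF v False] by simp
  next
   case True
   note v = v[unfolded True]
   have "x nu v = lcomb (tpow nu (Proj nu)) (SG nu) (%g. ucoord nu (act (tensor_power (Proj nu) nu) (inv[S_nu nu] g) (x nu v))) (uten nu)"
    by (rule weight_vector_expand[OF inf schur_mem(3)[OF x v] wv[OF v]])
   also have "... = lcomb (tpow nu (Proj nu)) (SG nu) (%g. ucoord nu (x nu (act (V nu) (inv[S_nu nu] g) v))) (uten nu)"
    by (rule lcomb_cong[OF Prvs refl uten_closed[OF inf]]) (simp_all add: rep_homD(3)[OF schur_mem(1)[OF x] G.inv_closed v])
   finally show ?thesis using mlvec_eval(1)[OF v, of "%v. ucoord nu (x nu v)"] True by simp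
  qed
 qed
qed

text \<open>On the multilinear part, \<open>gmor nu h\<close> is the transpose of the action of
  \<open>h\<close> on \<open>V nu\<close>. Naturality at these endomorphisms will yield
  equivariance.\<close>

lemma gmor_mlvec:
 assumes l: "l : dual (space (V nu))" and h: "h : SG nu"
 shows "amap (F_functor V) (Proj nu) (Proj nu) (gmor nu h) (mlvec V nu l) = (mlvec V nu (%v. l (act (V nu) h v)) :: ('v, 'a) schur)"
proof -
 interpret G: group "S_nu nu" by (rule group_S_nu)
 note g = gmor_hom[OF inf h]
 have l': "(%v. l (act (V nu) h v)) : dual (space (V nu))" by (rule dual_mhom[OF Vact(2)[OF h] l])
 show ?thesis
 proof (rule schur_eqI[OF F_functor_Proj_closed[OF g mlvec_closed[OF l]] mlvec_closed[OF l']])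
  fix nu' v assume v: "v : cs (V nu')"
  show "amap (F_functor V) (Proj nu) (Proj nu) (gmor nu h) (mlvec V nu l) nu' v = (mlvec V nu (%v. l (act (V nu) h v)) :: ('v, 'a) schur) nu' v"
  proof (cases "nu' = nu")
   case False
   show ?thesis using F_functor_mlvec_zero[OF l g v False] mlvec_eval(2)[OF v False] by simp
  next
   case True
   note v = v[unfolded True]
   let ?T = "tpow nu (Proj nu :: 'a smod)" and ?G = "SG nu"
   have "mlvec V nu (%v. l (act (V nu) h v)) nu v = lcomb ?T ?G (%k. l (act (V nu) h (act (V nu) (inv[S_nu nu] (k \<otimes>[S_nu nu] h)) v))) (%k. uten nu (k \<otimes>[S_nu nu] h))"
    unfolding mlvec_eval(1)[OF v] by (rule lcomb_group_reindex(2)[OF Prvs uten_closed[OF inf] h])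
   also have "... = lcomb ?T ?G (%k. l (act (V nu) (inv[S_nu nu] k) v)) (%k. tensor_power_map (Proj nu) (Proj nu) (gmor nu h) nu (uten nu k))"
   proof (rule lcomb_cong[OF Prvs refl])
    fix k assume k: "k : ?G"
    show "uten nu (k \<otimes>[S_nu nu] h) : carrier ?T" using k h by (intro uten_closed[OF inf] G.m_closed)
    show "uten nu (k \<otimes>[S_nu nu] h) = (tensor_power_map (Proj nu) (Proj nu) (gmor nu h) nu (uten nu k) :: 'a tens)" by (rule gmor_uten[OF k h, symmetric])
    have "h \<otimes>[S_nu nu] inv[S_nu nu] (k \<otimes>[S_nu nu] h) = inv[S_nu nu] k" using k h by (simp add: G.inv_mult_group G.m_assoc[symmetric])
    then show "l (act (V nu) h (act (V nu) (inv[S_nu nu] (k \<otimes>[S_nu nu] h)) v)) = l (act (V nu) (inv[S_nu nu] k) v)"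
    using Vact(5)[OF h G.inv_closed[OF G.m_closed[OF k h]] v] by simp
   qed
   finally show ?thesis using F_functor_mlvec[OF l g v] True by simp
  qed
 qed
qed

text \<open>Linearity of \<open>mlvec\<close> in the functional, as an expansion along a frame: a
  linear map on the multilinear part is thereby determined by finitely many functionals.\<close>

lemma mlvec_frame:
 assumes fr: "frame (space (V nu)) n a l" and m: "m : dual (space (V nu))"
 shows "mlvec V nu m = lcomb (schur_space V (Proj nu :: 'a smod)) {..<n} (%k. m (a k)) (%k. mlvec V nu (l k))"
proof -
 have lk: "l k : dual (space (V nu))" if "k : {..<n}" for k using fr that by (auto simp: frame_def)
 note mk = mlvec_closed[OF lk]
 have rV: "rvs (space (V nu))" by (rule fdvs_rvs[OF is_repD(1)[OF V[rule_format]]])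
 show ?thesis
 proof (rule schur_eqI[OF mlvec_closed[OF m] lcomb_closed[OF schur_rvs mk]])
  fix nu' v assume v: "v : cs (V nu')"
  have e: "lcomb (schur_space V (Proj nu)) {..<n} (%k. m (a k)) (%k. mlvec V nu (l k)) nu' v
   = lcomb (tpow nu' (Proj nu :: 'a smod)) {..<n} (%k. m (a k)) (%k. mlvec V nu (l k) nu' v)"
   by (rule mhom_lcomb[OF schur_rvs Prvs schur_eval_mhom[where V = V, OF v] mk])
  show "mlvec V nu m nu' v = lcomb (schur_space V (Proj nu :: 'a smod)) {..<n} (%k. m (a k)) (%k. mlvec V nu (l k)) nu' v"
   unfolding e
  proof (rule separated_eqI[OF svs_tensor_power[OF Psrep[OF inf]] schur_mem(3)[OF mlvec_closed[OF m] v] lcomb_closed[OF Prvs schur_mem(3)[OF mk v]]])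
   fix b assume b: "b : dual (tpow nu' (Proj nu :: 'a smod))"
   have r: "b (lcomb (tpow nu' (Proj nu)) {..<n} (%k. m (a k)) (%k. mlvec V nu (l k) nu' v)) = (\<Sum>k<n. m (a k) * b (mlvec V nu (l k) nu' v))"
    by (rule dual_lcomb[OF Prvs b schur_mem(3)[OF mk v]])
   show "b (mlvec V nu m nu' v) = b (lcomb (tpow nu' (Proj nu)) {..<n} (%k. m (a k)) (%k. mlvec V nu (l k) nu' v))"
    unfolding r
   proof (cases "nu' = nu")
    case False
    then show "b (mlvec V nu m nu' v) = (\<Sum>k<n. m (a k) * b (mlvec V nu (l k) nu' v))"
    using mlvec_eval(2)[OF v False] dual_zero[OF Prvs b] by simp
   next
    case True
    note v = v[unfolded True] and b = b[unfolded True]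
    have mv: "b (mlvec V nu c nu v) = (SUM g:SG nu. c (act (V nu) (inv[S_nu nu] g) v) * b (uten nu g))" for c
    unfolding mlvec_eval(1)[OF v] by (rule dual_lcomb[OF Prvs b uten_closed[OF inf]])
    have "(\<Sum>k<n. m (a k) * b (mlvec V nu (l k) nu v)) = (SUM g:SG nu. (\<Sum>k<n. l k (act (V nu) (inv[S_nu nu] g) v) * m (a k)) * b (uten nu g))"
    unfolding mv sum_distrib_left sum_distrib_right by (subst sum.swap) (simp only: mult_ac)
    also have "... = b (mlvec V nu m nu v)"
    unfolding mv by (rule sum.cong[OF refl]) (simp add: frame_dual[OF rV fr m Vact(3)[OF _ v]])
    finally show "b (mlvec V nu m nu' v) = (\<Sum>k<n. m (a k) * b (mlvec V nu (l k) nu' v))" using True by simp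
   qed
  qed
 qed
qed

end

context
 fixes V V' :: "'v s2mod"
 assumes V: "nrep V" and V': "nrep V'"
begin

section \<open>Natural transformations induced by morphisms of modules\<close>

lemma schur_amap_closed:
 assumes ph: "phi : nhom V' V" and W: "(W :: 'a smod) : Obj SVect" and x: "x : cF V W"
 shows "amap schur_functor V V' phi W x : cF V' W"
 unfolding schur_space_carrier
proof (intro conjI allI)
 have Wr: "srep W" using W by simp
 have p: "phi nu : rep_hom (S_nu nu) (V' nu) (V nu)" for nu using ph by blast
 show "amap schur_functor V V' phi W x nu : rep_hom (S_nu nu) (V' nu) (tensor_power W nu)" for nu
  unfolding schur_amap_eval(1)[where V' = V', OF W x] by (rule rep_hom_compose[OF V'[rule_format] p schur_mem(1)[OF x]])
 show "finite {nu. amap schur_functor V V' phi W x nu ~= (\<lambda>v\<in>cs (V' nu). \<zero>[tpow nu W])}"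
 proof (rule finite_subset)
  show "finite {nu. x nu ~= (\<lambda>v\<in>cs (V nu). \<zero>[tpow nu W])}" using x by (simp add: schur_space_carrier)
  have "amap schur_functor V V' phi W x nu = (\<lambda>v\<in>cs (V' nu). \<zero>[tpow nu W])"
   if "x nu = (\<lambda>v\<in>cs (V nu). \<zero>[tpow nu W])" for nu
   unfolding schur_amap_eval(1)[where V' = V', OF W x] that using rep_homD(4)[OF p] by (auto simp: compose_def fun_eq_iff)
  then show "{nu. amap schur_functor V V' phi W x nu ~= (\<lambda>v\<in>cs (V' nu). \<zero>[tpow nu W])}
   <= {nu. x nu ~= (\<lambda>v\<in>cs (V nu). \<zero>[tpow nu W])}" by blast
 qed
qed

lemma schur_amap_nat_trans:
 assumes ph: "phi : nhom V' V"
 shows "amap schur_functor V V' phi : nat_trans SVect Vect (F_functor V :: ('v, 'a) sfr) (F_functor V')"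
proof (rule nat_transI, unfold F_functor_simps(1))
 let ?eta = "amap schur_functor V V' phi"
 have p: "phi nu : rep_hom (S_nu nu) (V' nu) (V nu)" for nu using ph by blast
 show "?eta : extensional (Obj SVect)" by (simp add: schur_functor_simps)
 fix W :: "'a smod" assume W: "W : Obj SVect"
 have Wr: "srep W" using W by simp
 have r: "rvs (schur_space V W)" "rvs (schur_space V' W)" using svs_schur_space[OF V Wr] svs_schur_space[OF V' Wr] by blast+
 note cl = schur_amap_closed[OF ph W]
 have "?eta W : mhom (schur_space V W) (schur_space V' W)"
 proof (rule mhomI[OF cl])
  fix x y c assume x: "x : cF V W"
  show "?eta W (c \<odot>[schur_space V W] x) = c \<odot>[schur_space V' W] ?eta W x"
  proof (rule schur_eqI[OF cl[OF rvs_closed(3)[OF r(1) x]] rvs_closed(3)[OF r(2) cl[OF x]]])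
   fix nu v assume v: "v : cs (V' nu)"
   show "?eta W (c \<odot>[schur_space V W] x) nu v = (c \<odot>[schur_space V' W] ?eta W x) nu v"
    unfolding schur_amap_eval(2)[where V' = V', OF W rvs_closed(3)[OF r(1) x] v]
    using v rep_homD(4)[OF p v] by (simp add: schur_space_simps schur_amap_eval(2)[where V' = V', OF W x v])
  qed
  assume y: "y : cF V W"
  show "?eta W (x \<oplus>[schur_space V W] y) = ?eta W x \<oplus>[schur_space V' W] ?eta W y"
  proof (rule schur_eqI[OF cl[OF rvs_closed(2)[OF r(1) x y]] rvs_closed(2)[OF r(2) cl[OF x] cl[OF y]]])
   fix nu v assume v: "v : cs (V' nu)"
   show "?eta W (x \<oplus>[schur_space V W] y) nu v = (?eta W x \<oplus>[schur_space V' W] ?eta W y) nu v"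
    unfolding schur_amap_eval(2)[where V' = V', OF W rvs_closed(2)[OF r(1) x y] v]
    using v rep_homD(4)[OF p v] by (simp add: schur_space_simps schur_amap_eval(2)[where V' = V', OF W x v] schur_amap_eval(2)[where V' = V', OF W y v])
  qed
 qed
 then show "?eta W : lin (schur_space V W) (schur_space V' W)"
  unfolding lin_def using W by (simp add: schur_functor_simps)
 fix W' :: "'a smod" and f x assume W': "W' : Obj SVect" and f: "f : shom W W'" and x: "x : cF V W"
 have W'r: "srep W'" using W' by simp
 note fx = F_functor_closed(1)[OF V Wr W'r f x]
 show "?eta W' (amap (F_functor V) W W' f x) = amap (F_functor V') W W' f (?eta W x)"
 proof (rule schur_eqI[OF schur_amap_closed[OF ph W' fx] F_functor_closed(1)[OF V' Wr W'r f cl[OF x]]])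
  fix nu v assume v: "v : cs (V' nu)"
  show "?eta W' (amap (F_functor V) W W' f x) nu v = amap (F_functor V') W W' f (?eta W x) nu v"
   by (simp only: schur_amap_eval(2)[where V' = V', OF W' fx v] F_functor_eval[OF x rep_homD(4)[OF p v]]
    F_functor_eval[OF cl[OF x] v] schur_amap_eval(2)[where V' = V', OF W x v])
 qed
qed

text \<open>Under the identification of multilinear parts with dual spaces, the transformation
  induced by \<open>phi\<close> is the transpose of \<open>phi\<close>.\<close>

lemma schur_amap_mlvec:
 assumes ph: "phi : nhom V' V" and l: "l : dual (space (V nu))"
 shows "amap schur_functor V V' phi (Proj nu :: 'a smod) (mlvec V nu l) = mlvec V' nu (%v. l (phi nu v))"
proof -
 interpret G: group "S_nu nu" by (rule group_S_nu)
 note P = Proj_Obj[OF inf, of nu]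
 have p: "phi nu : rep_hom (S_nu nu) (V' nu) (V nu)" for nu using ph by blast
 have l': "(%v. l (phi nu v)) : dual (space (V' nu))" by (rule dual_mhom[OF rep_homD(2)[OF p] l])
 show ?thesis
 proof (rule schur_eqI[OF schur_amap_closed[OF ph P mlvec_closed[OF V l]] mlvec_closed[OF V' l']])
  fix nu' v assume v: "v : cs (V' nu')"
  note pv = rep_homD(4)[OF p v]
  show "amap schur_functor V V' phi (Proj nu :: 'a smod) (mlvec V nu l) nu' v = mlvec V' nu (%v. l (phi nu v)) nu' v"
   unfolding schur_amap_eval(2)[where V' = V', OF P mlvec_closed[OF V l] v]
  proof (cases "nu' = nu")
   case False
   then show "mlvec V nu l nu' (phi nu' v) = (mlvec V' nu (%v. l (phi nu v)) :: ('v, 'a) schur) nu' v"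
    using mlvec_eval(2)[OF V pv False] mlvec_eval(2)[OF V' v False] by simp
  next
   case True
   note v = v[unfolded True] and pv = pv[unfolded True]
   have "lcomb (tpow nu (Proj nu :: 'a smod)) (SG nu) (%g. l (act (V nu) (inv[S_nu nu] g) (phi nu v))) (uten nu)
    = lcomb (tpow nu (Proj nu)) (SG nu) (%g. l (phi nu (act (V' nu) (inv[S_nu nu] g) v))) (uten nu)"
    by (rule lcomb_cong[OF Prvs refl uten_closed[OF inf]]) (simp_all add: rep_homD(3)[OF p G.inv_closed v])
   then show "mlvec V nu l nu' (phi nu' v) = (mlvec V' nu (%v. l (phi nu v)) :: ('v, 'a) schur) nu' v"
    using mlvec_eval(1)[OF V pv, of l] mlvec_eval(1)[OF V' v, of "%v. l (phi nu v)"] True by simp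
  qed
 qed
qed

end

text \<open>A natural transformation commutes with the scalings, so it maps multilinear parts to
  each other, that is, dual spaces to dual spaces. In finite dimension these maps are transposes of
  maps \<open>phi nu\<close>; two transformations that agree on all multilinear parts are equal
  because their equalizer is a subfunctor.\<close>

lemma schur_functor_fully_faithful:
 fixes V V' :: "'v s2mod"
 assumes V: "nrep V" and V': "nrep V'"
 shows "bij_betw (amap schur_functor V V') (nhom V' V)
  (nat_trans SVect Vect (F_functor V :: ('v, 'a) sfr) (F_functor V'))"
proof (rule bij_betwI')
 fix phi psi assume ph: "phi : nhom V' V" and ps: "psi : nhom V' V"
 show "(amap schur_functor V V' phi = (amap schur_functor V V' psi :: 'a smod => _)) = (phi = psi)"
 proof
  assume eq: "amap schur_functor V V' phi = (amap schur_functor V V' psi :: 'a smod => _)"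
  show "phi = psi"
  proof
   fix nu
   have p: "phi nu : rep_hom (S_nu nu) (V' nu) (V nu)" "psi nu : rep_hom (S_nu nu) (V' nu) (V nu)" using ph ps by blast+
   show "phi nu = psi nu"
   proof (rule lin_eqI[OF rep_homD(1)[OF p(1)] rep_homD(1)[OF p(2)]])
    fix v assume v: "v : cs (V' nu)"
    show "phi nu v = psi nu v"
    proof (rule separated_eqI[OF fdvs_svs[OF is_repD(1)[OF V[rule_format]]] rep_homD(4)[OF p(1) v] rep_homD(4)[OF p(2) v]])
    fix l assume l: "l : dual (space (V nu))"
    have "mlvec V' nu (%v. l (phi nu v)) = (mlvec V' nu (%v. l (psi nu v)) :: ('v, 'a) schur)"
    using schur_amap_mlvec[OF V V' ph l] schur_amap_mlvec[OF V V' ps l] eq by simp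
    then have "ucoord nu ((mlvec V' nu (%v. l (phi nu v)) :: ('v, 'a) schur) nu v) = ucoord nu ((mlvec V' nu (%v. l (psi nu v)) :: ('v, 'a) schur) nu v)" by simp
    then show "l (phi nu v) = l (psi nu v)" unfolding ucoord_mlvec[OF V' v] .
    qed
   qed
  qed
 qed simp
next
 fix phi assume "phi : nhom V' V"
 then show "amap schur_functor V V' phi : nat_trans SVect Vect (F_functor V :: ('v, 'a) sfr) (F_functor V')"
  by (rule schur_amap_nat_trans[OF V V'])
next
 fix eta assume eta: "eta : nat_trans SVect Vect (F_functor V :: ('v, 'a) sfr) (F_functor V')"
 note P = Proj_Obj[OF inf]
 note et = nat_transD[OF eta, unfolded F_functor_simps(1)]
 have ml: "eta (Proj nu) x : mlpart nu (F_functor V')" if "x : mlpart nu (F_functor V)" for nu x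
 proof -
  have x: "x : cF V (Proj nu)"
   and wt: "!!t. amap (F_functor V) (Proj nu) (Proj nu) (diag nu t) x = (PROD s:slots nu. t s) \<odot>[schur_space V (Proj nu)] x"
   using that by (simp_all add: mlpart_def F_functor_simps(1))
  show ?thesis
   unfolding mlpart_def F_functor_simps(1)
   by (intro CollectI conjI allI et(3)[OF P x])
    (simp only: et(4)[OF P P diag_hom[OF inf] x, symmetric] wt mhom_smult[OF et(2)[OF P] x])
 qed
 \<comment> \<open>The map of dual spaces induced by \<open>eta\<close>, read off with
   \<open>ucoord\<close>.\<close>
 define \<Lambda> where "\<Lambda> nu l v = ucoord nu (eta (Proj nu) (mlvec V nu l) nu v)" for nu l v
 have L: "eta (Proj nu) (mlvec V nu l) = mlvec V' nu (\<Lambda> nu l)" "\<Lambda> nu l : dual (space (V' nu))" if "l : dual (space (V nu))" for nu l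
  using mlpart_mlvec[OF V' ml[OF mlvec_mlpart[OF V that]]] ucoord_dual[OF V' et(3)[OF P mlvec_closed[OF V that]]]
  unfolding \<Lambda>_def by blast+
 have Vd: "fdvs (space (V nu))" for nu by (rule is_repD(1)[OF V[rule_format]])
 have rV: "rvs (space (V nu))" "rvs (space (V' nu))" for nu using fdvs_rvs[OF is_repD(1)[OF V[rule_format]]] fdvs_rvs[OF is_repD(1)[OF V'[rule_format]]] by blast+
 have "ALL nu. EX n a l. frame (space (V nu)) n a l" using fdvs_frame[OF Vd] by metis
 then obtain n a l where fr: "!!nu. frame (space (V nu)) (n nu) (a nu) (l nu)" by metis
 have al: "a nu k : cs (V nu)" "l nu k : dual (space (V nu))" if "k : {..<n nu}" for nu k
  using fr[of nu] that by (auto simp: frame_def)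
 \<comment> \<open>The map whose transpose is \<open>\<Lambda> nu\<close>, written in a frame of
   \<open>V nu\<close>.\<close>
 define phi where "phi nu = (\<lambda>v\<in>cs (V' nu). lcomb (space (V nu)) {..<n nu} (%k. \<Lambda> nu (l nu k) v) (a nu))" for nu
 have pl: "phi nu : lin (space (V' nu)) (space (V nu))" for nu
  unfolding phi_def by (intro lin_restrict[OF lcomb_functionals_mhom[OF rV(1) L(2)[OF al(2)] al(1)] rV(2)])
 have dp: "m (phi nu v) = \<Lambda> nu m v" if m: "m : dual (space (V nu))" and v: "v : cs (V' nu)" for nu m v
 proof -
  have mk: "mlvec V nu (l nu k) : cF V (Proj nu :: 'a smod)" if "k : {..<n nu}" for k
   by (rule mlvec_closed[OF V al(2)[OF that]])
  have "eta (Proj nu) (mlvec V nu m) = lcomb (schur_space V' (Proj nu)) {..<n nu} (%k. m (a nu k)) (%k. eta (Proj nu) (mlvec V nu (l nu k)))"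
   unfolding mlvec_frame[OF V fr m] by (rule mhom_lcomb[OF schur_rvs[OF V] schur_rvs[OF V'] et(2)[OF P] mk])
  moreover have "(%x. ucoord nu (x nu v)) : dual (schur_space V' (Proj nu :: 'a smod))"
   by (rule dual_mhom[OF schur_eval_mhom[where V = V', OF v] ucoord_props(1)[OF inf]])
  then have "ucoord nu (lcomb (schur_space V' (Proj nu)) {..<n nu} (%k. m (a nu k)) (%k. eta (Proj nu) (mlvec V nu (l nu k))) nu v)
    = (\<Sum>k<n nu. m (a nu k) * ucoord nu (eta (Proj nu) (mlvec V nu (l nu k)) nu v))"
   by (rule dual_lcomb[OF schur_rvs[OF V'] _ et(3)[OF P mk]])
  ultimately have "\<Lambda> nu m v = (\<Sum>k<n nu. m (a nu k) * \<Lambda> nu (l nu k) v)"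
   unfolding \<Lambda>_def by simp
  moreover have "m (phi nu v) = (\<Sum>k<n nu. \<Lambda> nu (l nu k) v * m (a nu k))"
   unfolding phi_def restrict_apply' [OF v] by (rule dual_lcomb[OF rV(1) m al(1)])
  ultimately show ?thesis by (simp add: mult.commute)
 qed
 have ph: "phi : nhom V' V"
 proof (intro CollectI allI rep_homI[OF pl])
  fix nu h v assume h: "h : SG nu" and v: "v : cs (V' nu)"
  note hv = Vact(1)[OF V' h v] and pv = lin_closed[OF pl v]
  show "phi nu (act (V' nu) h v) = act (V nu) h (phi nu v)"
  proof (rule separated_eqI[OF fdvs_svs[OF Vd] lin_closed[OF pl hv] Vact(1)[OF V h pv]])
   fix m assume m: "m : dual (space (V nu))"
   have mh: "(%v. m (act (V nu) h v)) : dual (space (V nu))" by (rule dual_mhom[OF Vact(2)[OF V h] m])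
   \<comment> \<open>Equivariance of \<open>phi nu\<close>, transposed, is naturality of
     \<open>eta\<close> at \<open>gmor nu h\<close>.\<close>
   have "mlvec V' nu (\<Lambda> nu (%v. m (act (V nu) h v))) = eta (Proj nu) (amap (F_functor V) (Proj nu) (Proj nu) (gmor nu h) (mlvec V nu m))"
    by (simp only: L(1)[OF mh] gmor_mlvec[OF V m h])
   also have "... = amap (F_functor V') (Proj nu) (Proj nu) (gmor nu h) (mlvec V' nu (\<Lambda> nu m))"
    by (simp only: et(4)[OF P P gmor_hom[OF inf h] mlvec_closed[OF V m]] L(1)[OF m])
   also have "... = mlvec V' nu (%v. \<Lambda> nu m (act (V' nu) h v))" by (rule gmor_mlvec[OF V' L(2)[OF m] h])
   finally have "ucoord nu ((mlvec V' nu (\<Lambda> nu (%v. m (act (V nu) h v))) :: ('v, 'a) schur) nu v)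
    = ucoord nu ((mlvec V' nu (%v. \<Lambda> nu m (act (V' nu) h v)) :: ('v, 'a) schur) nu v)" by simp
   then show "m (phi nu (act (V' nu) h v)) = m (act (V nu) h (phi nu v))"
    unfolding ucoord_mlvec[OF V' v] using dp[OF m hv] dp[OF mh v] by simp
  qed
 qed
 let ?eta = "amap schur_functor V V' phi :: 'a smod => _"
 have eta': "?eta : nat_trans SVect Vect (F_functor V) (F_functor V')" by (rule schur_amap_nat_trans[OF V V' ph])
 note et' = nat_transD[OF eta', unfolded F_functor_simps(1)]
 have lp: "lpf (F_functor V :: ('v, 'a) sfr)" by (rule lpf_F_functor[OF V])
 have sr: "rvs (schur_space V W)" "rvs (schur_space V' W)" if "W : Obj SVect" for W :: "'a smod"
  using svs_schur_space[OF V SVect_srep[OF that]] svs_schur_space[OF V' SVect_srep[OF that]] by blast+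
 \<comment> \<open>The whole of \<open>F_functor V\<close> is compared with the equalizer of the two
   transformations.\<close>
 let ?N = "%W :: 'a smod. cF V W" and ?N' = "%W :: 'a smod. {x : cF V W. eta W x = ?eta W x}"
 have "?N W <= ?N' W" if W: "W : Obj SVect" for W :: "'a smod"
 proof (rule subfunctor_le[OF inf lp _ _ _ W])
  note cl = F_functor_closed(1)[OF V SVect_srep SVect_srep]
  show "subfun (F_functor V) ?N"
   using subfun_carrier[OF lpf_sfun[OF lp]] by (simp only: F_functor_simps(1))
  show "subfun (F_functor V) ?N'"
   unfolding subfun_def F_functor_simps(1)
  proof (intro conjI ballI)
   fix U :: "'a smod" assume U: "U : Obj SVect"
   show "lsub (schur_space V U) (?N' U)"
    unfolding lsub_def using sr[OF U] mhom_add[OF et(2)[OF U]] mhom_add[OF et'(2)[OF U]]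
    mhom_smult[OF et(2)[OF U]] mhom_smult[OF et'(2)[OF U]]
    by (auto simp: mhom_zero[OF sr(1)[OF U] sr(2)[OF U] et(2)[OF U]] mhom_zero[OF sr(1)[OF U] sr(2)[OF U] et'(2)[OF U]])
   fix U' :: "'a smod" and f x assume U': "U' : Obj SVect" and f: "f : shom U U'" and x: "x : ?N' U"
   then have xc: "x : cF V U" and xe: "eta U x = ?eta U x" by blast+
   show "amap (F_functor V) U U' f x : ?N' U'"
    using cl[OF U U' f xc] by (simp only: mem_Collect_eq et(4)[OF U U' f xc] et'(4)[OF U U' f xc] xe simp_thms)
  qed
  fix nu
  show "?N (Proj nu) \<inter> mlpart nu (F_functor V) <= ?N' (Proj nu)"
  proof
   fix x assume x: "x : ?N (Proj nu) \<inter> mlpart nu (F_functor V)"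
   let ?m = "%v. ucoord nu (x nu v)"
   have xm: "x = mlvec V nu ?m" and m: "?m : dual (space (V nu))" using mlpart_mlvec[OF V] ucoord_dual[OF V] x by blast+
   have "eta (Proj nu) (mlvec V nu ?m) = mlvec V' nu (\<Lambda> nu ?m)" by (rule L(1)[OF m])
   also have "... = mlvec V' nu (%v. ?m (phi nu v))" by (rule mlvec_cong[OF V']) (simp only: dp[OF m])
   also have "... = ?eta (Proj nu) (mlvec V nu ?m)" by (rule schur_amap_mlvec[OF V V' ph m, symmetric])
   finally show "x : ?N' (Proj nu)" using x xm by auto
  qed
 qed
 then have "eta W = ?eta W" if W: "W : Obj SVect" for W
  by (intro lin_eqI[OF et(1)[OF W] et'(1)[OF W]]) (use W in blast)
 moreover have "eta : extensional (Obj SVect)" using eta by (simp add: nat_trans_def)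
 ultimately have "eta = ?eta"
  by (intro extensionalityI[of eta "Obj SVect" ?eta]) (auto simp: schur_functor_simps)
 then show "EX phi:nhom V' V. eta = amap schur_functor V V' phi" using ph by blast
qed

end

section \<open>Essential surjectivity\<close>

text \<open>Homogeneity of degree one in the last two variables removes all monomials except those
  with \<open>e 1 + e 2 = 1\<close>, and these are additive. Variable 0 stays at 1 because it
  carries the constant summand of an affine family of morphisms.\<close>

lemma homogeneous_additive:
 fixes P :: "(nat => rat) => rat"
 defines "x s t \<equiv> (%i. if i = 0 then 1 else if i = 1 then s else t)"
 assumes P: "polyfun 3 d P" and hom: "!!u s t. P (x (u * s) (u * t)) = u * P (x s t)"
 shows "P (x 1 1) = P (x 1 0) + P (x 0 1)"
proof -
 obtain a where a: "!!z. P z = (SUM e:exponents 3 d. a e * (\<Prod>i<3. z i ^ e i))"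
  using P unfolding polyfun_def by blast
 \<comment> \<open>At least 1, so that the weights for exponent 1 are in range.\<close>
 define D where "D = max d 1"
 have px: "P (x s t) = (SUM e:exponents 3 d. a e * (s ^ e 1 * t ^ e 2))" for s t
  unfolding a x_def by (simp add: numeral_3_eq_3 numeral_2_eq_2 lessThan_Suc mult_ac)
 have e12: "e 1 + e 2 \<le> D" if "e : exponents 3 d" for e
  using that by (auto simp: exponents_def D_def numeral_3_eq_3 numeral_2_eq_2 lessThan_Suc)
 have lin: "P (x s t) = (SUM e:exponents 3 d. if e 1 + e 2 = 1 then a e * (s ^ e 1 * t ^ e 2) else 0)" for s t
 proof -
  \<comment> \<open>The factor equals 1 by the choice of the weights; homogeneity then moves it
    inside \<open>P\<close>.\<close>
  have "P (x s t) = (\<Sum>k\<le>D. weight D 1 k * of_nat k ^ 1) * P (x s t)"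
   by (subst weight_sum) (simp_all add: D_def)
  also have "... = (\<Sum>k\<le>D. weight D 1 k * P (x (of_nat k * s) (of_nat k * t)))"
   by (simp only: hom sum_distrib_right power_one_right mult.assoc)
  also have "... = (\<Sum>k\<le>D. SUM e:exponents 3 d. (a e * (s ^ e 1 * t ^ e 2)) * (weight D 1 k * of_nat k ^ (e 1 + e 2)))"
   unfolding px sum_distrib_left by (simp only: power_mult_distrib power_add mult_ac)
  also have "... = (SUM e:exponents 3 d. (a e * (s ^ e 1 * t ^ e 2)) * (\<Sum>k\<le>D. weight D 1 k * of_nat k ^ (e 1 + e 2)))"
   unfolding sum_distrib_left by (rule sum.swap)
  also have "... = (SUM e:exponents 3 d. if e 1 + e 2 = 1 then a e * (s ^ e 1 * t ^ e 2) else 0)"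
   by (rule sum.cong[OF refl]) (simp only: weight_sum[OF e12] mult_1_right mult_zero_right split: if_split, blast?)
  finally show ?thesis .
 qed
 show ?thesis
  unfolding lin sum.distrib[symmetric]
 proof (rule sum.cong[OF refl])
  fix e :: "nat => nat"
  have "e 1 + e 2 = 1 ==> e 1 = 1 & e 2 = 0 \<or> e 1 = 0 & e 2 = 1" by linarith
  then show "(if e 1 + e 2 = 1 then a e * (1 ^ e 1 * 1 ^ e 2) else 0)
   = (if e 1 + e 2 = 1 then a e * (1 ^ e 1 * 0 ^ e 2) else 0) + (if e 1 + e 2 = 1 then a e * (0 ^ e 1 * 1 ^ e 2) else 0)"
   by auto
 qed
qed

lemma lcomb_three:
 assumes "rvs V" "!!i. i < 3 ==> x i : carrier V"
 shows "lcomb V {..<3::nat} c x = c 0 \<odot>[V] x 0 \<oplus>[V] (c 1 \<odot>[V] x 1 \<oplus>[V] c 2 \<odot>[V] x 2)"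
proof -
 have x: "x i : carrier V" if "i : {0, 1, 2}" for i using assms(2) that by auto
 have "{..<3::nat} = {0, 1, 2}" by auto
 moreover have "lcomb V {0, 1, 2} c x = c 0 \<odot>[V] x 0 \<oplus>[V] lcomb V {1, 2} c x"
  "lcomb V {1, 2} c x = c 1 \<odot>[V] x 1 \<oplus>[V] lcomb V {2} c x" "lcomb V {2} c x = c 2 \<odot>[V] x 2 \<oplus>[V] lcomb V {} c x"
  by (rule lcomb_insert[OF assms(1)]; use x in auto)+
 ultimately show ?thesis using assms(1) x[of 2] by (simp add: rvs_simps)
qed

lemma fdvs_rat_vs: "fdvs rat_vs"
 by (rule fdvsI[OF rvs_rat_vs, of "{%x. x}"]) (auto simp: rat_vs_def intro!: dualI)

lemma rat_vs_dual_id: "(%x. x) : dual rat_vs"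
 by (rule dualI) (simp_all add: rat_vs_def)

lemma dual_rat_vs_lin: "l : dual V ==> rvs V ==> restrict l (carrier V) : lin V rat_vs"
 by (intro lin_restrict mhomI) (simp_all add: rat_vs_def)

lemma lcomb_lsub:
 assumes V: "rvs V" and K: "lsub V K" and x: "!!i. i : A ==> x i : K"
 shows "lcomb (V\<lparr>carrier := K\<rparr>) A c x = lcomb V A c x"
proof -
 have "(%x. x) : mhom (V\<lparr>carrier := K\<rparr>) V" using K by (intro mhom_lsub mhomI) (auto simp: lsub_def)
 then show ?thesis by (rule mhom_lcomb[OF rvs_lsub[OF V K] V]) (simp add: x)
qed

text \<open>As in the Yoneda lemma, an element of \<open>F (Proj nu)\<close> gives a function of
  tuples in \<open>W\<close>; for elements of the multilinear part this function is multilinear and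
  factors through the tensor power.\<close>

definition bmap :: "('a, 'b) svect_functor => nat multiset => 'a smod => 'b => 'a tens => 'b" where
 "bmap F nu W y = (SOME L. L : lin (tpow nu W) (omap F W) & (ALL w:ptuples nu W. L (pten nu W w) = amap F (Proj nu) W (ev nu W w) y))"

text \<open>\<open>R\<close> is the representation dual to the multilinear part of \<open>F (Proj nu)\<close> under the pairing \<open>p\<close>,
  with dual bases \<open>v\<close> and \<open>y\<close> (more precisely, a frame).\<close>

definition ml_dual :: "('a, 'b) svect_functor => nat multiset =>
  (nat => wr, 'v) rep \<times> nat \<times> (nat => 'b) \<times> (nat => 'v) \<times> ('v => 'b => rat) => bool" where
 "ml_dual F nu = (%(R, n, y, v, p). is_rep (S_nu nu) R &
  (ALL k:{..<n}. y k : mlpart nu F & v k : cs R) &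
  (ALL u:cs R. p u : dual ((omap F (Proj nu))\<lparr>carrier := mlpart nu F\<rparr>) &
   u = lcomb (space R) {..<n} (%k. p u (y k)) v) &
  (ALL x:mlpart nu F. (%u. p u x) : dual (space R) & x = lcomb (omap F (Proj nu)) {..<n} (%k. p (v k) x) y) &
  (ALL g:SG nu. ALL u:cs R. ALL x:mlpart nu F. p (act R g u) x = p u (amap F (Proj nu) (Proj nu) (gmor nu g) x)))"

context
 assumes inf: "infinite (UNIV :: 'a set)"
begin

section \<open>Multilinearity of evaluation at elements of the multilinear part\<close>

lemma mlpart_carrier: "y : mlpart nu F ==> y : carrier (omap F (Proj nu))"
 by (simp add: mlpart_def)

lemma ev_scale_tuple:
 assumes F: "sfun (F :: ('a, 'b) svect_functor)" and W: "W : Obj SVect" and w: "w : ptuples nu W" and y: "y : mlpart nu F"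
 shows "amap F (Proj nu) W (ev nu W (scale_tuple nu W t w)) y = (PROD s:slots nu. t s) \<odot>[omap F W] amap F (Proj nu) W (ev nu W w) y"
proof -
 note P = Proj_Obj[OF inf, of nu] and Wr = SVect_srep[OF W]
 note E = ev_hom[OF inf Wr w] and D = diag_hom[OF inf, of nu t] and yc = mlpart_carrier[OF y]
 have "amap F (Proj nu) W (ev nu W (scale_tuple nu W t w)) y = amap F (Proj nu) W (ev nu W w) (amap F (Proj nu) (Proj nu) (diag nu t) y)"
  unfolding ev_diag[OF inf Wr w, symmetric] by (rule sfunD(7)[OF F P P W D E yc])
 also have "amap F (Proj nu) (Proj nu) (diag nu t) y = (PROD s:slots nu. t s) \<odot>[omap F (Proj nu)] y" using y by (simp add: mlpart_def)
 finally show ?thesis by (simp only: mhom_smult[OF sfunD(4)[OF F P W E] yc])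
qed

text \<open>The three morphisms belong to \<open>w\<close> with zero in slot \<open>k\<close> and to
  the tuples concentrated in that slot with entry \<open>a\<close> or \<open>b\<close>. The
  condition \<open>c 0 = 1\<close> keeps the remaining entries of \<open>w\<close> fixed.\<close>

lemma ev_affine:
 assumes W: "srep (W :: 'a smod)" and w: "w : ptuples nu W" and k: "k : slots nu" and a: "a : carrier (factors W k)" and b: "b : carrier (factors W k)"
 shows "EX E:{..<3::nat} \<rightarrow> shom (Proj nu) W. ALL c. c 0 = 1 -->
  lcomb (shv (Proj nu) W) {..<3} c E = ev nu W (w(k := c 1 \<odot>[factors W k] a \<oplus>[factors W k] c 2 \<odot>[factors W k] b))"
proof -
 let ?X = "factors W"
 note X = factors_rvs[OF W]
 define T where "T c = (\<lambda>s\<in>slots nu. if s = k then c else \<zero>[?X s])" for c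
 have fz: "(if (i, j) = k then c else \<zero>[?X (i, j)]) : cs (W i)" if "c : carrier (?X k)" for i j c
  using that X[of "(i, j)"] by (auto simp: factors_def)
 have T: "T c : ptuples nu W" if "c : carrier (?X k)" for c
  by (rule ptuplesI) (use fz[OF that] in "simp_all add: T_def")
 have wk: "w(k := c) : ptuples nu W" if "c : carrier (?X k)" for c by (rule tuples_upd[OF w k that])
 let ?E = "%i::nat. ev nu W (if i = 0 then w(k := \<zero>[?X k]) else if i = 1 then T a else T b)"
 have E: "?E i : shom (Proj nu) W" for i using ev_hom[OF inf W] wk[of "\<zero>[?X k]"] T[OF a] T[OF b] X by auto
 show ?thesis
 proof (intro bexI[of _ ?E] allI impI)
  show "?E : {..<3} \<rightarrow> shom (Proj nu) W" using E by blast
  fix c :: "nat => rat" assume c: "c 0 = 1"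
  let ?v = "c 1 \<odot>[?X k] a \<oplus>[?X k] c 2 \<odot>[?X k] b"
  have v: "?v : carrier (?X k)" using X a b by blast
  show "lcomb (shv (Proj nu) W) {..<3} c ?E = ev nu W (w(k := ?v))"
  proof (rule ev_unique[OF inf W shom_lcomb_closed[OF Psrep[OF inf] W E] wk[OF v]])
   fix i j assume s: "(i, j) : slots nu"
   note Wi = X[of "(i, j)", unfolded factors_def prod.case]
   have Eg: "?E m i (gen nu (i, j)) = (if m = 0 then w(k := \<zero>[?X k]) else if m = 1 then T a else T b) (i, j)" for m
    using wk[of "\<zero>[?X k]"] T[OF a] T[OF b] X by (intro ev_gen[OF inf W _ s]) auto
   have wc: "w (i, j) : cs (W i)" by (rule ptuples_mem[OF w s])
   have Ec: "?E m i (gen nu (i, j)) : cs (W i)" for m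
    using rep_homD(4)[of "?E m i" "sym_group i" "Proj nu i" "W i", OF _ gen_closed[OF inf s]] E[of m] by blast
   have "lcomb (shv (Proj nu) W) {..<3} c ?E i (gen nu (i, j)) = lcomb (space (W i)) {..<3} c (%m. ?E m i (gen nu (i, j)))"
    by (rule shom_lcomb_eval[OF Psrep[OF inf] W E gen_closed[OF inf s]])
   also have "... = c 0 \<odot>[space (W i)] (w(k := \<zero>[?X k])) (i, j) \<oplus>[space (W i)] (c 1 \<odot>[space (W i)] T a (i, j) \<oplus>[space (W i)] c 2 \<odot>[space (W i)] T b (i, j))"
    unfolding lcomb_three[OF Wi Ec] unfolding Eg by simp
   also have "... = (w(k := ?v)) (i, j)"
   proof (cases "(i, j) = k")
    case True
    then have "?X k = space (W i)" by (auto simp: factors_def)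
    then show ?thesis using True s a b v Wi by (simp add: T_def rvs_simps[OF Wi])
   next
    case False
    then show ?thesis using s wc Wi by (simp add: T_def rvs_simps[OF Wi] c factors_def)
   qed
   finally show "lcomb (shv (Proj nu) W) {..<3} c ?E i (gen nu (i, j)) = (w(k := ?v)) (i, j)" .
  qed
 qed
qed

text \<open>Additivity in each variable follows from homogeneity of degree one: a polynomial map which is
  homogeneous of degree one is additive.\<close>

lemma ev_multilinear:
 assumes Fl: "lpf (F :: ('a, 'b) svect_functor)" and Wo: "W : Obj SVect" and y: "y : mlpart nu F"
 shows "multilinear (slots nu) (factors W) (omap F W) (%w. amap F (Proj nu) W (ev nu W w) y)"
proof -
 note F = lpf_sfun[OF Fl] and P = Proj_Obj[OF inf, of nu] and W = SVect_srep[OF Wo] and yc = mlpart_carrier[OF y]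
 note X = factors_rvs[OF W] and V = sfunD(1,2)[OF F Wo]
 let ?\<mu> = "%w. amap F (Proj nu) W (ev nu W w) y"
 have cl: "?\<mu> w : carrier (omap F W)" if "w : ptuples nu W" for w by (rule sfunD(5)[OF F P Wo ev_hom[OF inf W that] yc])
 have sm: "?\<mu> (w(k := r \<odot>[factors W k] a)) = r \<odot>[omap F W] ?\<mu> (w(k := a))"
  if w: "w : ptuples nu W" and k: "k : slots nu" and a: "a : carrier (factors W k)" for w k r a
 proof -
  note wa = tuples_upd[OF w k a]
  \<comment> \<open>Scaling in the slot \<open>k\<close> only, so that the product of all scalars is
    \<open>r\<close>.\<close>
  let ?t = "%s. if s = k then r else 1"
  have "w(k := r \<odot>[factors W k] a) = scale_tuple nu W ?t (w(k := a))"
  proof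
   fix s show "(w(k := r \<odot>[factors W k] a)) s = scale_tuple nu W ?t (w(k := a)) s"
    using k tuples_mem[OF w] ptuples_undefined[OF w] X[of s] by (auto simp: scale_tuple_def rvs_simps)
  qed
  moreover have "(PROD s:slots nu. ?t s) = r" using k finite_slots[of nu] by simp
  ultimately show ?thesis using ev_scale_tuple[OF F Wo wa y, of ?t] by simp
 qed
 have ad: "?\<mu> (w(k := a \<oplus>[factors W k] b)) = ?\<mu> (w(k := a)) \<oplus>[omap F W] ?\<mu> (w(k := b))"
  if w: "w : ptuples nu W" and k: "k : slots nu" and a: "a : carrier (factors W k)" and b: "b : carrier (factors W k)" for w k a b
 proof -
  let ?X = "factors W k"
  note Xk = X[of k]
  have ab: "a \<oplus>[?X] b : carrier ?X" using Xk a b by blast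
  note ua = tuples_upd[OF w k a] and ub = tuples_upd[OF w k b] and uab = tuples_upd[OF w k ab]
  obtain E where E: "E : {..<3::nat} \<rightarrow> shom (Proj nu) W"
   and ev: "ALL c. c 0 = 1 --> lcomb (shv (Proj nu) W) {..<3} c E = ev nu W (w(k := c 1 \<odot>[?X] a \<oplus>[?X] c 2 \<odot>[?X] b))"
   using ev_affine[OF W w k a b] by blast
  show ?thesis
  proof (rule separated_eqI[OF V(1) cl[OF uab]])
   show "?\<mu> (w(k := a)) \<oplus>[omap F W] ?\<mu> (w(k := b)) : carrier (omap F W)" using V cl[OF ua] cl[OF ub] by blast
   fix l assume l: "l : dual (omap F W)"
   obtain d where d: "ALL r a d' l. a : {..<r} \<rightarrow> shom (Proj nu) W --> d \<le> d' --> l : dual (omap F W) -->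
    polyfun r d' (%t. l (amap F (Proj nu) W (lcomb (shv (Proj nu) W) {..<r} t a) y))"
    using lpf_polyfun[OF Fl P Wo yc] by blast
   let ?P = "%t. l (amap F (Proj nu) W (lcomb (shv (Proj nu) W) {..<3} t E) y)"
   let ?x = "%s t. (%i::nat. if i = 0 then 1 else if i = 1 then s else t)"
   have pf: "polyfun 3 d ?P" by (rule d[rule_format, OF E order_refl l])
   have Px: "?P (?x s t) = l (?\<mu> (w(k := s \<odot>[?X] a \<oplus>[?X] t \<odot>[?X] b)))" for s t
    using ev[rule_format, of "?x s t"] by simp
   have hom: "?P (?x (u * s) (u * t)) = u * ?P (?x s t)" for u s t
   proof -
    have v: "s \<odot>[?X] a \<oplus>[?X] t \<odot>[?X] b : carrier ?X" using Xk a b by blast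
    have "(u * s) \<odot>[?X] a \<oplus>[?X] (u * t) \<odot>[?X] b = u \<odot>[?X] (s \<odot>[?X] a \<oplus>[?X] t \<odot>[?X] b)"
    using Xk a b by (simp add: rvs_distrib[OF Xk] rvs_simps[OF Xk])
    then show ?thesis
    unfolding Px using sm[OF w k v, of u] dual_smult[OF l cl[OF tuples_upd[OF w k v]]] by simp
   qed
   have "?P (?x 1 1) = ?P (?x 1 0) + ?P (?x 0 1)" by (rule homogeneous_additive[OF pf hom])
   then show "l (?\<mu> (w(k := a \<oplus>[?X] b))) = l (?\<mu> (w(k := a)) \<oplus>[omap F W] ?\<mu> (w(k := b)))"
    unfolding Px using a b by (simp add: rvs_simps[OF Xk] dual_add[OF l cl[OF ua] cl[OF ub]])
  qed
 qed
 show ?thesis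
  unfolding multilinear_def using cl sm ad by blast
qed

lemma bmap_props:
 assumes Fl: "lpf (F :: ('a, 'b) svect_functor)" and Wo: "W : Obj SVect" and y: "y : mlpart nu F"
 shows "bmap F nu W y : lin (tpow nu W) (omap F W)" "bmap F nu W y : mhom (tpow nu W) (omap F W)"
  and "z : carrier (tpow nu W) ==> bmap F nu W y z : carrier (omap F W)"
  and "w : ptuples nu W ==> bmap F nu W y (pten nu W w) = amap F (Proj nu) W (ev nu W w) y"
proof -
 note X = factors_rvs[OF SVect_srep[OF Wo]]
 have "EX L. L : lin (tpow nu W) (omap F W) & (ALL w:ptuples nu W. L (pten nu W w) = amap F (Proj nu) W (ev nu W w) y)"
  using tensor_lift[of "slots nu" "factors W", OF X sfunD(2)[OF lpf_sfun[OF Fl] Wo] ev_multilinear[OF Fl Wo y]] by blast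
 from someI_ex[OF this] have b: "bmap F nu W y : lin (tpow nu W) (omap F W)"
  "ALL w:ptuples nu W. bmap F nu W y (pten nu W w) = amap F (Proj nu) W (ev nu W w) y"
  unfolding bmap_def by blast+
 show "bmap F nu W y : lin (tpow nu W) (omap F W)" by (rule b(1))
 show "bmap F nu W y : mhom (tpow nu W) (omap F W)" by (rule lin_mhom[OF b(1)])
 show "z : carrier (tpow nu W) ==> bmap F nu W y z : carrier (omap F W)" by (rule lin_closed[OF b(1)])
 show "w : ptuples nu W ==> bmap F nu W y (pten nu W w) = amap F (Proj nu) W (ev nu W w) y" using b(2) by blast
qed

lemma bmap_natural:
 assumes Fl: "lpf (F :: ('a, 'b) svect_functor)" and W: "W : Obj SVect" and W': "W' : Obj SVect" and f: "f : shom W W'"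
  and y: "y : mlpart nu F" and z: "z : carrier (tpow nu W)"
 shows "amap F W W' f (bmap F nu W y z) = bmap F nu W' y (tensor_power_map W W' f nu z)"
proof (rule tpow_ext[OF SVect_srep[OF W] sfunD(2)[OF lpf_sfun[OF Fl] W'] _ _ _ z])
 note F = lpf_sfun[OF Fl] and P = Proj_Obj[OF inf, of nu] and Wr = SVect_srep[OF W] and Wr' = SVect_srep[OF W']
 show "(%z. amap F W W' f (bmap F nu W y z)) : mhom (tpow nu W) (omap F W')"
  by (rule mhom_comp[OF bmap_props(2)[OF Fl W y] sfunD(4)[OF F W W' f]])
 show "(%z. bmap F nu W' y (tensor_power_map W W' f nu z)) : mhom (tpow nu W) (omap F W')"
  by (rule mhom_comp[OF lin_mhom[OF tensor_power_map_props(1)[OF Wr Wr' f]] bmap_props(2)[OF Fl W' y]])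
 fix w assume w: "w : ptuples nu W"
 show "amap F W W' f (bmap F nu W y (pten nu W w)) = bmap F nu W' y (tensor_power_map W W' f nu (pten nu W w))"
  unfolding bmap_props(4)[OF Fl W y w] tensor_power_map_props(2)[OF Wr Wr' f w] bmap_props(4)[OF Fl W' y map_tuple_closed[OF f w]]
   ev_comp[OF inf Wr Wr' f w, symmetric]
  by (rule sfunD(7)[OF F P W W' ev_hom[OF inf Wr w] f mlpart_carrier[OF y], symmetric])
qed

lemma gmor_mlpart:
 assumes F: "sfun (F :: ('a, 'b) svect_functor)" and y: "y : mlpart nu F" and g: "g : SG nu"
 shows "amap F (Proj nu) (Proj nu) (gmor nu g) y : mlpart nu F"
proof -
 note P = Proj_Obj[OF inf, of nu] and G = gmor_hom[OF inf g] and D = diag_hom[OF inf, of nu] and yc = mlpart_carrier[OF y]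
 have "amap F (Proj nu) (Proj nu) (diag nu t) (amap F (Proj nu) (Proj nu) (gmor nu g) y)
  = (PROD s:slots nu. t s) \<odot>[omap F (Proj nu)] amap F (Proj nu) (Proj nu) (gmor nu g) y" for t
 proof -
  let ?h = "%(i, j). (i, inv_into UNIV (fst (g i)) j)"
  have hs: "?h s : slots nu" if "s : slots nu" for s using S_nu_inv_slot(1)[OF g] that by (cases s) simp
  have "inj ?h"
  proof (rule injI)
   fix s s' assume e: "?h s = ?h s'"
   have "inj (inv_into UNIV (fst (g i)))" for i
    by (rule permutes_inj[OF permutes_inv[OF S_nu_mem(1)[OF g]]])
   then show "s = s'" using e by (cases s; cases s') (auto dest: injD)
  qed
  then have "inj_on ?h (slots nu)" by (rule inj_on_subset) simp
  moreover have "?h ` slots nu <= slots nu" using hs by blast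
  ultimately have "bij_betw ?h (slots nu) (slots nu)"
   using endo_inj_surj[OF finite_slots[of nu], of ?h] unfolding bij_betw_def by blast
  then have pr: "(PROD s:slots nu. t (?h s)) = (PROD s:slots nu. t s)" by (rule prod.reindex_bij_betw)
  let ?t = "%(i, j). t (i, inv_into UNIV (fst (g i)) j)"
  have te: "?t = (%s. t (?h s))" by (auto simp: fun_eq_iff)
  have "amap F (Proj nu) (Proj nu) (diag nu t) (amap F (Proj nu) (Proj nu) (gmor nu g) y)
   = amap F (Proj nu) (Proj nu) (gmor nu g) (amap F (Proj nu) (Proj nu) (diag nu ?t) y)"
   by (simp only: sfunD(7)[OF F P P P G D yc, symmetric] sfunD(7)[OF F P P P D G yc, symmetric] gmor_diag_gmor[OF inf g])
  also have "amap F (Proj nu) (Proj nu) (diag nu ?t) y = (PROD s:slots nu. t s) \<odot>[omap F (Proj nu)] y"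
   using y unfolding te by (simp add: mlpart_def pr)
  finally show ?thesis by (simp only: mhom_smult[OF sfunD(4)[OF F P P G] yc])
 qed
 then show ?thesis using sfunD(5)[OF F P P G yc] by (simp add: mlpart_def)
qed

lemma gmor_one: "gmor nu \<one>[S_nu nu] = (idm (Proj nu) :: nat => 'a => 'a)"
 unfolding gmor_def act_tuple_one[OF Psrep[OF inf] Pgtup[OF inf]] by (rule ev_gtup[OF inf])

text \<open>This is a right action on \<open>F (Proj nu)\<close>. Passing to the dual space of the
  multilinear part turns it into a left action, as a representation requires.\<close>

lemma gmor_action:
 assumes F: "sfun (F :: ('a, 'b) svect_functor)" and y: "y : carrier (omap F (Proj nu))"
 shows "amap F (Proj nu) (Proj nu) (gmor nu \<one>[S_nu nu]) y = y"
  and "g : SG nu ==> h : SG nu ==>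
   amap F (Proj nu) (Proj nu) (gmor nu h) (amap F (Proj nu) (Proj nu) (gmor nu g) y) = amap F (Proj nu) (Proj nu) (gmor nu (g \<otimes>[S_nu nu] h)) y"
proof -
 note P = Proj_Obj[OF inf, of nu]
 show "amap F (Proj nu) (Proj nu) (gmor nu \<one>[S_nu nu]) y = y" unfolding gmor_one by (rule sfunD(6)[OF F P y])
 assume g: "g : SG nu" and h: "h : SG nu"
 show "amap F (Proj nu) (Proj nu) (gmor nu h) (amap F (Proj nu) (Proj nu) (gmor nu g) y) = amap F (Proj nu) (Proj nu) (gmor nu (g \<otimes>[S_nu nu] h)) y"
  by (simp only: sfunD(7)[OF F P P P gmor_hom[OF inf g] gmor_hom[OF inf h] y, symmetric] gmor_gmor[OF inf h g])
qed

text \<open>The representation is the dual of the multilinear part with the transposed action, moved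
  to the type \<open>'v\<close>. A frame of the multilinear part supplies \<open>y\<close>, its
  coordinate functionals supply \<open>v\<close>, and evaluation is the pairing.\<close>

lemma ml_dual_exists:
 assumes infv: "infinite (UNIV :: 'v set)" and F: "is_functor SVect Vect (F :: ('a, 'b) svect_functor)"
 shows "EX D :: (nat => wr, 'v) rep \<times> _. ml_dual F nu D"
proof -
 note P = Proj_Obj[OF inf, of nu] and Fs = is_functor_SVSI[OF F]
 let ?M = "mlpart nu F" and ?V = "omap F (Proj nu)" and ?g = "%g. amap F (Proj nu) (Proj nu) (gmor nu g)"
 have Vf: "fdvs ?V" using is_functorD(1)[OF F P] by simp
 note V = sfunD(2)[OF Fs P] and M = lsub_mlpart[OF inf Fs, of nu]
 let ?Y = "?V\<lparr>carrier := ?M\<rparr>"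
 have Y: "fdvs ?Y" by (rule fdvs_lsub[OF Vf M])
 note rY = fdvs_rvs[OF Y]
 interpret G: group "S_nu nu" by (rule group_S_nu)
 define R where "R = \<lparr>space = hom_vs ?Y rat_vs, act = (%g l. \<lambda>x\<in>?M. l (?g g x))\<rparr>"
 have Rs: "space R = hom_vs ?Y rat_vs" "act R g l = (\<lambda>x\<in>?M. l (?g g x))" for g l by (simp_all add: R_def)
 note gM = gmor_mlpart[OF Fs]
 have gm: "?g g : mhom ?Y ?Y" if g: "g : SG nu" for g
  by (rule mhomI) (simp_all add: gM[OF _ g] mhom_add[OF sfunD(4)[OF Fs P P gmor_hom[OF inf g]]] mhom_smult[OF sfunD(4)[OF Fs P P gmor_hom[OF inf g]]] mlpart_carrier)
 have rep: "is_rep (S_nu nu) R"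
  unfolding is_rep_def
 proof (intro conjI ballI)
  show "fdvs (space R)" unfolding Rs by (rule fdvs_hom_vs[OF Y fdvs_rat_vs])
  fix g assume g: "g : SG nu"
  show "act R g : mhom (space R) (space R)"
  proof (rule mhomI; unfold Rs hom_vs_simps)
   show "(\<lambda>x\<in>?M. l (?g g x)) : lin ?Y rat_vs" if "l : lin ?Y rat_vs" for l
    using lin_restrict[OF mhom_comp[OF gm[OF g] lin_mhom[OF that]] rY] by simp
  qed (auto simp: fun_eq_iff gM[OF _ g])
 next
  fix l assume "l : cs R"
  then have l: "l : lin ?Y rat_vs" by (simp add: Rs)
  show "act R \<one>[S_nu nu] l = l"
   unfolding Rs using gmor_action(1)[OF Fs mlpart_carrier] lin_undefined[OF l] by (auto simp: fun_eq_iff)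
  fix g h assume g: "g : SG nu" and h: "h : SG nu"
  show "act R (g \<otimes>[S_nu nu] h) l = act R g (act R h l)"
   unfolding Rs using gM[OF _ g] gmor_action(2)[OF Fs mlpart_carrier g h] by (auto simp: fun_eq_iff)
 qed
 obtain n y l where fr: "frame ?Y n y l" using fdvs_frame[OF Y] by blast
 have yl: "y k : ?M" "l k : dual ?Y" if "k : {..<n}" for k using fr that by (auto simp: frame_def)
 have ll: "restrict (l k) ?M : lin ?Y rat_vs" if "k : {..<n}" for k using dual_rat_vs_lin[OF yl(2)[OF that] rY] by simp
 obtain R' :: "(nat => wr, 'v) rep" and j j' where R': "is_rep (S_nu nu) R'" and j: "j : mhom (space R) (space R')" and j': "j' : mhom (space R') (space R)"
  and j'j: "!!x. x : cs R ==> j' (j x) = x" and jj': "!!u. u : cs R' ==> j (j' u) = u"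
  and ja: "!!g u. g : SG nu ==> u : cs R' ==> j' (act R' g u) = act R g (j' u)"
  using rep_transport[OF rep infv group_S_nu] by metis
 have j'l: "j' u : lin ?Y rat_vs" if "u : cs R'" for u using mhom_closed[OF j' that] by (simp add: Rs)
 let ?v = "%k. j (restrict (l k) ?M)"
 have "ml_dual F nu (R', n, y, ?v, j')"
  unfolding ml_dual_def prod.case
 proof (intro conjI ballI R' yl(1))
  have rR: "rvs (space R)" "rvs (space R')" using fdvs_rvs[OF is_repD(1)[OF rep]] fdvs_rvs[OF is_repD(1)[OF R']] by blast+
  show "?v k : cs R'" if "k : {..<n}" for k using mhom_closed[OF j] ll[OF that] by (simp add: Rs)
  fix u assume u: "u : cs R'"
  show pd: "j' u : dual ?Y" by (rule lin_rat_vs_dual[OF j'l[OF u]])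
  show "u = lcomb (space R') {..<n} (%k. j' u (y k)) ?v"
  proof -
   have lR: "restrict (l k) ?M : cs R" if "k : {..<n}" for k using ll[OF that] by (simp add: Rs)
   have lc: "lcomb (space R) {..<n} (%k. j' u (y k)) (%k. restrict (l k) ?M) : lin ?Y rat_vs"
   proof -
    have "lcomb (space R) {..<n} (%k. j' u (y k)) (%k. restrict (l k) ?M) : cs R" by (rule lcomb_closed[OF rR(1) lR])
    then show ?thesis by (simp add: Rs)
   qed
   have "j' u = lcomb (space R) {..<n} (%k. j' u (y k)) (%k. restrict (l k) ?M)"
   proof (rule lin_eqI[OF j'l[OF u] lc])
    fix x assume x: "x : carrier ?Y"
    have ed: "(%f. f x) : dual (space R)" unfolding Rs by (rule dual_eval[OF rat_vs_dual_id x])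
    have "lcomb (space R) {..<n} (%k. j' u (y k)) (%k. restrict (l k) ?M) x = (\<Sum>k<n. j' u (y k) * restrict (l k) ?M x)"
    by (rule dual_lcomb[OF rR(1) ed lR])
    also have "... = j' u x" using frame_dual[OF rY fr pd x] x by (simp add: mult.commute)
    finally show "j' u x = lcomb (space R) {..<n} (%k. j' u (y k)) (%k. restrict (l k) ?M) x" by simp
   qed
   then have "j (j' u) = j (lcomb (space R) {..<n} (%k. j' u (y k)) (%k. restrict (l k) ?M))" by simp
   also have "... = lcomb (space R') {..<n} (%k. j' u (y k)) ?v" by (rule mhom_lcomb[OF rR j lR])
   finally show ?thesis using jj'[OF u] by simp
  qed
 next
  have rR: "rvs (space R)" "rvs (space R')" using fdvs_rvs[OF is_repD(1)[OF rep]] fdvs_rvs[OF is_repD(1)[OF R']] by blast+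
  fix x assume x: "x : ?M"
  have ed: "(%f. f x) : dual (space R)" unfolding Rs by (rule dual_eval[OF rat_vs_dual_id]) (simp add: x)
  show "(%u. j' u x) : dual (space R')" by (rule dual_mhom[OF j' ed])
  have "x = lcomb ?Y {..<n} (%k. l k x) y" using fr x by (simp add: frame_def)
  also have "... = lcomb ?V {..<n} (%k. l k x) y" by (rule lcomb_lsub[OF V M yl(1)])
  also have "... = lcomb ?V {..<n} (%k. j' (?v k) x) y"
  proof (rule lcomb_cong[OF V refl mlpart_carrier[OF yl(1)] _ refl])
   fix k assume "k : {..<n}"
   from ll[OF this] have "restrict (l k) ?M : cs R" by (simp add: Rs)
   from j'j[OF this] show "l k x = j' (?v k) x" using x by simp
  qed
  finally show "x = lcomb ?V {..<n} (%k. j' (?v k) x) y" .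
 next
  fix g u x assume "g : SG nu" "u : cs R'" "x : ?M"
  then show "j' (act R' g u) x = j' u (?g g x)" by (simp add: ja Rs(2))
 qed
 then show ?thesis by blast
qed

end

section \<open>The comparison of \<open>F_functor V\<close> with \<open>F\<close>\<close>

lemma nat_iso:
 fixes F G :: "('a, 'b) svect_functor"
 assumes F: "sfun F" and G: "sfun G" and eta: "eta : nat_trans SVect Vect F G"
  and bij: "!!W. W : Obj SVect ==> bij_betw (eta W) (carrier (omap F W)) (carrier (omap G W))"
 shows "is_iso (fun_cat SVect Vect) F G eta"
proof -
 note et = nat_transD[OF eta]
 define eps where "eps = (\<lambda>W\<in>Obj SVect. \<lambda>z\<in>carrier (omap G W). the_inv_into (carrier (omap F W)) (eta W) z)"
 have e: "eps W z = the_inv_into (carrier (omap F W)) (eta W) z" if "W : Obj SVect" "z : carrier (omap G W)" for W z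
  using that by (simp only: eps_def restrict_apply if_True)
 have ec: "eps W z : carrier (omap F W)" "eta W (eps W z) = z" if W: "W : Obj SVect" and z: "z : carrier (omap G W)" for W z
  unfolding e[OF that] using bij[OF W] z
  by (auto simp: bij_betw_def intro!: the_inv_into_into f_the_inv_into_f simp del: graded_simps)
 have inj: "x = x'" if W: "W : Obj SVect" and "x : carrier (omap F W)" "x' : carrier (omap F W)" "eta W x = eta W x'" for W x x'
  using bij[OF W] that by (auto simp: bij_betw_def dest: inj_onD simp del: graded_simps)
 have en: "eps W (eta W x) = x" if W: "W : Obj SVect" and x: "x : carrier (omap F W)" for W x
  by (rule inj[OF W ec(1)[OF W et(3)[OF W x]] x ec(2)[OF W et(3)[OF W x]]])
 have "eps : nat_trans SVect Vect G F"
 proof (rule nat_transI)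
  show "eps : extensional (Obj SVect)" unfolding eps_def by (rule restrict_extensional)
  fix W :: "'a smod" assume W: "W : Obj SVect"
  note rF = sfunD(2)[OF F W] and rG = sfunD(2)[OF G W]
  have "eps W : mhom (omap G W) (omap F W)"
  proof (rule mhomI[OF ec(1)[OF W]])
   fix x y r assume x: "x : carrier (omap G W)"
   show "eps W (r \<odot>[omap G W] x) = r \<odot>[omap F W] eps W x"
    by (rule inj[OF W ec(1)[OF W rvs_closed(3)[OF rG x]] rvs_closed(3)[OF rF ec(1)[OF W x]]])
    (simp only: ec(2)[OF W rvs_closed(3)[OF rG x]] mhom_smult[OF et(2)[OF W] ec(1)[OF W x]] ec(2)[OF W x])
   assume y: "y : carrier (omap G W)"
   show "eps W (x \<oplus>[omap G W] y) = eps W x \<oplus>[omap F W] eps W y"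
    by (rule inj[OF W ec(1)[OF W rvs_closed(2)[OF rG x y]] rvs_closed(2)[OF rF ec(1)[OF W x] ec(1)[OF W y]]])
    (simp only: ec(2)[OF W rvs_closed(2)[OF rG x y]] mhom_add[OF et(2)[OF W] ec(1)[OF W x] ec(1)[OF W y]] ec(2)[OF W x] ec(2)[OF W y])
  qed
  moreover have "eps W : extensional (carrier (omap G W))" using W by (simp only: eps_def restrict_apply if_True restrict_extensional)
  ultimately show "eps W : lin (omap G W) (omap F W)" unfolding lin_def by blast
  fix W' :: "'a smod" and f x assume W': "W' : Obj SVect" and f: "f : shom W W'" and x: "x : carrier (omap G W)"
  show "eps W' (amap G W W' f x) = amap F W W' f (eps W x)"
   by (rule inj[OF W' ec(1)[OF W' sfunD(5)[OF G W W' f x]] sfunD(5)[OF F W W' f ec(1)[OF W x]]])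
    (simp only: ec(2)[OF W' sfunD(5)[OF G W W' f x]] et(4)[OF W W' f ec(1)[OF W x]] ec(2)[OF W x])
 qed
 moreover have "compose (carrier (omap F W)) (eps W) (eta W) = (\<lambda>v\<in>carrier (omap F W). v)" if "W : Obj SVect" for W
  using en[OF that] by (auto simp: compose_def fun_eq_iff)
 moreover have "compose (carrier (omap G W)) (eta W) (eps W) = (\<lambda>v\<in>carrier (omap G W). v)" if "W : Obj SVect" for W
  using ec(2)[OF that] by (auto simp: compose_def fun_eq_iff)
 ultimately show ?thesis
  unfolding is_iso_def fun_cat_def cat.simps Vect_simps using eta by (intro conjI bexI[of _ eps] restrict_ext) simp_all
qed

text \<open>Contraction with the canonical element \<open>\<Sum>k. y k \<otimes> v k\<close> of the
  multilinear part tensored with its dual. The sum runs over the support of \<open>xi\<close>, which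
  is finite for elements of \<open>cF V W\<close>.\<close>

definition beta :: "('a, 'b) svect_functor => 'v s2mod => (nat multiset => nat) => (nat multiset => nat => 'b) =>
  (nat multiset => nat => 'v) => 'a smod => ('v, 'a) schur => 'b" where
 "beta F V n y v = (\<lambda>W\<in>Obj SVect. \<lambda>xi\<in>cF V W.
  lcomb (omap F W) (SIGMA nu:{nu. xi nu ~= (\<lambda>v\<in>cs (V nu). \<zero>[tpow nu W])}. {..<n nu}) (%_. 1)
   (%(nu, k). bmap F nu W (y nu k) (xi nu (v nu k))))"

context
 fixes F :: "('v, 'a) sfr" and V :: "'v s2mod" and n y v p
 assumes inf: "infinite (UNIV :: 'a set)" and F: "is_functor SVect Vect F" and Fl: "lpf F"
  and D: "!!nu. ml_dual F nu (V nu, n nu, y nu, v nu, p nu)"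
begin

lemma DD:
 shows "nrep V"
  and "k : {..<n nu} ==> y nu k : mlpart nu F"
  and "k : {..<n nu} ==> v nu k : cs (V nu)"
  and "u : cs (V nu) ==> p nu u : dual ((omap F (Proj nu))\<lparr>carrier := mlpart nu F\<rparr>)"
  and "u : cs (V nu) ==> u = lcomb (space (V nu)) {..<n nu} (%k. p nu u (y nu k)) (v nu)"
  and "x : mlpart nu F ==> (%u. p nu u x) : dual (space (V nu))"
  and "x : mlpart nu F ==> x = lcomb (omap F (Proj nu)) {..<n nu} (%k. p nu (v nu k) x) (y nu)"
  and "g : SG nu ==> u : cs (V nu) ==> x : mlpart nu F ==>
   p nu (act (V nu) g u) x = p nu u (amap F (Proj nu) (Proj nu) (gmor nu g) x)"
 using D unfolding ml_dual_def prod.case by blast+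

lemma beta_terms:
 assumes W: "W : Obj SVect" and xi: "xi : cF V W" and k: "k : {..<n nu}"
 shows "bmap F nu W (y nu k) (xi nu (v nu k)) : carrier (omap F W)"
 by (rule bmap_props(3)[OF inf Fl W DD(2)[OF k] schur_mem(3)[OF xi DD(3)[OF k]]])

lemma beta_closed:
 assumes W: "W : Obj SVect" and xi: "xi : cF V W"
 shows "beta F V n y v W xi : carrier (omap F W)"
proof -
 let ?S = "SIGMA nu:{nu. xi nu ~= (\<lambda>v\<in>cs (V nu). \<zero>[tpow nu W])}. {..<n nu}"
 have "lcomb (omap F W) ?S (%_. 1) (%(nu, k). bmap F nu W (y nu k) (xi nu (v nu k))) : carrier (omap F W)"
  by (rule lcomb_closed[OF sfunD(2)[OF lpf_sfun[OF Fl] W]]) (auto intro: beta_terms[OF W xi])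
 then show ?thesis using W xi by (simp only: beta_def restrict_apply if_True)
qed

text \<open>Any finite set containing the support may be used, so that vectors with different
  supports, or a vector and its image under a morphism, can be compared term by term.\<close>

lemma beta_dual:
 assumes W: "W : Obj SVect" and xi: "xi : cF V W" and l: "l : dual (omap F W)"
  and S: "finite S" "{nu. xi nu ~= (\<lambda>v\<in>cs (V nu). \<zero>[tpow nu W])} <= S"
 shows "l (beta F V n y v W xi) = (SUM nu:S. \<Sum>k<n nu. l (bmap F nu W (y nu k) (xi nu (v nu k))))"
proof -
 note r = sfunD(2)[OF lpf_sfun[OF Fl] W]
 let ?N = "{nu. xi nu ~= (\<lambda>v\<in>cs (V nu). \<zero>[tpow nu W])}"
 let ?f = "%nu k. l (bmap F nu W (y nu k) (xi nu (v nu k)))"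
 have N: "finite ?N" using S finite_subset by blast
 have "l (beta F V n y v W xi) = l (lcomb (omap F W) (Sigma ?N (%nu. {..<n nu})) (%_. 1) (%(nu, k). bmap F nu W (y nu k) (xi nu (v nu k))))"
  using W xi by (simp only: beta_def restrict_apply if_True)
 also have "... = (SUM x:Sigma ?N (%nu. {..<n nu}). 1 * l ((%(nu, k). bmap F nu W (y nu k) (xi nu (v nu k))) x))"
  by (rule dual_lcomb[OF r l]) (auto intro: beta_terms[OF W xi])
 also have "... = (SUM (nu, k):Sigma ?N (%nu. {..<n nu}). ?f nu k)" by (rule sum.cong) auto
 also have "... = (SUM nu:?N. \<Sum>k<n nu. ?f nu k)" using N by (intro sum.Sigma[symmetric]) auto
 also have "... = (SUM nu:S. \<Sum>k<n nu. ?f nu k)"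
 proof (rule sum.mono_neutral_left[OF S], rule ballI)
  fix nu assume "nu : S - ?N"
  then have z: "xi nu = (\<lambda>v\<in>cs (V nu). \<zero>[tpow nu W])" by blast
  show "(\<Sum>k<n nu. ?f nu k) = 0"
  proof (rule sum.neutral, rule ballI)
   fix k assume k: "k : {..<n nu}"
   have "bmap F nu W (y nu k) (xi nu (v nu k)) = \<zero>[omap F W]"
    using mhom_zero[OF tpow_rvs[OF SVect_srep[OF W]] r bmap_props(2)[OF inf Fl W DD(2)[OF k]]] DD(3)[OF k] by (simp add: z)
   then show "?f nu k = 0" using dual_zero[OF r l] by simp
  qed
 qed
 finally show ?thesis .
qed

lemma beta_nat_trans: "beta F V n y v : nat_trans SVect Vect (F_functor V) F"
proof (rule nat_transI, unfold F_functor_simps(1))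
 let ?bt = "beta F V n y v"
 let ?Z = "%W nu. \<lambda>v\<in>cs (V nu). \<zero>[tpow nu W]"
 note V = DD(1) and Fs = lpf_sfun[OF Fl]
 have fin: "finite {nu. xi nu ~= ?Z W nu}" if "xi : cF V W" for xi and W :: "'a smod"
  using that unfolding schur_space_carrier by blast
 show "?bt : extensional (Obj SVect)" unfolding beta_def by (rule restrict_extensional)
 fix W :: "'a smod" assume W: "W : Obj SVect"
 note Wr = SVect_srep[OF W] and sF = sfunD(1)[OF Fs W] and rF = sfunD(2)[OF Fs W]
 have rS: "rvs (schur_space V W)" using svs_schur_space[OF V Wr] by blast
 note cl = beta_closed[OF W] and bm = bmap_props(2)[OF inf Fl W DD(2)]
 have "?bt W : mhom (schur_space V W) (omap F W)"
 proof (rule mhomI[OF cl])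
  fix x x' r assume x: "x : cF V W"
  show "?bt W (r \<odot>[schur_space V W] x) = r \<odot>[omap F W] ?bt W x"
  proof (rule separated_eqI[OF sF cl[OF rvs_closed(3)[OF rS x]] rvs_closed(3)[OF rF cl[OF x]]])
   fix l assume l: "l : dual (omap F W)"
   let ?rx = "r \<odot>[schur_space V W] x"
   note rx = rvs_closed(3)[OF rS x]
   let ?S = "{nu. x nu ~= ?Z W nu} \<union> {nu. ?rx nu ~= ?Z W nu}"
   have S: "finite ?S" using fin[OF x] fin[OF rx] by blast
   have t: "l (bmap F nu W (y nu k) (?rx nu (v nu k))) = r * l (bmap F nu W (y nu k) (x nu (v nu k)))" if k: "k : {..<n nu}" for nu k
    using DD(3)[OF k] by (simp add: schur_space_simps mhom_smult[OF bm[OF k] schur_mem(3)[OF x DD(3)[OF k]]] dual_smult[OF l beta_terms[OF W x k]])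
   have "l (?bt W ?rx) = (SUM nu:?S. \<Sum>k<n nu. l (bmap F nu W (y nu k) (?rx nu (v nu k))))" by (rule beta_dual[OF W rx l S]) blast
   also have "... = r * (SUM nu:?S. \<Sum>k<n nu. l (bmap F nu W (y nu k) (x nu (v nu k))))"
    unfolding sum_distrib_left by (intro sum.cong refl t)
   also have "(SUM nu:?S. \<Sum>k<n nu. l (bmap F nu W (y nu k) (x nu (v nu k)))) = l (?bt W x)" by (rule beta_dual[OF W x l S, symmetric]) blast
   finally show "l (?bt W ?rx) = l (r \<odot>[omap F W] ?bt W x)" by (simp only: dual_smult[OF l cl[OF x]])
  qed
  assume x': "x' : cF V W"
  show "?bt W (x \<oplus>[schur_space V W] x') = ?bt W x \<oplus>[omap F W] ?bt W x'"
  proof (rule separated_eqI[OF sF cl[OF rvs_closed(2)[OF rS x x']] rvs_closed(2)[OF rF cl[OF x] cl[OF x']]])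
   fix l assume l: "l : dual (omap F W)"
   let ?rx = "x \<oplus>[schur_space V W] x'"
   note rx = rvs_closed(2)[OF rS x x']
   let ?S = "{nu. x nu ~= ?Z W nu} \<union> {nu. x' nu ~= ?Z W nu} \<union> {nu. ?rx nu ~= ?Z W nu}"
   have S: "finite ?S" using fin[OF x] fin[OF rx] fin[OF x'] by blast
   have t: "l (bmap F nu W (y nu k) (?rx nu (v nu k))) = l (bmap F nu W (y nu k) (x nu (v nu k))) + l (bmap F nu W (y nu k) (x' nu (v nu k)))" if k: "k : {..<n nu}" for nu k
    using DD(3)[OF k] by (simp add: schur_space_simps mhom_add[OF bm[OF k] schur_mem(3)[OF x DD(3)[OF k]] schur_mem(3)[OF x' DD(3)[OF k]]]
    dual_add[OF l beta_terms[OF W x k] beta_terms[OF W x' k]])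
   have "l (?bt W ?rx) = (SUM nu:?S. \<Sum>k<n nu. l (bmap F nu W (y nu k) (?rx nu (v nu k))))" by (rule beta_dual[OF W rx l S]) blast
   also have "... = (SUM nu:?S. \<Sum>k<n nu. l (bmap F nu W (y nu k) (x nu (v nu k)))) + (SUM nu:?S. \<Sum>k<n nu. l (bmap F nu W (y nu k) (x' nu (v nu k))))"
    unfolding sum.distrib[symmetric] by (intro sum.cong refl t)
   also have "(SUM nu:?S. \<Sum>k<n nu. l (bmap F nu W (y nu k) (x nu (v nu k)))) = l (?bt W x)" by (rule beta_dual[OF W x l S, symmetric]) blast
   also have "(SUM nu:?S. \<Sum>k<n nu. l (bmap F nu W (y nu k) (x' nu (v nu k)))) = l (?bt W x')" by (rule beta_dual[OF W x' l S, symmetric]) blast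
   finally show "l (?bt W ?rx) = l (?bt W x \<oplus>[omap F W] ?bt W x')" by (simp only: dual_add[OF l cl[OF x] cl[OF x']])
  qed
 qed
 moreover have "?bt W : extensional (cF V W)" using W by (simp only: beta_def restrict_apply if_True restrict_extensional)
 ultimately show "?bt W : lin (schur_space V W) (omap F W)" unfolding lin_def by blast
 fix W' :: "'a smod" and f x assume W': "W' : Obj SVect" and f: "f : shom W W'" and x: "x : cF V W"
 note Wr' = SVect_srep[OF W'] and m = sfunD(4)[OF Fs W W' f]
 let ?fx = "amap (F_functor V) W W' f x"
 have fx: "?fx : cF V W'" by (rule F_functor_closed(1)[OF V Wr Wr' f x])
 show "?bt W' ?fx = amap F W W' f (?bt W x)"
 proof (rule separated_eqI[OF sfunD(1)[OF Fs W'] beta_closed[OF W' fx] sfunD(5)[OF Fs W W' f cl[OF x]]])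
  fix l assume l: "l : dual (omap F W')"
  let ?S = "{nu. x nu ~= ?Z W nu} \<union> {nu. ?fx nu ~= ?Z W' nu}"
  have S: "finite ?S" using fin[OF x] fin[OF fx] by blast
  have t: "l (bmap F nu W' (y nu k) (?fx nu (v nu k))) = l (amap F W W' f (bmap F nu W (y nu k) (x nu (v nu k))))" if k: "k : {..<n nu}" for nu k
   by (simp only: F_functor_eval[OF x DD(3)[OF k]] bmap_natural[OF inf Fl W W' f DD(2)[OF k] schur_mem(3)[OF x DD(3)[OF k]]])
  have "l (?bt W' ?fx) = (SUM nu:?S. \<Sum>k<n nu. l (bmap F nu W' (y nu k) (?fx nu (v nu k))))" by (rule beta_dual[OF W' fx l S]) blast
  also have "... = (SUM nu:?S. \<Sum>k<n nu. l (amap F W W' f (bmap F nu W (y nu k) (x nu (v nu k)))))" by (intro sum.cong refl t)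
  also have "... = l (amap F W W' f (?bt W x))" by (rule beta_dual[OF W x dual_mhom[OF m l] S, symmetric]) blast
  finally show "l (?bt W' ?fx) = l (amap F W W' f (?bt W x))" .
 qed
qed

text \<open>\<open>mlvec\<close> sums over the group, and every group element contributes the same
  vector, because its action on \<open>v nu k\<close> and the action of \<open>gmor\<close> on
  \<open>y nu k\<close> cancel. Hence the factor \<open>card (SG nu)\<close>.\<close>

lemma beta_mlvec:
 assumes m: "m : dual (space (V nu))"
 shows "beta F V n y v (Proj nu) (mlvec V nu m)
  = of_nat (card (SG nu)) \<odot>[omap F (Proj nu)] lcomb (omap F (Proj nu)) {..<n nu} (%k. m (v nu k)) (y nu)"
proof -
 interpret G: group "S_nu nu" by (rule group_S_nu)
 note V = DD(1) and Fs = lpf_sfun[OF Fl] and P = Proj_Obj[OF inf, of nu] and yk = DD(2)[of _ nu] and vk = DD(3)[of _ nu]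
 let ?V = "omap F (Proj nu)" and ?G = "SG nu" and ?g = "%g. amap F (Proj nu) (Proj nu) (gmor nu g)"
 have r: "rvs ?V" by (rule sfunD(2)[OF Fs P])
 have M: "lsub ?V (mlpart nu F)" by (rule lsub_mlpart[OF inf Fs])
 have rV: "rvs (space (V nu))" by (rule fdvs_rvs[OF is_repD(1)[OF V[rule_format]]])
 define ym where "ym = lcomb ?V {..<n nu} (%k. m (v nu k)) (y nu)"
 have ym: "ym : mlpart nu F" unfolding ym_def by (rule lsub_lcomb[OF r M yk])
 have ymc: "ym : carrier ?V" by (rule mlpart_carrier[OF inf ym])
 note xi = mlvec_closed[OF inf V m]
 \<comment> \<open>The functional \<open>m\<close> is the pairing with the vector \<open>ym\<close>
   of the multilinear part.\<close>
 have mp: "m u = p nu u ym" if u: "u : cs (V nu)" for u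
 proof -
  have "m u = m (lcomb (space (V nu)) {..<n nu} (%k. p nu u (y nu k)) (v nu))" using DD(5)[OF u] by simp
  also have "... = (\<Sum>k<n nu. p nu u (y nu k) * m (v nu k))" by (rule dual_lcomb[OF rV m vk])
  also have "... = (\<Sum>k<n nu. m (v nu k) * p nu u (y nu k))" by (simp only: mult.commute)
  also have "... = p nu u (lcomb (?V\<lparr>carrier := mlpart nu F\<rparr>) {..<n nu} (%k. m (v nu k)) (y nu))"
   by (rule dual_lcomb[OF rvs_lsub[OF r M] DD(4)[OF u], symmetric]) (use yk in simp)
  also have "... = p nu u ym" unfolding ym_def by (simp only: lcomb_lsub[OF r M yk])
  finally show ?thesis .
 qed
 show ?thesis
  unfolding ym_def[symmetric]
 proof (rule separated_eqI[OF sfunD(1)[OF Fs P] beta_closed[OF P xi] rvs_closed(3)[OF r ymc]])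
  fix l assume l: "l : dual ?V"
  have gk: "bmap F nu (Proj nu) (y nu k) (uten nu g) = ?g g (y nu k)" if "k : {..<n nu}" "g : ?G" for k g
   unfolding uten_def gmor_def by (rule bmap_props(4)[OF inf Fl P yk[OF that(1)] act_tuple_closed[OF Psrep[OF inf] that(2) Pgtup[OF inf]]])
  have gm: "?g g : mhom ?V ?V" if "g : ?G" for g by (rule sfunD(4)[OF Fs P P gmor_hom[OF inf that]])
  have t: "l (bmap F nu (Proj nu) (y nu k) (mlvec V nu m nu (v nu k))) = (SUM g:?G. m (act (V nu) (inv[S_nu nu] g) (v nu k)) * l (?g g (y nu k)))"
   if k: "k : {..<n nu}" for k
  proof -
   have "l (bmap F nu (Proj nu) (y nu k) (mlvec V nu m nu (v nu k)))
    = (SUM g:?G. m (act (V nu) (inv[S_nu nu] g) (v nu k)) * l (bmap F nu (Proj nu) (y nu k) (uten nu g)))"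
    unfolding mlvec_eval(1)[OF inf V vk[OF k]]
    by (rule dual_lcomb[OF Prvs[OF inf] dual_mhom[OF bmap_props(2)[OF inf Fl P yk[OF k]] l] uten_closed[OF inf]])
   then show ?thesis by (simp add: gk[OF k])
  qed
  \<comment> \<open>Moved across the pairing, the inverse of \<open>g\<close> acts on
    \<open>ym\<close>; the frame expansion collects the result, and the outer \<open>g\<close>
    cancels the inverse.\<close>
  have s: "(\<Sum>k<n nu. m (act (V nu) (inv[S_nu nu] g) (v nu k)) * l (?g g (y nu k))) = l ym" if g: "g : ?G" for g
  proof -
   have gi: "inv[S_nu nu] g : ?G" using g by simp
   let ?x = "?g (inv[S_nu nu] g) ym"
   have x: "?x : mlpart nu F" by (rule gmor_mlpart[OF inf Fs ym gi])
   have "(\<Sum>k<n nu. m (act (V nu) (inv[S_nu nu] g) (v nu k)) * l (?g g (y nu k))) = (\<Sum>k<n nu. p nu (v nu k) ?x * l (?g g (y nu k)))"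
    by (rule sum.cong[OF refl]) (simp only: mp[OF Vact(1)[OF inf V gi vk]] DD(8)[OF gi vk ym])
   also have "... = l (?g g (lcomb ?V {..<n nu} (%k. p nu (v nu k) ?x) (y nu)))"
    by (rule dual_lcomb[OF r dual_mhom[OF gm[OF g] l] mlpart_carrier[OF inf yk], symmetric])
   also have "lcomb ?V {..<n nu} (%k. p nu (v nu k) ?x) (y nu) = ?x" by (rule DD(7)[OF x, symmetric])
   also have "?g g ?x = ym" using gmor_action[OF inf Fs ymc] gi g by simp
   finally show ?thesis .
  qed
  have "l (beta F V n y v (Proj nu) (mlvec V nu m)) = (SUM nu':{nu}. \<Sum>k<n nu'. l (bmap F nu' (Proj nu) (y nu' k) (mlvec V nu m nu' (v nu' k))))"
   by (rule beta_dual[OF P xi l]) (auto simp: mlvec_def)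
  also have "... = (\<Sum>k<n nu. SUM g:?G. m (act (V nu) (inv[S_nu nu] g) (v nu k)) * l (?g g (y nu k)))" by (simp add: t)
  also have "... = (SUM g:?G. l ym)" by (subst sum.swap) (rule sum.cong[OF refl s])
  finally show "l (beta F V n y v (Proj nu) (mlvec V nu m)) = l (of_nat (card ?G) \<odot>[?V] ym)" by (simp add: dual_smult[OF l ymc])
 qed
qed

text \<open>Kernel and image are subfunctors, so both claims are reduced to multilinear parts. There
  \<open>beta\<close> is the group order times the canonical identification, and this order is
  invertible in the rationals.\<close>

lemma beta_bij:
 assumes W: "W : Obj SVect"
 shows "bij_betw (beta F V n y v W) (cF V W) (carrier (omap F W))"
  and "xi : cF V W ==> beta F V n y v W xi = \<zero>[omap F W] ==> xi = \<zero>[schur_space V W]"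
proof -
 let ?bt = "beta F V n y v"
 note V = DD(1) and Fs = lpf_sfun[OF Fl]
 note et = nat_transD[OF beta_nat_trans, unfolded F_functor_simps(1)]
 have lV: "lpf (F_functor V :: ('v, 'a) sfr)" by (rule lpf_F_functor[OF V])
 note Vs = lpf_sfun[OF lV]
 note rS = sfunD(2)[OF Vs, unfolded F_functor_simps(1)] and rF = sfunD(2)[OF Fs]
 note cS = sfunD(5)[OF Vs, unfolded F_functor_simps(1)] and mS = sfunD(4)[OF Vs, unfolded F_functor_simps(1)]
 let ?N = "%W :: 'a smod. {xi : cF V W. ?bt W xi = \<zero>[omap F W]}" and ?Z = "%W :: 'a smod. {\<zero>[schur_space V W]}"
 have G0: "of_nat (card (SG nu)) ~= (0 :: rat)" for nu
  using finite_S_nu[of nu] group.is_monoid[OF group_S_nu, of nu] monoid.one_closed[of "S_nu nu"] by (auto simp: card_eq_0_iff)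
 have inj: "?N W <= ?Z W"
 proof (rule subfunctor_le[OF inf lV _ _ _ W])
  show "subfun (F_functor V) ?N"
   unfolding subfun_def F_functor_simps(1)
  proof (intro conjI ballI)
   fix U :: "'a smod" assume U: "U : Obj SVect"
   note b = et(2)[OF U]
   show "lsub (schur_space V U) (?N U)"
    unfolding lsub_def using rS[OF U] rF[OF U] mhom_zero[OF rS[OF U] rF[OF U] b]
    by (auto simp: mhom_add[OF b] mhom_smult[OF b] rvs_simps[OF rF[OF U]] simp del: graded_simps)
   fix U' :: "'a smod" and f x assume U': "U' : Obj SVect" and f: "f : shom U U'" and "x : ?N U"
   then have x: "x : cF V U" and x0: "?bt U x = \<zero>[omap F U]" by blast+
   show "amap (F_functor V) U U' f x : ?N U'"
    using cS[OF U U' f x] et(4)[OF U U' f x] mhom_zero[OF rF[OF U] rF[OF U'] sfunD(4)[OF Fs U U' f]] by (simp only: x0 mem_Collect_eq simp_thms)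
  qed
  show "subfun (F_functor V) ?Z"
   unfolding subfun_def F_functor_simps(1)
  proof (intro conjI ballI)
   fix U :: "'a smod" assume U: "U : Obj SVect"
   show "lsub (schur_space V U) (?Z U)" unfolding lsub_def using rS[OF U] by (auto simp: rvs_simps[OF rS[OF U]] simp del: graded_simps)
   fix U' :: "'a smod" and f x assume "U' : Obj SVect" "f : shom U U'" "x : ?Z U"
   then show "amap (F_functor V) U U' f x : ?Z U'" using mhom_zero[OF rS[OF U] rS mS[OF U]] by (simp del: graded_simps)
  qed
  fix nu
  note P = Proj_Obj[OF inf, of nu]
  show "?N (Proj nu) \<inter> mlpart nu (F_functor V) <= ?Z (Proj nu)"
  proof
   fix x assume x: "x : ?N (Proj nu) \<inter> mlpart nu (F_functor V)"
   let ?m = "%v. ucoord nu (x nu v)" and ?F = "omap F (Proj nu)"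
   have xm: "x = mlvec V nu ?m" and m: "?m : dual (space (V nu))" using mlpart_mlvec[OF inf V] ucoord_dual[OF inf V] x by blast+
   let ?y = "lcomb ?F {..<n nu} (%k. ?m (v nu k)) (y nu)"
   note r = rF[OF P] and rV = fdvs_rvs[OF is_repD(1)[OF V[rule_format, of nu]]]
   have yc: "?y : carrier ?F" by (rule lcomb_closed[OF r mlpart_carrier[OF inf DD(2)]])
   have M: "lsub ?F (mlpart nu F)" by (rule lsub_mlpart[OF inf Fs])
   have "?bt (Proj nu) x = \<zero>[?F]" using x by blast
   then have y0: "of_nat (card (SG nu)) \<odot>[?F] ?y = \<zero>[?F]" using beta_mlvec[OF m] xm by simp
   have "?y = (inverse (of_nat (card (SG nu))) * of_nat (card (SG nu))) \<odot>[?F] ?y"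
    using G0[of nu] rvs_simps(3)[OF r yc] by simp
   also have "... = \<zero>[?F]" using rvs_simps(6)[OF r yc, symmetric] y0 rvs_simps(5)[OF r] by simp
   finally have y0: "?y = \<zero>[?F]" .
   have m0: "?m u = 0" if u: "u : cs (V nu)" for u
   proof -
    have "?m u = ?m (lcomb (space (V nu)) {..<n nu} (%k. p nu u (y nu k)) (v nu))" using DD(5)[OF u] by simp
    also have "... = (\<Sum>k<n nu. p nu u (y nu k) * ?m (v nu k))" by (rule dual_lcomb[OF rV m DD(3)])
    also have "... = (\<Sum>k<n nu. ?m (v nu k) * p nu u (y nu k))" by (simp only: mult.commute)
    also have "... = p nu u (lcomb (?F\<lparr>carrier := mlpart nu F\<rparr>) {..<n nu} (%k. ?m (v nu k)) (y nu))"
    by (rule dual_lcomb[OF rvs_lsub[OF r M] DD(4)[OF u], symmetric]) (use DD(2) in simp)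
    also have "... = p nu u ?y" by (simp only: lcomb_lsub[OF r M DD(2)[of _ nu]])
    also have "... = 0" using dual_zero[OF rvs_lsub[OF r M] DD(4)[OF u]] by (simp add: y0)
    finally show ?thesis .
   qed
   have "x = mlvec V nu (%_. 0)" using xm mlvec_cong[OF inf V m0] by simp
   also have "... = \<zero>[schur_space V (Proj nu)]"
    unfolding schur_space_simps mlvec_def by (intro ext) (simp add: lcomb_zero[OF Prvs[OF inf] uten_closed[OF inf]])
   finally show "x : ?Z (Proj nu)" by simp
  qed
 qed
 then show z: "xi : cF V W ==> ?bt W xi = \<zero>[omap F W] ==> xi = \<zero>[schur_space V W]" for xi by blast
 have surj: "carrier (omap F W) <= ?bt W ` cF V W"
 proof (rule subfunctor_le[OF inf Fl subfun_carrier[OF Fs] _ _ W])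
  show "subfun F (%W. ?bt W ` cF V W)"
   unfolding subfun_def
  proof (intro conjI ballI)
   fix U :: "'a smod" assume U: "U : Obj SVect"
   note b = et(2)[OF U]
   show "lsub (omap F U) (?bt U ` cF V U)"
    unfolding lsub_def
   proof (intro conjI ballI allI)
    show "?bt U ` cF V U <= carrier (omap F U)" using mhom_closed[OF b] by blast
    show "\<zero>[omap F U] : ?bt U ` cF V U"
    using mhom_zero[OF rS[OF U] rF[OF U] b, symmetric] rvs_closed(1)[OF rS[OF U]] by (rule image_eqI)
    fix x x' r assume "x : ?bt U ` cF V U"
    then obtain c where c: "x = ?bt U c" "c : cF V U" by blast
    show "r \<odot>[omap F U] x : ?bt U ` cF V U"
    unfolding c(1) using mhom_smult[OF b c(2), symmetric] rvs_closed(3)[OF rS[OF U] c(2)] by (rule image_eqI)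
    assume "x' : ?bt U ` cF V U"
    then obtain c' where c': "x' = ?bt U c'" "c' : cF V U" by blast
    show "x \<oplus>[omap F U] x' : ?bt U ` cF V U"
    unfolding c(1) c'(1) using mhom_add[OF b c(2) c'(2), symmetric] rvs_closed(2)[OF rS[OF U] c(2) c'(2)] by (rule image_eqI)
   qed
   fix U' :: "'a smod" and f x assume U': "U' : Obj SVect" and f: "f : shom U U'" and "x : ?bt U ` cF V U"
   then obtain c where c: "x = ?bt U c" "c : cF V U" by blast
   show "amap F U U' f x : ?bt U' ` cF V U'"
    unfolding c(1) using et(4)[OF U U' f c(2), symmetric] cS[OF U U' f c(2)] by (rule image_eqI)
  qed
  fix nu
  note P = Proj_Obj[OF inf, of nu]
  show "carrier (omap F (Proj nu)) \<inter> mlpart nu F <= ?bt (Proj nu) ` cF V (Proj nu)"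
  proof
   fix x assume "x : carrier (omap F (Proj nu)) \<inter> mlpart nu F"
   then have x: "x : mlpart nu F" by blast
   let ?c = "of_nat (card (SG nu)) :: rat" and ?F = "omap F (Proj nu)"
   let ?m = "%u. p nu u x"
   note m = DD(6)[OF x] and r = rF[OF P]
   have "?bt (Proj nu) (mlvec V nu ?m) = ?c \<odot>[?F] x" using beta_mlvec[OF m] DD(7)[OF x] by simp
   then have "?bt (Proj nu) (inverse ?c \<odot>[schur_space V (Proj nu)] mlvec V nu ?m) = inverse ?c \<odot>[?F] (?c \<odot>[?F] x)"
    by (simp only: mhom_smult[OF et(2)[OF P] mlvec_closed[OF inf V m]])
   also have "... = x" using rvs_simps(6)[OF r mlpart_carrier[OF inf x]] rvs_simps(3)[OF r mlpart_carrier[OF inf x]] G0[of nu] by simp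
   finally show "x : ?bt (Proj nu) ` cF V (Proj nu)"
    using rvs_closed(3)[OF rS[OF P] mlvec_closed[OF inf V m], of "inverse ?c"] by (intro image_eqI) simp_all
  qed
 qed
 note b = et(2)[OF W]
 have "inj_on (?bt W) (cF V W)"
 proof (rule inj_onI)
  fix x x' assume x: "x : cF V W" "x' : cF V W" "?bt W x = ?bt W x'"
  note mx = rvs_closed(3)[OF rS[OF W] x(2), of "-1"]
  have bx: "?bt W x' : carrier (omap F W)" by (rule mhom_closed[OF b x(2)])
  have "?bt W (x \<oplus>[schur_space V W] (-1) \<odot>[schur_space V W] x') = 1 \<odot>[omap F W] ?bt W x' \<oplus>[omap F W] (-1) \<odot>[omap F W] ?bt W x'"
   by (simp only: mhom_add[OF b x(1) mx] mhom_smult[OF b x(2)] x(3) rvs_simps(3)[OF rF[OF W] bx])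
  also have "... = \<zero>[omap F W]" using rvs_distrib(1)[OF rF[OF W] bx, of 1 "-1"] rvs_simps(4)[OF rF[OF W] bx] by simp
  finally have "x \<oplus>[schur_space V W] (-1) \<odot>[schur_space V W] x' = \<zero>[schur_space V W]"
   by (rule z[OF rvs_closed(2)[OF rS[OF W] x(1) mx]])
  then show "x = x'" by (rule eq_if_diff_zero[OF rS[OF W] x(1,2)])
 qed
 then show "bij_betw (?bt W) (cF V W) (carrier (omap F W))"
  unfolding bij_betw_def using surj mhom_closed[OF b] by blast
qed

end

text \<open>The values of \<open>F_functor V\<close> are finite-dimensional because
  \<open>beta\<close> embeds them into those of \<open>F\<close>. The last clause records where
  \<open>V\<close> vanishes; from it the finite support of \<open>V\<close> for bounded
  \<open>F\<close> will follow.\<close>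

lemma polynomial_functor_iso_F_functor:
 assumes inf: "infinite (UNIV :: 'a set)" and infv: "infinite (UNIV :: 'v set)"
  and F: "is_functor SVect Vect (F :: ('v, 'a) sfr)" and Fl: "lpf F"
 shows "EX V :: 'v s2mod. nrep V & (ALL W:Obj (SVect :: ('a smod, _) cat). fdvs (schur_space V W)) &
  (EX eta. is_iso (fun_cat SVect Vect) (F_functor V) F eta) &
  (ALL nu. mlpart nu F <= {\<zero>[omap F (Proj nu)]} --> cs (V nu) <= {\<zero>[space (V nu)]})"
proof -
 obtain D :: "nat multiset => (nat => wr, 'v) rep \<times> nat \<times> (nat => ('v, 'a) schur) \<times> (nat => 'v) \<times> ('v => ('v, 'a) schur => rat)"
  where D: "!!nu. ml_dual F nu (D nu)" using ml_dual_exists[OF inf infv F] by metis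
 define V where "V nu = fst (D nu)" for nu
 define n where "n nu = fst (snd (D nu))" for nu
 define y where "y nu = fst (snd (snd (D nu)))" for nu
 define v where "v nu = fst (snd (snd (snd (D nu))))" for nu
 define p where "p nu = snd (snd (snd (snd (D nu))))" for nu
 have D': "ml_dual F nu (V nu, n nu, y nu, v nu, p nu)" for nu using D[of nu] by (simp add: V_def n_def y_def v_def p_def)
 note d = DD[OF inf F Fl D'] and b = beta_bij[OF inf F Fl D']
 note V = d(1)
 show ?thesis
 proof (intro exI[of _ V] conjI allI impI ballI)
  show "is_rep (S_nu nu) (V nu)" for nu using V by blast
  have nt: "beta F V n y v : nat_trans SVect Vect (F_functor V) F" by (rule beta_nat_trans[OF inf F Fl D'])
  show "fdvs (schur_space V W)" if W: "W : Obj SVect" for W :: "'a smod"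
  proof (rule fdvs_injective)
   show "rvs (schur_space V W)" using svs_schur_space[OF V SVect_srep[OF W]] by blast
   show "fdvs (omap F W)" using is_functorD(1)[OF F W] by simp
   show "beta F V n y v W : mhom (schur_space V W) (omap F W)" using nat_transD(2)[OF nt W] by (simp only: F_functor_simps(1))
  qed (rule b(2)[OF W])
  show "EX eta. is_iso (fun_cat SVect Vect) (F_functor V) F eta"
  proof
   show "is_iso (fun_cat SVect Vect) (F_functor V) F (beta F V n y v)"
    by (rule nat_iso[OF lpf_sfun[OF lpf_F_functor[OF V]] lpf_sfun[OF Fl] nt]) (simp only: F_functor_simps(1) b(1))
  qed
  fix nu assume M: "mlpart nu F <= {\<zero>[omap F (Proj nu)]}"
  show "cs (V nu) <= {\<zero>[space (V nu)]}"
  proof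
   fix u assume u: "u : cs (V nu)"
   note rV = fdvs_rvs[OF is_repD(1)[OF V[rule_format, of nu]]]
   have r: "rvs (omap F (Proj nu))" by (rule sfunD(2)[OF lpf_sfun[OF Fl] Proj_Obj[OF inf]])
   have "p nu u (y nu k) = 0" if "k : {..<n nu}" for k
    using M d(2)[OF that] dual_zero[OF rvs_lsub[OF r lsub_mlpart[OF inf lpf_sfun[OF Fl]]] d(4)[OF u]] by auto
   then have "lcomb (space (V nu)) {..<n nu} (%k. p nu u (y nu k)) (v nu) = lcomb (space (V nu)) {..<n nu} (%k. 0) (v nu)"
    by (intro lcomb_cong[OF rV refl d(3)]) simp_all
   also have "... = \<zero>[space (V nu)]" by (rule lcomb_zero[OF rV d(3)])
   finally have "u = \<zero>[space (V nu)]" by (rule trans[OF d(5)[OF u]])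
   then show "u : {\<zero>[space (V nu)]}" by simp
  qed
 qed
qed

section \<open>Finiteness conditions\<close>

lemma fun_cat_simps [simp]:
 "Obj (fun_cat C D) = {F. is_functor C D F}" "Hom (fun_cat C D) = nat_trans C D"
 "Id (fun_cat C D) F = (\<lambda>X\<in>Obj C. Id D (omap F X))"
 "Comp (fun_cat C D) F G H eps eta = (\<lambda>X\<in>Obj C. Comp D (omap F X) (omap G X) (omap H X) (eps X) (eta X))"
 by (simp_all add: fun_cat_def)

lemma is_functor_Vect_F_functor:
 assumes V: "nrep V" and fd: "!!W. W : Obj (SVect :: ('a smod, _) cat) ==> fdvs (schur_space V W)"
 shows "is_functor SVect Vect (F_functor V :: ('v, 'a) sfr)"
proof -
 note f = is_functor_F_functor[where 'a = 'a, OF V, unfolded is_functor_def SVS_simps]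
 have "ALL W:Obj SVect. omap (F_functor V) W : {V :: ('v, 'a) schur qvs. fdvs V}"
  using fd by (intro ballI) (simp only: F_functor_simps(1) mem_Collect_eq)
 from conjI[OF this f[THEN conjunct2]] show ?thesis unfolding is_functor_def Vect_simps .
qed

lemma rep_hom_zero_space:
 assumes R: "is_rep G R" and R': "is_rep G R'" and z: "cs R <= {\<zero>[space R]}" and f: "f : rep_hom G R R'"
 shows "f = (\<lambda>v\<in>cs R. \<zero>[space R'])"
proof
 note V = fdvs_rvs[OF is_repD(1)[OF R]] and V' = fdvs_rvs[OF is_repD(1)[OF R']]
 fix v
 show "f v = (\<lambda>v\<in>cs R. \<zero>[space R']) v"
  using z mhom_zero[OF V V' rep_homD(2)[OF f]] rep_hom_undefined[OF f, of v] by (cases "v : cs R") auto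
qed

lemma fdvs_dsum_support:
 assumes V: "!!i. rvs (V i)" and fd: "fdvs (dsum V)"
 shows "EX N. finite N & (ALL x:carrier (dsum V). ALL i. i ~: N --> x i = \<zero>[V i])"
proof (rule fdvs_dsum_finite_support[OF V fd])
 fix N assume "finite N" and z: "!!i x. x : carrier (dsum V) ==> i ~: N ==> x i = \<zero>[V i]"
 then show ?thesis by (intro exI[of _ N] conjI ballI allI impI) 
qed

lemma S2Vect_finite_support:
 assumes "V : Obj (S2Vect :: ('v s2mod, _) cat)"
 shows "nrep V" "EX N. finite N & (ALL nu. nu ~: N --> cs (V nu) <= {\<zero>[space (V nu)]})"
proof -
 have V: "nrep V" and fd: "fdvs (dsum (%nu. space (V nu)))" using assms by simp_all
 obtain N where N: "finite N" and z: "!!nu. nu ~: N ==> cs (V nu) = {\<zero>[space (V nu)]}"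
  using fdvs_dsum_finite_support[of "%nu. space (V nu)", OF fdvs_rvs[OF is_repD(1)[OF V[rule_format]]] fd] by metis
 show "EX N. finite N & (ALL nu. nu ~: N --> cs (V nu) <= {\<zero>[space (V nu)]})"
  using N z by (intro exI[of _ N]) simp
 show "nrep V" by (rule V)
qed

text \<open>Where \<open>V nu\<close> is zero, only the zero map goes out of it, so the direct sum
  has finitely many nonzero members.\<close>

lemma S2Vect_fdvs_schur_space:
 assumes V: "V : Obj (S2Vect :: ('v s2mod, _) cat)" and W: "srep (W :: 'a smod)"
 shows "fdvs (schur_space V W)"
proof -
 obtain N where N: "finite N" and z: "!!nu. nu ~: N ==> cs (V nu) <= {\<zero>[space (V nu)]}"
  using S2Vect_finite_support(2)[OF V] by blast
 note V = S2Vect_finite_support(1)[OF V]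
 show ?thesis
  unfolding schur_space_def
 proof (rule fdvs_dsumI[OF fdvs_rep_hom_vs[OF V[rule_format] is_rep_tensor_power[OF W]] N])
  fix nu assume "nu ~: N"
  from rep_hom_zero_space[OF V[rule_format] is_rep_tensor_power[OF W] z[OF this]]
  show "carrier (rep_hom_vs (S_nu nu) (V nu) (tensor_power W nu)) <= {\<zero>[rep_hom_vs (S_nu nu) (V nu) (tensor_power W nu)]}"
   by auto
 qed
qed

text \<open>Finite dimension of \<open>schur_space V U\<close> forces its elements to be supported
  on one finite set of multisets, whose sizes bound the degree. This set may depend on
  \<open>U\<close>, so no uniform bound results.\<close>

lemma polynomial_functor_F_functor:
 assumes V: "nrep V" and fd: "!!W. W : Obj (SVect :: ('a smod, _) cat) ==> fdvs (schur_space V W)"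
 shows "polynomial_functor (F_functor V :: ('v, 'a) sfr)"
 unfolding polynomial_functor_def polynomial_map_def
proof (intro ballI)
 fix U U' :: "'a smod" assume Uo: "U : Obj SVect" "U' : Obj SVect"
 note U = SVect_srep[OF Uo(1)] and U' = SVect_srep[OF Uo(2)]
 have comp: "rvs (rep_hom_vs (S_nu nu) (V nu) (tensor_power U nu))" for nu using svs_schur_component[OF V U] by blast
 obtain N where N: "finite N" and z: "ALL x:cF V U. ALL nu. nu ~: N --> x nu = \<zero>[rep_hom_vs (S_nu nu) (V nu) (tensor_power U nu)]"
  using fdvs_dsum_support[of "%nu. rep_hom_vs (S_nu nu) (V nu) (tensor_power U nu)", OF comp fd[OF Uo(1), unfolded schur_space_def]]
  unfolding schur_space_def by (elim exE conjE)
 have sz: "size nu \<le> (SUM nu:N. size nu)" if "x : cF V U" "x nu ~= (\<lambda>v\<in>cs (V nu). \<zero>[tpow nu U])" for x nu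
  using bspec[OF z that(1), THEN spec, of nu] that(2) N by (intro member_le_sum) auto
 show "EX d. polynomial_map_le d (shv U U') (hom_vs (omap (F_functor V) U) (omap (F_functor V) U')) (amap (F_functor V) U U')"
  by (rule exI, rule polynomial_map_le_F_functor[where d = "SUM nu:N. size nu", OF V U U' _ Uo], rule sz)
qed

lemma bounded_F_functor:
 assumes Vo: "V : Obj (S2Vect :: ('v s2mod, _) cat)"
 shows "bounded_polynomial_functor (F_functor V :: ('v, 'a) sfr)"
proof -
 obtain N where N: "finite N" and z: "!!nu. nu ~: N ==> cs (V nu) <= {\<zero>[space (V nu)]}"
  using S2Vect_finite_support(2)[OF Vo] by blast
 note V = S2Vect_finite_support(1)[OF Vo]
 \<comment> \<open>The sizes bound the degrees, and the sums of parts bound every single part; one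
   number thus serves both conditions of boundedness.\<close>
 define d where "d = (SUM nu:N. size nu + sum_mset nu)"
 have d: "size nu + sum_mset nu \<le> d" if "nu : N" for nu unfolding d_def using that N by (intro member_le_sum) auto
 have x0: "x nu = (\<lambda>v\<in>cs (V nu). \<zero>[tpow nu U])" if U: "srep U" and "x : cF V U" "nu ~: N" for x nu and U :: "'a smod"
  using rep_hom_zero_space[OF V[rule_format] is_rep_tensor_power[OF U] z[OF that(3)] schur_mem(1)[OF that(2)]] by simp
 show ?thesis
  unfolding bounded_polynomial_functor_def
 proof (intro exI[of _ d] ballI conjI impI)
  fix U U' :: "'a smod" assume Uo: "U : Obj SVect" "U' : Obj SVect"
  note U = SVect_srep[OF Uo(1)] and U' = SVect_srep[OF Uo(2)]
  have sz: "size nu \<le> d" if x: "x : cF V U" and nz: "x nu ~= (\<lambda>v\<in>cs (V nu). \<zero>[tpow nu U])" for x nu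
  proof -
   have "nu : N" using x0[OF U x] nz by blast
   then show ?thesis using d[of nu] by simp
  qed
  show "polynomial_map_le d (shv U U') (hom_vs (omap (F_functor V) U) (omap (F_functor V) U')) (amap (F_functor V) U U')"
   by (rule polynomial_map_le_F_functor[OF V U U' _ Uo], rule sz)
  fix f g assume "f : Hom SVect U U'" "g : Hom SVect U U'" and fg: "ALL n<=d. f n = g n"
  then have f: "f : shom U U'" and g: "g : shom U U'" by simp_all
  have tp: "tensor_power_map U U' f nu = tensor_power_map U U' g nu" if nu: "nu : N" for nu
  proof -
   have "f i = g i" if "(i, j) : slots nu" for i j
   proof -
    have "i \<in># nu" using that by (auto simp: slots_eq)
    then have "i \<le> sum_mset nu" by (auto dest!: multi_member_split)
    then show ?thesis using fg d[OF nu] by simp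
   qed
   then have "(%w :: nat \<times> nat => 'a. \<lambda>(i, j)\<in>slots nu. f i (w (i, j))) = (%w. \<lambda>(i, j)\<in>slots nu. g i (w (i, j)))"
    by (intro ext) (auto simp: restrict_def)
   then show ?thesis by (simp add: tensor_power_map_def)
  qed
  show "amap (F_functor V) U U' f = amap (F_functor V) U U' g"
  proof
   fix x
   show "amap (F_functor V) U U' f x = amap (F_functor V) U U' g x"
   proof (cases "x : cF V U")
    case True
    show ?thesis
    proof
    fix nu
    show "amap (F_functor V) U U' f x nu = amap (F_functor V) U U' g x nu"
    proof (cases "nu : N")
    case nu: True
    show ?thesis using True by (simp add: F_functor_simps(2) tp[OF nu])
    next
    case False
    show ?thesis using F_functor_closed(2)[OF V U U' f True x0[OF U True False]] F_functor_closed(2)[OF V U U' g True x0[OF U True False]] by simp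
    qed
    qed
   qed (simp add: F_functor_simps(2))
  qed
 qed
qed

lemma bounded_imp_polynomial: "bounded_polynomial_functor F ==> polynomial_functor F"
 unfolding bounded_polynomial_functor_def polynomial_functor_def polynomial_map_def by blast

context
 assumes inf: "infinite (UNIV :: 'a set)"
begin

section \<open>Multilinear parts of bounded functors\<close>

lemma diag_const:
 "diag nu (%_. c) = lcomb (shv (Proj nu :: 'a smod) (Proj nu)) {..<1::nat} (%_. c) (%_. idm (Proj nu))"
proof (rule shom_eqI[OF diag_hom[OF inf]])
 note P = Psrep[OF inf, of nu]
 have I: "idm (Proj nu) : shom (Proj nu :: 'a smod) (Proj nu)" using P by (auto intro: rep_hom_id)
 show "lcomb (shv (Proj nu) (Proj nu)) {..<1::nat} (%_. c) (%_. idm (Proj nu)) : shom (Proj nu :: 'a smod) (Proj nu)"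
  by (rule shom_lcomb_closed[OF P P I])
 fix i z assume z: "z : cs (Proj nu i :: (perm, 'a) rep)"
 note V = Proj_rvs[OF inf, of nu i]
 have cl: "act (Proj nu i) (fst x) (gen nu (i, snd x)) : cs (Proj nu i :: (perm, 'a) rep)" if "x : idx nu i" for x
  using act_gen_closed[OF inf, of "fst x" "snd x"] that by simp
 have "diag nu (%_. c) i z = lcomb (space (Proj nu i)) (idx nu i) (%x. c * gcoord nu i x z) (%x. act (Proj nu i) (fst x) (gen nu (i, snd x)))"
  using diag_expand[OF inf z, of "%_. c"] by (simp only: mult.commute)
 also have "... = c \<odot>[space (Proj nu i)] lcomb (space (Proj nu i)) (idx nu i) (%x. gcoord nu i x z) (%x. act (Proj nu i) (fst x) (gen nu (i, snd x)))"
  by (rule lcomb_smult[OF V cl])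
 also have "lcomb (space (Proj nu i)) (idx nu i) (%x. gcoord nu i x z) (%x. act (Proj nu i) (fst x) (gen nu (i, snd x))) = z"
  using gcoord_expand[OF inf z] by (simp add: case_prod_unfold)
 also have "c \<odot>[space (Proj nu i)] z = lcomb (space (Proj nu i)) {..<1::nat} (%_. c) (%_. idm (Proj nu) i z)"
  using lcomb_insert[where V = "space (Proj nu i)" and A = "{}" and a = "0::nat" and c = "%_. c" and x = "%_. z", OF V] z V
  by (simp add: lessThan_Suc rvs_simps[OF V])
 also have "... = lcomb (shv (Proj nu) (Proj nu)) {..<1::nat} (%_. c) (%_. idm (Proj nu)) i z"
  by (rule shom_lcomb_eval[OF P P I z, symmetric])
 finally show "diag nu (%_. c) i z = lcomb (shv (Proj nu) (Proj nu)) {..<1::nat} (%_. c) (%_. idm (Proj nu)) i z" .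
qed

lemma diag_cong: "(!!j. t (i, j) = t' (i, j)) ==> diag nu t i = (diag nu t' i :: 'a => 'a)"
proof -
 assume "!!j. t (i, j) = t' (i, j)"
 then have s: "scale_tuple nu (Proj nu) t (gtup nu) (i, j) = (scale_tuple nu (Proj nu) t' (gtup nu) (i, j) :: 'a)" for j
  by (simp add: scale_tuple_def)
 show "diag nu t i = (diag nu t' i :: 'a => 'a)" unfolding diag_def ev_def s ..
qed

text \<open>If \<open>size nu\<close> exceeds \<open>d\<close>, scaling by \<open>s\<close>
  multiplies \<open>y\<close> by \<open>s ^ size nu\<close> although it is polynomial of degree at
  most \<open>d\<close> in \<open>s\<close>. If a part \<open>i\<close> of \<open>nu\<close> exceeds
  \<open>d\<close>, killing the generators of degree \<open>i\<close> cannot be noticed by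
  \<open>F\<close>, although it multiplies \<open>y\<close> by 0.\<close>

lemma bounded_mlpart:
 assumes F: "is_functor SVect Vect (F :: ('a, 'b) svect_functor)"
  and pm: "!!U. U : Obj SVect ==> polynomial_map_le d (shv U U) (hom_vs (omap F U) (omap F U)) (amap F U U)"
  and loc: "!!U f g. U : Obj SVect ==> f : shom U U ==> g : shom U U ==> (ALL n<=d. f n = g n) ==> amap F U U f = amap F U U g"
  and y: "y : mlpart nu F" and big: "d < size nu \<or> (\<exists>i\<in>#nu. d < i)"
 shows "y = \<zero>[omap F (Proj nu)]"
proof -
 note P = Proj_Obj[OF inf, of nu] and Fs = is_functor_SVSI[OF F] and D = diag_hom[OF inf, of nu]
 let ?V = "omap F (Proj nu)"
 note r = sfunD(2)[OF Fs P] and yc = mlpart_carrier[OF inf y]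
 have wt: "amap F (Proj nu) (Proj nu) (diag nu t) y = (PROD s:slots nu. t s) \<odot>[?V] y" for t using y by (simp add: mlpart_def)
 show ?thesis
 proof (cases "d < size nu")
  case True
  let ?B = "hom_vs ?V ?V"
  have rB: "rvs ?B" by (rule rvs_hom_vs[OF r r])
  have I: "(%_. idm (Proj nu)) : {..<1::nat} \<rightarrow> shom (Proj nu :: 'a smod) (Proj nu)" using Psrep[OF inf] by (auto intro: rep_hom_id)
  obtain c where c: "c : exponents 1 d \<rightarrow> lin ?V ?V"
   and eq: "ALL t :: nat => rat. amap F (Proj nu) (Proj nu) (lcomb (shv (Proj nu) (Proj nu)) {..<1} t (%_. idm (Proj nu)))
    = lcomb ?B (exponents 1 d) (%e. \<Prod>i<1. t i ^ e i) c"
   using pm[OF P, unfolded polynomial_map_le_def carrier_graded_hom_vs hom_vs_simps(1), folded lcomb_def, THEN conjunct2] I by blast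
  have "ALL l:dual ?V. l y = 0"
  proof
   fix l assume l: "l : dual ?V"
   let ?n = "size nu"
   have q: "s ^ ?n * l y = (SUM e:exponents 1 d. s ^ e 0 * l (c e y))" for s
   proof -
    have "s ^ ?n * l y = l (amap F (Proj nu) (Proj nu) (diag nu (%_. s)) y)" by (simp add: wt dual_smult[OF l yc] card_slots)
    also have "... = l (lcomb ?B (exponents 1 d) (%e. \<Prod>i<1. s ^ e i) c y)"
    unfolding diag_const using eq[rule_format, of "%_. s"] by simp
    also have "... = (SUM e:exponents 1 d. (\<Prod>i<1. s ^ e i) * l (c e y))"
    by (rule dual_lcomb[OF rB dual_eval[OF l yc]]) (use c in auto)
    finally show ?thesis by simp
   qed
   \<comment> \<open>The weights extract the coefficient at exponent \<open>size nu\<close>, which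
     lies beyond the degree of the polynomial in \<open>q\<close>.\<close>
   have "l y = (\<Sum>k\<le>?n. weight ?n ?n k * of_nat k ^ ?n) * l y" by (subst weight_sum) simp_all
   also have "... = (\<Sum>k\<le>?n. SUM e:exponents 1 d. l (c e y) * (weight ?n ?n k * of_nat k ^ e 0))"
    by (simp only: sum_distrib_right mult.assoc q sum_distrib_left) (simp only: mult_ac)
   also have "... = (SUM e:exponents 1 d. l (c e y) * (\<Sum>k\<le>?n. weight ?n ?n k * of_nat k ^ e 0))"
    unfolding sum_distrib_left by (rule sum.swap)
   also have "... = 0"
   proof (rule sum.neutral, rule ballI)
    fix e assume "e : exponents 1 d"
    then have "e 0 \<le> d" by (rule exponents_le) simp
    then show "l (c e y) * (\<Sum>k\<le>?n. weight ?n ?n k * of_nat k ^ e 0) = 0" using True by (subst weight_sum) auto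
   qed
   finally show "l y = 0" .
  qed
  then show ?thesis using sfunD(1)[OF Fs P] yc by (simp add: separated_def)
 next
  case False
  then obtain i where i: "i \<in># nu" "d < i" using big by blast
  \<comment> \<open>Zero exactly on the slots in degree \<open>i\<close>, of which there is at least
    one since \<open>i\<close> occurs in \<open>nu\<close>.\<close>
  let ?t = "%s :: nat \<times> nat. if fst s = i then 0 else 1 :: rat"
  have "ALL n<=d. diag nu ?t n = (diag nu (%_. 1) n :: 'a => 'a)" using i(2) by (intro allI impI diag_cong) auto
  then have "amap F (Proj nu) (Proj nu) (diag nu ?t) y = amap F (Proj nu) (Proj nu) (diag nu (%_. 1)) y"
   using loc[OF P D D] by metis
  also have "... = y" unfolding diag_one[OF inf] by (rule sfunD(6)[OF Fs P yc])
  finally have "y = (PROD s:slots nu. ?t s) \<odot>[?V] y" by (simp only: wt)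
  moreover have "(i, 1) : slots nu" using i(1) by (simp add: slots_iff Suc_le_eq count_greater_zero_iff)
  then have "(PROD s:slots nu. ?t s) = 0" using finite_slots[of nu] by (intro prod_zero) force+
  ultimately show ?thesis using rvs_simps(4)[OF r yc] by simp
 qed
qed

end

lemma finite_bounded_multisets: "finite {nu :: nat multiset. size nu \<le> d & (\<forall>i\<in>#nu. i \<le> d)}"
proof (rule finite_subset)
 show "{nu :: nat multiset. size nu \<le> d & (\<forall>i\<in>#nu. i \<le> d)} <= mset ` {xs. set xs <= {..d} & length xs \<le> d}"
 proof
  fix nu :: "nat multiset" assume nu: "nu : {nu. size nu \<le> d & (\<forall>i\<in>#nu. i \<le> d)}"
  obtain xs where "mset xs = nu" using ex_mset by blast
  then show "nu : mset ` {xs. set xs <= {..d} & length xs \<le> d}" using nu by (intro image_eqI[of _ _ xs]) auto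
 qed
 show "finite (mset ` {xs. set xs <= {..d} & length xs \<le> d})" by (intro finite_imageI finite_lists_length_le) simp
qed

text \<open>Multilinear parts vanish outside the finitely many multisets of bounded size with
  bounded parts, and the members of \<open>V\<close> vanish with them; so \<open>V\<close> has
  finite total dimension.\<close>

lemma bounded_functor_iso_F_functor:
 assumes inf: "infinite (UNIV :: 'a set)" and infv: "infinite (UNIV :: 'v set)"
  and F: "is_functor SVect Vect (F :: ('v, 'a) sfr)" and bd: "bounded_polynomial_functor F"
 shows "EX V: Obj (S2Vect :: ('v s2mod, _) cat). EX eta. is_iso (fun_cat SVect Vect) (F_functor V) F eta"
proof -
 have Fl: "lpf F" by (rule lpf_of_polynomial[OF F bounded_imp_polynomial[OF bd]])
 obtain V :: "'v s2mod" and eta where V: "nrep V" and iso: "is_iso (fun_cat SVect Vect) (F_functor V) F eta"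
  and z: "!!nu. mlpart nu F <= {\<zero>[omap F (Proj nu)]} ==> cs (V nu) <= {\<zero>[space (V nu)]}"
  using polynomial_functor_iso_F_functor[OF inf infv F Fl] by blast
 obtain d where d: "ALL U:Obj SVect. ALL U':Obj SVect. polynomial_map_le d (shv U U') (hom_vs (omap F U) (omap F U')) (amap F U U') &
  (ALL f:Hom SVect U U'. ALL g:Hom SVect U U'. (ALL n<=d. f n = g n) --> amap F U U' f = amap F U U' g)"
  using bd unfolding bounded_polynomial_functor_def by blast
 have "cs (V nu) <= {\<zero>[space (V nu)]}" if "nu ~: {nu. size nu \<le> d & (\<forall>i\<in>#nu. i \<le> d)}" for nu
 proof (rule z, rule subsetI)
  fix y assume y: "y : mlpart nu F"
  have "y = \<zero>[omap F (Proj nu)]"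
  proof (rule bounded_mlpart[OF inf F _ _ y])
   fix U :: "'a smod" assume U: "U : Obj SVect"
   show "polynomial_map_le d (shv U U) (hom_vs (omap F U) (omap F U)) (amap F U U)" using d U by blast
   fix f g assume "f : shom U U" "g : shom U U"
   then have "f : Hom SVect U U" "g : Hom SVect U U" by simp_all
   moreover assume "ALL n<=d. f n = g n"
   ultimately show "amap F U U f = amap F U U g" using d U by blast
  next
   show "d < size nu \<or> (\<exists>i\<in>#nu. d < i)" using that by (auto simp: not_le)
  qed
  then show "y : {\<zero>[omap F (Proj nu)]}" by simp
 qed
 then have "fdvs (dsum (%nu. space (V nu)))"
  by (rule fdvs_dsumI[OF is_repD(1)[OF V[rule_format]] finite_bounded_multisets[of d]])
 then have "V : Obj S2Vect" using V by simp
 then show ?thesis using iso by blast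
qed

section \<open>Adjoints\<close>

text \<open>Of positive definiteness the consequence recorded is
  \<open>b x x = 0 --> x = \<zero>\<close>: it makes representing vectors unique and gives the Riesz
  representation.\<close>

definition inv_form :: "('g, 'm) monoid_scheme => ('g, 'a) rep => ('a => 'a => rat) => bool" where
 "inv_form G R b \<longleftrightarrow> (ALL x:cs R. b x : dual (space R)) &
  (ALL x:cs R. ALL y:cs R. b x y = b y x) &
  (ALL x:cs R. b x x = 0 --> x = \<zero>[space R]) &
  (ALL g:carrier G. ALL x:cs R. ALL y:cs R. b (act R g x) (act R g y) = b x y)"

definition form :: "('g, 'm) monoid_scheme => ('g, 'a) rep => 'a => 'a => rat" where
 "form G R = (SOME b. inv_form G R b)"

definition adjoint :: "'g monoid => ('g, 'a) rep => ('g, 'b) rep => ('a => 'b) => 'b => 'a" where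
 "adjoint G R R' f = (\<lambda>y\<in>cs R'. SOME z. z : cs R & (ALL x:cs R. form G R z x = form G R' y (f x)))"

text \<open>Sums of squares of the frame functionals, summed over the group for invariance. Squares
  of rationals are nonnegative, so if the sum vanishes at \<open>x\<close>, every functional
  does.\<close>

lemma inv_form_exists:
 assumes R: "is_rep G R" and G: "group G" and fin: "finite (carrier G)"
 shows "EX b. inv_form G R b"
proof -
 interpret G: group G by (rule G)
 note Vf = is_repD(1)[OF R] and V = fdvs_rvs[OF is_repD(1)[OF R]]
 obtain n a l where fr: "frame (space R) n a l" using fdvs_frame[OF Vf] by blast
 have al: "a k : cs R" "l k : dual (space R)" if "k : {..<n}" for k using fr that by (auto simp: frame_def)
 define b where "b x y = (SUM g:carrier G. \<Sum>k<n. l k (act R g x) * l k (act R g y))" for x y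
 have "inv_form G R b"
  unfolding inv_form_def
 proof (intro conjI ballI impI)
  fix x assume x: "x : cs R"
  show "b x : dual (space R)"
   unfolding b_def
  proof (rule dualI)
   fix y z r assume y: "y : cs R"
   show "(SUM g:carrier G. \<Sum>k<n. l k (act R g x) * l k (act R g (r \<odot>[space R] y))) = r * (SUM g:carrier G. \<Sum>k<n. l k (act R g x) * l k (act R g y))"
    unfolding sum_distrib_left
    by (intro sum.cong refl) (simp add: mhom_smult[OF is_repD(2)[OF R] y] dual_smult[OF al(2) is_repD(5)[OF R _ y]])
   assume z: "z : cs R"
   show "(SUM g:carrier G. \<Sum>k<n. l k (act R g x) * l k (act R g (y \<oplus>[space R] z)))
    = (SUM g:carrier G. \<Sum>k<n. l k (act R g x) * l k (act R g y)) + (SUM g:carrier G. \<Sum>k<n. l k (act R g x) * l k (act R g z))"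
    unfolding sum.distrib[symmetric]
    by (intro sum.cong refl)
    (simp add: mhom_add[OF is_repD(2)[OF R] y z] dual_add[OF al(2) is_repD(5)[OF R _ y] is_repD(5)[OF R _ z]] distrib_left)
  qed
  show "b x y = b y x" for y unfolding b_def by (simp only: mult.commute)
  assume "b x x = 0"
  then have "(\<Sum>k<n. l k (act R \<one>[G] x) * l k (act R \<one>[G] x)) = 0"
   unfolding b_def using fin by (subst (asm) sum_nonneg_eq_0_iff) (auto intro: sum_nonneg)
  then have "ALL k:{..<n}. l k x = 0" by (simp add: sum_nonneg_eq_0_iff is_repD(3)[OF R x])
  then have "lcomb (space R) {..<n} (%k. l k x) a = lcomb (space R) {..<n} (%k. 0) a" by (intro lcomb_cong[OF V refl al(1)]) simp_all
  also have "... = \<zero>[space R]" by (rule lcomb_zero[OF V al(1)])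
  finally show "x = \<zero>[space R]" using fr x by (simp add: frame_def)
 next
  fix g x y assume g: "g : carrier G" and x: "x : cs R" and y: "y : cs R"
  have "b (act R g x) (act R g y) = (SUM h:carrier G. \<Sum>k<n. l k (act R (h \<otimes>[G] g) x) * l k (act R (h \<otimes>[G] g) y))"
   unfolding b_def by (intro sum.cong refl) (simp add: is_repD(4)[OF R _ g x] is_repD(4)[OF R _ g y])
  also have "... = b x y"
   unfolding b_def
   by (rule sum.reindex_bij_betw[OF bij_betw_byWitness[where f' = "%h. h \<otimes>[G] inv[G] g"], where g = "%h. \<Sum>k<n. l k (act R h x) * l k (act R h y)"])
    (use g in "auto simp: G.m_assoc")
  finally show "b (act R g x) (act R g y) = b x y" .
 qed
 then show ?thesis by blast
qed

lemma form_props: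
 assumes "is_rep G R" "group G" "finite (carrier G)"
 shows "x : cs R ==> form G R x : dual (space R)"
  and "x : cs R ==> y : cs R ==> form G R x y = form G R y x"
  and "x : cs R ==> form G R x x = 0 ==> x = \<zero>[space R]"
  and "g : carrier G ==> x : cs R ==> y : cs R ==> form G R (act R g x) (act R g y) = form G R x y"
proof -
 have "inv_form G R (form G R)" unfolding form_def by (rule someI_ex[OF inv_form_exists[OF assms]])
 note f = this[unfolded inv_form_def]
 show "x : cs R ==> form G R x : dual (space R)"
  and "x : cs R ==> y : cs R ==> form G R x y = form G R y x"
  and "x : cs R ==> form G R x x = 0 ==> x = \<zero>[space R]"
  and "g : carrier G ==> x : cs R ==> y : cs R ==> form G R (act R g x) (act R g y) = form G R x y"
  using f by blast+
qed

lemma form_eqI: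
 assumes R: "is_rep G R" "group G" "finite (carrier G)" and x: "x : cs R" and y: "y : cs R"
  and eq: "!!z. z : cs R ==> form G R x z = form G R y z"
 shows "x = y"
proof -
 note V = fdvs_rvs[OF is_repD(1)[OF R(1)]] and f = form_props[OF R]
 let ?d = "x \<oplus>[space R] (-1) \<odot>[space R] y"
 have my: "(-1) \<odot>[space R] y : cs R" and d: "?d : cs R" using V x y by auto
 have "form G R ?d ?d = form G R x ?d - form G R y ?d"
  by (simp add: dual_add[OF f(1)[OF d] x my] dual_smult[OF f(1)[OF d] y] f(2)[OF d x] f(2)[OF d y])
 then have "?d = \<zero>[space R]" using eq[OF d] by (intro f(3)[OF d]) simp
 then show ?thesis by (rule eq_if_diff_zero[OF V x y])
qed

text \<open>The representable functionals \<open>L\<close> are closed under combinations and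
  separate points, because \<open>form G R x x\<close> expands in the values of the form at
  \<open>a k\<close> and \<open>x\<close>. A frame with functionals in \<open>L\<close> then
  represents any \<open>m\<close>.\<close>

lemma form_riesz:
 assumes R: "is_rep G R" "group G" "finite (carrier G)" and m: "m : dual (space R)"
 shows "EX z:cs R. ALL x:cs R. form G R z x = m x"
proof -
 note Vf = is_repD(1)[OF R(1)] and V = fdvs_rvs[OF is_repD(1)[OF R(1)]] and f = form_props[OF R]
 let ?b = "form G R" and ?C = "cs R"
 define L where "L = {l : dual (space R). EX z:?C. ALL x:?C. l x = ?b z x}"
 obtain n a l where fr: "frame (space R) n a l" using fdvs_frame[OF Vf] by blast
 have ak: "a k : ?C" if "k : {..<n}" for k using fr that by (auto simp: frame_def)
 obtain n' a' l' where fr': "frame (space R) n' a' l'" and l': "l' : {..<n'} \<rightarrow> L"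
 proof (rule frame_exists_in[OF V, of L "(%k. ?b (a k)) ` {..<n}"])
  show "L <= dual (space R)" by (auto simp: L_def)
  show "(%x. l x + c * m x) : L" if l: "l : L" and m: "m : L" for l m c
  proof -
   obtain z w where zw: "z : ?C" "w : ?C" "ALL x:?C. l x = ?b z x" "ALL x:?C. m x = ?b w x" and lm: "l : dual (space R)" "m : dual (space R)"
    using l m unfolding L_def by blast
   have cw: "c \<odot>[space R] w : ?C" and s: "z \<oplus>[space R] c \<odot>[space R] w : ?C" using V zw by auto
   have "l x + c * m x = ?b (z \<oplus>[space R] c \<odot>[space R] w) x" if x: "x : ?C" for x
    using zw x by (simp add: f(2)[OF s x] dual_add[OF f(1)[OF x] zw(1) cw] dual_smult[OF f(1)[OF x] zw(2)] f(2)[OF x zw(1)] f(2)[OF x zw(2)])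
   moreover have "(%x. l x + c * m x) : dual (space R)" by (rule dualI) (simp_all add: dual_add[OF lm(1)] dual_add[OF lm(2)] dual_smult[OF lm(1)] dual_smult[OF lm(2)] algebra_simps)
   ultimately show ?thesis using s unfolding L_def by blast
  qed
  show "finite ((%k. ?b (a k)) ` {..<n})" by simp
  show "(%k. ?b (a k)) ` {..<n} <= L" using ak f(1) unfolding L_def by blast
  fix x assume x: "x : ?C" and z: "!!l. l : (%k. ?b (a k)) ` {..<n} ==> l x = 0"
  have "?b x x = (\<Sum>k<n. l k x * ?b x (a k))" by (rule frame_dual[OF V fr f(1)[OF x] x])
  also have "... = 0" using z by (intro sum.neutral ballI) (simp add: f(2)[OF x ak])
  finally show "x = \<zero>[space R]" by (rule f(3)[OF x])
 qed
 have "ALL k:{..<n'}. EX z:?C. ALL x:?C. l' k x = ?b z x" using l' unfolding L_def by blast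
 then obtain w where w: "!!k. k : {..<n'} ==> w k : ?C" "!!k x. k : {..<n'} ==> x : ?C ==> l' k x = ?b (w k) x" by metis
 let ?z = "lcomb (space R) {..<n'} (%k. m (a' k)) w"
 have z: "?z : ?C" by (rule lcomb_closed[OF V w(1)])
 have "?b ?z x = m x" if x: "x : ?C" for x
 proof -
  have "?b ?z x = (\<Sum>k<n'. m (a' k) * ?b x (w k))" unfolding f(2)[OF z x] by (rule dual_lcomb[OF V f(1)[OF x] w(1)])
  also have "... = (\<Sum>k<n'. l' k x * m (a' k))" by (rule sum.cong[OF refl]) (simp add: w(2)[OF _ x] f(2)[OF x w(1)])
  also have "... = m x" by (rule frame_dual[OF V fr' m x, symmetric])
  finally show ?thesis .
 qed
 then show ?thesis using z by blast
qed

section \<open>Adjoints of equivariant maps\<close>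

context
 fixes G :: "'g monoid"
 assumes G: "group G" "finite (carrier G)"
begin

lemma adjoint_eval:
 assumes R: "is_rep G R" and R': "is_rep G R'" and f: "f : rep_hom G R R'" and y: "y : cs R'"
 shows "adjoint G R R' f y : cs R"
  and "x : cs R ==> form G R (adjoint G R R' f y) x = form G R' y (f x)"
proof -
 have "EX z. z : cs R & (ALL x:cs R. form G R z x = form G R' y (f x))"
  using form_riesz[OF R G dual_mhom[OF rep_homD(2)[OF f] form_props(1)[OF R' G y]]] by blast
 from someI_ex[OF this] show "adjoint G R R' f y : cs R"
  "x : cs R ==> form G R (adjoint G R R' f y) x = form G R' y (f x)"
  using y by (simp_all add: adjoint_def)
qed

lemma adjoint_unique:
 assumes R: "is_rep G R" and R': "is_rep G R'" and f: "f : rep_hom G R R'" and y: "y : cs R'"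
  and z: "z : cs R" "!!x. x : cs R ==> form G R z x = form G R' y (f x)"
 shows "adjoint G R R' f y = z"
 by (rule form_eqI[OF R G adjoint_eval(1)[OF R R' f y] z(1)]) (simp only: adjoint_eval(2)[OF R R' f y] z(2))

lemma adjoint_hom:
 assumes R: "is_rep G R" and R': "is_rep G R'" and f: "f : rep_hom G R R'"
 shows "adjoint G R R' f : rep_hom G R' R"
proof (rule rep_homI)
 interpret G: group G by (rule G)
 note V = fdvs_rvs[OF is_repD(1)[OF R]] and V' = fdvs_rvs[OF is_repD(1)[OF R']]
 note F = form_props[OF R G] and F' = form_props[OF R' G] and ad = adjoint_eval[OF R R' f] and fc = rep_homD(4)[OF f]
 let ?a = "adjoint G R R' f"
 have "?a : mhom (space R') (space R)"
 proof (rule mhomI[OF ad(1)])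
  fix x y r assume x: "x : cs R'"
  note ax = ad(1)[OF x]
  have rx: "r \<odot>[space R'] x : cs R'" "r \<odot>[space R] ?a x : cs R" using V V' x ax by auto
  show "?a (r \<odot>[space R'] x) = r \<odot>[space R] ?a x"
  proof (rule adjoint_unique[OF R R' f rx])
   fix u assume u: "u : cs R"
   show "form G R (r \<odot>[space R] ?a x) u = form G R' (r \<odot>[space R'] x) (f u)"
    using F(2)[OF rx(2) u] dual_smult[OF F(1)[OF u] ax] F(2)[OF u ax] ad(2)[OF x u]
    F'(2)[OF rx(1) fc[OF u]] dual_smult[OF F'(1)[OF fc[OF u]] x] F'(2)[OF fc[OF u] x] by simp
  qed
  assume y: "y : cs R'"
  note ay = ad(1)[OF y]
  have xy: "x \<oplus>[space R'] y : cs R'" "?a x \<oplus>[space R] ?a y : cs R" using V V' x y ax ay by auto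
  show "?a (x \<oplus>[space R'] y) = ?a x \<oplus>[space R] ?a y"
  proof (rule adjoint_unique[OF R R' f xy])
   fix u assume u: "u : cs R"
   show "form G R (?a x \<oplus>[space R] ?a y) u = form G R' (x \<oplus>[space R'] y) (f u)"
    using F(2)[OF xy(2) u] dual_add[OF F(1)[OF u] ax ay] F(2)[OF u ax] F(2)[OF u ay] ad(2)[OF x u] ad(2)[OF y u]
    F'(2)[OF xy(1) fc[OF u]] dual_add[OF F'(1)[OF fc[OF u]] x y] F'(2)[OF fc[OF u] x] F'(2)[OF fc[OF u] y] by simp
  qed
 qed
 then show "?a : lin (space R') (space R)" unfolding lin_def by (simp add: adjoint_def)
 fix g y assume g: "g : carrier G" and y: "y : cs R'"
 note ay = ad(1)[OF y]
 show "?a (act R' g y) = act R g (?a y)"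
 proof (rule adjoint_unique[OF R R' f is_repD(5)[OF R' g y] is_repD(5)[OF R g ay]])
  fix u assume u: "u : cs R"
  \<comment> \<open>Writing \<open>u\<close> as \<open>g\<close> applied to \<open>?u\<close> makes
    the invariance of both forms applicable.\<close>
  let ?u = "act R (inv[G] g) u"
  have gi: "inv[G] g : carrier G" using g by simp
  have uc: "?u : cs R" by (rule is_repD(5)[OF R gi u])
  have gu: "act R g ?u = u" using is_repD(4)[OF R g gi u] is_repD(3)[OF R u] g by simp
  have "form G R (act R g (?a y)) (act R g ?u) = form G R' (act R' g y) (f (act R g ?u))"
   by (simp only: F(4)[OF g ay uc] ad(2)[OF y uc] rep_homD(3)[OF f g uc] F'(4)[OF g y fc[OF uc]])
  then show "form G R (act R g (?a y)) u = form G R' (act R' g y) (f u)" by (simp only: gu)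
 qed
qed

text \<open>By symmetry of the forms, the equation that defines the adjoint is symmetric in
  \<open>f\<close> and its adjoint.\<close>

lemma adjoint_adjoint:
 assumes R: "is_rep G R" and R': "is_rep G R'" and f: "f : rep_hom G R R'"
 shows "adjoint G R' R (adjoint G R R' f) = f"
proof (rule lin_eqI[OF rep_homD(1)[OF adjoint_hom[OF R' R adjoint_hom[OF R R' f]]] rep_homD(1)[OF f]])
 fix x assume x: "x : cs R"
 note ad = adjoint_eval[OF R R' f] and fx = rep_homD(4)[OF f x]
 show "adjoint G R' R (adjoint G R R' f) x = f x"
 proof (rule adjoint_unique[OF R' R adjoint_hom[OF R R' f] x fx])
  fix y assume y: "y : cs R'"
  show "form G R' (f x) y = form G R x (adjoint G R R' f y)"
   by (simp only: form_props(2)[OF R' G fx y] form_props(2)[OF R G x ad(1)[OF y]] ad(2)[OF y x])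
 qed
qed

lemma adjoint_id:
 assumes R: "is_rep G R"
 shows "adjoint G R R (\<lambda>v\<in>cs R. v) = (\<lambda>v\<in>cs R. v)"
 by (rule lin_eqI[OF rep_homD(1)[OF adjoint_hom[OF R R rep_hom_id[OF R]]] rep_homD(1)[OF rep_hom_id[OF R]]])
  (simp add: adjoint_unique[OF R R rep_hom_id[OF R]])

lemma adjoint_compose:
 assumes R: "is_rep G R" and R': "is_rep G R'" and R'': "is_rep G R''" and f: "f : rep_hom G R R'" and g: "g : rep_hom G R' R''"
 shows "adjoint G R R'' (compose (cs R) g f) = compose (cs R'') (adjoint G R R' f) (adjoint G R' R'' g)"
proof (rule lin_eqI)
 note gf = rep_hom_compose[OF R f g]
 note af = adjoint_hom[OF R R' f] and ag = adjoint_hom[OF R' R'' g]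
 show "adjoint G R R'' (compose (cs R) g f) : lin (space R'') (space R)" by (rule rep_homD(1)[OF adjoint_hom[OF R R'' gf]])
 show "compose (cs R'') (adjoint G R R' f) (adjoint G R' R'' g) : lin (space R'') (space R)"
  by (rule rep_homD(1)[OF rep_hom_compose[OF R'' ag af]])
 fix y assume y: "y : cs R''"
 note gy = adjoint_eval[OF R' R'' g y]
 show "adjoint G R R'' (compose (cs R) g f) y = compose (cs R'') (adjoint G R R' f) (adjoint G R' R'' g) y"
  unfolding compose_eq[OF y]
  by (rule adjoint_unique[OF R R'' gf y adjoint_eval(1)[OF R R' f gy(1)]])
   (simp only: adjoint_eval(2)[OF R R' f gy(1)] gy(2)[OF rep_homD(4)[OF f]] compose_eq)
qed

end

section \<open>The equivalences\<close>

definition dagger :: "'v s2mod => 'v s2mod => (nat multiset => 'v => 'v) => nat multiset => 'v => 'v" where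
 "dagger V V' f = (%nu. adjoint (S_nu nu) (V nu) (V' nu) (f nu))"

lemma dagger_bij:
 assumes V: "nrep V" and V': "nrep V'"
 shows "bij_betw (dagger V V') (nhom V V') (nhom V' V)"
proof (rule bij_betw_byWitness[where f' = "dagger V' V"])
 note ad = adjoint_hom[OF group_S_nu finite_S_nu]
 show "dagger V V' ` nhom V V' <= nhom V' V" "dagger V' V ` nhom V' V <= nhom V V'"
  using V V' by (auto simp: dagger_def intro!: ad)
 show "ALL f:nhom V V'. dagger V' V (dagger V V' f) = f" "ALL f:nhom V' V. dagger V V' (dagger V' V f) = f"
  using V V' by (auto simp: dagger_def intro!: adjoint_adjoint[OF group_S_nu finite_S_nu])
qed

text \<open>The adjoint of a morphism from \<open>V\<close> to \<open>V'\<close> runs from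
  \<open>V'\<close> to \<open>V\<close>, the direction in which precomposition gives a
  transformation from \<open>F_functor V\<close> to \<open>F_functor V'\<close>.\<close>

definition covariant_schur_functor ::
 "('v s2mod, nat multiset => 'v => 'v, ('v, 'a) sfr, 'a smod => ('v, 'a) schur => ('v, 'a) schur) fctr" where
 "covariant_schur_functor = \<lparr>omap = F_functor, amap = (%V V' f. amap schur_functor V V' (dagger V V' f))\<rparr>"

section \<open>Functoriality in the module, and the equivalences\<close>

lemma schur_amap_id:
 assumes V: "nrep V"
 shows "amap schur_functor V V (%nu. \<lambda>v\<in>cs (V nu). v) = Id (fun_cat SVect Vect) (F_functor V :: ('v, 'a) sfr)"
 unfolding fun_cat_simps Vect_simps F_functor_simps(1)
proof (rule ext)
 fix W :: "'a smod"
 show "amap schur_functor V V (%nu. \<lambda>v\<in>cs (V nu). v) W = (\<lambda>W\<in>Obj SVect. \<lambda>x\<in>cF V W. x) W"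
 proof (cases "W : Obj SVect")
  case True
  have "compose (cs (V nu)) (x nu) (\<lambda>v\<in>cs (V nu). v) = x nu" if "x : cF V W" for x nu
   using schur_mem(4)[OF that] by (auto simp: compose_def fun_eq_iff)
  then have "(\<lambda>x\<in>cF V W. %nu. compose (cs (V nu)) (x nu) (\<lambda>v\<in>cs (V nu). v)) = (\<lambda>x\<in>cF V W. x)"
   by (intro restrict_ext ext) simp
  then show ?thesis using True by (simp only: schur_functor_simps restrict_apply if_True)
 qed (simp only: schur_functor_simps restrict_apply if_False)
qed

lemma schur_amap_comp:
 assumes inf: "infinite (UNIV :: 'a set)" and V: "nrep V" and V': "nrep V'" and V'': "nrep V''" and p: "phi : nhom V' V" and q: "psi : nhom V'' V'"
 shows "amap schur_functor V V'' (%nu. compose (cs (V'' nu)) (phi nu) (psi nu))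
  = Comp (fun_cat SVect Vect) (F_functor V :: ('v, 'a) sfr) (F_functor V') (F_functor V'')
    (amap schur_functor V' V'' psi) (amap schur_functor V V' phi)"
 unfolding fun_cat_simps Vect_simps F_functor_simps(1)
proof (rule ext)
 fix W :: "'a smod"
 show "amap schur_functor V V'' (%nu. compose (cs (V'' nu)) (phi nu) (psi nu)) W
  = (\<lambda>W\<in>Obj SVect. compose (cF V W) (amap schur_functor V' V'' psi W) (amap schur_functor V V' phi W)) W"
 proof (cases "W : Obj SVect")
  case W: True
  have qc: "psi nu u : cs (V' nu)" if "u : cs (V'' nu)" for nu u
   using q rep_homD(4)[of "psi nu" "S_nu nu" "V'' nu" "V' nu", OF _ that] by blast
  have "amap schur_functor V V'' (%nu. compose (cs (V'' nu)) (phi nu) (psi nu)) W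
   = compose (cF V W) (amap schur_functor V' V'' psi W) (amap schur_functor V V' phi W)"
  proof (rule ext)
   fix x
   show "amap schur_functor V V'' (%nu. compose (cs (V'' nu)) (phi nu) (psi nu)) W x
    = compose (cF V W) (amap schur_functor V' V'' psi W) (amap schur_functor V V' phi W) x"
   proof (cases "x : cF V W")
    case x: True
    show ?thesis
    unfolding compose_eq[OF x]
    proof (rule ext)
    fix nu
    show "amap schur_functor V V'' (%nu. compose (cs (V'' nu)) (phi nu) (psi nu)) W x nu = amap schur_functor V' V'' psi W (amap schur_functor V V' phi W x) nu"
    unfolding schur_amap_eval(1)[OF W x] schur_amap_eval(1)[OF W schur_amap_closed[OF inf V V' p W x]]
    using qc by (auto simp: compose_def fun_eq_iff)
    qed
   next
    case False
    then show ?thesis using W by (simp add: schur_functor_simps compose_def)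
   qed
  qed
  then show ?thesis using W by (simp only: restrict_apply if_True)
 qed (simp only: schur_functor_simps restrict_apply if_False)
qed

context
 fixes P :: "'v s2mod => bool" and Q :: "('v, 'a) sfr => bool"
 assumes inf: "infinite (UNIV :: 'a set)"
  and F: "!!V. nrep V ==> P V ==> is_functor SVect Vect (F_functor V :: ('v, 'a) sfr)"
  and Q: "!!V. nrep V ==> P V ==> Q (F_functor V)"
  and iso: "!!F. is_functor SVect Vect F ==> Q F ==> EX V. nrep V & P V & (EX eta. is_iso (fun_cat SVect Vect) (F_functor V) F eta)"
begin

text \<open>\<open>P\<close> is a finiteness condition on modules and \<open>Q\<close> the matching
  condition on functors. Full faithfulness holds for all families of representations, so the two
  equivalences differ only in how the conditions correspond.\<close>

lemma schur_functor_equivalences: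
 shows "is_equivalence (opposite (full_subcat (pgraded_cat S_nu) P)) (full_subcat (fun_cat SVect Vect) Q) schur_functor"
  and "is_equivalence (full_subcat (pgraded_cat S_nu) P) (full_subcat (fun_cat SVect Vect) Q) covariant_schur_functor"
proof -
 let ?C = "full_subcat (pgraded_cat S_nu) P" and ?D = "full_subcat (fun_cat SVect Vect) Q"
 let ?S = "schur_functor :: ('v s2mod, _, ('v, 'a) sfr, _) fctr"
  and ?T = "covariant_schur_functor :: ('v s2mod, _, ('v, 'a) sfr, _) fctr"
 have C: "is_category ?C" by (rule is_category_full_subcat[OF is_category_pgraded])
 have D: "is_category ?D" by (rule is_category_full_subcat[OF is_category_fun_cat[OF is_category_graded is_category_Vect]])
 have Co: "V : Obj ?C \<longleftrightarrow> nrep V & P V" for V by simp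
 have Ch: "Hom ?C V V' = nhom V V'" for V V' by simp
 have Cc: "Comp ?C U V W g f = (%nu. compose (cs (U nu)) (g nu) (f nu))" for U V W g f by simp
 have Ci: "Id ?C V = (%nu. \<lambda>v\<in>cs (V nu). v)" for V by simp
 have Do: "F_functor V : Obj ?D" if "nrep V" "P V" for V using F[OF that] Q[OF that] by simp
 have Dh: "Hom ?D = nat_trans SVect Vect" "Id ?D = Id (fun_cat SVect Vect)" "Comp ?D = Comp (fun_cat SVect Vect)" by simp_all
 have So: "omap ?S V = F_functor V" "omap ?T V = F_functor V" for V by (simp_all add: schur_functor_simps covariant_schur_functor_def)
 have Ta: "amap ?T V V' f = amap ?S V V' (dagger V V' f)" for V V' f by (simp add: covariant_schur_functor_def)
 have dag: "dagger V V' f : nhom V' V" if "nrep V" "nrep V'" "f : nhom V V'" for V V' f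
  using dagger_bij[OF that(1,2)] that(3) by (rule bij_betw_apply)
 have ess: "EX X:{V. nrep V & P V}. EX f. is_iso ?D (F_functor X) Z f" if "Z : Obj ?D" for Z
  using iso[of Z] that by (auto simp: is_iso_def)
 note nt = schur_amap_nat_trans[OF inf]
 show "is_equivalence (opposite ?C) ?D ?S"
 proof (rule fully_faithful_essentially_surjective_imp_equivalence[OF is_category_opposite[OF C] D])
  show "is_functor (opposite ?C) ?D ?S"
   unfolding is_functor_def opposite_simps Ch Cc Ci Dh So
  proof (intro conjI ballI)
   fix V V' V'' assume V: "V : Obj ?C"
   then have V: "nrep V" "P V" unfolding Co by blast+
   show "F_functor V : Obj ?D" by (rule Do[OF V])
   show "amap ?S V V (%nu. \<lambda>v\<in>cs (V nu). v) = Id (fun_cat SVect Vect) (F_functor V)" by (rule schur_amap_id[OF V(1)])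
   assume "V' : Obj ?C"
   then have V': "nrep V'" unfolding Co by blast
   fix f g assume f: "f : nhom V' V"
   show "amap ?S V V' f : nat_trans SVect Vect (F_functor V) (F_functor V')" by (rule nt[OF V(1) V' f])
   assume "V'' : Obj ?C" and g: "g : nhom V'' V'"
   then have V'': "nrep V''" unfolding Co by blast
   show "amap ?S V V'' (%nu. compose (cs (V'' nu)) (f nu) (g nu))
    = Comp (fun_cat SVect Vect) (F_functor V) (F_functor V') (F_functor V'') (amap ?S V' V'' g) (amap ?S V V' f)"
    by (rule schur_amap_comp[OF inf V(1) V' V'' f g])
  qed
 next
  fix V V' assume "V : Obj (opposite ?C)" "V' : Obj (opposite ?C)"
  then have "nrep V" "nrep V'" by simp_all
  from schur_functor_fully_faithful[OF inf this]
  show "bij_betw (amap ?S V V') (Hom (opposite ?C) V V') (Hom ?D (omap ?S V) (omap ?S V'))"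
   unfolding opposite_simps Ch Dh So .
 next
  fix Z assume "Z : Obj ?D"
  from ess[OF this] show "EX X:Obj (opposite ?C). EX f. is_iso ?D (omap ?S X) Z f" unfolding So by simp
 qed
 show "is_equivalence ?C ?D ?T"
 proof (rule fully_faithful_essentially_surjective_imp_equivalence[OF C D])
  show "is_functor ?C ?D ?T"
   unfolding is_functor_def Ch Cc Ci Dh So Ta
  proof (intro conjI ballI)
   fix V V' V'' assume V: "V : Obj ?C"
   then have V: "nrep V" "P V" unfolding Co by blast+
   show "F_functor V : Obj ?D" by (rule Do[OF V])
   have "dagger V V (%nu. \<lambda>v\<in>cs (V nu). v) = (%nu. \<lambda>v\<in>cs (V nu). v)"
    unfolding dagger_def by (intro ext adjoint_id[OF group_S_nu finite_S_nu, THEN fun_cong]) (use V in blast)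
   then show "amap ?S V V (dagger V V (%nu. \<lambda>v\<in>cs (V nu). v)) = Id (fun_cat SVect Vect) (F_functor V)"
    using schur_amap_id[OF V(1)] by simp
   assume "V' : Obj ?C"
   then have V': "nrep V'" unfolding Co by blast
   fix f g assume f: "f : nhom V V'"
   note df = dag[OF V(1) V' f]
   show "amap ?S V V' (dagger V V' f) : nat_trans SVect Vect (F_functor V) (F_functor V')" by (rule nt[OF V(1) V' df])
   assume "V'' : Obj ?C" and g: "g : nhom V' V''"
   then have V'': "nrep V''" unfolding Co by blast
   have "dagger V V'' (%nu. compose (cs (V nu)) (g nu) (f nu)) = (%nu. compose (cs (V'' nu)) (dagger V V' f nu) (dagger V' V'' g nu))"
    unfolding dagger_def
    by (rule ext, rule adjoint_compose[OF group_S_nu finite_S_nu]) (use V V' V'' f g in blast)+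
   then show "amap ?S V V'' (dagger V V'' (%nu. compose (cs (V nu)) (g nu) (f nu)))
    = Comp (fun_cat SVect Vect) (F_functor V) (F_functor V') (F_functor V'') (amap ?S V' V'' (dagger V' V'' g)) (amap ?S V V' (dagger V V' f))"
    using schur_amap_comp[OF inf V(1) V' V'' df dag[OF V' V'' g]] by simp
  qed
 next
  fix V V' assume "V : Obj ?C" "V' : Obj ?C"
  then have V: "nrep V" "nrep V'" unfolding Co by blast+
  have "amap ?T V V' = amap ?S V V' \<circ> dagger V V'" by (simp add: fun_eq_iff Ta)
  then show "bij_betw (amap ?T V V') (Hom ?C V V') (Hom ?D (omap ?T V) (omap ?T V'))"
   unfolding Ch Dh So using bij_betw_trans[OF dagger_bij[OF V] schur_functor_fully_faithful[OF inf V]] by simp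
 next
  fix Z assume "Z : Obj ?D"
  from ess[OF this] show "EX X:Obj ?C. EX f. is_iso ?D (omap ?T X) Z f" unfolding So by simp
 qed
qed

end

theorem theorem2p5:
  assumes "infinite (UNIV :: 'a set)" and "infinite (UNIV :: 'v set)"
  shows
    "(\<exists>\<Phi> :: ('v s2mod, nat multiset \<Rightarrow> 'v \<Rightarrow> 'v, ('a, ('v, 'a) schur) svect_functor,
              'a smod \<Rightarrow> ('v, 'a) schur \<Rightarrow> ('v, 'a) schur) fctr.
        is_equivalence S2Vect PolyFun_bounded \<Phi> \<and>
        is_equivalence (S2Vect_pf TYPE('a)) PolyFun \<Phi> \<and>
        (\<forall>V\<in>Obj S2Vect \<union> Obj (S2Vect_pf TYPE('a)). omap \<Phi> V = F_functor V)) \<and>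
     is_equivalence (opposite S2Vect) PolyFun_bounded
       (schur_functor :: ('v s2mod, _, ('a, ('v, 'a) schur) svect_functor, _) fctr) \<and>
     is_equivalence (opposite (S2Vect_pf TYPE('a))) PolyFun
       (schur_functor :: ('v s2mod, _, ('a, ('v, 'a) schur) svect_functor, _) fctr)"
proof -
 \<comment> \<open>Two pairs of conditions: finite total dimension with bounded polynomial functors,
   and finite-dimensional values with all polynomial functors.\<close>
 let ?P = "%V :: 'v s2mod. fdvs (dsum (%nu. space (V nu)))"
  and ?P' = "%V :: 'v s2mod. ALL W:Obj (SVect :: ('a smod, _) cat). fdvs (schur_space V W)"
  and ?B = "bounded_polynomial_functor :: ('v, 'a) sfr => bool"
  and ?Q = "polynomial_functor :: ('v, 'a) sfr => bool"
 have S2: "V : Obj S2Vect" if "nrep V" "?P V" for V using that by simp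
 have fd: "fdvs (schur_space V W)" if "nrep V" "?P V" "W : Obj SVect" for V and W :: "'a smod"
  by (rule S2Vect_fdvs_schur_space[OF S2[OF that(1,2)] SVect_srep[OF that(3)]])
 have iso_b: "EX V. nrep V & ?P V & (EX eta. is_iso (fun_cat SVect Vect) (F_functor V) F eta)"
  if "is_functor SVect Vect F" "?B F" for F :: "('v, 'a) sfr"
 proof -
  note F = that
  obtain V eta where "V : Obj (S2Vect :: ('v s2mod, _) cat)" "is_iso (fun_cat SVect Vect) (F_functor V) F eta"
   using bounded_functor_iso_F_functor[OF assms F] by blast
  then show ?thesis by auto
 qed
 have iso_p: "EX V. nrep V & ?P' V & (EX eta. is_iso (fun_cat SVect Vect) (F_functor V) F eta)"
  if "is_functor SVect Vect F" "?Q F" for F :: "('v, 'a) sfr"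
  using polynomial_functor_iso_F_functor[OF assms that(1) lpf_of_polynomial[OF that]] by blast
 have Fb: "is_functor SVect Vect (F_functor V :: ('v, 'a) sfr)" if "nrep V" "?P V" for V
  by (rule is_functor_Vect_F_functor[OF that(1)], rule fd[OF that])
 have Qb: "?B (F_functor V)" if "nrep V" "?P V" for V
  by (rule bounded_F_functor[OF S2[OF that]])
 have Fp: "is_functor SVect Vect (F_functor V :: ('v, 'a) sfr)" if "nrep V" "?P' V" for V
  by (rule is_functor_Vect_F_functor[OF that(1)], rule bspec[OF that(2)])
 have Qp: "?Q (F_functor V)" if "nrep V" "?P' V" for V
  by (rule polynomial_functor_F_functor[OF that(1)], rule bspec[OF that(2)])
 have eq_b: "is_equivalence (opposite S2Vect) PolyFun_bounded (schur_functor :: ('v s2mod, _, ('v, 'a) sfr, _) fctr)"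
  "is_equivalence S2Vect PolyFun_bounded (covariant_schur_functor :: ('v s2mod, _, ('v, 'a) sfr, _) fctr)"
  unfolding graded_cat_def[of S_nu]
  by (rule schur_functor_equivalences[where P = ?P and Q = ?B, OF assms(1)]; (rule Fb Qb iso_b; assumption))+
 have eq_p: "is_equivalence (opposite (S2Vect_pf TYPE('a))) PolyFun (schur_functor :: ('v s2mod, _, ('v, 'a) sfr, _) fctr)"
  "is_equivalence (S2Vect_pf TYPE('a)) PolyFun (covariant_schur_functor :: ('v s2mod, _, ('v, 'a) sfr, _) fctr)"
  unfolding S2Vect_pf_def
  by (rule schur_functor_equivalences[where P = ?P' and Q = ?Q, OF assms(1)]; (rule Fp Qp iso_p; assumption))+
 show ?thesis
 proof (intro conjI exI[of _ covariant_schur_functor])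
  show "ALL V:Obj S2Vect \<union> Obj (S2Vect_pf TYPE('a)).
    omap (covariant_schur_functor :: ('v s2mod, _, ('v, 'a) sfr, _) fctr) V = F_functor V"
   by (simp add: covariant_schur_functor_def)
 qed (rule eq_b eq_p)+
qed

end
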